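(* Let $l\ge3$ be an integer and let $G$ be a smooth Riemannian metric on $\mathrm{Imm}^l(M,\mathbb R^d)$ such that $$\|h\|_{G_f}\gtrsim\|\nabla h\|_{L^\infty(g)}$$ for all $f\in\mathrm{Imm}^l(M,\mathbb R^d)$ and $h\in T_f\mathrm{Imm}^l(M,\mathbb R^d)$. Then the functions (mapping $f$ to its pullback metric and its inverse) $$g:(\mathrm{Imm}^l(M,\mathbb R^d),G)\to\big(H^{l-1}(M,T^*M\otimes T^*M),\|\cdot\|_{L^\infty(\bar g)}\big),$$ $$g^{-1}:(\mathrm{Imm}^l(M,\mathbb R^d),G)\to\big(H^{l-1}(M,TM\otimes TM),\|\cdot\|_{L^\infty(\bar g)}\big)$$ are Lipschitz continuous, and thus uniformly bounded, on any $G$-metric ball in $\mathrm{Imm}^l(M,\mathbb R^d)$. The same holds true for the fiber metrics induced by $g$ on the tensor bundles $(TM)^{\otimes i}\otimes(T^*M)^{\otimes j}\otimes(\mathbb R^d)^{\otimes m}$.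
   Context: $M$ is a smooth, closed (compact, without boundary), oriented two-dimensional manifold with a fixed smooth background Riemannian metric $\bar g$ (independent of $f$), and $d\ge3$. $\mathrm{Imm}^l(M,\mathbb R^d)$ is the set of $f\in H^l(M,\mathbb R^d)$ with $T_xf$ injective for all $x\in M$; it is open in the Hilbert space $H^l(M,\mathbb R^d)$, so $T_f\mathrm{Imm}^l(M,\mathbb R^d)\cong H^l(M,\mathbb R^d)$. For an immersion $f$: $g=f^*\langle\cdot,\cdot\rangle_{\mathbb R^d}$ is the pullback metric. It induces, together with the Euclidean product, fiber metrics (also denoted $g$) on the bundles $(TM)^{\otimes i}\otimes(T^*M)^{\otimes j}\otimes(\mathbb R^d)^{\otimes m}$, given on elementary tensors by the product of $g$ on the tangent factors, $g^{-1}$ on the cotangent factors and $\langle\cdot,\cdot\rangle_{\mathbb R^d}$ on the $\mathbb R^d$ factors. $\nabla h=Th$ for $h:M\to\mathbb R^d$. $\|\alpha\|_{L^\infty(g)}$ is the essential supremum of $g(\alpha,\alpha)^{1/2}$, and $\|\alpha\|_{L^\infty(\bar g)}$ is the analogous norm for $\bar g$. $\|h\|_{G_f}=\sqrt{G_f(h,h)}$. The notation $A\gtrsim B$ means $A\ge cB$ with a constant $c>0$ independent of $f$ and $h$. Lipschitz continuity and metric balls refer to the geodesic distance of $G$. *)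

theory Defs
  imports "HOL-Analysis.Analysis"
begin

section \<open>Smooth functions on open subsets of the plane\<close>

definition pderiv_at :: "2 \<Rightarrow> (real^2 \<Rightarrow> 'b::real_normed_vector) \<Rightarrow> real^2 \<Rightarrow> 'b" where
  "pderiv_at i u y = frechet_derivative u (at y) (axis i 1)"

primrec iter_pderiv :: "2 list \<Rightarrow> (real^2 \<Rightarrow> 'b::real_normed_vector) \<Rightarrow> real^2 \<Rightarrow> 'b" where
  "iter_pderiv [] u = u"
| "iter_pderiv (i # is) u = pderiv_at i (iter_pderiv is u)"

definition smooth_fun_on :: "(real^2) set \<Rightarrow> (real^2 \<Rightarrow> 'b::real_normed_vector) \<Rightarrow> bool" where
  "smooth_fun_on S u \<longleftrightarrow> open S \<and> (\<forall>is. \<forall>y\<in>S. iter_pderiv is u differentiable (at y))"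

section \<open>Oriented closed surfaces\<close>

text \<open>A chart is its domain together with its coordinate map; the values of the
  coordinate map outside the domain are irrelevant.\<close>

type_synonym 'm chart = "'m set \<times> ('m \<Rightarrow> real^2)"

definition cdom :: "'m chart \<Rightarrow> 'm set" where "cdom c = fst c"
definition cmap :: "'m chart \<Rightarrow> 'm \<Rightarrow> real^2" where "cmap c = snd c"
definition cinv :: "'m chart \<Rightarrow> real^2 \<Rightarrow> 'm" where "cinv c = inv_into (cdom c) (cmap c)"
definition cimg :: "'m chart \<Rightarrow> (real^2) set" where "cimg c = cmap c ` cdom c"

definition is_chart :: "'m::topological_space chart \<Rightarrow> bool" where
  "is_chart c \<longleftrightarrow> open (cdom c) \<and> open (cimg c) \<and> homeomorphism (cdom c) (cimg c) (cmap c) (cinv c)"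

text \<open>\<open>transition_jac c c' x $ i $ j\<close> is the derivative of the i-th coordinate of \<open>c'\<close>
  with respect to the j-th coordinate of \<open>c\<close> at the point x.\<close>

definition transition_jac :: "'m chart \<Rightarrow> 'm chart \<Rightarrow> 'm \<Rightarrow> real^2^2" where
  "transition_jac c c' x = jacobian (cmap c' \<circ> cinv c) (at (cmap c x))"

text \<open>An atlas of a smooth closed oriented surface. The manifold is the whole type; second
  countability follows from compactness. The atlas is not required to be maximal.\<close>

definition closed_oriented_surface :: "'m::t2_space chart set \<Rightarrow> bool" where
  "closed_oriented_surface A \<longleftrightarrow>
     compact (UNIV :: 'm set) \<and>
     (\<forall>c\<in>A. is_chart c) \<and> (\<Union>c\<in>A. cdom c) = UNIV \<and>
     (\<forall>c\<in>A. \<forall>c'\<in>A. smooth_fun_on (cmap c ` (cdom c \<inter> cdom c')) (cmap c' \<circ> cinv c) \<and>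
        (\<forall>x\<in>cdom c \<inter> cdom c'. det (transition_jac c c' x) > 0))"

text \<open>A finite cover by open coordinate rectangles whose closures lie in the chart images.
  It is used only to write down a Sobolev norm; different covers give the same Sobolev spaces
  with equivalent norms.\<close>

definition coord_cover :: "'m chart set \<Rightarrow> ('m chart \<times> (real^2) \<times> (real^2)) set \<Rightarrow> bool" where
  "coord_cover A C \<longleftrightarrow>
     finite C \<and> (\<forall>(c, a, b)\<in>C. c \<in> A \<and> cbox a b \<subseteq> cimg c) \<and>
     (\<Union>(c, a, b)\<in>C. cinv c ` box a b) = UNIV"

section \<open>Tensor fields\<close>

text \<open>Tensor fields with values in \<open>(TM)\<^sup>p \<otimes> (T*M)\<^sup>q \<otimes> (R\<^sup>d)\<^sup>r\<close> (tensor powers) are given by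
  their components: \<open>\<tau> c x I J K\<close> is the component at the point x with respect to the
  coordinate frame of the chart c, with contravariant indices I (of length p), covariant
  indices J (of length q) and \<open>R\<^sup>d\<close>-indices K (of length r). Values at other charts, points
  or index lists are irrelevant.\<close>

type_synonym ('m, 'd) tfield = "'m chart \<Rightarrow> 'm \<Rightarrow> 2 list \<Rightarrow> 2 list \<Rightarrow> 'd list \<Rightarrow> real"

definition tensor_field :: "'m chart set \<Rightarrow> nat \<Rightarrow> nat \<Rightarrow> nat \<Rightarrow> ('m, 'd) tfield \<Rightarrow> bool" where
  "tensor_field A p q r \<tau> \<longleftrightarrow>
     (\<forall>c\<in>A. \<forall>c'\<in>A. \<forall>x\<in>cdom c \<inter> cdom c'. \<forall>I J K.
        length I = p \<longrightarrow> length J = q \<longrightarrow> length K = r \<longrightarrow>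
        \<tau> c' x I J K =
          (\<Sum>I' | length I' = p. \<Sum>J' | length J' = q.
             (\<Prod>n<p. transition_jac c c' x $ (I ! n) $ (I' ! n)) *
             (\<Prod>n<q. transition_jac c' c x $ (J' ! n) $ (J ! n)) * \<tau> c x I' J' K))"

definition smooth_tensor_field ::
  "'m chart set \<Rightarrow> nat \<Rightarrow> nat \<Rightarrow> nat \<Rightarrow> ('m, 'd) tfield \<Rightarrow> bool" where
  "smooth_tensor_field A p q r \<tau> \<longleftrightarrow> tensor_field A p q r \<tau> \<and>
     (\<forall>c\<in>A. \<forall>I J K. length I = p \<longrightarrow> length J = q \<longrightarrow> length K = r \<longrightarrow>
        smooth_fun_on (cimg c) (\<lambda>y. \<tau> c (cinv c y) I J K))"

definition continuous_tensor_field ::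
  "'m::topological_space chart set \<Rightarrow> nat \<Rightarrow> nat \<Rightarrow> nat \<Rightarrow> ('m, 'd) tfield \<Rightarrow> bool" where
  "continuous_tensor_field A p q r \<tau> \<longleftrightarrow> tensor_field A p q r \<tau> \<and>
     (\<forall>c\<in>A. \<forall>I J K. length I = p \<longrightarrow> length J = q \<longrightarrow> length K = r \<longrightarrow>
        continuous_on (cdom c) (\<lambda>x. \<tau> c x I J K))"

definition tdiff :: "('m, 'd) tfield \<Rightarrow> ('m, 'd) tfield \<Rightarrow> ('m, 'd) tfield" where
  "tdiff \<sigma> \<tau> = (\<lambda>c x I J K. \<sigma> c x I J K - \<tau> c x I J K)"

section \<open>Sobolev spaces\<close>

text \<open>The \<open>H\<^sup>k\<close> norm of a smooth tensor field (for k = 0 and a continuous one: the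
  \<open>L\<^sup>2\<close> norm).\<close>

definition pre_sob_norm ::
  "('m chart \<times> (real^2) \<times> (real^2)) set \<Rightarrow> nat \<Rightarrow> nat \<Rightarrow> nat \<Rightarrow> nat \<Rightarrow> ('m, 'd::finite) tfield \<Rightarrow> real"
where
  "pre_sob_norm C k p q r \<tau> = sqrt (\<Sum>(c, a, b)\<in>C.
     \<Sum>I | length I = p. \<Sum>J | length J = q. \<Sum>K | length K = r. \<Sum>is | length is \<le> k.
       integral (cbox a b) (\<lambda>y. (iter_pderiv is (\<lambda>z. \<tau> c (cinv c z) I J K) y)\<^sup>2))"

text \<open>\<open>H\<^sup>k\<close> is the completion of the smooth tensor fields, realised as a space of tensor fields:
  an element is the \<open>L\<^sup>2\<close> limit of an \<open>H\<^sup>k\<close>-Cauchy sequence of smooth fields. Since each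
  \<open>L\<^sup>2\<close> class in \<open>H\<^sup>k\<close> has exactly one continuous representative when \<open>k \<ge> 2\<close> (Sobolev
  embedding in dimension two), classes are identified with their continuous
  representatives; the definition is meant for \<open>k \<ge> 2\<close> only.\<close>

definition sob_approx ::
  "'m chart set \<Rightarrow> ('m chart \<times> (real^2) \<times> (real^2)) set \<Rightarrow> nat \<Rightarrow> nat \<Rightarrow> nat \<Rightarrow> nat \<Rightarrow>
   (nat \<Rightarrow> ('m, 'd::finite) tfield) \<Rightarrow> ('m, 'd) tfield \<Rightarrow> bool"
where
  "sob_approx A C k p q r \<sigma> \<tau> \<longleftrightarrow>
     (\<forall>n. smooth_tensor_field A p q r (\<sigma> n)) \<and>
     (\<forall>e>0. \<exists>N. \<forall>m\<ge>N. \<forall>n\<ge>N. pre_sob_norm C k p q r (tdiff (\<sigma> m) (\<sigma> n)) < e) \<and>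
     (\<lambda>n. pre_sob_norm C 0 p q r (tdiff (\<sigma> n) \<tau>)) \<longlonglongrightarrow> 0"

definition sobolev ::
  "'m::topological_space chart set \<Rightarrow> ('m chart \<times> (real^2) \<times> (real^2)) set \<Rightarrow> nat \<Rightarrow> nat \<Rightarrow> nat \<Rightarrow> nat \<Rightarrow>
   ('m, 'd::finite) tfield set"
where
  "sobolev A C k p q r =
     {\<tau>. continuous_tensor_field A p q r \<tau> \<and> (\<exists>\<sigma>. sob_approx A C k p q r \<sigma> \<tau>)}"

text \<open>For \<open>\<tau>\<close> in \<open>H\<^sup>k\<close> all approximating sequences have the same limit of norms, so the infimum below is
  taken over a one-element set.\<close>

definition sob_norm ::
  "'m chart set \<Rightarrow> ('m chart \<times> (real^2) \<times> (real^2)) set \<Rightarrow> nat \<Rightarrow> nat \<Rightarrow> nat \<Rightarrow> nat \<Rightarrow>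
   ('m, 'd::finite) tfield \<Rightarrow> real"
where
  "sob_norm A C k p q r \<tau> =
     Inf {L. \<exists>\<sigma>. sob_approx A C k p q r \<sigma> \<tau> \<and> (\<lambda>n. pre_sob_norm C k p q r (\<sigma> n)) \<longlonglongrightarrow> L}"

text \<open>Functions \<open>M \<rightarrow> R\<^sup>d\<close> are the tensor fields with p = q = 0 and r = 1.\<close>

definition fun_tensor :: "('m \<Rightarrow> real^'d) \<Rightarrow> ('m, 'd) tfield" where
  "fun_tensor f = (\<lambda>c x I J K. f x $ (K ! 0))"

definition sobolev_maps ::
  "'m::topological_space chart set \<Rightarrow> ('m chart \<times> (real^2) \<times> (real^2)) set \<Rightarrow> nat \<Rightarrow>
   ('m \<Rightarrow> real^'d::finite) set"
where
  "sobolev_maps A C l = {f. fun_tensor f \<in> sobolev A C l 0 0 1}"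

definition map_norm ::
  "'m chart set \<Rightarrow> ('m chart \<times> (real^2) \<times> (real^2)) set \<Rightarrow> nat \<Rightarrow> ('m \<Rightarrow> real^'d::finite) \<Rightarrow> real"
where
  "map_norm A C l f = sob_norm A C l 0 0 1 (fun_tensor f)"

text \<open>Differentiability of the maps below is automatic for \<open>l \<ge> 3\<close>.\<close>

definition Imm ::
  "'m::topological_space chart set \<Rightarrow> ('m chart \<times> (real^2) \<times> (real^2)) set \<Rightarrow> nat \<Rightarrow>
   ('m \<Rightarrow> real^'d::finite) set"
where
  "Imm A C l = {f \<in> sobolev_maps A C l. \<forall>c\<in>A. \<forall>x\<in>cdom c.
     (f \<circ> cinv c) differentiable (at (cmap c x)) \<and>
     inj (frechet_derivative (f \<circ> cinv c) (at (cmap c x)))}"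

section \<open>Riemannian metrics on the surface and induced fiber metrics\<close>

type_synonym 'm metric_field = "'m chart \<Rightarrow> 'm \<Rightarrow> real^2^2"

definition riemannian_metric :: "'m chart set \<Rightarrow> 'm metric_field \<Rightarrow> bool" where
  "riemannian_metric A g \<longleftrightarrow>
     (\<forall>c\<in>A. \<forall>i j. smooth_fun_on (cimg c) (\<lambda>y. g c (cinv c y) $ i $ j)) \<and>
     (\<forall>c\<in>A. \<forall>x\<in>cdom c. transpose (g c x) = g c x \<and> (\<forall>v. v \<noteq> 0 \<longrightarrow> v \<bullet> (g c x *v v) > 0)) \<and>
     (\<forall>c\<in>A. \<forall>c'\<in>A. \<forall>x\<in>cdom c \<inter> cdom c'.
        g c x = transpose (transition_jac c c' x) ** g c' x ** transition_jac c c' x)"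

definition pullback_metric :: "('m \<Rightarrow> real^'d::finite) \<Rightarrow> 'm metric_field" where
  "pullback_metric f = (\<lambda>c x. \<chi> i j.
     pderiv_at i (f \<circ> cinv c) (cmap c x) \<bullet> pderiv_at j (f \<circ> cinv c) (cmap c x))"

text \<open>The Gram coefficients, with respect to the coordinate frame, of the fiber metric induced
  by the matrix g on tensors of type (p, q, r): on elementary tensors the product of g on the
  tangent factors, \<open>g\<^sup>-\<^sup>1\<close> on the cotangent factors and the Euclidean product.\<close>

definition fiber_gram ::
  "real^2^2 \<Rightarrow> nat \<Rightarrow> nat \<Rightarrow> nat \<Rightarrow> 2 list \<Rightarrow> 2 list \<Rightarrow> 'd list \<Rightarrow> 2 list \<Rightarrow> 2 list \<Rightarrow> 'd list \<Rightarrow> real"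
where
  "fiber_gram g p q r I J K I' J' K' =
     (\<Prod>n<p. g $ (I ! n) $ (I' ! n)) * (\<Prod>n<q. matrix_inv g $ (J ! n) $ (J' ! n)) *
     (\<Prod>n<r. if K ! n = K' ! n then 1 else 0)"

definition fiber_inner ::
  "real^2^2 \<Rightarrow> nat \<Rightarrow> nat \<Rightarrow> nat \<Rightarrow> (2 list \<Rightarrow> 2 list \<Rightarrow> 'd::finite list \<Rightarrow> real) \<Rightarrow>
   (2 list \<Rightarrow> 2 list \<Rightarrow> 'd list \<Rightarrow> real) \<Rightarrow> real"
where
  "fiber_inner g p q r \<alpha> \<beta> =
     (\<Sum>I | length I = p. \<Sum>J | length J = q. \<Sum>K | length K = r.
      \<Sum>I' | length I' = p. \<Sum>J' | length J' = q. \<Sum>K' | length K' = r.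
        fiber_gram g p q r I J K I' J' K' * \<alpha> I J K * \<beta> I' J' K')"

text \<open>Essential supremum of the pointwise norm. A subset of M is a null set (for the volume
  measure of any Riemannian metric) iff its image in every chart is Lebesgue negligible.\<close>

definition Linf_norm ::
  "'m chart set \<Rightarrow> 'm metric_field \<Rightarrow> nat \<Rightarrow> nat \<Rightarrow> nat \<Rightarrow> ('m, 'd::finite) tfield \<Rightarrow> ennreal"
where
  "Linf_norm A g p q r \<tau> = Inf {s. \<forall>c\<in>A. negligible
     (cmap c ` {x \<in> cdom c. s < ennreal (sqrt (fiber_inner (g c x) p q r (\<tau> c x) (\<tau> c x)))})}"

text \<open>\<open>\<nabla>h = Th\<close>, a tensor field of type (0, 1, 1).\<close>

definition nabla :: "('m \<Rightarrow> real^'d::finite) \<Rightarrow> ('m, 'd) tfield" where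
  "nabla h = (\<lambda>c x I J K. pderiv_at (J ! 0) (h \<circ> cinv c) (cmap c x) $ (K ! 0))"

text \<open>A metric and its inverse as tensor fields of type (0, 2, 0) and (2, 0, 0), and the fiber
  metric induced on the bundle of type (i, j, m). The latter is a bilinear form on that bundle,
  hence (identifying \<open>R\<^sup>d\<close> with its dual) a tensor field of type (2j, 2i, 2m), whose
  first j, i and m indices belong to the first argument of the form.\<close>

definition metric_tensor :: "'m metric_field \<Rightarrow> ('m, 'd) tfield" where
  "metric_tensor g = (\<lambda>c x I J K. g c x $ (J ! 0) $ (J ! 1))"

definition inv_metric_tensor :: "'m metric_field \<Rightarrow> ('m, 'd) tfield" where
  "inv_metric_tensor g = (\<lambda>c x I J K. matrix_inv (g c x) $ (I ! 0) $ (I ! 1))"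

definition fiber_metric_tensor :: "'m metric_field \<Rightarrow> nat \<Rightarrow> nat \<Rightarrow> nat \<Rightarrow> ('m, 'd) tfield" where
  "fiber_metric_tensor g i j m = (\<lambda>c x I J K. fiber_gram (g c x) i j m
     (take i J) (take j I) (take m K) (drop i J) (drop j I) (drop m K))"

section \<open>Smooth Riemannian metrics on spaces of maps and their geodesic distance\<close>

text \<open>Below, V is a linear space of maps with norm N, and U is an open subset of V. Bounded
  n-linear forms are functions of lists of length n.\<close>

definition bounded_multilinear_form ::
  "('m \<Rightarrow> 'v::real_vector) set \<Rightarrow> (('m \<Rightarrow> 'v) \<Rightarrow> real) \<Rightarrow> nat \<Rightarrow> (('m \<Rightarrow> 'v) list \<Rightarrow> real) \<Rightarrow> bool"
where
  "bounded_multilinear_form V N n T \<longleftrightarrow>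
     (\<forall>hs ks h k a b. set hs \<subseteq> V \<longrightarrow> set ks \<subseteq> V \<longrightarrow> h \<in> V \<longrightarrow> k \<in> V \<longrightarrow>
        Suc (length hs + length ks) = n \<longrightarrow>
        T (hs @ (\<lambda>x. a *\<^sub>R h x + b *\<^sub>R k x) # ks) = a * T (hs @ h # ks) + b * T (hs @ k # ks)) \<and>
     (\<exists>B. \<forall>hs. set hs \<subseteq> V \<longrightarrow> length hs = n \<longrightarrow> \<bar>T hs\<bar> \<le> B * prod_list (map N hs))"

text \<open>Frechet smoothness of \<open>f \<mapsto> T f\<close> as a map from U into the normed space of bounded
  n-linear forms: \<open>D f\<close> restricted to lists of length n + s is the s-th derivative at f, the
  directions of differentiation coming first.\<close>

definition smooth_form_field ::
  "('m \<Rightarrow> 'v::real_vector) set \<Rightarrow> (('m \<Rightarrow> 'v) \<Rightarrow> real) \<Rightarrow> ('m \<Rightarrow> 'v) set \<Rightarrow> nat \<Rightarrow>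
   (('m \<Rightarrow> 'v) \<Rightarrow> ('m \<Rightarrow> 'v) list \<Rightarrow> real) \<Rightarrow> bool"
where
  "smooth_form_field V N U n T \<longleftrightarrow> (\<exists>D.
     (\<forall>f\<in>U. \<forall>hs. set hs \<subseteq> V \<longrightarrow> length hs = n \<longrightarrow> D f hs = T f hs) \<and>
     (\<forall>f\<in>U. \<forall>k\<ge>n. bounded_multilinear_form V N k (D f)) \<and>
     (\<forall>f\<in>U. \<forall>k\<ge>n. \<forall>e>0. \<exists>\<delta>>0. \<forall>f'\<in>U. N (\<lambda>x. f' x - f x) < \<delta> \<longrightarrow>
        (\<forall>hs. set hs \<subseteq> V \<longrightarrow> length hs = k \<longrightarrow>
           \<bar>D f' hs - D f hs - D f ((\<lambda>x. f' x - f x) # hs)\<bar>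
             \<le> e * N (\<lambda>x. f' x - f x) * prod_list (map N hs))))"

text \<open>Weak metrics are allowed: the inner products need not induce the topology of V.\<close>

definition smooth_riemannian_metric ::
  "('m \<Rightarrow> 'v::real_vector) set \<Rightarrow> (('m \<Rightarrow> 'v) \<Rightarrow> real) \<Rightarrow> ('m \<Rightarrow> 'v) set \<Rightarrow>
   (('m \<Rightarrow> 'v) \<Rightarrow> ('m \<Rightarrow> 'v) \<Rightarrow> ('m \<Rightarrow> 'v) \<Rightarrow> real) \<Rightarrow> bool"
where
  "smooth_riemannian_metric V N U G \<longleftrightarrow>
     smooth_form_field V N U 2 (\<lambda>f hs. G f (hs ! 0) (hs ! 1)) \<and>
     (\<forall>f\<in>U. \<forall>h\<in>V. \<forall>k\<in>V. G f h k = G f k h) \<and>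
     (\<forall>f\<in>U. \<forall>h\<in>V. h \<noteq> (\<lambda>x. 0) \<longrightarrow> G f h h > 0)"

text \<open>\<open>\<gamma>\<close> is a continuously differentiable path in U, parametrised by [0, 1], with velocity v.\<close>

definition C1_path ::
  "('m \<Rightarrow> 'v::real_vector) set \<Rightarrow> (('m \<Rightarrow> 'v) \<Rightarrow> real) \<Rightarrow> ('m \<Rightarrow> 'v) set \<Rightarrow>
   (real \<Rightarrow> 'm \<Rightarrow> 'v) \<Rightarrow> (real \<Rightarrow> 'm \<Rightarrow> 'v) \<Rightarrow> bool"
where
  "C1_path V N U \<gamma> v \<longleftrightarrow>
     (\<forall>t\<in>{0..1}. \<gamma> t \<in> U \<and> v t \<in> V) \<and>
     (\<forall>t\<in>{0..1}. \<forall>e>0. \<exists>\<delta>>0. \<forall>s\<in>{0..1}. \<bar>s - t\<bar> < \<delta> \<longrightarrow>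
        N (\<lambda>x. \<gamma> s x - \<gamma> t x - (s - t) *\<^sub>R v t x) \<le> e * \<bar>s - t\<bar> \<and>
        N (\<lambda>x. v s x - v t x) \<le> e)"

text \<open>Infinite if there is no path joining the two points.\<close>

definition geodesic_dist ::
  "('m \<Rightarrow> 'v::real_vector) set \<Rightarrow> (('m \<Rightarrow> 'v) \<Rightarrow> real) \<Rightarrow> ('m \<Rightarrow> 'v) set \<Rightarrow>
   (('m \<Rightarrow> 'v) \<Rightarrow> ('m \<Rightarrow> 'v) \<Rightarrow> ('m \<Rightarrow> 'v) \<Rightarrow> real) \<Rightarrow> ('m \<Rightarrow> 'v) \<Rightarrow> ('m \<Rightarrow> 'v) \<Rightarrow> ennreal"
where
  "geodesic_dist V N U G f0 f1 =
     Inf {ennreal (integral {0..1} (\<lambda>t. sqrt (G (\<gamma> t) (v t) (v t)))) | \<gamma> v.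
            C1_path V N U \<gamma> v \<and> \<gamma> 0 = f0 \<and> \<gamma> 1 = f1}"

text \<open>F is Lipschitz continuous and bounded on every ball of the extended (pseudo)metric dst on
  U, with respect to the norm nrm of tensor fields.\<close>

definition lipschitz_bounded_on_balls ::
  "'f set \<Rightarrow> ('f \<Rightarrow> 'f \<Rightarrow> ennreal) \<Rightarrow> (('m, 'd) tfield \<Rightarrow> ennreal) \<Rightarrow> ('f \<Rightarrow> ('m, 'd) tfield) \<Rightarrow> bool"
where
  "lipschitz_bounded_on_balls U dst nrm F \<longleftrightarrow>
     (\<forall>f0\<in>U. \<forall>R::real. let B = {f \<in> U. dst f0 f < ennreal R} in
        (\<exists>K::real. K \<ge> 0 \<and> (\<forall>f1\<in>B. \<forall>f2\<in>B. nrm (tdiff (F f1) (F f2)) \<le> ennreal K * dst f1 f2)) \<and>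
        (\<exists>K::real. \<forall>f\<in>B. nrm (F f) \<le> ennreal K))"

end

theory Submission
  imports Defs
begin

text \<open>Let \<open>\<gamma>\<close> be a path of immersions with velocity \<open>v\<close> and let \<open>g\<close> denote the pullback metric along
it. For a fixed tangent vector \<open>u\<close> of the surface the derivative of \<open>g(u,u)\<close> is \<open>2 \<langle>\<nabla>\<^sub>u v, \<nabla>\<^sub>u \<gamma>\<rangle>\<close>.
Since \<open>|\<nabla>\<^sub>u \<gamma>|\<^sup>2 = g(u,u)\<close> and \<open>|\<nabla>\<^sub>u v| \<le> |\<nabla>v|\<^sub>g g(u,u)\<^sup>1\<^sup>/\<^sup>2\<close>, the logarithmic derivative of
\<open>g(u,u)\<close> is at most \<open>2 |\<nabla>v|\<^sub>g\<close>, which by hypothesis is at most \<open>2/c\<close> times the speed of \<open>\<gamma>\<close>. Hence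
the metrics at the two ends of a path of length \<open>L\<close> satisfy \<open>e\<^sup>-\<^sup>\<kappa> g\<^sub>0 \<le> g\<^sub>1 \<le> e\<^sup>\<kappa> g\<^sub>0\<close> with \<open>\<kappa> =
2L/c\<close> (\<open>quasi_isometric_path\<close>); by duality the same holds for their inverses. On a ball around \<open>f\<^sub>0\<close>
this bounds \<open>g\<close> and \<open>g\<^sup>-\<^sup>1\<close> by multiples of their values at \<open>f\<^sub>0\<close>, which are bounded because the
surface is compact. For two points of the ball it bounds the differences by a multiple of \<open>e\<^sup>\<kappa> - 1\<close>,
so by a multiple of \<open>L\<close> when \<open>L \<le> 1\<close>, and for longer paths the uniform bound is already a multiple
of \<open>L\<close>. The induced fiber metrics are products of components of \<open>g\<close> and \<open>g\<^sup>-\<^sup>1\<close>, so they inherit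
both estimates (\<open>fiber_metric_Lipschitz\<close>). The metric and its inverse are the fiber metrics on
vectors and covectors.

The pointwise argument needs that maps of class \<open>H\<^sup>l\<close> with \<open>l \<ge> 3\<close> are continuously differentiable,
with first derivatives bounded by the \<open>H\<^sup>l\<close> norm (\<open>sobolev_map_cell\<close>, \<open>pderiv_le_map_norm\<close>). It is
then carried out in finitely many coordinate rectangles; the pointwise norm of a tensor does not
depend on the chart, so bounds there are bounds everywhere (\<open>Linf_norm_le_cells\<close>).

That the fiber metrics lie in \<open>H\<^sup>l\<^sup>-\<^sup>1\<close> (\<open>fiber_metric_sobolev\<close>) rests on two facts about \<open>H\<^sup>k\<close> on a
rectangle with \<open>k \<ge> 2\<close>: it is an algebra (\<open>sobolev_Cauchy_mult\<close>), and it is closed under inversion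
of functions bounded away from zero (\<open>sobolev_Cauchy_inverse\<close>). Both are proved for Cauchy sequences
of smooth functions, since \<open>H\<^sup>k\<close> is a completion; the underlying inequalities come from the
one-dimensional Sobolev inequality applied along the two coordinate directions.\<close>

section \<open>Iterated integrals on a rectangle\<close>

definition vec2 :: "real \<Rightarrow> real \<Rightarrow> real^2" where
  "vec2 s t = (\<chi> i. if i = 1 then s else t)"

lemma vec2_nth [simp]: "vec2 s t $ 1 = s" "vec2 s t $ 2 = t"
  by (simp_all add: vec2_def)

lemma vec2_eta [simp]: "vec2 (y $ 1) (y $ 2) = y"
  by (simp add: vec_eq_iff forall_2)

lemma mem_cbox_2: "y \<in> cbox a b \<longleftrightarrow> a$1 \<le> y$1 \<and> y$1 \<le> b$1 \<and> a$2 \<le> y$2 \<and> y$2 \<le> b$2"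
  for y :: "real^2"
  by (auto simp: mem_box_cart forall_2)

lemma vec2_in_cbox: "vec2 s t \<in> cbox a b \<longleftrightarrow> s \<in> {a$1..b$1} \<and> t \<in> {a$2..b$2}"
  by (auto simp: mem_cbox_2)

lemma box_2_nonempty: "box a b \<noteq> {} \<longleftrightarrow> a$1 < b$1 \<and> a$2 < b$2" for a b :: "real^2"
  by (simp add: interval_ne_empty_cart forall_2)

lemma cbox_pair_real: "cbox (p, q) (r, s) = {p..r} \<times> {q..s}" for p q r s :: real
  by (simp add: cbox_Pair_eq)

lemma vec2_image_cbox: "(\<lambda>z. vec2 (fst z) (snd z)) ` cbox u v = cbox (vec2 (fst u) (snd u)) (vec2 (fst v) (snd v))"
proof -
  have "y \<in> (\<lambda>z. vec2 (fst z) (snd z)) ` cbox u v" if "y \<in> cbox (vec2 (fst u) (snd u)) (vec2 (fst v) (snd v))" for y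
    using that
    by (intro image_eqI[where x = "(y$1, y$2)"], simp, cases u, cases v) (auto simp: mem_cbox_2 cbox_pair_real)
  then show ?thesis
    by (cases u, cases v) (auto simp: mem_cbox_2 cbox_pair_real)
qed

lemma pair_image_cbox: "(\<lambda>y. (y$1, y$2)) ` cbox a b = cbox (a$1, a$2) (b$1, b$2)" for a b :: "real^2"
proof -
  have "z \<in> (\<lambda>y. (y$1, y$2)) ` cbox a b" if "z \<in> cbox (a$1, a$2) (b$1, b$2)" for z
    using that
    by (intro image_eqI[where x = "vec2 (fst z) (snd z)"]) (auto simp: mem_cbox_2 cbox_pair_real)
  then show ?thesis
    by (auto simp: mem_cbox_2 cbox_pair_real)
qed

lemma continuous_vec2: "continuous_on S (\<lambda>z. vec2 (fst z) (snd z))"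
  unfolding vec2_def
  by (intro continuous_on_vec_lambda, case_tac "i = 1") (auto intro!: continuous_intros)

lemma continuous_on_vec2_comp:
  assumes "continuous_on (cbox a b) F"
  shows "continuous_on (cbox (a$1, a$2) (b$1, b$2)) (\<lambda>(s, t). F (vec2 s t))"
    and "s \<in> {a$1..b$1} \<Longrightarrow> continuous_on {a$2..b$2} (\<lambda>t. F (vec2 s t))"
    and "t \<in> {a$2..b$2} \<Longrightarrow> continuous_on {a$1..b$1} (\<lambda>s. F (vec2 s t))"
proof -
  show *: "continuous_on (cbox (a$1, a$2) (b$1, b$2)) (\<lambda>(s, t). F (vec2 s t))"
    unfolding case_prod_beta
    by (rule continuous_on_compose2[OF assms continuous_vec2]) (auto simp: cbox_pair_real vec2_in_cbox)
  show "s \<in> {a$1..b$1} \<Longrightarrow> continuous_on {a$2..b$2} (\<lambda>t. F (vec2 s t))"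
    using continuous_on_compose2[OF *, of "{a$2..b$2}" "\<lambda>t. (s, t)"]
    by (auto simp: cbox_pair_real image_subset_iff continuous_on_Pair)
  show "t \<in> {a$2..b$2} \<Longrightarrow> continuous_on {a$1..b$1} (\<lambda>s. F (vec2 s t))"
    using continuous_on_compose2[OF *, of "{a$1..b$1}" "\<lambda>s. (s, t)"]
    by (auto simp: cbox_pair_real image_subset_iff continuous_on_Pair)
qed

lemma ex_2: "(\<exists>i::2. P i) \<longleftrightarrow> P 1 \<or> P 2"
  using forall_2[of "\<lambda>i. \<not> P i"] by blast

text \<open>The coordinates identify the plane with the product of two lines and preserve the content of
rectangles, so integrals over rectangles can be moved to the product, where iterated integration
applies.\<close>

lemma integral_cbox_vec2:
  fixes F :: "real^2 \<Rightarrow> real"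
  assumes "continuous_on (cbox a b) F"
  shows "integral (cbox a b) F = integral (cbox (a$1, a$2) (b$1, b$2)) (\<lambda>(s, t). F (vec2 s t))"
proof -
  let ?g = "\<lambda>z. vec2 (fst z) (snd z)" and ?h = "\<lambda>y::real^2. (y$1, y$2)"
  have "(F has_integral integral (cbox a b) F) (cbox a b)"
    using integrable_continuous[OF assms] by blast
  then have "((\<lambda>x. F (?g x)) has_integral (1 / 1) *\<^sub>R integral (cbox a b) F) (?h ` cbox a b)"
  proof (rule has_integral_twiddle[rotated -1])
    show "measure lborel (?g ` cbox u v) = 1 * measure lborel (cbox u v)" for u v
      unfolding vec2_image_cbox
      by (cases u, cases v) (auto simp: content_Pair content_cbox_if_cart UNIV_2
        interval_eq_empty_cart ex_2 content_real_if)
    show "continuous (at x) ?g" for x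
      using continuous_vec2[of UNIV] by (cases x) (simp add: continuous_on_eq_continuous_at)
  qed (auto simp: vec2_image_cbox pair_image_cbox)
  then show ?thesis
    by (simp add: pair_image_cbox case_prod_unfold integral_unique)
qed

lemma integral_cbox_iterated:
  fixes F :: "real^2 \<Rightarrow> real"
  assumes "continuous_on (cbox a b) F"
  shows "integral (cbox a b) F = integral {a$1..b$1} (\<lambda>s. integral {a$2..b$2} (\<lambda>t. F (vec2 s t)))"
    and "integral (cbox a b) F = integral {a$2..b$2} (\<lambda>t. integral {a$1..b$1} (\<lambda>s. F (vec2 s t)))"
proof -
  note c = continuous_on_vec2_comp(1)[OF assms]
  show "integral (cbox a b) F = integral {a$1..b$1} (\<lambda>s. integral {a$2..b$2} (\<lambda>t. F (vec2 s t)))"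
    using integral_integrable_2dim[OF c] integral_cbox_vec2[OF assms] integral_prod_continuous[OF c] by simp
  then show "integral (cbox a b) F = integral {a$2..b$2} (\<lambda>t. integral {a$1..b$1} (\<lambda>s. F (vec2 s t)))"
    using integral_swap_continuous[OF c] by simp
qed

text \<open>The values \<open>(w s)\<^sup>2\<close> and \<open>(w t)\<^sup>2\<close> differ by an integral of \<open>2 w w'\<close>, which is dominated by
\<open>w\<^sup>2 + w'\<^sup>2\<close>. Averaging over all \<open>t\<close> produces the factor \<open>1 / (q - p)\<close>.\<close>

lemma sobolev_1d:
  fixes w w' :: "real \<Rightarrow> real"
  assumes "p < q" and d: "\<And>x. x \<in> {p..q} \<Longrightarrow> (w has_real_derivative w' x) (at x within {p..q})"
    and w': "continuous_on {p..q} w'" and s: "s \<in> {p..q}"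
  shows "(w s)\<^sup>2 \<le> (1 / (q - p) + 1) * integral {p..q} (\<lambda>x. (w x)\<^sup>2 + (w' x)\<^sup>2)"
proof -
  let ?E = "\<lambda>x. (w x)\<^sup>2 + (w' x)\<^sup>2"
  let ?J = "integral {p..q} ?E"
  have w: "continuous_on {p..q} w"
    using d DERIV_continuous continuous_on_eq_continuous_within by blast
  have E: "?E integrable_on {p..q}" and W: "(\<lambda>x. (w x)\<^sup>2) integrable_on {p..q}"
    using w w' by (auto intro!: integrable_continuous_real continuous_intros)
  have diff: "\<bar>(w y)\<^sup>2 - (w x)\<^sup>2\<bar> \<le> ?J" if "p \<le> x" "x \<le> y" "y \<le> q" for x y
  proof -
    have sub: "{x..y} \<subseteq> {p..q}" using that by auto
    have I: "((\<lambda>z. 2 * w z * w' z) has_integral (w y)\<^sup>2 - (w x)\<^sup>2) {x..y}"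
      using \<open>x \<le> y\<close>
      by (rule fundamental_theorem_of_calculus)
         (use sub in \<open>auto intro!: derivative_eq_intros DERIV_subset[OF d]
            simp flip: has_real_derivative_iff_has_vector_derivative\<close>)
    have "?E integrable_on {x..y}"
      using E sub integrable_on_subinterval by blast
    moreover have "norm (2 * w z * w' z) \<le> ?E z" for z
      using sum_squares_bound[of "w z" "w' z"] sum_squares_bound[of "w z" "- w' z"] by (auto simp: abs_if)
    ultimately have "norm (integral {x..y} (\<lambda>z. 2 * w z * w' z)) \<le> integral {x..y} ?E"
      using I by (intro integral_norm_bound_integral) auto
    also have "\<dots> \<le> ?J"
      using \<open>?E integrable_on {x..y}\<close> E sub by (intro integral_subset_le) auto
    finally show ?thesis
      using I by (simp add: integral_unique)
  qed
  have "(w s)\<^sup>2 \<le> (w t)\<^sup>2 + ?J" if "t \<in> {p..q}" for t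
    using diff[of s t] diff[of t s] that s by (cases "s \<le> t") auto
  then have "integral {p..q} (\<lambda>t. (w s)\<^sup>2) \<le> integral {p..q} (\<lambda>t. (w t)\<^sup>2 + ?J)"
    using W by (intro integral_le) (auto intro!: integrable_add)
  also have "\<dots> = integral {p..q} (\<lambda>t. (w t)\<^sup>2) + (q - p) * ?J"
    using W \<open>p < q\<close> by (subst integral_add) auto
  also have "integral {p..q} (\<lambda>t. (w t)\<^sup>2) \<le> ?J"
    using W E by (intro integral_le) auto
  finally show ?thesis
    using \<open>p < q\<close> by (simp add: field_simps)
qed

section \<open>Smooth functions\<close>

lemma frechet_derivative_cong_open:
  assumes "open S" "y \<in> S" and eq: "\<And>z. z \<in> S \<Longrightarrow> u z = v z"
  shows "frechet_derivative u (at y) = frechet_derivative v (at y)"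
proof -
  have "(u has_derivative D) (at y) \<longleftrightarrow> (v has_derivative D) (at y)" for D
    using has_derivative_transform_within_open[of _ _ y UNIV S] assms by metis
  then show ?thesis
    by (simp add: frechet_derivative_def)
qed

lemma pderiv_at_cong_open:
  assumes "open S" "y \<in> S" "\<And>z. z \<in> S \<Longrightarrow> u z = v z"
  shows "pderiv_at i u y = pderiv_at i v y"
  unfolding pderiv_at_def using frechet_derivative_cong_open[OF assms] by simp

lemma pderiv_at_eqI: "(u has_derivative D) (at y) \<Longrightarrow> pderiv_at i u y = D (axis i 1)"
  unfolding pderiv_at_def by (metis frechet_derivative_at)

lemma differentiable_cong_open:
  assumes "open S" "y \<in> S" "\<And>z. z \<in> S \<Longrightarrow> u z = v z" "u differentiable (at y)"
  shows "v differentiable (at y)"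
  using assms has_derivative_transform_within_open[of _ _ y UNIV S] unfolding differentiable_def by metis

lemma differentiable_has_derivative: "u differentiable (at y) \<Longrightarrow> (u has_derivative frechet_derivative u (at y)) (at y)"
  using frechet_derivative_works by blast

lemma frechet_derivative_eq_sum_pderiv:
  assumes "F differentiable (at y)"
  shows "frechet_derivative F (at y) u = (\<Sum>i\<in>UNIV. u $ i *\<^sub>R pderiv_at i F y)"
proof -
  have lin: "linear (frechet_derivative F (at y))" using assms by (rule linear_frechet_derivative)
  have "u = (\<Sum>i\<in>UNIV. u $ i *\<^sub>R axis i 1)"
    by (simp add: vec_eq_iff axis_def if_distrib[of "\<lambda>x. _ * x"] cong: if_cong)
  then have "frechet_derivative F (at y) u = frechet_derivative F (at y) (\<Sum>i\<in>UNIV. u $ i *\<^sub>R axis i 1)"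
    by (rule arg_cong)
  then show ?thesis
    by (simp add: linear_sum[OF lin] linear_scale[OF lin] pderiv_at_def)
qed

lemma pderiv_at_add:
  assumes "u differentiable (at y)" "v differentiable (at y)"
  shows "pderiv_at i (\<lambda>z. u z + v z) y = pderiv_at i u y + pderiv_at i v y"
  using pderiv_at_eqI[OF has_derivative_add[OF assms[THEN differentiable_has_derivative]]]
  by (simp add: pderiv_at_def)

lemma pderiv_at_diff:
  assumes "u differentiable (at y)" "v differentiable (at y)"
  shows "pderiv_at i (\<lambda>z. u z - v z) y = pderiv_at i u y - pderiv_at i v y"
  using pderiv_at_eqI[OF has_derivative_diff[OF assms[THEN differentiable_has_derivative]]]
  by (simp add: pderiv_at_def)

lemma pderiv_at_scaleR:
  assumes "u differentiable (at y)"
  shows "pderiv_at i (\<lambda>z. r *\<^sub>R u z) y = r *\<^sub>R pderiv_at i u y"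
  using pderiv_at_eqI[OF has_derivative_scaleR_right[OF assms[THEN differentiable_has_derivative]]]
  by (simp add: pderiv_at_def)

lemma pderiv_at_mult:
  fixes u v :: "real^2 \<Rightarrow> real"
  assumes "u differentiable (at y)" "v differentiable (at y)"
  shows "pderiv_at i (\<lambda>z. u z * v z) y = u y * pderiv_at i v y + pderiv_at i u y * v y"
  using pderiv_at_eqI[OF has_derivative_mult[OF assms[THEN differentiable_has_derivative]]]
  by (simp add: pderiv_at_def)

lemma pderiv_at_inverse:
  fixes u :: "real^2 \<Rightarrow> real"
  assumes "u differentiable (at y)" "u y \<noteq> 0"
  shows "pderiv_at i (\<lambda>z. inverse (u z)) y = - (pderiv_at i u y * (inverse (u y) * inverse (u y)))"
proof -
  have "((\<lambda>z. inverse (u z)) has_derivative (\<lambda>h. - (inverse (u y) * frechet_derivative u (at y) h * inverse (u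
      y)))) (at y)"
    using Deriv.has_derivative_inverse[OF assms(2) differentiable_has_derivative[OF assms(1)]] .
  from pderiv_at_eqI[OF this] show ?thesis
    by (simp add: pderiv_at_def mult_ac)
qed

lemma pderiv_at_const [simp]: "pderiv_at i (\<lambda>z. c) y = 0"
  by (rule pderiv_at_eqI[OF has_derivative_const])

lemma pderiv_at_nth:
  assumes "u differentiable (at y)"
  shows "pderiv_at i (\<lambda>z. u z $ k) y = pderiv_at i u y $ k"
  using pderiv_at_eqI[OF bounded_linear.has_derivative[OF bounded_linear_vec_nth
      differentiable_has_derivative[OF assms]], of i k]
  by (simp add: pderiv_at_def)

lemma iter_pderiv_append: "iter_pderiv (is @ js) u = iter_pderiv is (iter_pderiv js u)"
  by (induction "is") auto

lemma smooth_fun_on_iff: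
  "smooth_fun_on S u \<longleftrightarrow> open S \<and> (\<forall>y\<in>S. u differentiable (at y)) \<and> (\<forall>i. smooth_fun_on S (pderiv_at i u))"
proof
  assume u: "smooth_fun_on S u"
  have "smooth_fun_on S (pderiv_at i u)" for i
    unfolding smooth_fun_on_def
  proof (intro conjI allI ballI)
    show "iter_pderiv is (pderiv_at i u) differentiable at y" if "y \<in> S" for "is" y
      using u that iter_pderiv_append[of "is" "[i]" u] by (metis iter_pderiv.simps smooth_fun_on_def)
  qed (use u in \<open>simp add: smooth_fun_on_def\<close>)
  then show "open S \<and> (\<forall>y\<in>S. u differentiable (at y)) \<and> (\<forall>i. smooth_fun_on S (pderiv_at i u))"
    using u unfolding smooth_fun_on_def by (metis iter_pderiv.simps(1))
next
  assume u: "open S \<and> (\<forall>y\<in>S. u differentiable (at y)) \<and> (\<forall>i. smooth_fun_on S (pderiv_at i u))"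
  have "iter_pderiv is u differentiable at y" if "y \<in> S" for "is" y
  proof (cases "is" rule: rev_cases)
    case Nil
    then show ?thesis using u that by simp
  next
    case (snoc js i)
    then show ?thesis using u that by (simp add: iter_pderiv_append smooth_fun_on_def)
  qed
  then show "smooth_fun_on S u"
    using u by (simp add: smooth_fun_on_def)
qed

text \<open>Differentiability to a given order, by recursion on the innermost derivative. Since
\<open>iter_pderiv\<close> adds derivatives on the outside, only this form lets the product and quotient rules be
applied first and the induction hypothesis to the resulting terms.\<close>

primrec diff_order :: "nat \<Rightarrow> (real^2) set \<Rightarrow> (real^2 \<Rightarrow> real) \<Rightarrow> bool" where
  "diff_order 0 S u \<longleftrightarrow> True"
| "diff_order (Suc n) S u \<longleftrightarrow> (\<forall>y\<in>S. u differentiable (at y)) \<and> (\<forall>i. diff_order n S (pderiv_at i u))"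

lemma smooth_fun_on_imp_diff_order: "smooth_fun_on S u \<Longrightarrow> diff_order n S u"
proof (induction n arbitrary: u)
  case (Suc n)
  then show ?case using smooth_fun_on_iff[of S u] by simp
qed simp

lemma diff_order_iter_pderiv: "diff_order (Suc (length is)) S u \<Longrightarrow> y \<in> S \<Longrightarrow> iter_pderiv is u differentiable (at y)"
  by (induction "is" arbitrary: u rule: rev_induct) (auto simp: iter_pderiv_append)

lemma smooth_fun_onI:
  assumes "open S" "\<And>n. diff_order n S u"
  shows "smooth_fun_on S u"
  using assms diff_order_iter_pderiv unfolding smooth_fun_on_def by blast

lemma smooth_fun_on_eq_diff_order:
  fixes u :: "real^2 \<Rightarrow> real"
  shows "smooth_fun_on S u \<longleftrightarrow> open S \<and> (\<forall>n. diff_order n S u)"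
  using smooth_fun_onI[of S u] smooth_fun_on_imp_diff_order[of S u]
  unfolding smooth_fun_on_def by blast

lemma diff_order_cong:
  assumes "open S" "\<And>y. y \<in> S \<Longrightarrow> u y = v y" "diff_order n S u"
  shows "diff_order n S v"
  using assms(2,3)
proof (induction n arbitrary: u v)
  case (Suc n)
  have "diff_order n S (pderiv_at i v)" for i
  proof (rule Suc.IH)
    show "pderiv_at i u y = pderiv_at i v y" if "y \<in> S" for y
      using pderiv_at_cong_open[OF \<open>open S\<close> that Suc.prems(1)] .
  qed (use Suc.prems in auto)
  moreover have "v differentiable (at y)" if "y \<in> S" for y
    using differentiable_cong_open[OF \<open>open S\<close> that Suc.prems(1)] Suc.prems(2) that by simp
  ultimately show ?case
    by simp
qed auto

lemma diff_order_Suc_imp: "diff_order (Suc n) S u \<Longrightarrow> diff_order n S u"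
  by (induction n arbitrary: u) auto

lemma diff_order_const: "diff_order n S (\<lambda>y. c)"
proof (induction n arbitrary: c)
  case (Suc n)
  have "pderiv_at i (\<lambda>y. c) = (\<lambda>y. 0)" for i by (rule ext) simp
  then show ?case using Suc by simp
qed auto

lemma diff_order_add:
  assumes "open S"
  shows "diff_order n S u \<Longrightarrow> diff_order n S v \<Longrightarrow> diff_order n S (\<lambda>y. u y + v y)"
proof (induction n arbitrary: u v)
  case (Suc n)
  have "diff_order n S (pderiv_at i (\<lambda>y. u y + v y))" for i
    by (rule diff_order_cong[OF \<open>open S\<close> _ Suc.IH[of "pderiv_at i u" "pderiv_at i v"]])
       (use Suc.prems in \<open>auto simp: pderiv_at_add\<close>)
  then show ?case
    using Suc.prems by (auto intro: differentiable_add)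
qed auto

lemma diff_order_mult:
  assumes "open S"
  shows "diff_order n S u \<Longrightarrow> diff_order n S v \<Longrightarrow> diff_order n S (\<lambda>y. u y * v y)"
proof (induction n arbitrary: u v)
  case (Suc n)
  have "diff_order n S (pderiv_at i (\<lambda>y. u y * v y))" for i
    by (rule diff_order_cong[OF \<open>open S\<close> _ diff_order_add[OF \<open>open S\<close>
          Suc.IH[of u "pderiv_at i v"] Suc.IH[of "pderiv_at i u" v]]])
       (use Suc.prems in \<open>auto simp: pderiv_at_mult diff_order_Suc_imp[simplified]\<close>)
  then show ?case
    using Suc.prems by (auto intro: differentiable_mult)
qed auto

lemma diff_order_inverse:
  assumes "open S" and nz: "\<And>y. y \<in> S \<Longrightarrow> u y \<noteq> 0"
  shows "diff_order n S u \<Longrightarrow> diff_order n S (\<lambda>y. inverse (u y))"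
proof (induction n)
  case (Suc n)
  note * = diff_order_mult[OF \<open>open S\<close>]
  have IH: "diff_order n S (\<lambda>y. inverse (u y))"
    using Suc diff_order_Suc_imp by blast
  have "diff_order n S (pderiv_at i (\<lambda>y. inverse (u y)))" for i
    by (rule diff_order_cong[OF \<open>open S\<close> _ *[OF diff_order_const[of n S "-1"] *[OF _ *[OF IH IH]], of "pderiv_at
        i u"]])
       (use Suc.prems nz in \<open>auto simp: pderiv_at_inverse\<close>)
  then show ?case
    using Suc.prems nz by (auto intro: differentiable_inverse)
qed auto

lemma smooth_fun_on_open: "smooth_fun_on S u \<Longrightarrow> open S"
  by (simp add: smooth_fun_on_def)

lemma smooth_fun_on_differentiable: "smooth_fun_on S u \<Longrightarrow> y \<in> S \<Longrightarrow> u differentiable (at y)"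
  using smooth_fun_on_iff by blast

lemma smooth_fun_on_pderiv: "smooth_fun_on S u \<Longrightarrow> smooth_fun_on S (pderiv_at i u)"
  using smooth_fun_on_iff by blast

lemma smooth_fun_on_continuous: "smooth_fun_on S u \<Longrightarrow> continuous_on S u"
  by (intro continuous_at_imp_continuous_on ballI differentiable_imp_continuous_within)
     (rule smooth_fun_on_differentiable)

lemma smooth_fun_on_cong:
  fixes u v :: "real^2 \<Rightarrow> real"
  assumes "smooth_fun_on S u" "\<And>y. y \<in> S \<Longrightarrow> u y = v y"
  shows "smooth_fun_on S v"
proof (rule smooth_fun_onI)
  show o: "open S" using assms smooth_fun_on_open by blast
  show "diff_order n S v" for n
    by (rule diff_order_cong[OF o assms(2) smooth_fun_on_imp_diff_order[OF assms(1)]])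
qed

lemma smooth_fun_on_const: "open S \<Longrightarrow> smooth_fun_on S (\<lambda>y. c :: real)"
  by (rule smooth_fun_onI[OF _ diff_order_const])

lemma smooth_fun_on_add:
  fixes u v :: "real^2 \<Rightarrow> real"
  shows "smooth_fun_on S u \<Longrightarrow> smooth_fun_on S v \<Longrightarrow> smooth_fun_on S (\<lambda>y. u y + v y)"
  unfolding smooth_fun_on_eq_diff_order using diff_order_add[of S] by blast

lemma smooth_fun_on_mult:
  fixes u v :: "real^2 \<Rightarrow> real"
  shows "smooth_fun_on S u \<Longrightarrow> smooth_fun_on S v \<Longrightarrow> smooth_fun_on S (\<lambda>y. u y * v y)"
  unfolding smooth_fun_on_eq_diff_order using diff_order_mult[of S] by blast

lemma smooth_fun_on_inverse:
  fixes u :: "real^2 \<Rightarrow> real"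
  shows "smooth_fun_on S u \<Longrightarrow> (\<And>y. y \<in> S \<Longrightarrow> u y \<noteq> 0) \<Longrightarrow> smooth_fun_on S (\<lambda>y. inverse (u y))"
  unfolding smooth_fun_on_eq_diff_order using diff_order_inverse[of S] by blast

lemma smooth_fun_on_cmult:
  fixes u :: "real^2 \<Rightarrow> real"
  shows "smooth_fun_on S u \<Longrightarrow> smooth_fun_on S (\<lambda>y. c * u y)"
  by (rule smooth_fun_on_mult[OF smooth_fun_on_const]) (auto dest: smooth_fun_on_open)

lemma smooth_fun_on_diff:
  fixes u v :: "real^2 \<Rightarrow> real"
  shows "smooth_fun_on S u \<Longrightarrow> smooth_fun_on S v \<Longrightarrow> smooth_fun_on S (\<lambda>y. u y - v y)"
  using smooth_fun_on_add[of S u "\<lambda>y. -1 * v y"] smooth_fun_on_cmult[of S v "-1"] by simp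

lemma smooth_fun_on_sum:
  fixes u :: "'i \<Rightarrow> real^2 \<Rightarrow> real"
  assumes "open S" "\<And>i. i \<in> X \<Longrightarrow> smooth_fun_on S (u i)"
  shows "smooth_fun_on S (\<lambda>y. \<Sum>i\<in>X. u i y)"
  using assms(2)
proof (induction X rule: infinite_finite_induct)
  case (insert i X)
  then show ?case
    using smooth_fun_on_add[of S "u i" "\<lambda>y. \<Sum> i\<in>X. u i y"] by simp
qed (simp_all add: smooth_fun_on_const[OF assms(1)])

lemma smooth_fun_on_prod:
  fixes u :: "'i \<Rightarrow> real^2 \<Rightarrow> real"
  assumes "open S" "\<And>i. i \<in> X \<Longrightarrow> smooth_fun_on S (u i)"
  shows "smooth_fun_on S (\<lambda>y. \<Prod>i\<in>X. u i y)"
  using assms(2)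
proof (induction X rule: infinite_finite_induct)
  case (insert i X)
  then show ?case
    using smooth_fun_on_mult[of S "u i" "\<lambda>y. \<Prod> i\<in>X. u i y"] by simp
qed (simp_all add: smooth_fun_on_const[OF assms(1)])

section \<open>Sobolev inequalities on a rectangle\<close>

lemma vec2_alt: "vec2 s t = s *\<^sub>R axis 1 1 + t *\<^sub>R axis 2 1"
  by (simp add: vec_eq_iff forall_2 axis_def)

lemma has_derivative_vec2_line:
  shows "((\<lambda>x. vec2 x t) has_derivative (\<lambda>h. h *\<^sub>R axis 1 1)) (at s within X)"
    and "((\<lambda>x. vec2 s x) has_derivative (\<lambda>h. h *\<^sub>R axis 2 1)) (at t within X)"
  unfolding vec2_alt by (auto intro!: derivative_eq_intros)

lemma DERIV_along_axis:
  fixes u :: "real^2 \<Rightarrow> real"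
  assumes "u differentiable (at (vec2 s t))"
  shows "((\<lambda>x. u (vec2 x t)) has_real_derivative pderiv_at 1 u (vec2 s t)) (at s within X)"
    and "((\<lambda>x. u (vec2 s x)) has_real_derivative pderiv_at 2 u (vec2 s t)) (at t within X)"
proof -
  let ?D = "frechet_derivative u (at (vec2 s t))"
  have u: "(u has_derivative ?D) (at (vec2 s t))"
    using assms by (rule differentiable_has_derivative)
  have lin: "?D (h *\<^sub>R v) = pd * h" if "pd = ?D v" for h v pd
    using linear_frechet_derivative[OF assms] that by (simp add: linear_scale)
  show "((\<lambda>x. u (vec2 x t)) has_real_derivative pderiv_at 1 u (vec2 s t)) (at s within X)"
    unfolding has_field_derivative_def
    using has_derivative_compose[OF has_derivative_vec2_line(1)[of t s X] u]
    by (simp add: lin pderiv_at_def)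
  show "((\<lambda>x. u (vec2 s x)) has_real_derivative pderiv_at 2 u (vec2 s t)) (at t within X)"
    unfolding has_field_derivative_def
    using has_derivative_compose[OF has_derivative_vec2_line(2)[of s t X] u]
    by (simp add: lin pderiv_at_def)
qed

lemma inner_integral_integrable:
  fixes F :: "real^2 \<Rightarrow> real"
  assumes F: "continuous_on (cbox a b) F"
  shows "(\<lambda>s. integral {a$2..b$2} (\<lambda>t. F (vec2 s t))) integrable_on {a$1..b$1}"
    and "(\<lambda>t. integral {a$1..b$1} (\<lambda>s. F (vec2 s t))) integrable_on {a$2..b$2}"
proof -
  show "(\<lambda>s. integral {a$2..b$2} (\<lambda>t. F (vec2 s t))) integrable_on {a$1..b$1}"
    using integral_integrable_2dim[OF continuous_on_vec2_comp(1)[OF F]] by simp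
  have "continuous_on (cbox (a$2, a$1) (b$2, b$1)) (\<lambda>z. (snd z, fst z))"
    by (intro continuous_intros)
  then have "continuous_on (cbox (a$2, a$1) (b$2, b$1)) (\<lambda>(t, s). F (vec2 s t))"
    using continuous_on_compose2[OF continuous_on_vec2_comp(1)[OF F]]
    by (force simp: cbox_pair_real case_prod_unfold)
  from integral_integrable_2dim[OF this]
  show "(\<lambda>t. integral {a$1..b$1} (\<lambda>s. F (vec2 s t))) integrable_on {a$2..b$2}"
    by simp
qed

text \<open>The derivatives are required to exist in full neighbourhoods of the points of the closed
rectangle, so that the values on the boundary are covered by the same chain rule as those in the
interior.\<close>

definition C1_on_cbox :: "real^2 \<Rightarrow> real^2 \<Rightarrow> (real^2 \<Rightarrow> real) \<Rightarrow> bool" where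
  "C1_on_cbox a b u \<longleftrightarrow>
     (\<forall>y\<in>cbox a b. u differentiable (at y)) \<and> (\<forall>i. continuous_on (cbox a b) (pderiv_at i u))"

lemma C1_on_cbox_continuous: "C1_on_cbox a b u \<Longrightarrow> continuous_on (cbox a b) u"
  unfolding C1_on_cbox_def
  by (intro continuous_at_imp_continuous_on ballI differentiable_imp_continuous_within) auto

lemma smooth_fun_on_C1_on_cbox: "smooth_fun_on S u \<Longrightarrow> cbox a b \<subseteq> S \<Longrightarrow> C1_on_cbox a b u"
  unfolding C1_on_cbox_def
  using smooth_fun_on_differentiable smooth_fun_on_continuous[OF smooth_fun_on_pderiv]
    continuous_on_subset by blast

definition l2sq :: "real^2 \<Rightarrow> real^2 \<Rightarrow> (real^2 \<Rightarrow> real) \<Rightarrow> real" where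
  "l2sq a b u = integral (cbox a b) (\<lambda>y. (u y)\<^sup>2)"

lemma l2sq_integrable: "continuous_on (cbox a b) u \<Longrightarrow> (\<lambda>y. (u y :: real)\<^sup>2) integrable_on cbox a b"
  by (intro integrable_continuous continuous_intros)

lemma l2sq_nonneg [simp]: "0 \<le> l2sq a b u"
  unfolding l2sq_def by (cases "(\<lambda>y. (u y)\<^sup>2) integrable_on cbox a b") (auto intro: integral_nonneg simp:
      not_integrable_integral)

lemma l2sq_cong: "(\<And>y. y \<in> cbox a b \<Longrightarrow> u y = v y) \<Longrightarrow> l2sq a b u = l2sq a b v"
  unfolding l2sq_def by (intro integral_cong) auto

definition h1sq :: "real^2 \<Rightarrow> real^2 \<Rightarrow> (real^2 \<Rightarrow> real) \<Rightarrow> real" where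
  "h1sq a b u = l2sq a b u + (\<Sum>i\<in>UNIV. l2sq a b (pderiv_at i u))"

definition box_const :: "real^2 \<Rightarrow> real^2 \<Rightarrow> real" where
  "box_const a b = (1 / (b$1 - a$1) + 1) * (1 / (b$2 - a$2) + 1)"

lemma box_const_nonneg: "box a b \<noteq> {} \<Longrightarrow> 0 \<le> box_const a b"
  by (simp add: box_2_nonempty box_const_def)

lemma sobolev_along_axis:
  assumes ne: "box a b \<noteq> {}" and w: "C1_on_cbox a b w" and y: "y \<in> cbox a b"
  shows "(w y)\<^sup>2 \<le> (1 / (b$1 - a$1) + 1) *
           integral {a$1..b$1} (\<lambda>s. (w (vec2 s (y$2)))\<^sup>2 + (pderiv_at 1 w (vec2 s (y$2)))\<^sup>2)"
    and "(w y)\<^sup>2 \<le> (1 / (b$2 - a$2) + 1) *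
           integral {a$2..b$2} (\<lambda>t. (w (vec2 (y$1) t))\<^sup>2 + (pderiv_at 2 w (vec2 (y$1) t))\<^sup>2)"
proof -
  have yy: "y$1 \<in> {a$1..b$1}" "y$2 \<in> {a$2..b$2}" and lt: "a$1 < b$1" "a$2 < b$2"
    using y ne by (auto simp: mem_cbox_2 box_2_nonempty)
  have c: "continuous_on (cbox a b) (pderiv_at i w)" for i
    using w by (simp add: C1_on_cbox_def)
  have d: "w differentiable (at (vec2 s t))" if "s \<in> {a$1..b$1}" "t \<in> {a$2..b$2}" for s t
    using w that vec2_in_cbox unfolding C1_on_cbox_def by blast
  show "(w y)\<^sup>2 \<le> (1 / (b$1 - a$1) + 1) *
           integral {a$1..b$1} (\<lambda>s. (w (vec2 s (y$2)))\<^sup>2 + (pderiv_at 1 w (vec2 s (y$2)))\<^sup>2)"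
    using sobolev_1d[OF lt(1) DERIV_along_axis(1)[OF d[OF _ yy(2)]] continuous_on_vec2_comp(3)[OF c yy(2)] yy(1)]
    by simp
  show "(w y)\<^sup>2 \<le> (1 / (b$2 - a$2) + 1) *
           integral {a$2..b$2} (\<lambda>t. (w (vec2 (y$1) t))\<^sup>2 + (pderiv_at 2 w (vec2 (y$1) t))\<^sup>2)"
    using sobolev_1d[OF lt(2) DERIV_along_axis(2)[OF d[OF yy(1)]] continuous_on_vec2_comp(2)[OF c yy(1)] yy(2)]
    by simp
qed

lemma l2sq_add_integral:
  assumes "continuous_on (cbox a b) u" "continuous_on (cbox a b) v"
  shows "integral (cbox a b) (\<lambda>y. (u y)\<^sup>2 + (v y)\<^sup>2) = l2sq a b u + l2sq a b v"
  unfolding l2sq_def using assms by (intro integral_add l2sq_integrable)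

text \<open>A form of Ladyzhenskaya's inequality. On each line parallel to the second axis \<open>w\<^sup>2\<close> is
bounded by a function \<open>A\<close> of the first coordinate alone, and \<open>z\<^sup>2\<close> is bounded by a function \<open>B\<close> of
the second coordinate alone. The integral of the product \<open>A B\<close> splits into a product of two
integrals.\<close>

lemma l2sq_mult_le_h1sq:
  assumes ne: "box a b \<noteq> {}" and w: "C1_on_cbox a b w" and z: "C1_on_cbox a b z"
  shows "l2sq a b (\<lambda>y. w y * z y) \<le> box_const a b * (h1sq a b w * h1sq a b z)"
proof -
  define K1 where "K1 = 1 / (b$1 - a$1) + 1"
  define K2 where "K2 = 1 / (b$2 - a$2) + 1"
  have K: "0 \<le> K1" "0 \<le> K2" using ne by (auto simp: K1_def K2_def box_2_nonempty)
  define E where "E y = (w y)\<^sup>2 + (pderiv_at 2 w y)\<^sup>2" for y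
  define F where "F y = (z y)\<^sup>2 + (pderiv_at 1 z y)\<^sup>2" for y
  note c = C1_on_cbox_continuous[OF w] C1_on_cbox_continuous[OF z]
  have cd: "continuous_on (cbox a b) (pderiv_at i w)" "continuous_on (cbox a b) (pderiv_at i z)" for i
    using w z by (auto simp: C1_on_cbox_def)
  have E: "continuous_on (cbox a b) E" and F: "continuous_on (cbox a b) F"
    unfolding E_def F_def using c cd by (auto intro!: continuous_intros)
  have wz: "continuous_on (cbox a b) (\<lambda>y. (w y * z y)\<^sup>2)"
    using c by (auto intro!: continuous_intros)
  define A where "A s = integral {a$2..b$2} (\<lambda>t. E (vec2 s t))" for s
  define B where "B t = integral {a$1..b$1} (\<lambda>s. F (vec2 s t))" for t
  have A0: "0 \<le> A s" if "s \<in> {a$1..b$1}" for s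
    unfolding A_def using continuous_on_vec2_comp(2)[OF E that]
    by (intro integral_nonneg integrable_continuous_real) (auto simp: E_def)
  have Aint: "A integrable_on {a$1..b$1}" and Bint: "B integrable_on {a$2..b$2}"
    unfolding A_def B_def by (rule inner_integral_integrable[OF E] inner_integral_integrable[OF F])+
  have pointwise: "(w (vec2 s t) * z (vec2 s t))\<^sup>2 \<le> K2 * A s * (K1 * B t)"
    if "s \<in> {a$1..b$1}" "t \<in> {a$2..b$2}" for s t
  proof -
    have y: "vec2 s t \<in> cbox a b" using that by (simp add: vec2_in_cbox)
    show ?thesis
      unfolding power_mult_distrib
      using sobolev_along_axis(2)[OF ne w y] sobolev_along_axis(1)[OF ne z y] A0[OF that(1)] K
      by (intro mult_mono) (auto simp: A_def B_def E_def F_def K1_def K2_def)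
  qed
  have "l2sq a b (\<lambda>y. w y * z y) =
      integral {a$1..b$1} (\<lambda>s. integral {a$2..b$2} (\<lambda>t. (w (vec2 s t) * z (vec2 s t))\<^sup>2))"
    unfolding l2sq_def by (rule integral_cbox_iterated(1)[OF wz])
  also have "\<dots> \<le> integral {a$1..b$1} (\<lambda>s. K2 * A s * (K1 * integral {a$2..b$2} B))"
  proof (rule integral_le)
    show "(\<lambda>s. integral {a$2..b$2} (\<lambda>t. (w (vec2 s t) * z (vec2 s t))\<^sup>2)) integrable_on {a$1..b$1}"
      by (rule inner_integral_integrable(1)[OF wz])
    show "(\<lambda>s. K2 * A s * (K1 * integral {a$2..b$2} B)) integrable_on {a$1..b$1}"
      using Aint by (intro integrable_on_mult_left integrable_on_mult_right)
    fix s assume s: "s \<in> {a$1..b$1}"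
    have "integral {a$2..b$2} (\<lambda>t. (w (vec2 s t) * z (vec2 s t))\<^sup>2)
        \<le> integral {a$2..b$2} (\<lambda>t. K2 * A s * (K1 * B t))"
      using integrable_continuous_real[OF continuous_on_vec2_comp(2)[OF wz s]] pointwise[OF s] Bint
      by (intro integral_le integrable_on_mult_right) auto
    then show "integral {a$2..b$2} (\<lambda>t. (w (vec2 s t) * z (vec2 s t))\<^sup>2) \<le> K2 * A s * (K1 * integral {a$2..b$2} B)"
      by simp
  qed
  also have "\<dots> = K1 * K2 * (integral {a$1..b$1} A * integral {a$2..b$2} B)"
    by (simp add: mult_ac)
  also have "integral {a$1..b$1} A = l2sq a b w + l2sq a b (pderiv_at 2 w)"
    using integral_cbox_iterated(1)[OF E] l2sq_add_integral[OF c(1) cd(1)[of 2]]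
    unfolding A_def E_def[abs_def] by simp
  also have "integral {a$2..b$2} B = l2sq a b z + l2sq a b (pderiv_at 1 z)"
    using integral_cbox_iterated(2)[OF F] l2sq_add_integral[OF c(2) cd(2)[of 1]]
    unfolding B_def F_def[abs_def] by simp
  also have "K1 * K2 * ((l2sq a b w + l2sq a b (pderiv_at 2 w)) * (l2sq a b z + l2sq a b (pderiv_at 1 z)))
      \<le> K1 * K2 * (h1sq a b w * h1sq a b z)"
    using K by (intro mult_left_mono mult_mono) (auto simp: h1sq_def sum_2)
  finally show ?thesis
    by (simp add: box_const_def K1_def K2_def)
qed

text \<open>The embedding of \<open>H\<^sup>2\<close> into the bounded functions: the one-dimensional inequality along the
first axis brings in \<open>w\<close> and its first derivative, and the inequality along the second axis is then
applied to both of them.\<close>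

lemma sq_le_h1sq_h1sq:
  assumes ne: "box a b \<noteq> {}" and w: "C1_on_cbox a b w" and w': "\<And>i. C1_on_cbox a b (pderiv_at i w)"
    and y: "y \<in> cbox a b"
  shows "(w y)\<^sup>2 \<le> box_const a b * (h1sq a b w + (\<Sum>i\<in>UNIV. h1sq a b (pderiv_at i w)))"
proof -
  define K1 where "K1 = 1 / (b$1 - a$1) + 1"
  define K2 where "K2 = 1 / (b$2 - a$2) + 1"
  have K: "0 \<le> K1" "0 \<le> K2" using ne by (auto simp: K1_def K2_def box_2_nonempty)
  have yy: "y$1 \<in> {a$1..b$1}" "y$2 \<in> {a$2..b$2}"
    using y by (auto simp: mem_cbox_2)
  let ?w1 = "pderiv_at 1 w"
  define E where "E y = (w y)\<^sup>2 + (pderiv_at 2 w y)\<^sup>2" for y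
  define F where "F y = (?w1 y)\<^sup>2 + (pderiv_at 2 ?w1 y)\<^sup>2" for y
  note c = C1_on_cbox_continuous[OF w] C1_on_cbox_continuous[OF w'[of 1]]
  have cd: "continuous_on (cbox a b) (pderiv_at i w)" "continuous_on (cbox a b) (pderiv_at i ?w1)" for i
    using w w' by (auto simp: C1_on_cbox_def)
  have E: "continuous_on (cbox a b) E" and F: "continuous_on (cbox a b) F"
    unfolding E_def F_def using c cd by (auto intro!: continuous_intros)
  have W: "continuous_on (cbox a b) (\<lambda>x. (w x)\<^sup>2 + (?w1 x)\<^sup>2)"
    using c by (auto intro!: continuous_intros)
  have "(w y)\<^sup>2 \<le> K1 * integral {a$1..b$1} (\<lambda>s. (w (vec2 s (y$2)))\<^sup>2 + (?w1 (vec2 s (y$2)))\<^sup>2)"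
    unfolding K1_def by (rule sobolev_along_axis(1)[OF ne w y])
  also have "\<dots> \<le> K1 * integral {a$1..b$1} (\<lambda>s. K2 * (integral {a$2..b$2} (\<lambda>t. E (vec2 s t)) + integral
      {a$2..b$2} (\<lambda>t. F (vec2 s t))))"
  proof (intro mult_left_mono K integral_le)
    show "(\<lambda>s. (w (vec2 s (y$2)))\<^sup>2 + (?w1 (vec2 s (y$2)))\<^sup>2) integrable_on {a$1..b$1}"
      using continuous_on_vec2_comp(3)[OF W yy(2)] by (rule integrable_continuous_real)
    show "(\<lambda>s. K2 * (integral {a$2..b$2} (\<lambda>t. E (vec2 s t)) + integral {a$2..b$2} (\<lambda>t. F (vec2 s t))))
        integrable_on {a$1..b$1}"
      by (intro integrable_on_mult_right integrable_add inner_integral_integrable(1)[OF E]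
          inner_integral_integrable(1)[OF F])
    fix s assume "s \<in> {a$1..b$1}"
    then have z: "vec2 s (y$2) \<in> cbox a b" using yy by (simp add: vec2_in_cbox)
    show "(w (vec2 s (y$2)))\<^sup>2 + (?w1 (vec2 s (y$2)))\<^sup>2 \<le>
        K2 * (integral {a$2..b$2} (\<lambda>t. E (vec2 s t)) + integral {a$2..b$2} (\<lambda>t. F (vec2 s t)))"
      using sobolev_along_axis(2)[OF ne w z] sobolev_along_axis(2)[OF ne w'[of 1] z]
      unfolding distrib_left by (intro add_mono) (simp_all add: E_def F_def K2_def)
  qed
  also have "integral {a$1..b$1} (\<lambda>s. K2 * (integral {a$2..b$2} (\<lambda>t. E (vec2 s t)) + integral {a$2..b$2} (\<lambda>t. F
      (vec2 s t))))
      = K2 * (integral (cbox a b) E + integral (cbox a b) F)"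
    unfolding integral_cbox_iterated(1)[OF E] integral_cbox_iterated(1)[OF F] integral_mult_right
    by (subst integral_add[OF inner_integral_integrable(1)[OF E] inner_integral_integrable(1)[OF F]]) simp
  also have "integral (cbox a b) E = l2sq a b w + l2sq a b (pderiv_at 2 w)"
    unfolding E_def by (rule l2sq_add_integral[OF c(1) cd(1)])
  also have "integral (cbox a b) F = l2sq a b ?w1 + l2sq a b (pderiv_at 2 ?w1)"
    unfolding F_def by (rule l2sq_add_integral[OF c(2) cd(2)])
  finally have *: "(w y)\<^sup>2 \<le> K1 * K2 * ((l2sq a b w + l2sq a b (pderiv_at 2 w)) + (l2sq a b ?w1 + l2sq a b
      (pderiv_at 2 ?w1)))"
    by (simp add: mult_ac)
  have "(l2sq a b w + l2sq a b (pderiv_at 2 w)) + (l2sq a b ?w1 + l2sq a b (pderiv_at 2 ?w1))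
      \<le> h1sq a b w + (\<Sum>i\<in>UNIV. h1sq a b (pderiv_at i w))"
    by (auto simp: h1sq_def sum_2 intro!: add_nonneg_nonneg add_mono add_increasing2)
  then have "K1 * K2 * ((l2sq a b w + l2sq a b (pderiv_at 2 w)) + (l2sq a b ?w1 + l2sq a b (pderiv_at 2 ?w1)))
      \<le> K1 * K2 * (h1sq a b w + (\<Sum>i\<in>UNIV. h1sq a b (pderiv_at i w)))"
    using K by (intro mult_left_mono) auto
  with * show ?thesis
    by (simp add: box_const_def K1_def K2_def)
qed

section \<open>Cauchy sequences in Sobolev spaces on a rectangle\<close>

text \<open>Convergence to zero when both indices tend to infinity; a sequence is Cauchy for a seminorm if
the seminorms of its differences vanish in this sense.\<close>

definition vanishes2 :: "(nat \<Rightarrow> nat \<Rightarrow> real) \<Rightarrow> bool" where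
  "vanishes2 d \<longleftrightarrow> (\<forall>e>0. \<exists>N. \<forall>m\<ge>N. \<forall>n\<ge>N. \<bar>d m n\<bar> < e)"

lemma vanishes2_tendsto: "vanishes2 d \<longleftrightarrow> ((\<lambda>z. d (snd z) (fst z)) \<longlongrightarrow> 0) (sequentially \<times>\<^sub>F sequentially)"
  unfolding vanishes2_def tendsto_iff
  by (simp add: case_prod_unfold eventually_prod_sequentially[where P = "\<lambda>z. _ z", simplified])

lemma vanishes2_add: "vanishes2 c \<Longrightarrow> vanishes2 d \<Longrightarrow> vanishes2 (\<lambda>m n. c m n + d m n)"
  unfolding vanishes2_tendsto using tendsto_add[of _ 0 _ _ 0] by simp

lemma vanishes2_cmult: "vanishes2 d \<Longrightarrow> vanishes2 (\<lambda>m n. r * d m n)"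
  unfolding vanishes2_tendsto using tendsto_mult_left[of _ 0 _ r] by simp

lemma vanishes2_le:
  assumes "vanishes2 d" "\<And>m n. \<bar>c m n\<bar> \<le> d m n"
  shows "vanishes2 c"
  using assms unfolding vanishes2_def by (meson abs_le_D1 le_less_trans order_trans abs_ge_self)

lemma vanishes2_bounded_mult:
  assumes "vanishes2 d" "\<And>m n. \<bar>c m n\<bar> \<le> B" "\<And>m n. 0 \<le> d m n"
  shows "vanishes2 (\<lambda>m n. c m n * d m n)"
  by (rule vanishes2_le[OF vanishes2_cmult[OF assms(1), of B]])
     (use assms in \<open>auto simp: abs_mult intro: mult_right_mono\<close>)

lemma l2sq_mono:
  assumes "continuous_on (cbox a b) u" "continuous_on (cbox a b) v"
    and "\<And>y. y \<in> cbox a b \<Longrightarrow> \<bar>u y\<bar> \<le> \<bar>v y\<bar>"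
  shows "l2sq a b u \<le> l2sq a b v"
  unfolding l2sq_def using assms
  by (intro integral_le l2sq_integrable) (auto simp: abs_le_square_iff)

lemma l2sq_cmult: "l2sq a b (\<lambda>y. c * u y) = c\<^sup>2 * l2sq a b u"
  by (simp add: l2sq_def power_mult_distrib)

lemma l2sq_add_le:
  assumes "continuous_on (cbox a b) u" "continuous_on (cbox a b) v"
  shows "l2sq a b (\<lambda>y. u y + v y) \<le> 2 * l2sq a b u + 2 * l2sq a b v"
proof -
  have "l2sq a b (\<lambda>y. u y + v y) \<le> integral (cbox a b) (\<lambda>y. 2 * (u y)\<^sup>2 + 2 * (v y)\<^sup>2)"
    unfolding l2sq_def
  proof (rule integral_le)
    show "(u y + v y)\<^sup>2 \<le> 2 * (u y)\<^sup>2 + 2 * (v y)\<^sup>2" for y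
      using zero_le_power2[of "u y - v y"] by (simp add: power2_eq_square algebra_simps)
  qed (use assms in \<open>auto intro!: integrable_continuous continuous_intros\<close>)
  also have "\<dots> = 2 * l2sq a b u + 2 * l2sq a b v"
    unfolding l2sq_def using assms by (subst integral_add) (auto intro!: integrable_continuous continuous_intros)
  finally show ?thesis .
qed

lemma l2sq_mult_le:
  assumes "continuous_on (cbox a b) u" "continuous_on (cbox a b) v"
    and "\<And>y. y \<in> cbox a b \<Longrightarrow> \<bar>u y\<bar> \<le> B"
  shows "l2sq a b (\<lambda>y. u y * v y) \<le> B\<^sup>2 * l2sq a b v"
  unfolding l2sq_cmult[symmetric]
proof (intro l2sq_mono)
  show "\<bar>u y * v y\<bar> \<le> \<bar>B * v y\<bar>" if "y \<in> cbox a b" for y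
    using assms(3)[OF that] by (auto simp: abs_mult intro!: mult_right_mono)
qed (use assms in \<open>auto intro!: continuous_on_mult\<close>)

definition L2_Cauchy :: "real^2 \<Rightarrow> real^2 \<Rightarrow> (nat \<Rightarrow> real^2 \<Rightarrow> real) \<Rightarrow> bool" where
  "L2_Cauchy a b u \<longleftrightarrow> (\<forall>n. continuous_on (cbox a b) (u n)) \<and>
     vanishes2 (\<lambda>m n. l2sq a b (\<lambda>y. u m y - u n y))"

definition sup_Cauchy :: "real^2 \<Rightarrow> real^2 \<Rightarrow> (nat \<Rightarrow> real^2 \<Rightarrow> real) \<Rightarrow> bool" where
  "sup_Cauchy a b u \<longleftrightarrow> (\<forall>n. continuous_on (cbox a b) (u n)) \<and>
     (\<forall>e>0. \<exists>N. \<forall>m\<ge>N. \<forall>n\<ge>N. \<forall>y\<in>cbox a b. \<bar>u m y - u n y\<bar> < e)"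

lemma sup_CauchyD:
  assumes "sup_Cauchy a b u" "e > 0"
  obtains N where "\<And>m n y. m \<ge> N \<Longrightarrow> n \<ge> N \<Longrightarrow> y \<in> cbox a b \<Longrightarrow> \<bar>u m y - u n y\<bar> < e"
  using assms unfolding sup_Cauchy_def by blast

lemma vanishes2D:
  assumes "vanishes2 d" "e > 0"
  obtains N where "\<And>m n. m \<ge> N \<Longrightarrow> n \<ge> N \<Longrightarrow> \<bar>d m n\<bar> < e"
  using assms unfolding vanishes2_def by blast

lemma bounded_by_tail:
  fixes f :: "nat \<Rightarrow> real"
  assumes "\<And>n. n \<ge> N \<Longrightarrow> f n \<le> c"
  shows "\<exists>B\<ge>0. \<forall>n. f n \<le> B"
proof (intro exI[of _ "max \<bar>c\<bar> (Max ((\<lambda>n. \<bar>f n\<bar>) ` {..N}))"] conjI allI)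
  show "f n \<le> max \<bar>c\<bar> (Max ((\<lambda>n. \<bar>f n\<bar>) ` {..N}))" for n
  proof (cases "n \<ge> N")
    case True
    then show ?thesis using assms[of n] by linarith
  next
    case False
    then have "\<bar>f n\<bar> \<le> Max ((\<lambda>n. \<bar>f n\<bar>) ` {..N})" by (intro Max_ge) auto
    then show ?thesis by linarith
  qed
qed auto

lemma L2_Cauchy_bounded:
  assumes "L2_Cauchy a b u"
  shows "\<exists>B\<ge>0. \<forall>n. l2sq a b (u n) \<le> B"
proof -
  have van: "vanishes2 (\<lambda>m n. l2sq a b (\<lambda>y. u m y - u n y))" using assms by (simp add: L2_Cauchy_def)
  obtain N where N: "\<And>m n. m \<ge> N \<Longrightarrow> n \<ge> N \<Longrightarrow> \<bar>l2sq a b (\<lambda>y. u m y - u n y)\<bar> < 1"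
    by (rule vanishes2D[OF van zero_less_one]) blast
  have c: "continuous_on (cbox a b) (u n)" for n using assms by (simp add: L2_Cauchy_def)
  show ?thesis
  proof (rule bounded_by_tail)
    fix n assume "n \<ge> N"
    then have "l2sq a b (\<lambda>y. u n y - u N y) \<le> 1" using N[of n N] by auto
    then show "l2sq a b (u n) \<le> 2 * 1 + 2 * l2sq a b (u N)"
      using l2sq_add_le[of a b "\<lambda>y. u n y - u N y" "u N"] c by (simp add: continuous_on_diff)
  qed
qed

lemma sup_Cauchy_bounded:
  assumes "sup_Cauchy a b u"
  shows "\<exists>B\<ge>0. \<forall>n. \<forall>y\<in>cbox a b. \<bar>u n y\<bar> \<le> B"
proof (cases "cbox a b = {}")
  case False
  have c: "continuous_on (cbox a b) (\<lambda>y. \<bar>u n y\<bar>)" for n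
    using assms by (auto simp: sup_Cauchy_def intro!: continuous_intros)
  have "\<exists>x\<in>cbox a b. \<forall>y\<in>cbox a b. \<bar>u n y\<bar> \<le> \<bar>u n x\<bar>" for n
    using continuous_attains_sup[OF compact_cbox False c] .
  then have "\<forall>n. \<exists>x. x \<in> cbox a b \<and> (\<forall>y\<in>cbox a b. \<bar>u n y\<bar> \<le> \<bar>u n x\<bar>)"
    by blast
  from choice[OF this] obtain x
    where x: "\<And>n. x n \<in> cbox a b" "\<And>n y. y \<in> cbox a b \<Longrightarrow> \<bar>u n y\<bar> \<le> \<bar>u n (x n)\<bar>"
    by blast
  obtain N where N: "\<And>m n y. m \<ge> N \<Longrightarrow> n \<ge> N \<Longrightarrow> y \<in> cbox a b \<Longrightarrow> \<bar>u m y - u n y\<bar> < 1"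
    by (rule sup_CauchyD[OF assms zero_less_one]) blast
  define f where "f n = \<bar>u n (x n)\<bar>" for n
  have "f n \<le> f N + 1" if "n \<ge> N" for n
    unfolding f_def using N[OF that order_refl x(1)[of n]] x(2)[OF x(1)[of n], of N] by linarith
  then obtain B where "B \<ge> 0" "\<And>n. f n \<le> B"
    using bounded_by_tail[of N f "f N + 1"] by blast
  moreover have "\<bar>u n y\<bar> \<le> B" if "y \<in> cbox a b" for n y
    using x(2)[OF that, of n] \<open>f n \<le> B\<close> unfolding f_def by linarith
  ultimately show ?thesis
    by blast
qed auto

lemma L2_Cauchy_le:
  assumes "\<And>n. continuous_on (cbox a b) (w n)"
    and "vanishes2 d" "\<And>m n. l2sq a b (\<lambda>y. w m y - w n y) \<le> d m n"
  shows "L2_Cauchy a b w"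
  unfolding L2_Cauchy_def using assms by (auto intro: vanishes2_le)

lemma L2_Cauchy_add:
  assumes "L2_Cauchy a b u" "L2_Cauchy a b v"
  shows "L2_Cauchy a b (\<lambda>n y. u n y + v n y)"
proof -
  have c: "continuous_on (cbox a b) (u n)" "continuous_on (cbox a b) (v n)" for n
    using assms by (auto simp: L2_Cauchy_def)
  have "vanishes2 (\<lambda>m n. 2 * l2sq a b (\<lambda>y. u m y - u n y) + 2 * l2sq a b (\<lambda>y. v m y - v n y))"
    using assms by (intro vanishes2_add vanishes2_cmult) (auto simp: L2_Cauchy_def)
  then show ?thesis
  proof (rule L2_Cauchy_le[rotated])
    show "l2sq a b (\<lambda>y. (u m y + v m y) - (u n y + v n y))
        \<le> 2 * l2sq a b (\<lambda>y. u m y - u n y) + 2 * l2sq a b (\<lambda>y. v m y - v n y)" for m n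
      using l2sq_add_le[of a b "\<lambda>y. u m y - u n y" "\<lambda>y. v m y - v n y"] c
      by (simp add: continuous_on_diff algebra_simps)
  qed (use c in \<open>auto intro!: continuous_intros\<close>)
qed

lemma sup_Cauchy_vanishes2:
  assumes w: "sup_Cauchy a b w" and z: "\<And>n. continuous_on (cbox a b) (z n)" and B: "\<And>n. l2sq a b (z n) \<le> B"
  shows "vanishes2 (\<lambda>m n. l2sq a b (\<lambda>y. (w m y - w n y) * z n y))"
  unfolding vanishes2_def
proof (intro allI impI)
  fix e :: real assume "e > 0"
  have B0: "0 \<le> B" using B[of 0] l2sq_nonneg[of a b "z 0"] by linarith
  define d where "d = sqrt (e / (B + 1))"
  have d: "d > 0" "d\<^sup>2 * B < e"
    using \<open>e > 0\<close> B0 by (auto simp: d_def field_simps)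
  obtain N where N: "\<And>m n y. m \<ge> N \<Longrightarrow> n \<ge> N \<Longrightarrow> y \<in> cbox a b \<Longrightarrow> \<bar>w m y - w n y\<bar> < d"
    by (rule sup_CauchyD[OF w d(1)]) blast
  have "\<bar>l2sq a b (\<lambda>y. (w m y - w n y) * z n y)\<bar> < e" if "m \<ge> N" "n \<ge> N" for m n
  proof -
    have "l2sq a b (\<lambda>y. (w m y - w n y) * z n y) \<le> d\<^sup>2 * l2sq a b (z n)"
      using w z N[OF that] by (intro l2sq_mult_le) (auto simp: sup_Cauchy_def intro!: continuous_intros less_imp_le)
    also have "\<dots> \<le> d\<^sup>2 * B" using B by (intro mult_left_mono) auto
    finally show ?thesis using d(2) by simp
  qed
  then show "\<exists>N. \<forall>m\<ge>N. \<forall>n\<ge>N. \<bar>l2sq a b (\<lambda>y. (w m y - w n y) * z n y)\<bar> < e"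
    by blast
qed

lemma L2_Cauchy_mult_sup:
  assumes w: "sup_Cauchy a b w" and z: "L2_Cauchy a b z"
  shows "L2_Cauchy a b (\<lambda>n y. w n y * z n y)"
proof -
  have c: "continuous_on (cbox a b) (w n)" "continuous_on (cbox a b) (z n)" for n
    using assms by (auto simp: L2_Cauchy_def sup_Cauchy_def)
  obtain B where B: "\<And>n. l2sq a b (z n) \<le> B" using L2_Cauchy_bounded[OF z] by blast
  obtain B' where B': "\<And>n y. y \<in> cbox a b \<Longrightarrow> \<bar>w n y\<bar> \<le> B'" using sup_Cauchy_bounded[OF w] by blast
  have "vanishes2 (\<lambda>m n. 2 * (B'\<^sup>2 * l2sq a b (\<lambda>y. z m y - z n y)) + 2 * l2sq a b (\<lambda>y. (w m y - w n y) * z n y))"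
    using z sup_Cauchy_vanishes2[OF w c(2) B]
    by (intro vanishes2_add vanishes2_cmult) (auto simp: L2_Cauchy_def)
  then show ?thesis
  proof (rule L2_Cauchy_le[rotated])
    fix m n
    have "l2sq a b (\<lambda>y. w m y * z m y - w n y * z n y) \<le>
       2 * l2sq a b (\<lambda>y. w m y * (z m y - z n y)) + 2 * l2sq a b (\<lambda>y. (w m y - w n y) * z n y)"
      using l2sq_add_le[of a b "\<lambda>y. w m y * (z m y - z n y)" "\<lambda>y. (w m y - w n y) * z n y"] c
      by (simp add: continuous_on_diff continuous_on_mult algebra_simps)
    also have "l2sq a b (\<lambda>y. w m y * (z m y - z n y)) \<le> B'\<^sup>2 * l2sq a b (\<lambda>y. z m y - z n y)"
      using c B' by (intro l2sq_mult_le) (auto intro!: continuous_intros)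
    finally show "l2sq a b (\<lambda>y. w m y * z m y - w n y * z n y) \<le>
       2 * (B'\<^sup>2 * l2sq a b (\<lambda>y. z m y - z n y)) + 2 * l2sq a b (\<lambda>y. (w m y - w n y) * z n y)"
      by simp
  qed (use c in \<open>auto intro!: continuous_intros\<close>)
qed

lemma sup_Cauchy_const: "sup_Cauchy a b (\<lambda>n y. c)"
  by (auto simp: sup_Cauchy_def)

lemma L2_Cauchy_const: "L2_Cauchy a b (\<lambda>n y. c)"
  by (auto simp: L2_Cauchy_def vanishes2_def l2sq_def)

lemma sup_Cauchy_imp_L2_Cauchy: "sup_Cauchy a b w \<Longrightarrow> L2_Cauchy a b w"
  using L2_Cauchy_mult_sup[OF _ L2_Cauchy_const[of a b 1]] by simp

lemma L2_Cauchy_cmult: "L2_Cauchy a b u \<Longrightarrow> L2_Cauchy a b (\<lambda>n y. c * u n y)"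
  by (rule L2_Cauchy_mult_sup[OF sup_Cauchy_const])

lemma L2_Cauchy_cong:
  assumes "L2_Cauchy a b u" "\<And>n y. y \<in> cbox a b \<Longrightarrow> u n y = v n y"
  shows "L2_Cauchy a b v"
proof -
  have "l2sq a b (\<lambda>y. u m y - u n y) = l2sq a b (\<lambda>y. v m y - v n y)" for m n
    using assms(2) by (intro l2sq_cong) simp
  moreover have "continuous_on (cbox a b) (u n) = continuous_on (cbox a b) (v n)" for n
    using assms(2) by (intro continuous_on_cong) simp_all
  ultimately show ?thesis using assms(1) by (simp add: L2_Cauchy_def)
qed

lemma sup_Cauchy_mult:
  assumes w: "sup_Cauchy a b w" and z: "sup_Cauchy a b z"
  shows "sup_Cauchy a b (\<lambda>n y. w n y * z n y)"
  unfolding sup_Cauchy_def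
proof (intro conjI allI impI)
  show "continuous_on (cbox a b) (\<lambda>y. w n y * z n y)" for n
    using assms by (auto simp: sup_Cauchy_def intro!: continuous_intros)
  fix e :: real assume "e > 0"
  obtain B where B: "B \<ge> 0" "\<And>n y. y \<in> cbox a b \<Longrightarrow> \<bar>w n y\<bar> \<le> B" using sup_Cauchy_bounded[OF w] by blast
  obtain B' where B': "B' \<ge> 0" "\<And>n y. y \<in> cbox a b \<Longrightarrow> \<bar>z n y\<bar> \<le> B'" using sup_Cauchy_bounded[OF z] by blast
  define d where "d = e / (B + B' + 1)"
  have d: "d > 0" "(B + B') * d < e" using \<open>e > 0\<close> B(1) B'(1) by (auto simp: d_def field_simps)
  obtain N1 where N1: "\<And>m n y. m \<ge> N1 \<Longrightarrow> n \<ge> N1 \<Longrightarrow> y \<in> cbox a b \<Longrightarrow> \<bar>w m y - w n y\<bar> < d"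
    by (rule sup_CauchyD[OF w d(1)]) blast
  obtain N2 where N2: "\<And>m n y. m \<ge> N2 \<Longrightarrow> n \<ge> N2 \<Longrightarrow> y \<in> cbox a b \<Longrightarrow> \<bar>z m y - z n y\<bar> < d"
    by (rule sup_CauchyD[OF z d(1)]) blast
  have "\<bar>w m y * z m y - w n y * z n y\<bar> < e" if "m \<ge> max N1 N2" "n \<ge> max N1 N2" "y \<in> cbox a b" for m n y
  proof -
    have "w m y * z m y - w n y * z n y = w m y * (z m y - z n y) + (w m y - w n y) * z n y"
      by (simp add: algebra_simps)
    also have "\<bar>\<dots>\<bar> \<le> \<bar>w m y\<bar> * \<bar>z m y - z n y\<bar> + \<bar>w m y - w n y\<bar> * \<bar>z n y\<bar>"
      by (metis abs_mult abs_triangle_ineq)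
    also have "\<dots> \<le> B * d + d * B'"
      using B B' N1[of m n y] N2[of m n y] that by (intro add_mono mult_mono) auto
    finally show ?thesis using d(2) by (simp add: algebra_simps)
  qed
  then show "\<exists>N. \<forall>m\<ge>N. \<forall>n\<ge>N. \<forall>y\<in>cbox a b. \<bar>w m y * z m y - w n y * z n y\<bar> < e"
    by blast
qed

lemma sup_Cauchy_inverse:
  assumes w: "sup_Cauchy a b w" and "d > 0" and lb: "\<And>n y. y \<in> cbox a b \<Longrightarrow> d \<le> \<bar>w n y\<bar>"
  shows "sup_Cauchy a b (\<lambda>n y. inverse (w n y))"
  unfolding sup_Cauchy_def
proof (intro conjI allI impI)
  have nz: "w n y \<noteq> 0" if "y \<in> cbox a b" for n y using lb[OF that, of n] \<open>d > 0\<close> by auto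
  then show "continuous_on (cbox a b) (\<lambda>y. inverse (w n y))" for n
    using w by (auto simp: sup_Cauchy_def intro!: continuous_intros)
  fix e :: real assume "e > 0"
  then have ed: "e * d\<^sup>2 > 0" using \<open>d > 0\<close> by simp
  obtain N where N: "\<And>m n y. m \<ge> N \<Longrightarrow> n \<ge> N \<Longrightarrow> y \<in> cbox a b \<Longrightarrow> \<bar>w m y - w n y\<bar> < e * d\<^sup>2"
    by (rule sup_CauchyD[OF w ed]) blast
  have "\<bar>inverse (w m y) - inverse (w n y)\<bar> < e" if "m \<ge> N" "n \<ge> N" "y \<in> cbox a b" for m n y
  proof -
    have "inverse (w m y) - inverse (w n y) = (w n y - w m y) / (w m y * w n y)"
      using nz[OF that(3)] by (simp add: field_simps)
    then have "\<bar>inverse (w m y) - inverse (w n y)\<bar> = \<bar>w n y - w m y\<bar> / (\<bar>w m y\<bar> * \<bar>w n y\<bar>)"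
      by (simp add: abs_mult)
    also have "\<dots> \<le> \<bar>w n y - w m y\<bar> / (d * d)"
      using lb[OF that(3)] nz[OF that(3)] \<open>d > 0\<close>
      by (intro divide_left_mono mult_mono mult_pos_pos) auto
    also have "\<dots> < e"
      using N[OF that(2,1,3)] \<open>d > 0\<close> by (simp add: field_simps power2_eq_square)
    finally show ?thesis .
  qed
  then show "\<exists>N. \<forall>m\<ge>N. \<forall>n\<ge>N. \<forall>y\<in>cbox a b. \<bar>inverse (w m y) - inverse (w n y)\<bar> < e"
    by blast
qed

text \<open>Cauchy sequences for the \<open>H\<^sup>k\<close> norm on the rectangle, consisting of functions that are smooth
on a neighbourhood \<open>S\<close>. Such sequences represent the elements of \<open>H\<^sup>k\<close>, and operations on \<open>H\<^sup>k\<close> can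
be treated by showing that they preserve these sequences. The recursion peels off innermost
derivatives, as in \<open>diff_order\<close>.\<close>

primrec sobolev_Cauchy ::
  "(real^2) set \<Rightarrow> real^2 \<Rightarrow> real^2 \<Rightarrow> nat \<Rightarrow> (nat \<Rightarrow> real^2 \<Rightarrow> real) \<Rightarrow> bool" where
  "sobolev_Cauchy S a b 0 u \<longleftrightarrow> (\<forall>n. smooth_fun_on S (u n)) \<and> L2_Cauchy a b u"
| "sobolev_Cauchy S a b (Suc k) u \<longleftrightarrow> (\<forall>n. smooth_fun_on S (u n)) \<and> L2_Cauchy a b u \<and>
     (\<forall>i. sobolev_Cauchy S a b k (\<lambda>n. pderiv_at i (u n)))"

lemma sobolev_Cauchy_smooth: "sobolev_Cauchy S a b k u \<Longrightarrow> smooth_fun_on S (u n)"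
  by (cases k) auto

lemma sobolev_Cauchy_L2: "sobolev_Cauchy S a b k u \<Longrightarrow> L2_Cauchy a b u"
  by (cases k) auto

lemma sobolev_Cauchy_pderiv: "sobolev_Cauchy S a b (Suc k) u \<Longrightarrow> sobolev_Cauchy S a b k (\<lambda>n. pderiv_at i (u n))"
  by auto

lemma sobolev_Cauchy_Suc: "sobolev_Cauchy S a b (Suc k) u \<Longrightarrow> sobolev_Cauchy S a b k u"
  by (induction k arbitrary: u) auto

lemma sobolev_Cauchy_mono: "k \<le> k' \<Longrightarrow> sobolev_Cauchy S a b k' u \<Longrightarrow> sobolev_Cauchy S a b k u"
  by (induction rule: dec_induct) (auto dest: sobolev_Cauchy_Suc simp del: sobolev_Cauchy.simps)

lemma sobolev_Cauchy_iff_iter_pderiv: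
  "sobolev_Cauchy S a b k u \<longleftrightarrow> (\<forall>n. smooth_fun_on S (u n)) \<and>
     (\<forall>is. length is \<le> k \<longrightarrow> L2_Cauchy a b (\<lambda>n. iter_pderiv is (u n)))"
proof (induction k arbitrary: u)
  case (Suc k)
  have "(\<forall>is. length is \<le> Suc k \<longrightarrow> P is) \<longleftrightarrow> P [] \<and> (\<forall>i is. length is \<le> k \<longrightarrow> P (is @ [i]))" for P :: "2 list \<Rightarrow> bool"
  proof (intro iffI conjI allI impI)
    fix "is" :: "2 list" assume "P [] \<and> (\<forall>i is. length is \<le> k \<longrightarrow> P (is @ [i]))" "length is \<le> Suc k"
    then show "P is" by (cases "is" rule: rev_cases) auto
  qed auto
  then show ?case
    using Suc smooth_fun_on_pderiv[of S] by (simp add: iter_pderiv_append) blast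
qed simp

locale rectangle_nbhd =
  fixes S :: "(real^2) set" and a b :: "real^2"
  assumes S: "open S" "cbox a b \<subseteq> S" and ne: "box a b \<noteq> {}"
begin

lemma sobolev_Cauchy_cong:
  assumes "sobolev_Cauchy S a b k u" "\<And>n y. y \<in> S \<Longrightarrow> u n y = v n y"
  shows "sobolev_Cauchy S a b k v"
  using assms
proof (induction k arbitrary: u v)
  case 0
  have "smooth_fun_on S (v n)" for n
    using smooth_fun_on_cong[OF sobolev_Cauchy_smooth[OF 0(1)] 0(2)] .
  moreover have "L2_Cauchy a b v"
    using L2_Cauchy_cong[OF sobolev_Cauchy_L2[OF 0(1)]] 0(2) S(2) by blast
  ultimately show ?case by simp
next
  case (Suc k)
  have "smooth_fun_on S (v n)" for n
    using smooth_fun_on_cong[OF sobolev_Cauchy_smooth[OF Suc.prems(1)] Suc.prems(2)] .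
  moreover have "L2_Cauchy a b v"
    using L2_Cauchy_cong[OF sobolev_Cauchy_L2[OF Suc.prems(1)]] Suc.prems(2) S(2) by blast
  moreover have "sobolev_Cauchy S a b k (\<lambda>n. pderiv_at i (v n))" for i
  proof (rule Suc.IH)
    show "sobolev_Cauchy S a b k (\<lambda>n. pderiv_at i (u n))"
      using Suc.prems(1) by (rule sobolev_Cauchy_pderiv)
    show "pderiv_at i (u n) y = pderiv_at i (v n) y" if "y \<in> S" for n y
      using pderiv_at_cong_open[OF S(1) that Suc.prems(2)] .
  qed
  ultimately show ?case by simp
qed

lemma sobolev_Cauchy_const: "sobolev_Cauchy S a b k (\<lambda>n y. c)"
proof (induction k arbitrary: c)
  case (Suc k)
  have "pderiv_at i (\<lambda>y. c) = (\<lambda>y. 0)" for i by (rule ext) simp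
  then show ?case using Suc L2_Cauchy_const smooth_fun_on_const[OF S(1)] by simp
qed (simp add: L2_Cauchy_const smooth_fun_on_const[OF S(1)])

lemma sobolev_Cauchy_add:
  assumes "sobolev_Cauchy S a b k u" "sobolev_Cauchy S a b k v"
  shows "sobolev_Cauchy S a b k (\<lambda>n y. u n y + v n y)"
  using assms
proof (induction k arbitrary: u v)
  case 0
  then show ?case by (simp add: smooth_fun_on_add L2_Cauchy_add)
next
  case (Suc k)
  have "sobolev_Cauchy S a b k (\<lambda>n. pderiv_at i (\<lambda>y. u n y + v n y))" for i
  proof (rule sobolev_Cauchy_cong[OF Suc.IH])
    show "sobolev_Cauchy S a b k (\<lambda>n. pderiv_at i (u n))" "sobolev_Cauchy S a b k (\<lambda>n. pderiv_at i (v n))"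
      using Suc.prems by (auto intro: sobolev_Cauchy_pderiv)
    show "pderiv_at i (u n) y + pderiv_at i (v n) y = pderiv_at i (\<lambda>y. u n y + v n y) y" if "y \<in> S" for n y
      using that Suc.prems[THEN sobolev_Cauchy_smooth] by (simp add: pderiv_at_add smooth_fun_on_differentiable[of S])
  qed
  then show ?case
    using Suc.prems by (simp add: smooth_fun_on_add L2_Cauchy_add)
qed

lemma sobolev_Cauchy_imp_C1: "sobolev_Cauchy S a b k u \<Longrightarrow> C1_on_cbox a b (u n)"
  using smooth_fun_on_C1_on_cbox[OF sobolev_Cauchy_smooth S(2)] .

text \<open>The differences \<open>u m - u n\<close> are small in \<open>H\<^sup>2\<close>, hence small in the supremum norm.\<close>

lemma sobolev_Cauchy_sup:
  assumes u: "sobolev_Cauchy S a b (Suc (Suc k)) u"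
  shows "sup_Cauchy a b u"
  unfolding sup_Cauchy_def
proof (intro conjI allI impI)
  show "continuous_on (cbox a b) (u n)" for n
    using sobolev_Cauchy_imp_C1[OF u] by (rule C1_on_cbox_continuous)
  let ?d = "\<lambda>m n y. u m y - u n y"
  have sm: "smooth_fun_on S (?d m n)" for m n
    using sobolev_Cauchy_smooth[OF u] by (intro smooth_fun_on_diff)
  have p1: "pderiv_at i (?d m n) y = pderiv_at i (u m) y - pderiv_at i (u n) y" if "y \<in> S" for i m n y
    using that sobolev_Cauchy_smooth[OF u] by (simp add: pderiv_at_diff smooth_fun_on_differentiable[of S])
  have p2: "pderiv_at j (pderiv_at i (?d m n)) y = pderiv_at j (pderiv_at i (u m)) y - pderiv_at j (pderiv_at i
      (u n)) y"
    if "y \<in> S" for i j m n y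
  proof -
    have "pderiv_at j (pderiv_at i (?d m n)) y = pderiv_at j (\<lambda>z. pderiv_at i (u m) z - pderiv_at i (u n) z) y"
      using p1 by (rule pderiv_at_cong_open[OF S(1) that])
    then show ?thesis
      using that sobolev_Cauchy_smooth[OF u]
      by (simp add: pderiv_at_diff smooth_fun_on_differentiable[of S, OF smooth_fun_on_pderiv])
  qed
  have C1: "C1_on_cbox a b (?d m n)" "C1_on_cbox a b (pderiv_at i (?d m n))" for m n i
    using smooth_fun_on_C1_on_cbox[OF sm S(2)] smooth_fun_on_C1_on_cbox[OF smooth_fun_on_pderiv[OF sm] S(2)] by auto
  define D where "D m n = box_const a b * (h1sq a b (?d m n) + (\<Sum>i\<in>UNIV. h1sq a b (pderiv_at i (?d m n))))" for m n
  have L: "vanishes2 (\<lambda>m n. l2sq a b (?d m n))"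
    using sobolev_Cauchy_L2[OF u] by (simp add: L2_Cauchy_def)
  have L1: "vanishes2 (\<lambda>m n. l2sq a b (pderiv_at i (?d m n)))" for i
    using sobolev_Cauchy_L2[OF sobolev_Cauchy_pderiv[OF u], of i] p1 S(2)
    by (simp add: L2_Cauchy_def subset_iff cong: l2sq_cong)
  have L2: "vanishes2 (\<lambda>m n. l2sq a b (pderiv_at j (pderiv_at i (?d m n))))" for i j
    using sobolev_Cauchy_L2[OF sobolev_Cauchy_pderiv[OF sobolev_Cauchy_pderiv[OF u]], of j i] p2 S(2)
    by (simp add: L2_Cauchy_def subset_iff cong: l2sq_cong)
  have "vanishes2 D"
    unfolding D_def h1sq_def sum_2
    by (intro vanishes2_cmult vanishes2_add L L1 L2)
  fix e :: real assume "e > 0"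
  obtain N where N: "\<And>m n. m \<ge> N \<Longrightarrow> n \<ge> N \<Longrightarrow> \<bar>D m n\<bar> < e\<^sup>2"
    by (rule vanishes2D[OF \<open>vanishes2 D\<close> zero_less_power[OF \<open>e > 0\<close>, of 2]]) blast
  have "\<bar>u m y - u n y\<bar> < e" if "m \<ge> N" "n \<ge> N" "y \<in> cbox a b" for m n y
  proof -
    have "(?d m n y)\<^sup>2 \<le> D m n"
      unfolding D_def by (rule sq_le_h1sq_h1sq[OF ne C1 that(3)])
    then have "\<bar>?d m n y\<bar>\<^sup>2 < e\<^sup>2"
      using N[OF that(1,2)] by simp
    then show ?thesis
      by (rule power_less_imp_less_base) (use \<open>e > 0\<close> in simp)
  qed
  then show "\<exists>N. \<forall>m\<ge>N. \<forall>n\<ge>N. \<forall>y\<in>cbox a b. \<bar>u m y - u n y\<bar> < e"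
    by blast
qed

lemma sobolev_Cauchy_h1sq_vanishes:
  assumes u: "sobolev_Cauchy S a b 1 u"
  shows "vanishes2 (\<lambda>m n. h1sq a b (\<lambda>y. u m y - u n y))"
proof -
  have p1: "pderiv_at i (\<lambda>y. u m y - u n y) y = pderiv_at i (u m) y - pderiv_at i (u n) y" if "y \<in> S" for i m n y
    using that sobolev_Cauchy_smooth[OF u] by (simp add: pderiv_at_diff smooth_fun_on_differentiable[of S])
  have "vanishes2 (\<lambda>m n. l2sq a b (\<lambda>y. u m y - u n y))"
    using sobolev_Cauchy_L2[OF u] by (simp add: L2_Cauchy_def)
  moreover have "vanishes2 (\<lambda>m n. l2sq a b (pderiv_at i (\<lambda>y. u m y - u n y)))" for i
    using sobolev_Cauchy_L2[OF sobolev_Cauchy_pderiv[OF u[unfolded One_nat_def]], of i] p1 S(2)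
    by (simp add: L2_Cauchy_def subset_iff cong: l2sq_cong)
  ultimately show ?thesis
    unfolding h1sq_def sum_2 by (intro vanishes2_add)
qed

lemma sobolev_Cauchy_h1sq_bounded:
  assumes u: "sobolev_Cauchy S a b 1 u"
  shows "\<exists>B. \<forall>n. h1sq a b (u n) \<le> B"
proof -
  obtain B where B: "\<And>n. l2sq a b (u n) \<le> B"
    using L2_Cauchy_bounded[OF sobolev_Cauchy_L2[OF u]] by blast
  have "\<exists>B. \<forall>n. l2sq a b (pderiv_at i (u n)) \<le> B" for i
    using L2_Cauchy_bounded[OF sobolev_Cauchy_L2[OF sobolev_Cauchy_pderiv[OF u[unfolded One_nat_def]]]] by blast
  then obtain B' where "\<And>i n. l2sq a b (pderiv_at i (u n)) \<le> B' i"
    by metis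
  then have "h1sq a b (u n) \<le> B + (\<Sum>i\<in>UNIV. B' i)" for n
    unfolding h1sq_def by (intro add_mono B sum_mono)
  then show ?thesis by blast
qed

lemma h1sq_nonneg: "0 \<le> h1sq a b u"
  by (simp add: h1sq_def sum_nonneg)

text \<open>In two dimensions \<open>H\<^sup>1\<close> does not embed into the bounded functions. This is the borderline
estimate that replaces it wherever two first order factors meet.\<close>

lemma L2_Cauchy_mult_sobolev1:
  assumes u: "sobolev_Cauchy S a b 1 u" and v: "sobolev_Cauchy S a b 1 v"
  shows "L2_Cauchy a b (\<lambda>n y. u n y * v n y)"
proof -
  note C1 = sobolev_Cauchy_imp_C1[OF u] sobolev_Cauchy_imp_C1[OF v]
  note c = C1[THEN C1_on_cbox_continuous]
  have C1d: "C1_on_cbox a b (\<lambda>y. u m y - u n y)" "C1_on_cbox a b (\<lambda>y. v m y - v n y)" for m n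
    using sobolev_Cauchy_smooth[OF u] sobolev_Cauchy_smooth[OF v]
    by (auto intro!: smooth_fun_on_C1_on_cbox[OF _ S(2)] smooth_fun_on_diff)
  obtain B where B: "\<And>n. h1sq a b (u n) \<le> B" using sobolev_Cauchy_h1sq_bounded[OF u] by blast
  obtain B' where B': "\<And>n. h1sq a b (v n) \<le> B'" using sobolev_Cauchy_h1sq_bounded[OF v] by blast
  let ?K = "box_const a b"
  have "vanishes2 (\<lambda>m n. 2 * (?K * (h1sq a b (u m) * h1sq a b (\<lambda>y. v m y - v n y)))
      + 2 * (?K * (h1sq a b (v n) * h1sq a b (\<lambda>y. u m y - u n y))))"
    using B B' h1sq_nonneg
    by (intro vanishes2_add vanishes2_cmult
        vanishes2_bounded_mult[OF sobolev_Cauchy_h1sq_vanishes[OF v], of "\<lambda>m n. h1sq a b (u m)" B]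
        vanishes2_bounded_mult[OF sobolev_Cauchy_h1sq_vanishes[OF u], of "\<lambda>m n. h1sq a b (v n)" B']) auto
  then show ?thesis
  proof (rule L2_Cauchy_le[rotated])
    fix m n
    have "l2sq a b (\<lambda>y. u m y * v m y - u n y * v n y) \<le>
       2 * l2sq a b (\<lambda>y. u m y * (v m y - v n y)) + 2 * l2sq a b (\<lambda>y. v n y * (u m y - u n y))"
      using l2sq_add_le[of a b "\<lambda>y. u m y * (v m y - v n y)" "\<lambda>y. v n y * (u m y - u n y)"] c
      by (simp add: continuous_on_diff continuous_on_mult algebra_simps)
    then show "l2sq a b (\<lambda>y. u m y * v m y - u n y * v n y) \<le>
       2 * (?K * (h1sq a b (u m) * h1sq a b (\<lambda>y. v m y - v n y)))
      + 2 * (?K * (h1sq a b (v n) * h1sq a b (\<lambda>y. u m y - u n y)))"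
      using l2sq_mult_le_h1sq[OF ne C1(1)[of m] C1d(2)[of m n]] l2sq_mult_le_h1sq[OF ne C1(2)[of n] C1d(1)[of m n]]
      by linarith
  qed (use c in \<open>auto intro!: continuous_intros\<close>)
qed

lemma pderiv_product:
  assumes u: "sobolev_Cauchy S a b k u" and v: "sobolev_Cauchy S a b j v" and "y \<in> S"
  shows "u n y * pderiv_at i (v n) y + pderiv_at i (u n) y * v n y = pderiv_at i (\<lambda>y. u n y * v n y) y"
  using assms(3) sobolev_Cauchy_smooth[OF u] sobolev_Cauchy_smooth[OF v]
  by (simp add: pderiv_at_mult smooth_fun_on_differentiable[of S])

lemma sobolev_Cauchy_SucI:
  assumes "\<And>n. smooth_fun_on S (u n)" "L2_Cauchy a b u"
    and "\<And>i. sobolev_Cauchy S a b k (d i)" "\<And>i n y. y \<in> S \<Longrightarrow> d i n y = pderiv_at i (u n) y"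
  shows "sobolev_Cauchy S a b (Suc k) u"
  using assms sobolev_Cauchy_cong[of k "d _" "\<lambda>n. pderiv_at _ (u n)"] by simp

lemma sobolev_Cauchy_0I:
  assumes "\<And>n. smooth_fun_on S (u n)" "L2_Cauchy a b u"
  shows "sobolev_Cauchy S a b 0 u"
  using assms by simp

lemma sobolev_Cauchy_mult_1_2:
  assumes u: "sobolev_Cauchy S a b 1 u" and v: "sobolev_Cauchy S a b 2 v"
  shows "sobolev_Cauchy S a b 1 (\<lambda>n y. u n y * v n y)"
proof -
  have v1: "sobolev_Cauchy S a b 1 v" using v by (rule sobolev_Cauchy_mono[rotated]) simp
  have sup: "sup_Cauchy a b v" using sobolev_Cauchy_sup[of 0 v] v by (simp add: numeral_2_eq_2)
  have uv: "L2_Cauchy a b (\<lambda>n y. u n y * v n y)"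
    using L2_Cauchy_mult_sup[OF sup sobolev_Cauchy_L2[OF u]] by (simp add: mult.commute)
  have sm: "smooth_fun_on S (\<lambda>y. u n y * v n y)" for n
    using sobolev_Cauchy_smooth[OF u] sobolev_Cauchy_smooth[OF v] by (rule smooth_fun_on_mult)
  note smd = sobolev_Cauchy_smooth[OF u] sobolev_Cauchy_smooth[OF v]
    smooth_fun_on_pderiv[OF sobolev_Cauchy_smooth[OF u]] smooth_fun_on_pderiv[OF sobolev_Cauchy_smooth[OF v]]
  have "sobolev_Cauchy S a b 0 (\<lambda>n y. u n y * pderiv_at i (v n) y + pderiv_at i (u n) y * v n y)" for i
  proof (intro sobolev_Cauchy_0I L2_Cauchy_add smooth_fun_on_add smooth_fun_on_mult smd)
    show "L2_Cauchy a b (\<lambda>n y. u n y * pderiv_at i (v n) y)"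
      using L2_Cauchy_mult_sobolev1[OF u sobolev_Cauchy_pderiv, of v i] v by (simp add: numeral_2_eq_2)
    show "L2_Cauchy a b (\<lambda>n y. pderiv_at i (u n) y * v n y)"
      using L2_Cauchy_mult_sup[OF sup sobolev_Cauchy_L2[OF sobolev_Cauchy_pderiv[of S a b 0 u i]]] u
      by (simp add: mult.commute)
  qed
  from sobolev_Cauchy_SucI[OF sm uv this pderiv_product[OF u v]] show ?thesis
    by simp
qed

text \<open>The product rule reduces \<open>Suc k\<close> to \<open>k\<close> for \<open>k \<ge> 2\<close>. For \<open>k = 2\<close> the first derivatives of the
product are sums of products of an \<open>H\<^sup>1\<close> factor and an \<open>H\<^sup>2\<close> factor; as \<open>H\<^sup>1\<close> is not an algebra,
these are covered by \<open>sobolev_Cauchy_mult_1_2\<close> instead of an induction hypothesis.\<close>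

lemma sobolev_Cauchy_mult:
  assumes "2 \<le> k" "sobolev_Cauchy S a b k u" "sobolev_Cauchy S a b k v"
  shows "sobolev_Cauchy S a b k (\<lambda>n y. u n y * v n y)"
  using assms
proof (induction k arbitrary: u v rule: dec_induct)
  case base
  note u = \<open>sobolev_Cauchy S a b 2 u\<close> and v = \<open>sobolev_Cauchy S a b 2 v\<close>
  have 1: "sobolev_Cauchy S a b 1 u" "sobolev_Cauchy S a b 1 v"
    using u v by (auto intro: sobolev_Cauchy_mono[of 1 2] simp del: sobolev_Cauchy.simps One_nat_def)
  have d: "sobolev_Cauchy S a b 1 (\<lambda>n. pderiv_at i (u n))" "sobolev_Cauchy S a b 1 (\<lambda>n. pderiv_at i (v n))" for i
    by (rule sobolev_Cauchy_pderiv[OF u[folded Suc_1]], rule sobolev_Cauchy_pderiv[OF v[folded Suc_1]])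
  have "sobolev_Cauchy S a b 1 (\<lambda>n y. u n y * pderiv_at i (v n) y + pderiv_at i (u n) y * v n y)" for i
    using sobolev_Cauchy_mult_1_2[OF d(1) v, of i] sobolev_Cauchy_mult_1_2[OF d(2) u, of i]
    by (intro sobolev_Cauchy_add) (simp_all add: mult.commute)
  from sobolev_Cauchy_SucI[OF _ L2_Cauchy_mult_sobolev1[OF 1] this pderiv_product[OF u v]]
  show ?case
    using sobolev_Cauchy_smooth[OF u] sobolev_Cauchy_smooth[OF v] by (simp add: smooth_fun_on_mult numeral_2_eq_2)
next
  case (step k)
  note u = \<open>sobolev_Cauchy S a b (Suc k) u\<close> and v = \<open>sobolev_Cauchy S a b (Suc k) v\<close>
  have 1: "sobolev_Cauchy S a b 1 u" "sobolev_Cauchy S a b 1 v"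
    using u v by (auto intro: sobolev_Cauchy_mono[of 1 "Suc k"] simp del: sobolev_Cauchy.simps One_nat_def)
  have "sobolev_Cauchy S a b k (\<lambda>n y. u n y * pderiv_at i (v n) y + pderiv_at i (u n) y * v n y)" for i
    by (rule sobolev_Cauchy_add[OF step.IH[OF sobolev_Cauchy_Suc[OF u] sobolev_Cauchy_pderiv[OF v]]
          step.IH[OF sobolev_Cauchy_pderiv[OF u] sobolev_Cauchy_Suc[OF v]]])
  then show ?case
    by (rule sobolev_Cauchy_SucI[OF smooth_fun_on_mult[OF sobolev_Cauchy_smooth[OF u] sobolev_Cauchy_smooth[OF v]]
          L2_Cauchy_mult_sobolev1[OF 1] _ pderiv_product[OF u v]])
qed

text \<open>The reciprocals converge uniformly. Their derivatives are given by \<open>D\<close>, in which the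
reciprocal occurs only undifferentiated, so \<open>H\<^sup>k\<close> regularity of the reciprocal gives \<open>H\<^sup>k\<^sup>+\<^sup>1\<close>
regularity once \<open>H\<^sup>k\<close> is an algebra. The first two orders have to be obtained by hand: the second
derivatives are combinations of bounded functions with either one second derivative of \<open>u\<close> or a
product of two first derivatives.\<close>

lemma sobolev_Cauchy_inverse:
  assumes "2 \<le> k" and u: "sobolev_Cauchy S a b k u" and "d > 0"
    and lb: "\<And>n y. y \<in> cbox a b \<Longrightarrow> d \<le> \<bar>u n y\<bar>" and nz: "\<And>n y. y \<in> S \<Longrightarrow> u n y \<noteq> 0"
  shows "sobolev_Cauchy S a b k (\<lambda>n y. inverse (u n y))"
proof -
  let ?b = "\<lambda>n y. inverse (u n y)"
  have sm: "smooth_fun_on S (?b n)" for n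
    using sobolev_Cauchy_smooth[OF u] nz by (rule smooth_fun_on_inverse)
  have u2: "sobolev_Cauchy S a b 2 u" using assms(1) u by (rule sobolev_Cauchy_mono)
  have sup_u: "sup_Cauchy a b u" using sobolev_Cauchy_sup[of 0 u] u2 by (simp add: numeral_2_eq_2)
  have sup: "sup_Cauchy a b ?b" using sup_Cauchy_inverse[OF sup_u \<open>d > 0\<close> lb] .
  note L2 = sup_Cauchy_imp_L2_Cauchy[OF sup]
  define D where "D i n y = (-1) * (pderiv_at i (u n) y * (?b n y * ?b n y))" for i n y
  have D: "D i n y = pderiv_at i (?b n) y" if "y \<in> S" for i n y
    unfolding D_def using that nz smooth_fun_on_differentiable[OF sobolev_Cauchy_smooth[OF u]]
    by (simp add: pderiv_at_inverse)
  have smD: "smooth_fun_on S (D i n)" for i n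
    unfolding D_def using sm sobolev_Cauchy_smooth[OF u]
    by (intro smooth_fun_on_cmult smooth_fun_on_mult smooth_fun_on_pderiv)
  have L2D: "L2_Cauchy a b (D i)" for i
  proof -
    have "L2_Cauchy a b (\<lambda>n y. (?b n y * ?b n y) * pderiv_at i (u n) y)"
      using u2 by (intro L2_Cauchy_mult_sup sup_Cauchy_mult sup sobolev_Cauchy_L2[of S a b 1])
        (simp add: numeral_2_eq_2)
    from L2_Cauchy_cmult[OF this, of "-1"] show ?thesis
      by (simp add: D_def[abs_def] mult_ac)
  qed
  have b1: "sobolev_Cauchy S a b 1 ?b"
    using sobolev_Cauchy_SucI[OF sm L2 sobolev_Cauchy_0I[OF smD L2D] D] by simp
  have "sobolev_Cauchy S a b (Suc 1) ?b"
  proof (rule sobolev_Cauchy_SucI[OF sm L2 _ D])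
    fix i
    \<comment> \<open>the derivative of \<open>D i\<close>, grouped into uniformly convergent factors times square integrable ones\<close>
    define E where "E j n y = (-1) * ((?b n y * ?b n y) * pderiv_at j (pderiv_at i (u n)) y)
      + 2 * ((?b n y * ?b n y * ?b n y) * (pderiv_at i (u n) y * pderiv_at j (u n) y))" for j n y
    have "sobolev_Cauchy S a b (Suc 0) (D i)"
    proof (rule sobolev_Cauchy_SucI[OF smD L2D])
      show "sobolev_Cauchy S a b 0 (E j)" for j
      proof (rule sobolev_Cauchy_0I)
        show "smooth_fun_on S (E j n)" for n
          unfolding E_def using sm sobolev_Cauchy_smooth[OF u]
          by (intro smooth_fun_on_add smooth_fun_on_cmult smooth_fun_on_mult smooth_fun_on_pderiv)
        show "L2_Cauchy a b (E j)"
          unfolding E_def using u2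
          by (intro L2_Cauchy_add L2_Cauchy_cmult L2_Cauchy_mult_sup sup_Cauchy_mult sup
              L2_Cauchy_mult_sobolev1 sobolev_Cauchy_L2[of S a b 0]) (simp_all add: numeral_2_eq_2)
      qed
      show "E j n y = pderiv_at j (D i n) y" if y: "y \<in> S" for j n y
      proof -
        note df = smooth_fun_on_differentiable[OF _ y]
        have db: "pderiv_at j (?b n) y = - (pderiv_at j (u n) y * (?b n y * ?b n y))"
          using D[OF y, of j n] by (simp add: D_def)
        have bd: "?b n differentiable at y" and pd: "pderiv_at i (u n) differentiable at y"
          using df[OF sm] df[OF smooth_fun_on_pderiv[OF sobolev_Cauchy_smooth[OF u]]] by auto
        have bb: "pderiv_at j (\<lambda>y. ?b n y * ?b n y) y = 2 * (?b n y * pderiv_at j (?b n) y)"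
          using pderiv_at_mult[OF bd bd, of j] by simp
        have bbd: "(\<lambda>y. ?b n y * ?b n y) differentiable at y" using bd bd by (rule differentiable_mult)
        have "pderiv_at j (D i n) y = - pderiv_at j (\<lambda>y. pderiv_at i (u n) y * (?b n y * ?b n y)) y"
          unfolding D_def using pderiv_at_scaleR[OF differentiable_mult[OF pd bbd], of j "-1"] by simp
        also have "\<dots> = E j n y"
          unfolding pderiv_at_mult[OF pd bbd] bb db E_def by (simp add: algebra_simps)
        finally show ?thesis ..
      qed
    qed
    then show "sobolev_Cauchy S a b 1 (D i)" by simp
  qed
  then have b2: "sobolev_Cauchy S a b 2 ?b" by (simp add: numeral_2_eq_2)
  show ?thesis
    using assms(1) u
  proof (induction k rule: dec_induct)
    case base
    show ?case by (rule b2)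
  next
    case (step k)
    have k: "sobolev_Cauchy S a b k ?b" using step sobolev_Cauchy_Suc by blast
    have "sobolev_Cauchy S a b k (D i)" for i
      unfolding D_def using step.hyps(1)
      by (intro sobolev_Cauchy_mult sobolev_Cauchy_const k sobolev_Cauchy_pderiv[OF step.prems])
    then show ?case
      by (rule sobolev_Cauchy_SucI[OF sm L2 _ D])
  qed
qed

lemma sobolev_Cauchy_sum:
  assumes "\<And>i. i \<in> X \<Longrightarrow> sobolev_Cauchy S a b k (u i)"
  shows "sobolev_Cauchy S a b k (\<lambda>n y. \<Sum>i\<in>X. u i n y)"
  using assms
proof (induction X rule: infinite_finite_induct)
  case (insert i X)
  then show ?case using sobolev_Cauchy_add[of k "u i" "\<lambda>n y. \<Sum>i\<in>X. u i n y"] by simp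
qed (simp_all add: sobolev_Cauchy_const)

lemma sobolev_Cauchy_prod:
  assumes "2 \<le> k" "\<And>i. i \<in> X \<Longrightarrow> sobolev_Cauchy S a b k (u i)"
  shows "sobolev_Cauchy S a b k (\<lambda>n y. \<Prod>i\<in>X. u i n y)"
  using assms(2)
proof (induction X rule: infinite_finite_induct)
  case (insert i X)
  then show ?case using sobolev_Cauchy_mult[OF assms(1), of "u i" "\<lambda>n y. \<Prod>i\<in>X. u i n y"] by simp
qed (simp_all add: sobolev_Cauchy_const)

end

section \<open>Sums over index lists\<close>

lemma finite_lists_length [simp]: "finite {I :: 'a::finite list. length I = p}"
  using finite_lists_length_eq[of "UNIV :: 'a set" p] by simp

lemma sum_lists_0: "(\<Sum>I | length I = 0. F I) = F []"
  by simp

lemma sum_lists_Suc: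
  fixes F :: "'a::finite list \<Rightarrow> real"
  shows "(\<Sum>I | length I = Suc p. F I) = (\<Sum>x\<in>UNIV. \<Sum>I | length I = p. F (x # I))"
proof -
  have "(\<Sum>z\<in>UNIV \<times> {I. length I = p}. F (fst z # snd z)) = (\<Sum>I | length I = Suc p. F I)"
    by (rule sum.reindex_bij_witness[of _ "\<lambda>I. (hd I, tl I)" "\<lambda>z. fst z # snd z"]) (auto simp: length_Suc_conv)
  then show ?thesis
    by (simp add: sum.cartesian_product case_prod_unfold)
qed

lemma sum_lists_append:
  fixes F :: "'a::finite list \<Rightarrow> real"
  shows "(\<Sum>I | length I = p + q. F I) = (\<Sum>I | length I = p. \<Sum>J | length J = q. F (I @ J))"
proof (induction p arbitrary: F)
  case (Suc p)
  then show ?case by (simp only: add_Suc sum_lists_Suc append_Cons)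
qed (simp only: sum_lists_0 append_Nil add_0)

lemma sum_lists_prod2:
  fixes f :: "nat \<Rightarrow> 'a::finite \<Rightarrow> 'a \<Rightarrow> real"
  shows "(\<Sum>I | length I = p. \<Sum>J | length J = p. \<Prod>n<p. f n (I ! n) (J ! n)) = (\<Prod>n<p. \<Sum>x\<in>UNIV. \<Sum>y\<in>UNIV. f n x y)"
proof (induction p arbitrary: f)
  case (Suc p)
  have "(\<Sum>I | length I = Suc p. \<Sum>J | length J = Suc p. \<Prod>n<Suc p. f n (I ! n) (J ! n))
     = (\<Sum>x\<in>UNIV. \<Sum>I | length I = p. \<Sum>y\<in>UNIV. \<Sum>J | length J = p. f 0 x y * (\<Prod>n<p. f (Suc n) (I ! n) (J ! n)))"
    unfolding sum_lists_Suc prod.lessThan_Suc_shift by simp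
  also have "\<dots> = (\<Sum>x\<in>UNIV. \<Sum>y\<in>UNIV. f 0 x y * (\<Sum>I | length I = p. \<Sum>J | length J = p. (\<Prod>n<p. f (Suc n) (I ! n) (J
      ! n))))"
    unfolding sum_distrib_left by (rule sum.cong[OF refl], rule sum.swap)
  also have "\<dots> = (\<Prod>n<Suc p. \<Sum>x\<in>UNIV. \<Sum>y\<in>UNIV. f n x y)"
    unfolding Suc[of "\<lambda>n. f (Suc n)"] prod.lessThan_Suc_shift by (simp add: sum_distrib_right)
  finally show ?case .
qed simp

lemma prod_lessThan_add:
  fixes f :: "nat \<Rightarrow> real"
  shows "(\<Prod>n<p + q. f n) = (\<Prod>n<p. f n) * (\<Prod>n<q. f (p + n))"
  by (induction q) (simp_all add: mult.assoc)

text \<open>A fiber metric is a tensor whose indices come in pairs, the \<open>n\<close>-th with the \<open>(p + n)\<close>-th. Its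
change of frame therefore factorises into a product of changes of frame of bilinear forms.\<close>

lemma sum_paired_lists:
  fixes W :: "nat \<Rightarrow> 'a::finite \<Rightarrow> real" and h :: "'a \<Rightarrow> 'a \<Rightarrow> real"
  shows "(\<Sum>J | length J = 2 * p. (\<Prod>n<2 * p. W n (J ! n)) * (\<Prod>n<p. h (J ! n) (J ! (p + n))))
    = (\<Prod>n<p. \<Sum>x\<in>UNIV. \<Sum>y\<in>UNIV. W n x * W (p + n) y * h x y)"
proof -
  have "(\<Sum>J | length J = 2 * p. (\<Prod>n<2 * p. W n (J ! n)) * (\<Prod>n<p. h (J ! n) (J ! (p + n))))
      = (\<Sum>I | length I = p. \<Sum>J | length J = p. (\<Prod>n<p. W n (I ! n) * W (p + n) (J ! n) * h (I ! n) (J ! n)))"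
    unfolding mult_2 sum_lists_append prod_lessThan_add
    by (intro sum.cong refl) (auto simp: nth_append prod.distrib intro!: arg_cong2[where f = "(*)"] prod.cong)
  then show ?thesis
    using sum_lists_prod2[where p = p and f = "\<lambda>n x y. W n x * W (p + n) y * h x y"] by simp
qed

lemma quadratic_form_change:
  fixes M M' W :: "'x \<Rightarrow> 'x \<Rightarrow> real"
  assumes M: "\<And>t t'. t \<in> X \<Longrightarrow> t' \<in> X \<Longrightarrow> (\<Sum>s\<in>X. \<Sum>s'\<in>X. W s t * W s' t' * M' s s') = M t t'"
    and y: "\<And>s. s \<in> X \<Longrightarrow> y s = (\<Sum>t\<in>X. W s t * x t)"
  shows "(\<Sum>s\<in>X. \<Sum>s'\<in>X. M' s s' * y s * y s') = (\<Sum>t\<in>X. \<Sum>t'\<in>X. M t t' * x t * x t')"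
proof -
  have "(\<Sum>s\<in>X. \<Sum>s'\<in>X. M' s s' * y s * y s')
      = (\<Sum>s\<in>X. \<Sum>s'\<in>X. \<Sum>t\<in>X. \<Sum>t'\<in>X. W s t * W s' t' * M' s s' * x t * x t')"
  proof (intro sum.cong refl)
    fix s s' assume "s \<in> X" "s' \<in> X"
    then show "M' s s' * y s * y s' = (\<Sum>t\<in>X. \<Sum>t'\<in>X. W s t * W s' t' * M' s s' * x t * x t')"
      by (simp add: y sum_distrib_left sum_distrib_right mult_ac)
  qed
  also have "\<dots> = (\<Sum>s\<in>X. \<Sum>t\<in>X. \<Sum>s'\<in>X. \<Sum>t'\<in>X. W s t * W s' t' * M' s s' * x t * x t')"
    by (rule sum.cong[OF refl], rule sum.swap)
  also have "\<dots> = (\<Sum>t\<in>X. \<Sum>s\<in>X. \<Sum>s'\<in>X. \<Sum>t'\<in>X. W s t * W s' t' * M' s s' * x t * x t')"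
    by (rule sum.swap)
  also have "\<dots> = (\<Sum>t\<in>X. \<Sum>s\<in>X. \<Sum>t'\<in>X. \<Sum>s'\<in>X. W s t * W s' t' * M' s s' * x t * x t')"
    by (rule sum.cong[OF refl], rule sum.cong[OF refl], rule sum.swap)
  also have "\<dots> = (\<Sum>t\<in>X. \<Sum>t'\<in>X. \<Sum>s\<in>X. \<Sum>s'\<in>X. W s t * W s' t' * M' s s' * x t * x t')"
    by (rule sum.cong[OF refl], rule sum.swap)
  also have "\<dots> = (\<Sum>t\<in>X. \<Sum>t'\<in>X. M t t' * x t * x t')"
    by (intro sum.cong refl) (simp add: M[symmetric] sum_distrib_right)
  finally show ?thesis .
qed

section \<open>Change of frame for fiber metrics\<close>

lemma matrix_inv_inverse:
  fixes g :: "real^'n^'n"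
  assumes "invertible g"
  shows "g ** matrix_inv g = mat 1" "matrix_inv g ** g = mat 1"
  using someI_ex[OF assms[unfolded invertible_def]] unfolding matrix_inv_def by blast+

lemma matrix_inv_eqI:
  fixes g :: "real^'n^'n"
  assumes "g ** h = mat 1"
  shows "matrix_inv g = h"
proof -
  have "h ** g = mat 1" using assms matrix_left_right_inverse by blast
  then have "invertible g" using assms unfolding invertible_def by blast
  then have "matrix_inv g ** g = mat 1" by (rule matrix_inv_inverse)
  then show ?thesis using assms by (metis matrix_mul_assoc matrix_mul_lid matrix_mul_rid)
qed

lemma congruence_nth:
  fixes P h :: "real^'n^'n"
  shows "(transpose P ** h ** P) $ k $ l = (\<Sum>x\<in>UNIV. \<Sum>y\<in>UNIV. P $ x $ k * P $ y $ l * h $ x $ y)"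
proof -
  have "(transpose P ** h ** P) $ k $ l = (\<Sum>y\<in>UNIV. \<Sum>x\<in>UNIV. P $ x $ k * P $ y $ l * h $ x $ y)"
    by (simp add: matrix_matrix_mult_def transpose_def sum_distrib_right sum_distrib_left mult_ac)
  then show ?thesis
    by (subst sum.swap)
qed

text \<open>Here \<open>P\<close> and \<open>Q\<close> are the transition matrices between two frames, and \<open>g\<close> and \<open>g'\<close> represent
the same nondegenerate bilinear form in the first and the second frame.\<close>

locale frame_change =
  fixes P Q g g' :: "real^2^2"
  assumes PQ: "P ** Q = mat 1" and g: "g = transpose P ** g' ** P" and inv: "invertible g"
begin

lemma QP: "Q ** P = mat 1"
  using PQ matrix_left_right_inverse by blast

lemma TPQ: "transpose Q ** transpose P = mat 1"
  using PQ by (metis matrix_transpose_mul transpose_mat)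

lemma g': "g' = transpose Q ** g ** Q"
  unfolding g using PQ TPQ by (metis matrix_mul_assoc matrix_mul_lid matrix_mul_rid)

lemma ginv': "matrix_inv g' = transpose (transpose P) ** matrix_inv g ** transpose P"
proof (rule matrix_inv_eqI)
  have "g' ** (P ** matrix_inv g ** transpose P)
      = transpose Q ** (g ** ((Q ** P) ** matrix_inv g)) ** transpose P"
    unfolding g' by (simp add: matrix_mul_assoc)
  also have "\<dots> = mat 1"
    by (simp add: QP TPQ matrix_inv_inverse(1)[OF inv])
  finally show "g' ** (transpose (transpose P) ** matrix_inv g ** transpose P) = mat 1"
    by simp
qed

lemma ginv: "matrix_inv g = transpose (transpose Q) ** matrix_inv g' ** transpose Q"
  unfolding ginv' transpose_transpose using QP TPQ
  by (metis matrix_mul_assoc matrix_mul_lid matrix_mul_rid matrix_transpose_mul transpose_mat)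

lemma frame_change_nth:
  "g $ k $ l = (\<Sum>x\<in>UNIV. \<Sum>y\<in>UNIV. P $ x $ k * P $ y $ l * g' $ x $ y)"
  "matrix_inv g $ k $ l = (\<Sum>x\<in>UNIV. \<Sum>y\<in>UNIV. Q $ k $ x * Q $ l $ y * matrix_inv g' $ x $ y)"
  "g' $ k $ l = (\<Sum>x\<in>UNIV. \<Sum>y\<in>UNIV. Q $ x $ k * Q $ y $ l * g $ x $ y)"
  "matrix_inv g' $ k $ l = (\<Sum>x\<in>UNIV. \<Sum>y\<in>UNIV. P $ k $ x * P $ l $ y * matrix_inv g $ x $ y)"
proof -
  have tr: "transpose M $ x $ y = M $ y $ x" for M :: "real^2^2" and x y
    by (simp add: transpose_def)
  show "g $ k $ l = (\<Sum>x\<in>UNIV. \<Sum>y\<in>UNIV. P $ x $ k * P $ y $ l * g' $ x $ y)"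
    by (subst g) (rule congruence_nth)
  show "g' $ k $ l = (\<Sum>x\<in>UNIV. \<Sum>y\<in>UNIV. Q $ x $ k * Q $ y $ l * g $ x $ y)"
    by (subst g') (rule congruence_nth)
  show "matrix_inv g $ k $ l = (\<Sum>x\<in>UNIV. \<Sum>y\<in>UNIV. Q $ k $ x * Q $ l $ y * matrix_inv g' $ x $ y)"
    using congruence_nth[of "transpose Q" "matrix_inv g'" k l] unfolding tr ginv[symmetric] .
  show "matrix_inv g' $ k $ l = (\<Sum>x\<in>UNIV. \<Sum>y\<in>UNIV. P $ k $ x * P $ l $ y * matrix_inv g $ x $ y)"
    using congruence_nth[of "transpose P" "matrix_inv g" k l] unfolding tr ginv'[symmetric] .
qed

lemma fiber_gram_change:
  "fiber_gram g p q r I J K I2 J2 K2 =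
   (\<Sum>I' | length I' = p. \<Sum>J' | length J' = q. \<Sum>I2' | length I2' = p. \<Sum>J2' | length J2' = q.
      ((\<Prod>n<p. P $ (I' ! n) $ (I ! n)) * (\<Prod>n<q. Q $ (J ! n) $ (J' ! n))) *
      ((\<Prod>n<p. P $ (I2' ! n) $ (I2 ! n)) * (\<Prod>n<q. Q $ (J2 ! n) $ (J2' ! n))) *
      fiber_gram g' p q r I' J' K I2' J2' K2)" (is "_ = ?R")
proof -
  let ?d = "\<Prod>n<r. if K ! n = K2 ! n then 1 else 0 :: real"
  let ?a = "\<lambda>I' I2'. \<Prod>n<p. P $ (I' ! n) $ (I ! n) * P $ (I2' ! n) $ (I2 ! n) * g' $ (I' ! n) $ (I2' ! n)"
  let ?b = "\<lambda>J' J2'. \<Prod>n<q. Q $ (J ! n) $ (J' ! n) * Q $ (J2 ! n) $ (J2' ! n) * matrix_inv g' $ (J' ! n) $ (J2' ! n)"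
  have "?R = (\<Sum>I' | length I' = p. \<Sum>J' | length J' = q. \<Sum>I2' | length I2' = p. \<Sum>J2' | length J2' = q.
      ?a I' I2' * ?b J' J2' * ?d)"
    by (intro sum.cong refl) (simp add: fiber_gram_def prod.distrib mult_ac)
  also have "\<dots> = (\<Sum>I' | length I' = p. \<Sum>I2' | length I2' = p. \<Sum>J' | length J' = q. \<Sum>J2' | length J2' = q.
      ?a I' I2' * ?b J' J2' * ?d)"
    by (rule sum.cong[OF refl], rule sum.swap)
  also have "\<dots> = (\<Sum>I' | length I' = p. \<Sum>I2' | length I2' = p. ?a I' I2') *
      (\<Sum>J' | length J' = q. \<Sum>J2' | length J2' = q. ?b J' J2') * ?d"
    by (simp only: sum_distrib_left[symmetric] sum_distrib_right[symmetric])
  also have "\<dots> = fiber_gram g p q r I J K I2 J2 K2"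
    unfolding sum_lists_prod2[where f = "\<lambda>n x y. P $ x $ (I ! n) * P $ y $ (I2 ! n) * g' $ x $ y"]
      sum_lists_prod2[where f = "\<lambda>n x y. Q $ (J ! n) $ x * Q $ (J2 ! n) $ y * matrix_inv g' $ x $ y"]
    by (simp only: fiber_gram_def frame_change_nth(1,2))
  finally show ?thesis ..
qed

text \<open>The induced inner product of tensors does not depend on the frame: the transformation matrices
of the tensor components are absorbed into those of the Gram coefficients. The indices \<open>I\<close>, \<open>J\<close> and
\<open>K\<close> are combined into a single index running over \<open>Y\<close>, on which the change of frame is one matrix
\<open>W\<close>.\<close>

lemma fiber_inner_change:
  assumes \<beta>: "\<And>I J K. length I = p \<Longrightarrow> length J = q \<Longrightarrow> length K = r \<Longrightarrow>
     \<beta> I J K = (\<Sum>I' | length I' = p. \<Sum>J' | length J' = q.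
        (\<Prod>n<p. P $ (I ! n) $ (I' ! n)) * (\<Prod>n<q. Q $ (J' ! n) $ (J ! n)) * \<alpha> I' J' K)"
  shows "fiber_inner g' p q r \<beta> \<beta> = fiber_inner g p q r \<alpha> (\<alpha> :: _ \<Rightarrow> _ \<Rightarrow> 'd::finite list \<Rightarrow> real)"
proof -
  define X where "X = {I :: 2 list. length I = p} \<times> {J :: 2 list. length J = q}"
  define Y where "Y = X \<times> {K :: 'd list. length K = r}"
  have fi: "fiber_inner h p q r \<gamma> \<gamma> =
     (\<Sum>s\<in>Y. \<Sum>s'\<in>Y. fiber_gram h p q r (fst (fst s)) (snd (fst s)) (snd s) (fst (fst s')) (snd (fst s')) (snd s')
        * \<gamma> (fst (fst s)) (snd (fst s)) (snd s) * \<gamma> (fst (fst s')) (snd (fst s')) (snd s'))" for h \<gamma>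
    unfolding fiber_inner_def by (simp only: Y_def X_def sum.cartesian_product' fst_conv snd_conv)
  define W where "W s t = (if snd s = snd t then (\<Prod>n<p. P $ (fst (fst s) ! n) $ (fst (fst t) ! n)) *
     (\<Prod>n<q. Q $ (snd (fst t) ! n) $ (snd (fst s) ! n)) else 0)" for s t :: "(2 list \<times> 2 list) \<times> 'd list"
  have sumK: "(\<Sum>s\<in>Y. (if snd s = K then F (fst s) (snd s) else 0)) = (\<Sum>x\<in>X. F x K)"
    if "length K = r" for K and F :: "_ \<Rightarrow> _ \<Rightarrow> real"
  proof -
    have "(\<Sum>s\<in>Y. (if snd s = K then F (fst s) (snd s) else 0)) = (\<Sum>x\<in>X. \<Sum>k | length k = r. if k = K then F x k
        else 0)"
      by (simp only: Y_def sum.cartesian_product' fst_conv snd_conv)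
    also have "\<dots> = (\<Sum>x\<in>X. F x K)"
      using that by (intro sum.cong refl) (simp add: sum.delta)
    finally show ?thesis .
  qed
  show ?thesis
    unfolding fi
  proof (rule quadratic_form_change[where W = W])
    fix s assume s: "s \<in> Y"
    then have l: "length (fst (fst s)) = p" "length (snd (fst s)) = q" "length (snd s) = r"
      by (auto simp: Y_def X_def)
    show "\<beta> (fst (fst s)) (snd (fst s)) (snd s) = (\<Sum>t\<in>Y. W s t * \<alpha> (fst (fst t)) (snd (fst t)) (snd t))"
    proof -
      have "(\<Sum>t\<in>Y. W s t * \<alpha> (fst (fst t)) (snd (fst t)) (snd t)) =
         (\<Sum>t\<in>Y. if snd t = snd s then (\<lambda>x k. (\<Prod>n<p. P $ (fst (fst s) ! n) $ (fst x ! n)) *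
            (\<Prod>n<q. Q $ (snd x ! n) $ (snd (fst s) ! n)) * \<alpha> (fst x) (snd x) k) (fst t) (snd t) else 0)"
        by (intro sum.cong refl) (simp add: W_def)
      also have "\<dots> = (\<Sum>x\<in>X. (\<Prod>n<p. P $ (fst (fst s) ! n) $ (fst x ! n)) *
            (\<Prod>n<q. Q $ (snd x ! n) $ (snd (fst s) ! n)) * \<alpha> (fst x) (snd x) (snd s))"
        by (rule sumK[OF l(3), of "\<lambda>x k. (\<Prod>n<p. P $ (fst (fst s) ! n) $ (fst x ! n)) *
            (\<Prod>n<q. Q $ (snd x ! n) $ (snd (fst s) ! n)) * \<alpha> (fst x) (snd x) k"])
      also have "\<dots> = \<beta> (fst (fst s)) (snd (fst s)) (snd s)"
        unfolding \<beta>[OF l] by (simp only: X_def sum.cartesian_product' fst_conv snd_conv)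
      finally show ?thesis ..
    qed
  next
    fix t t' assume "t \<in> Y" "t' \<in> Y"
    then have l: "length (snd t) = r" "length (snd t') = r"
      by (auto simp: Y_def)
    let ?G = "\<lambda>s s'. fiber_gram g' p q r (fst (fst s)) (snd (fst s)) (snd s) (fst (fst s')) (snd (fst s')) (snd s')"
    let ?w = "\<lambda>x t. (\<Prod>n<p. P $ (fst x ! n) $ (fst (fst t) ! n)) * (\<Prod>n<q. Q $ (snd (fst t) ! n) $ (snd x ! n))"
    have "(\<Sum>s\<in>Y. \<Sum>s'\<in>Y. W s t * W s' t' * ?G s s') =
       (\<Sum>s\<in>Y. if snd s = snd t then (\<lambda>x k. \<Sum>s'\<in>Y. if snd s' = snd t' then (\<lambda>x' k'. ?w x t * ?w x' t' * ?G (x, k)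
           (x', k')) (fst s') (snd s') else 0) (fst s) (snd s) else 0)"
      by (intro sum.cong refl) (auto simp: W_def intro!: sum.cong)
    also have "\<dots> = (\<Sum>x\<in>X. \<Sum>s'\<in>Y. if snd s' = snd t' then ?w x t * ?w (fst s') t' * ?G (x, snd t) (fst s', snd
        s') else 0)"
      by (rule sumK[OF l(1), of "\<lambda>x k. \<Sum>s'\<in>Y. if snd s' = snd t' then ?w x t * ?w (fst s') t' * ?G (x, k) (fst
          s', snd s') else 0"])
    also have "\<dots> = (\<Sum>x\<in>X. \<Sum>x'\<in>X. ?w x t * ?w x' t' * ?G (x, snd t) (x', snd t'))"
      by (rule sum.cong[OF refl], rule sumK[OF l(2), of "\<lambda>x' k'. ?w _ t * ?w x' t' * ?G (_, snd t) (x', k')"])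
    also have "\<dots> = fiber_gram g p q r (fst (fst t)) (snd (fst t)) (snd t) (fst (fst t')) (snd (fst t')) (snd t')"
      unfolding fiber_gram_change[of p q r "fst (fst t)"] X_def
      by (simp only: sum.cartesian_product' fst_conv snd_conv)
    finally show "(\<Sum>s\<in>Y. \<Sum>s'\<in>Y. W s t * W s' t' * ?G s s') =
       fiber_gram g p q r (fst (fst t)) (snd (fst t)) (snd t) (fst (fst t')) (snd (fst t')) (snd t')" .
  qed
qed

lemma fiber_metric_change:
  assumes "length I = 2 * j" "length J = 2 * i" "length K = 2 * m"
  shows "fiber_gram g' i j m (take i J) (take j I) (take m K) (drop i J) (drop j I) (drop m K) =
    (\<Sum>I' | length I' = 2 * j. \<Sum>J' | length J' = 2 * i.
       (\<Prod>n<2 * j. P $ (I ! n) $ (I' ! n)) * (\<Prod>n<2 * i. Q $ (J' ! n) $ (J ! n)) *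
       fiber_gram g i j m (take i J') (take j I') (take m K) (drop i J') (drop j I') (drop m K))"
    (is "_ = ?R")
proof -
  let ?d = "\<Prod>n<m. if take m K ! n = drop m K ! n then 1 else 0 :: real"
  have gram: "fiber_gram h i j m (take i J) (take j I) (take m K) (drop i J) (drop j I) (drop m K) =
      (\<Prod>n<i. h $ (J ! n) $ (J ! (i + n))) * (\<Prod>n<j. matrix_inv h $ (I ! n) $ (I ! (j + n))) * ?d"
    if "length I = 2 * j" "length J = 2 * i" for I J h
    using that by (simp add: fiber_gram_def)
  have "?R = (\<Sum>I' | length I' = 2 * j. \<Sum>J' | length J' = 2 * i.
       ((\<Prod>n<2 * j. P $ (I ! n) $ (I' ! n)) * (\<Prod>n<j. matrix_inv g $ (I' ! n) $ (I' ! (j + n)))) *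
       ((\<Prod>n<2 * i. Q $ (J' ! n) $ (J ! n)) * (\<Prod>n<i. g $ (J' ! n) $ (J' ! (i + n)))) * ?d)"
    by (intro sum.cong refl) (simp add: gram mult_ac)
  also have "\<dots> = (\<Sum>I' | length I' = 2 * j. (\<Prod>n<2 * j. P $ (I ! n) $ (I' ! n)) * (\<Prod>n<j. matrix_inv g $ (I' ! n) $
      (I' ! (j + n)))) *
       (\<Sum>J' | length J' = 2 * i. (\<Prod>n<2 * i. Q $ (J' ! n) $ (J ! n)) * (\<Prod>n<i. g $ (J' ! n) $ (J' ! (i + n)))) * ?d"
    by (simp only: sum_distrib_left[symmetric] sum_distrib_right[symmetric])
  also have "\<dots> = (\<Prod>n<j. matrix_inv g' $ (I ! n) $ (I ! (j + n))) * (\<Prod>n<i. g' $ (J ! n) $ (J ! (i + n))) * ?d"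
    unfolding sum_paired_lists[where W = "\<lambda>n x. P $ (I ! n) $ x" and h = "\<lambda>x y. matrix_inv g $ x $ y"]
      sum_paired_lists[where W = "\<lambda>n x. Q $ x $ (J ! n)" and h = "\<lambda>x y. g $ x $ y"]
    by (simp only: frame_change_nth(3,4))
  also have "\<dots> = fiber_gram g' i j m (take i J) (take j I) (take m K) (drop i J) (drop j I) (drop m K)"
    using assms by (simp add: gram)
  finally show ?thesis ..
qed

end

section \<open>The inverse of a two by two matrix\<close>

definition adjugate :: "real^2^2 \<Rightarrow> 2 \<Rightarrow> 2 \<Rightarrow> real" where
  "adjugate g i j = (if i = j then (if i = 1 then g $ 2 $ 2 else g $ 1 $ 1) else - g $ i $ j)"

lemma matrix_inv_2:
  fixes g :: "real^2^2"
  assumes "det g \<noteq> 0"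
  shows "matrix_inv g $ i $ j = adjugate g i j * inverse (det g)"
proof -
  define D where "D = inverse (det g)"
  have "(g $ 1 $ 1 * g $ 2 $ 2 - g $ 1 $ 2 * g $ 2 $ 1) * D = 1"
    using assms by (simp add: D_def det_2)
  then have "g ** (\<chi> i j. adjugate g i j * inverse (det g)) = mat 1"
    unfolding D_def[symmetric]
    by (simp add: vec_eq_iff forall_2 matrix_matrix_mult_def sum_2 mat_def adjugate_def algebra_simps)
  from matrix_inv_eqI[OF this] show ?thesis
    by simp
qed

lemma smooth_fun_on_fiber_gram:
  assumes "open S" and h: "\<And>i j. smooth_fun_on S (\<lambda>y. h y $ i $ j)" and nz: "\<And>y. y \<in> S \<Longrightarrow> det (h y) \<noteq> 0"
  shows "smooth_fun_on S (\<lambda>y. fiber_gram (h y) p q r I J K I' J' K')"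
proof -
  have adj: "smooth_fun_on S (\<lambda>y. adjugate (h y) i j)" for i j
    unfolding adjugate_def using h smooth_fun_on_cmult[OF h, of "-1" i j] by (cases "i = j"; cases "i = 1") simp_all
  have "smooth_fun_on S (\<lambda>y. det (h y))"
    unfolding det_2 by (intro smooth_fun_on_diff smooth_fun_on_mult h)
  then have "smooth_fun_on S (\<lambda>y. adjugate (h y) i j * inverse (det (h y)))" for i j
    using nz by (intro smooth_fun_on_mult adj smooth_fun_on_inverse)
  then have inv: "smooth_fun_on S (\<lambda>y. matrix_inv (h y) $ i $ j)" for i j
    by (rule smooth_fun_on_cong) (simp add: matrix_inv_2 nz)
  show ?thesis
    unfolding fiber_gram_def
    by (intro smooth_fun_on_mult smooth_fun_on_prod smooth_fun_on_const h inv assms(1))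
qed

lemma (in rectangle_nbhd) sobolev_Cauchy_fiber_gram:
  assumes k: "2 \<le> k" and h: "\<And>i j. sobolev_Cauchy S a b k (\<lambda>n y. h n y $ i $ j)"
    and nz: "\<And>n y. y \<in> S \<Longrightarrow> det (h n y) \<noteq> 0"
    and d: "d > 0" "\<And>n y. y \<in> cbox a b \<Longrightarrow> d \<le> \<bar>det (h n y)\<bar>"
  shows "sobolev_Cauchy S a b k (\<lambda>n y. fiber_gram (h n y) p q r I J K I' J' K')"
proof -
  note cm = sobolev_Cauchy_mult[OF k sobolev_Cauchy_const[of k "-1"]]
  have adj: "sobolev_Cauchy S a b k (\<lambda>n y. adjugate (h n y) i j)" for i j
    unfolding adjugate_def using h cm[OF h, of i j] by (cases "i = j"; cases "i = 1") simp_all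
  have "sobolev_Cauchy S a b k (\<lambda>n y. h n y $ 1 $ 1 * h n y $ 2 $ 2 + (-1) * (h n y $ 1 $ 2 * h n y $ 2 $ 1))"
    by (rule sobolev_Cauchy_add[OF sobolev_Cauchy_mult[OF k h h] cm[OF sobolev_Cauchy_mult[OF k h h]]])
  then have "sobolev_Cauchy S a b k (\<lambda>n y. det (h n y))"
    unfolding det_2 by simp
  from sobolev_Cauchy_mult[OF k adj sobolev_Cauchy_inverse[OF k this d nz]]
  have "sobolev_Cauchy S a b k (\<lambda>n y. adjugate (h n y) i j * inverse (det (h n y)))" for i j .
  then have inv: "sobolev_Cauchy S a b k (\<lambda>n y. matrix_inv (h n y) $ i $ j)" for i j
    by (rule sobolev_Cauchy_cong) (simp add: matrix_inv_2 nz)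
  show ?thesis
    unfolding fiber_gram_def
    by (intro sobolev_Cauchy_mult[OF k] sobolev_Cauchy_prod[OF k] sobolev_Cauchy_const h inv)
qed

lemma continuous_on_matrix_inv:
  fixes h :: "'a::topological_space \<Rightarrow> real^2^2"
  assumes h: "\<And>i j. continuous_on S (\<lambda>y. h y $ i $ j)" and nz: "\<And>y. y \<in> S \<Longrightarrow> det (h y) \<noteq> 0"
  shows "continuous_on S (\<lambda>y. matrix_inv (h y) $ i $ j)"
proof -
  have adj: "continuous_on S (\<lambda>y. adjugate (h y) i j)" for i j
    unfolding adjugate_def using h continuous_on_minus[OF h, of i j] by (cases "i = j"; cases "i = 1") simp_all
  have "continuous_on S (\<lambda>y. det (h y))"
    unfolding det_2 by (intro continuous_intros h)
  then have "continuous_on S (\<lambda>y. adjugate (h y) i j * inverse (det (h y)))"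
    using nz by (intro continuous_intros adj) auto
  then show ?thesis
    by (rule continuous_on_eq) (simp add: matrix_inv_2 nz)
qed

lemma continuous_on_fiber_gram:
  fixes h :: "'a::topological_space \<Rightarrow> real^2^2"
  assumes h: "\<And>i j. continuous_on S (\<lambda>y. h y $ i $ j)" and nz: "\<And>y. y \<in> S \<Longrightarrow> det (h y) \<noteq> 0"
  shows "continuous_on S (\<lambda>y. fiber_gram (h y) p q r I J K I' J' K')"
  unfolding fiber_gram_def
  by (intro continuous_on_mult continuous_on_prod continuous_on_const h continuous_on_matrix_inv nz)

section \<open>Charts\<close>

locale surface =
  fixes A :: "'m::t2_space chart set" and C :: "('m chart \<times> (real^2) \<times> (real^2)) set"
  assumes A: "closed_oriented_surface A" and C: "coord_cover A C"
begin

lemma chart: "c \<in> A \<Longrightarrow> is_chart c"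
  using A by (simp add: closed_oriented_surface_def)

lemma open_cdom: "c \<in> A \<Longrightarrow> open (cdom c)" and open_cimg: "c \<in> A \<Longrightarrow> open (cimg c)"
  using chart by (auto simp: is_chart_def)

lemma chart_homeomorphism: "c \<in> A \<Longrightarrow> homeomorphism (cdom c) (cimg c) (cmap c) (cinv c)"
  using chart by (auto simp: is_chart_def)

lemma cinv_cmap: "c \<in> A \<Longrightarrow> x \<in> cdom c \<Longrightarrow> cinv c (cmap c x) = x"
  and cmap_cinv: "c \<in> A \<Longrightarrow> y \<in> cimg c \<Longrightarrow> cmap c (cinv c y) = y"
  and cmap_in: "c \<in> A \<Longrightarrow> x \<in> cdom c \<Longrightarrow> cmap c x \<in> cimg c"
  and cinv_in: "c \<in> A \<Longrightarrow> y \<in> cimg c \<Longrightarrow> cinv c y \<in> cdom c"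
  and continuous_cmap: "c \<in> A \<Longrightarrow> continuous_on (cdom c) (cmap c)"
  and continuous_cinv: "c \<in> A \<Longrightarrow> continuous_on (cimg c) (cinv c)"
  using chart_homeomorphism[of c] unfolding homeomorphism_def by auto

lemma cell: "(c, a, b) \<in> C \<Longrightarrow> c \<in> A \<and> cbox a b \<subseteq> cimg c"
  using C unfolding coord_cover_def by blast

lemma finite_C: "finite C"
  using C by (simp add: coord_cover_def)

text \<open>Every point of the surface lies in an open coordinate rectangle of the cover; statements on
the surface are reduced to these rectangles.\<close>

lemma ex_cell:
  obtains c a b y where "(c, a, b) \<in> C" "y \<in> box a b" "x = cinv c y" "c \<in> A" "x \<in> cdom c" "cmap c x = y"
proof -
  have "x \<in> (\<Union>(c, a, b)\<in>C. cinv c ` box a b)"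
    using C by (simp add: coord_cover_def)
  then obtain c a b y where *: "(c, a, b) \<in> C" "y \<in> box a b" "x = cinv c y"
    by blast
  have c: "c \<in> A" "y \<in> cimg c"
    using cell[OF *(1)] *(2) box_subset_cbox[of a b] by auto
  show thesis
    by (rule that[OF * c(1)]) (use c * cinv_in[OF c] cmap_cinv[OF c] in simp_all)
qed

lemma rectangle_nbhd_cell: "(c, a, b) \<in> C \<Longrightarrow> box a b \<noteq> {} \<Longrightarrow> rectangle_nbhd (cimg c) a b"
  using cell open_cimg by unfold_locales auto

lemma transition_smooth:
  "c \<in> A \<Longrightarrow> c' \<in> A \<Longrightarrow> smooth_fun_on (cmap c ` (cdom c \<inter> cdom c')) (cmap c' \<circ> cinv c)"
  using A unfolding closed_oriented_surface_def by blast

lemma open_overlap: "c \<in> A \<Longrightarrow> c' \<in> A \<Longrightarrow> open (cmap c ` (cdom c \<inter> cdom c'))"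
  using transition_smooth smooth_fun_on_open by blast

lemma transition_differentiable:
  assumes "c \<in> A" "c' \<in> A" "x \<in> cdom c" "x \<in> cdom c'"
  shows "(cmap c' \<circ> cinv c) differentiable (at (cmap c x))"
  using smooth_fun_on_differentiable[OF transition_smooth[OF assms(1,2)], of "cmap c x"] assms(3,4) by blast

lemma transition_jac_nth:
  "transition_jac c c' x $ i $ j = pderiv_at j (cmap c' \<circ> cinv c) (cmap c x) $ i"
  by (simp add: transition_jac_def jacobian_def matrix_def pderiv_at_def)

text \<open>The coordinate expressions of \<open>f\<close> in the two charts differ by the transition map, which is
smooth; this is the chain rule.\<close>

lemma chart_change:
  fixes f :: "'m \<Rightarrow> 'b::real_normed_vector"
  assumes c: "c \<in> A" "c' \<in> A" "x \<in> cdom c" "x \<in> cdom c'"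
    and f: "(f \<circ> cinv c') differentiable (at (cmap c' x))"
  shows "(f \<circ> cinv c) differentiable (at (cmap c x))"
    and "pderiv_at j (f \<circ> cinv c) (cmap c x) =
       (\<Sum>i\<in>UNIV. transition_jac c c' x $ i $ j *\<^sub>R pderiv_at i (f \<circ> cinv c') (cmap c' x))"
proof -
  let ?T = "cmap c' \<circ> cinv c" and ?y = "cmap c x" and ?O = "cmap c ` (cdom c \<inter> cdom c')"
  let ?DT = "frechet_derivative ?T (at ?y)" and ?Df = "frechet_derivative (f \<circ> cinv c') (at (cmap c' x))"
  have T: "(?T has_derivative ?DT) (at ?y)"
    using transition_differentiable[OF c] by (rule differentiable_has_derivative)
  have Ty: "?T ?y = cmap c' x" using c by (simp add: cinv_cmap)
  have "((f \<circ> cinv c') has_derivative ?Df) (at (?T ?y))"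
    unfolding Ty using f by (rule differentiable_has_derivative)
  from diff_chain_at[OF T this] have *: "((f \<circ> cinv c') \<circ> ?T has_derivative ?Df \<circ> ?DT) (at ?y)" .
  have "((f \<circ> cinv c) has_derivative ?Df \<circ> ?DT) (at ?y)"
  proof (rule has_derivative_transform_within_open[OF * open_overlap[OF c(1,2)]])
    show "?y \<in> ?O" using c by blast
    show "(f \<circ> cinv c' \<circ> ?T) z = (f \<circ> cinv c) z" if "z \<in> ?O" for z
      using that c by (auto simp: cinv_cmap)
  qed
  note D = this
  then show "(f \<circ> cinv c) differentiable (at (cmap c x))"
    by (auto simp: differentiable_def)
  show "pderiv_at j (f \<circ> cinv c) (cmap c x) =
       (\<Sum>i\<in>UNIV. transition_jac c c' x $ i $ j *\<^sub>R pderiv_at i (f \<circ> cinv c') (cmap c' x))"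
    unfolding pderiv_at_eqI[OF D] o_apply frechet_derivative_eq_sum_pderiv[OF f] transition_jac_nth
    by (simp add: pderiv_at_def)
qed

text \<open>The chain rule applied to the coordinate map of \<open>c\<close> itself, whose expression in \<open>c\<close> is the
identity.\<close>

lemma transition_jac_inverse:
  assumes c: "c \<in> A" "c' \<in> A" "x \<in> cdom c" "x \<in> cdom c'"
  shows "transition_jac c' c x ** transition_jac c c' x = mat 1"
proof -
  have d: "(cmap c \<circ> cinv c') differentiable (at (cmap c' x))"
    using transition_differentiable[OF c(2,1,4,3)] .
  have id: "pderiv_at j (cmap c \<circ> cinv c) (cmap c x) = axis j 1" for j
  proof (rule pderiv_at_eqI[of _ "\<lambda>h. h"])
    show "((cmap c \<circ> cinv c) has_derivative (\<lambda>h. h)) (at (cmap c x))"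
      by (rule has_derivative_transform_within_open[OF has_derivative_ident open_cimg[OF c(1)]])
        (use c cmap_in cmap_cinv in auto)
  qed
  have "(\<Sum>i\<in>UNIV. transition_jac c' c x $ k $ i * transition_jac c c' x $ i $ j) = (axis j 1 :: real^2) $ k" for k j
    using arg_cong[OF chart_change(2)[OF c d, of j], of "\<lambda>v. v $ k"]
    unfolding id by (simp add: transition_jac_nth[of c' c] mult.commute)
  then show ?thesis
    by (simp add: vec_eq_iff matrix_matrix_mult_def mat_def axis_def eq_commute)
qed

lemma continuous_transition_jac:
  assumes "c \<in> A" "c' \<in> A"
  shows "continuous_on (cdom c \<inter> cdom c') (\<lambda>x. transition_jac c c' x $ i $ j)"
proof -
  let ?O = "cmap c ` (cdom c \<inter> cdom c')"
  have "continuous_on ?O (pderiv_at j (cmap c' \<circ> cinv c))"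
    using smooth_fun_on_continuous[OF smooth_fun_on_pderiv[OF transition_smooth[OF assms]]] .
  moreover have "continuous_on (cdom c \<inter> cdom c') (cmap c)"
    using continuous_cmap[OF assms(1)] by (rule continuous_on_subset) auto
  ultimately have "continuous_on (cdom c \<inter> cdom c') (\<lambda>x. pderiv_at j (cmap c' \<circ> cinv c) (cmap c x))"
    using continuous_on_compose2 by blast
  then show ?thesis
    unfolding transition_jac_nth by (intro continuous_intros)
qed

lemma open_cell:
  assumes "(c, a, b) \<in> C"
  shows "open (cinv c ` box a b)"
proof -
  have c: "c \<in> A" "cbox a b \<subseteq> cimg c" using cell[OF assms] by auto
  have "cinv c ` box a b = cdom c \<inter> cmap c -` box a b"
    using c box_subset_cbox[of a b] by (force simp: cinv_in cmap_cinv cinv_cmap image_iff)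
  then show ?thesis
    using continuous_open_preimage[OF continuous_cmap[OF c(1)] open_cdom[OF c(1)] open_box] by simp
qed

text \<open>Near any point the components in an arbitrary chart are combinations of the components in a
chart of the cover, with coefficients that are products of derivatives of transition maps.\<close>

lemma continuous_tensor_fieldI:
  fixes \<tau> :: "('m, 'd) tfield"
  assumes \<tau>: "tensor_field A p q r \<tau>"
    and cont: "\<And>c a b I J K. (c, a, b) \<in> C \<Longrightarrow> length I = p \<Longrightarrow> length J = q \<Longrightarrow> length K = r \<Longrightarrow>
      continuous_on (box a b) (\<lambda>y. \<tau> c (cinv c y) I J K)"
  shows "continuous_tensor_field A p q r \<tau>"
  unfolding continuous_tensor_field_def
proof (intro conjI \<tau> ballI allI impI)
  fix c' and I J :: "2 list" and K :: "'d list"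
  assume c': "c' \<in> A" and l: "length I = p" "length J = q" "length K = r"
  have "isCont (\<lambda>x. \<tau> c' x I J K) x" if x: "x \<in> cdom c'" for x
  proof -
    obtain c a b y where c: "(c, a, b) \<in> C" "y \<in> box a b" "x = cinv c y" "c \<in> A"
      by (rule ex_cell[of x])
    have cb: "cbox a b \<subseteq> cimg c" using cell[OF c(1)] by auto
    let ?U = "cinv c ` box a b \<inter> cdom c'"
    have U: "open ?U" "x \<in> ?U"
      using open_cell[OF c(1)] open_cdom[OF c'] c x by auto
    have Usub: "?U \<subseteq> cdom c \<inter> cdom c'"
      using cb c box_subset_cbox[of a b] by (auto intro!: cinv_in)
    have "continuous_on ?U (\<lambda>x. \<tau> c x I' J' K)" if "length I' = p" "length J' = q" for I' J'
    proof -
      have "continuous_on ?U (\<lambda>x. (\<lambda>y. \<tau> c (cinv c y) I' J' K) (cmap c x))"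
      proof (rule continuous_on_compose2[OF cont[OF c(1) that l(3)]])
        show "continuous_on ?U (cmap c)"
          using continuous_cmap[OF c(4)] by (rule continuous_on_subset) (use Usub in auto)
        show "cmap c ` ?U \<subseteq> box a b"
          using cb c box_subset_cbox[of a b] by (auto simp: cmap_cinv)
      qed
      then show ?thesis
      proof (rule continuous_on_eq)
        fix z assume "z \<in> ?U"
        then have "z \<in> cdom c" using Usub by blast
        then show "\<tau> c (cinv c (cmap c z)) I' J' K = \<tau> c z I' J' K"
          by (simp add: cinv_cmap[OF c(4)])
      qed
    qed
    then have "continuous_on ?U (\<lambda>x. \<Sum>I' | length I' = p. \<Sum>J' | length J' = q.
             (\<Prod>n<p. transition_jac c c' x $ (I ! n) $ (I' ! n)) *
             (\<Prod>n<q. transition_jac c' c x $ (J' ! n) $ (J ! n)) * \<tau> c x I' J' K)"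
      using continuous_on_subset[OF continuous_transition_jac[OF c(4) c'] Usub]
        continuous_on_subset[OF continuous_transition_jac[OF c' c(4)], of ?U] Usub
      by (intro continuous_on_sum continuous_on_mult continuous_on_prod) auto
    then have "continuous_on ?U (\<lambda>x. \<tau> c' x I J K)"
    proof (rule continuous_on_eq)
      fix z assume "z \<in> ?U"
      then have "z \<in> cdom c \<inter> cdom c'" using Usub by blast
      from \<tau>[unfolded tensor_field_def, rule_format, OF c(4) c' this l]
      show "(\<Sum>I' | length I' = p. \<Sum>J' | length J' = q.
             (\<Prod>n<p. transition_jac c c' z $ (I ! n) $ (I' ! n)) *
             (\<Prod>n<q. transition_jac c' c z $ (J' ! n) $ (J ! n)) * \<tau> c z I' J' K) = \<tau> c' z I J K" ..
    qed
    then show ?thesis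
      using U by (simp add: continuous_on_eq_continuous_at)
  qed
  then show "continuous_on (cdom c') (\<lambda>x. \<tau> c' x I J K)"
    by (simp add: continuous_at_imp_continuous_on)
qed

section \<open>Pointwise and uniform norms\<close>

definition metric_law :: "'m metric_field \<Rightarrow> bool" where
  "metric_law g \<longleftrightarrow> (\<forall>c\<in>A. \<forall>c'\<in>A. \<forall>x\<in>cdom c \<inter> cdom c'.
     g c x = transpose (transition_jac c c' x) ** g c' x ** transition_jac c c' x)"

lemma frame_change_transition:
  assumes "metric_law g" "c \<in> A" "c' \<in> A" "x \<in> cdom c" "x \<in> cdom c'" "invertible (g c x)"
  shows "frame_change (transition_jac c c' x) (transition_jac c' c x) (g c x) (g c' x)"
  using assms transition_jac_inverse[OF assms(3,2,5,4)] unfolding frame_change_def metric_law_def by blast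

lemma tensor_field_fiber_metric:
  assumes g: "metric_law g" and inv: "\<And>c x. c \<in> A \<Longrightarrow> x \<in> cdom c \<Longrightarrow> invertible (g c x)"
  shows "tensor_field A (2 * j) (2 * i) (2 * m) (fiber_metric_tensor g i j m)"
  unfolding tensor_field_def fiber_metric_tensor_def
  using frame_change.fiber_metric_change[OF frame_change_transition[OF g _ _ _ _ inv]] by auto

lemma fiber_inner_chart_change:
  fixes \<tau> :: "('m, 'd::finite) tfield"
  assumes "metric_law g" "c \<in> A" "c' \<in> A" "x \<in> cdom c" "x \<in> cdom c'" "invertible (g c x)"
    and \<tau>: "tensor_field A p q r \<tau>"
  shows "fiber_inner (g c' x) p q r (\<tau> c' x) (\<tau> c' x) = fiber_inner (g c x) p q r (\<tau> c x) (\<tau> c x)"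
  by (rule frame_change.fiber_inner_change[OF frame_change_transition[OF assms(1-6)]])
     (use \<tau>[unfolded tensor_field_def, rule_format, OF assms(2,3)] assms(4,5) in auto)

lemma Linf_norm_leI:
  assumes "\<And>c x. c \<in> A \<Longrightarrow> x \<in> cdom c \<Longrightarrow> sqrt (fiber_inner (g c x) p q r (\<tau> c x) (\<tau> c x)) \<le> s"
  shows "Linf_norm A g p q r \<tau> \<le> ennreal s"
  unfolding Linf_norm_def
proof (rule Inf_lower, intro CollectI ballI)
  fix c assume c: "c \<in> A"
  have "\<not> ennreal s < ennreal (sqrt (fiber_inner (g c x) p q r (\<tau> c x) (\<tau> c x)))" if "x \<in> cdom c" for x
    using ennreal_leI[OF assms[OF c that]] by (simp add: not_less)
  then have "{x \<in> cdom c. ennreal s < ennreal (sqrt (fiber_inner (g c x) p q r (\<tau> c x) (\<tau> c x)))} = {}"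
    by blast
  then show "negligible (cmap c ` {x \<in> cdom c. ennreal s < ennreal (sqrt (fiber_inner (g c x) p q r (\<tau> c x) (\<tau> c
      x)))})"
    by (metis image_empty negligible_empty)
qed

end

lemma abs_fiber_gram_le:
  assumes "1 \<le> B" "\<And>i j. \<bar>g $ i $ j\<bar> \<le> B" "\<And>i j. \<bar>matrix_inv g $ i $ j\<bar> \<le> B"
  shows "\<bar>fiber_gram g p q r I J K I' J' K'\<bar> \<le> B ^ p * B ^ q"
proof -
  have "\<bar>\<Prod>n<p. g $ (I ! n) $ (I' ! n)\<bar> \<le> (\<Prod>n<p. B)"
    unfolding abs_prod using assms by (intro prod_mono) auto
  moreover have "\<bar>\<Prod>n<q. matrix_inv g $ (J ! n) $ (J' ! n)\<bar> \<le> (\<Prod>n<q. B)"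
    unfolding abs_prod using assms by (intro prod_mono) auto
  moreover have "\<bar>\<Prod>n<r. if K ! n = K' ! n then 1 else 0\<bar> \<le> (\<Prod>n<r. 1 :: real)"
    unfolding abs_prod by (intro prod_mono) auto
  ultimately have "\<bar>fiber_gram g p q r I J K I' J' K'\<bar> \<le> (B ^ p * B ^ q) * 1"
    unfolding fiber_gram_def abs_mult using assms(1) by (intro mult_mono) auto
  then show ?thesis by simp
qed

lemma fiber_inner_le:
  fixes \<alpha> :: "2 list \<Rightarrow> 2 list \<Rightarrow> 'd::finite list \<Rightarrow> real"
  assumes B: "1 \<le> B" "\<And>i j. \<bar>g $ i $ j\<bar> \<le> B" "\<And>i j. \<bar>matrix_inv g $ i $ j\<bar> \<le> B"
    and \<alpha>: "0 \<le> s" "\<And>I J K. length I = p \<Longrightarrow> length J = q \<Longrightarrow> length K = r \<Longrightarrow> \<bar>\<alpha> I J K\<bar> \<le> s"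
  shows "fiber_inner g p q r \<alpha> \<alpha> \<le> (\<Sum>I :: 2 list | length I = p. \<Sum>J :: 2 list | length J = q. \<Sum>K :: 'd list |
      length K = r.
      \<Sum>I' :: 2 list | length I' = p. \<Sum>J' :: 2 list | length J' = q. \<Sum>K' :: 'd list | length K' = r. B ^ p * B ^
          q) * s\<^sup>2"
proof -
  have *: "fiber_gram g p q r I J K I' J' K' * \<alpha> I J K * \<alpha> I' J' K' \<le> B ^ p * B ^ q * s\<^sup>2"
    if "length I = p" "length J = q" "length K = r" "length I' = p" "length J' = q" "length K' = r"
    for I J K I' J' K'
  proof -
    have "\<bar>fiber_gram g p q r I J K I' J' K' * \<alpha> I J K * \<alpha> I' J' K'\<bar> \<le> B ^ p * B ^ q * s * s"
      unfolding abs_mult using that B(1) \<alpha> abs_fiber_gram_le[OF B, of p q r I J K I' J' K']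
      by (intro mult_mono) auto
    then show ?thesis by (simp add: power2_eq_square mult.assoc)
  qed
  show ?thesis
    unfolding fiber_inner_def sum_distrib_right
    by (intro sum_mono) (use * in auto)
qed

context surface
begin

lemma riemannian_metricD:
  assumes "riemannian_metric A g"
  shows "metric_law g" "c \<in> A \<Longrightarrow> x \<in> cdom c \<Longrightarrow> invertible (g c x)"
    "c \<in> A \<Longrightarrow> smooth_fun_on (cimg c) (\<lambda>y. g c (cinv c y) $ i $ j)"
proof -
  show "metric_law g" "c \<in> A \<Longrightarrow> smooth_fun_on (cimg c) (\<lambda>y. g c (cinv c y) $ i $ j)"
    using assms unfolding riemannian_metric_def metric_law_def by blast+
  assume c: "c \<in> A" "x \<in> cdom c"
  have pos: "v \<bullet> (g c x *v v) > 0" if "v \<noteq> 0" for v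
    using assms c that unfolding riemannian_metric_def by blast
  have "v = 0" if "g c x *v v = 0" for v
    using pos[of v] unfolding that by (cases "v = 0") simp_all
  then show "invertible (g c x)"
    unfolding invertible_left_inverse matrix_left_invertible_ker by blast
qed

text \<open>The closed coordinate rectangles are compact and there are finitely many of them.\<close>

lemma bounded_on_cells:
  fixes \<phi> :: "'m chart \<Rightarrow> 'm \<Rightarrow> real"
  assumes "\<And>c. c \<in> A \<Longrightarrow> continuous_on (cdom c) (\<phi> c)"
  shows "\<exists>B\<ge>1. \<forall>c a b y. (c, a, b) \<in> C \<longrightarrow> y \<in> cbox a b \<longrightarrow> \<bar>\<phi> c (cinv c y)\<bar> \<le> B"
proof -
  have "\<exists>B. \<forall>y\<in>cbox (fst (snd z)) (snd (snd z)). \<bar>\<phi> (fst z) (cinv (fst z) y)\<bar> \<le> B" if "z \<in> C" for z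
  proof -
    obtain c a b where z: "z = (c, a, b)" by (cases z)
    have c: "c \<in> A" "cbox a b \<subseteq> cimg c" using cell that z by auto
    have "continuous_on (cbox a b) (\<lambda>y. \<phi> c (cinv c y))"
      using c by (intro continuous_on_compose2[OF assms[OF c(1)] continuous_on_subset[OF continuous_cinv]])
        (auto intro: cinv_in)
    then have "compact ((\<lambda>y. \<phi> c (cinv c y)) ` cbox a b)"
      by (intro compact_continuous_image compact_cbox)
    from compact_imp_bounded[OF this] obtain B where "\<forall>x\<in>(\<lambda>y. \<phi> c (cinv c y)) ` cbox a b. norm x \<le> B"
      unfolding bounded_iff ..
    then show ?thesis
      unfolding z by (intro exI[of _ B]) simp
  qed
  then have "\<forall>z\<in>C. \<exists>B. \<forall>y\<in>cbox (fst (snd z)) (snd (snd z)). \<bar>\<phi> (fst z) (cinv (fst z) y)\<bar> \<le> B"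
    by blast
  from bchoice[OF this] obtain B
    where B: "\<And>z y. z \<in> C \<Longrightarrow> y \<in> cbox (fst (snd z)) (snd (snd z)) \<Longrightarrow> \<bar>\<phi> (fst z) (cinv (fst z) y)\<bar> \<le> B z"
    by blast
  \<comment> \<open>a common bound for the finitely many constants \<open>B z\<close>\<close>
  define B' where "B' = 1 + (\<Sum>z\<in>C. \<bar>B z\<bar>)"
  have le: "B z \<le> B'" if "z \<in> C" for z
    using member_le_sum[of z C "\<lambda>z. \<bar>B z\<bar>"] finite_C that by (auto simp: B'_def)
  have "B' \<ge> 1" by (simp add: B'_def sum_nonneg)
  moreover have "\<bar>\<phi> c (cinv c y)\<bar> \<le> B'" if "(c, a, b) \<in> C" "y \<in> cbox a b" for c a b y
    using B[OF that(1), of y] le[OF that(1)] that(2) by simp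
  ultimately show ?thesis
    by blast
qed

lemma metric_bounded_on_cells:
  fixes g :: "'m metric_field"
  assumes cont: "\<And>c i j. c \<in> A \<Longrightarrow> continuous_on (cdom c) (\<lambda>x. g c x $ i $ j)"
    and inv: "\<And>c x. c \<in> A \<Longrightarrow> x \<in> cdom c \<Longrightarrow> invertible (g c x)"
  shows "\<exists>B\<ge>1. \<forall>c a b y. (c, a, b) \<in> C \<longrightarrow> y \<in> cbox a b \<longrightarrow> (\<forall>i j. \<bar>g c (cinv c y) $ i $ j\<bar> \<le> B \<and> \<bar>matrix_inv (g c
      (cinv c y)) $ i $ j\<bar> \<le> B)"
proof -
  have nz: "det (g c x) \<noteq> 0" if "c \<in> A" "x \<in> cdom c" for c x
    using inv[OF that] by (simp add: invertible_det_nz)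
  have "\<exists>B\<ge>1. \<forall>c a b y. (c, a, b) \<in> C \<longrightarrow> y \<in> cbox a b \<longrightarrow> \<bar>g c (cinv c y) $ i $ j\<bar> \<le> B" for i j
    using cont by (intro bounded_on_cells[of "\<lambda>c x. g c x $ i $ j"])
  then obtain B where B: "\<And>i j. B i j \<ge> 1 \<and> (\<forall>c a b y. (c, a, b) \<in> C \<longrightarrow> y \<in> cbox a b \<longrightarrow> \<bar>g c (cinv c y) $ i $ j\<bar> \<le>
      B i j)"
    by (metis (no_types, lifting))
  have "\<exists>B\<ge>1. \<forall>c a b y. (c, a, b) \<in> C \<longrightarrow> y \<in> cbox a b \<longrightarrow> \<bar>matrix_inv (g c (cinv c y)) $ i $ j\<bar> \<le> B" for i j
    using cont nz by (intro bounded_on_cells[of "\<lambda>c x. matrix_inv (g c x) $ i $ j"] continuous_on_matrix_inv)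
  then obtain B' where B': "\<And>i j. B' i j \<ge> 1 \<and> (\<forall>c a b y. (c, a, b) \<in> C \<longrightarrow> y \<in> cbox a b \<longrightarrow> \<bar>matrix_inv (g c (cinv
      c y)) $ i $ j\<bar> \<le> B' i j)"
    by (metis (no_types, lifting))
  \<comment> \<open>all constants are at least 1, so their sum bounds each of them\<close>
  define M where "M = (\<Sum>i\<in>UNIV. \<Sum>j\<in>UNIV. B i j + B' i j)"
  have M: "1 \<le> M" "B i j \<le> M" "B' i j \<le> M" for i j
  proof -
    have "0 \<le> B i j \<and> 0 \<le> B' i j" for i j using B[of i j] B'[of i j] by linarith
    then have "B i j + B' i j \<le> M"
      unfolding M_def
      by (intro order_trans[OF member_le_sum[of j UNIV "\<lambda>j. B i j + B' i j"] member_le_sum[of i UNIV "\<lambda>i.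
          \<Sum>j\<in>UNIV. B i j + B' i j"]])
        (auto intro!: sum_nonneg)
    then show "1 \<le> M" "B i j \<le> M" "B' i j \<le> M"
      using B[of i j] B'[of i j] by linarith+
  qed
  have "\<bar>g c (cinv c y) $ i $ j\<bar> \<le> M \<and> \<bar>matrix_inv (g c (cinv c y)) $ i $ j\<bar> \<le> M"
    if z: "(c, a, b) \<in> C" "y \<in> cbox a b" for c a b y i j
    using B[of i j, THEN conjunct2, rule_format, OF z] B'[of i j, THEN conjunct2, rule_format, OF z]
      M(2)[of i j] M(3)[of i j] by linarith
  then show ?thesis
    using M(1) by blast
qed

text \<open>By independence of the frame the pointwise norm at any point may be computed in a chart of the
cover, where the components of the background metric and of its inverse are bounded.\<close>

lemma Linf_norm_le_cells:
  assumes g: "riemannian_metric A g"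
  shows "\<exists>K\<ge>0. \<forall>\<tau> :: ('m, 'd::finite) tfield. \<forall>s\<ge>0. tensor_field A p q r \<tau> \<longrightarrow>
    (\<forall>c a b y I J K. (c, a, b) \<in> C \<longrightarrow> y \<in> box a b \<longrightarrow> length I = p \<longrightarrow> length J = q \<longrightarrow> length K = r \<longrightarrow> \<bar>\<tau> c (cinv c y)
        I J K\<bar> \<le> s)
    \<longrightarrow> Linf_norm A g p q r \<tau> \<le> ennreal (K * s)"
proof -
  have "continuous_on (cdom c) (\<lambda>x. g c x $ i $ j)" if "c \<in> A" for c i j
  proof -
    have "continuous_on (cdom c) (\<lambda>x. g c (cinv c (cmap c x)) $ i $ j)"
      using smooth_fun_on_continuous[OF riemannian_metricD(3)[OF g that]] continuous_cmap[OF that]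
      by (rule continuous_on_compose2) (use cmap_in[OF that] in auto)
    then show ?thesis
      by (rule continuous_on_eq) (simp add: cinv_cmap that)
  qed
  from metric_bounded_on_cells[OF this riemannian_metricD(2)[OF g]] obtain B where
    B1: "B \<ge> 1" and B: "\<forall>c a b y. (c, a, b) \<in> C \<longrightarrow> y \<in> cbox a b \<longrightarrow> (\<forall>i j. \<bar>g c (cinv c y) $ i $ j\<bar> \<le> B \<and>
        \<bar>matrix_inv (g c (cinv c y)) $ i $ j\<bar> \<le> B)"
    by blast
  define N where "N = (\<Sum>I :: 2 list | length I = p. \<Sum>J :: 2 list | length J = q. \<Sum>K :: 'd list | length K = r.
      \<Sum>I' :: 2 list | length I' = p. \<Sum>J' :: 2 list | length J' = q. \<Sum>K' :: 'd list | length K' = r. B ^ p * B ^ q)"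
  have "N \<ge> 0" unfolding N_def using B1 by (intro sum_nonneg) auto
  have "Linf_norm A g p q r \<tau> \<le> ennreal (sqrt N * s)"
    if s: "0 \<le> s" and \<tau>: "tensor_field A p q r \<tau>"
      and bd: "\<forall>c a b y I J K. (c, a, b) \<in> C \<longrightarrow> y \<in> box a b \<longrightarrow> length I = p \<longrightarrow> length J = q \<longrightarrow> length K = r \<longrightarrow> \<bar>\<tau> c
          (cinv c y) I J K\<bar> \<le> s"
    for \<tau> :: "('m, 'd) tfield" and s
  proof (rule Linf_norm_leI)
    fix c' x assume c': "c' \<in> A" "x \<in> cdom c'"
    obtain c a b y where c: "(c, a, b) \<in> C" "y \<in> box a b" "x = cinv c y" "c \<in> A" "x \<in> cdom c"
      by (rule ex_cell[of x])
    have y: "y \<in> cbox a b" using c(2) box_subset_cbox[of a b] by blast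
    have "fiber_inner (g c' x) p q r (\<tau> c' x) (\<tau> c' x) = fiber_inner (g c x) p q r (\<tau> c x) (\<tau> c x)"
      by (rule fiber_inner_chart_change[OF riemannian_metricD(1)[OF g] c(4) c'(1) c(5) c'(2)
          riemannian_metricD(2)[OF g c(4,5)] \<tau>])
    also have "\<dots> \<le> N * s\<^sup>2"
      unfolding N_def
    proof (rule fiber_inner_le[OF B1 _ _ s])
      show "\<bar>g c x $ i $ j\<bar> \<le> B" "\<bar>matrix_inv (g c x) $ i $ j\<bar> \<le> B" for i j
        using B[rule_format, OF c(1) y, of i j] unfolding c(3) by blast+
      show "\<bar>\<tau> c x I J K\<bar> \<le> s" if "length I = p" "length J = q" "length K = r" for I J K
        using bd[rule_format, OF c(1,2) that] unfolding c(3) .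
    qed
    finally have "sqrt (fiber_inner (g c' x) p q r (\<tau> c' x) (\<tau> c' x)) \<le> sqrt (N * s\<^sup>2)"
      by (rule real_sqrt_le_mono)
    then show "sqrt (fiber_inner (g c' x) p q r (\<tau> c' x) (\<tau> c' x)) \<le> sqrt N * s"
      using s by (simp add: real_sqrt_mult)
  qed
  then show ?thesis
    using \<open>N \<ge> 0\<close> by (intro exI[of _ "sqrt N"] conjI) (simp, blast)
qed

end

section \<open>The Sobolev seminorms\<close>

lemma vanishes2_sum:
  assumes "finite Z" "\<And>z. z \<in> Z \<Longrightarrow> vanishes2 (\<lambda>m n. d z m n)"
  shows "vanishes2 (\<lambda>m n. \<Sum>z\<in>Z. d z m n)"
  using assms
proof (induction Z)
  case empty
  show ?case by (simp add: vanishes2_def)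
next
  case (insert z Z)
  then show ?case using vanishes2_add[of "d z" "\<lambda>m n. \<Sum>z\<in>Z. d z m n"] by simp
qed

text \<open>Together with \<open>(x + y)\<^sup>2 \<le> (1 + t) x\<^sup>2 + (1 + 1 / t) y\<^sup>2\<close> this yields Minkowski's inequality.
The optimal weight is \<open>t = B / A\<close>; both numbers are first made positive.\<close>

lemma sqrt_le_add_of_weighted:
  fixes X A B :: real
  assumes "\<And>t. t > 0 \<Longrightarrow> X \<le> (1 + t) * A\<^sup>2 + (1 + 1 / t) * B\<^sup>2" "0 \<le> A" "0 \<le> B"
  shows "sqrt X \<le> A + B"
proof (rule field_le_epsilon)
  fix e :: real assume e: "e > 0"
  define a where "a = A + e / 2"
  define b where "b = B + e / 2"
  have ab: "a > 0" "b > 0" "A \<le> a" "B \<le> b" using assms e by (auto simp: a_def b_def)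
  have "X \<le> (1 + b / a) * A\<^sup>2 + (1 + 1 / (b / a)) * B\<^sup>2"
    using assms(1)[of "b / a"] ab by simp
  also have "\<dots> \<le> (1 + b / a) * a\<^sup>2 + (1 + 1 / (b / a)) * b\<^sup>2"
    using ab assms(2,3) by (intro add_mono mult_left_mono power_mono) auto
  also have "\<dots> = (a + b)\<^sup>2"
    using ab by (simp add: field_simps power2_eq_square)
  finally have "sqrt X \<le> sqrt ((a + b)\<^sup>2)" by (rule real_sqrt_le_mono)
  also have "\<dots> = A + B + e" using ab by (simp add: a_def b_def)
  finally show "sqrt X \<le> A + B + e" .
qed

lemma l2sq_lincomb_le:
  assumes "t > 0" "continuous_on (cbox a b) u" "continuous_on (cbox a b) v"
  shows "l2sq a b (\<lambda>y. \<alpha> * u y + \<beta> * v y) \<le> (1 + t) * (\<alpha>\<^sup>2 * l2sq a b u) + (1 + 1 / t) * (\<beta>\<^sup>2 * l2sq a b v)"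
proof -
  have "l2sq a b (\<lambda>y. \<alpha> * u y + \<beta> * v y)
      \<le> integral (cbox a b) (\<lambda>y. ((1 + t) * \<alpha>\<^sup>2) * (u y)\<^sup>2 + ((1 + 1 / t) * \<beta>\<^sup>2) * (v y)\<^sup>2)"
    unfolding l2sq_def
  proof (rule integral_le)
    fix y
    have "0 \<le> (t * (\<alpha> * u y) - \<beta> * v y)\<^sup>2 / t" using assms(1) by simp
    then show "(\<alpha> * u y + \<beta> * v y)\<^sup>2 \<le> ((1 + t) * \<alpha>\<^sup>2) * (u y)\<^sup>2 + ((1 + 1 / t) * \<beta>\<^sup>2) * (v y)\<^sup>2"
      using assms(1) by (simp add: power2_eq_square field_simps)
  qed (use assms in \<open>auto intro!: integrable_continuous continuous_intros\<close>)
  also have "\<dots> = (1 + t) * (\<alpha>\<^sup>2 * l2sq a b u) + (1 + 1 / t) * (\<beta>\<^sup>2 * l2sq a b v)"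
    unfolding l2sq_def using assms(2,3)
    by (subst integral_add) (auto intro!: integrable_continuous continuous_intros)
  finally show ?thesis .
qed

lemma smooth_fun_on_iter_pderiv_differentiable:
  "smooth_fun_on S u \<Longrightarrow> y \<in> S \<Longrightarrow> iter_pderiv is u differentiable (at y)"
  by (simp add: smooth_fun_on_def)

lemma smooth_fun_on_iter_pderiv_continuous:
  assumes "smooth_fun_on S u"
  shows "continuous_on S (iter_pderiv is u)"
  by (intro continuous_at_imp_continuous_on ballI differentiable_imp_continuous_within
      smooth_fun_on_iter_pderiv_differentiable[OF assms])

lemma iter_pderiv_lincomb:
  fixes u v :: "real^2 \<Rightarrow> real"
  assumes u: "smooth_fun_on S u" and v: "smooth_fun_on S v" and "y \<in> S"
  shows "iter_pderiv is (\<lambda>z. \<alpha> * u z + \<beta> * v z) y = \<alpha> * iter_pderiv is u y + \<beta> * iter_pderiv is v y"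
  using \<open>y \<in> S\<close>
proof (induction "is" arbitrary: y)
  case (Cons i "is")
  let ?U = "iter_pderiv is u" and ?V = "iter_pderiv is v"
  have d: "?U differentiable (at y)" "?V differentiable (at y)"
    using smooth_fun_on_iter_pderiv_differentiable[OF u Cons.prems]
      smooth_fun_on_iter_pderiv_differentiable[OF v Cons.prems] by auto
  have s: "(\<lambda>z. r *\<^sub>R w z) differentiable (at y)" if "w differentiable (at y)" for r and w :: "real^2 \<Rightarrow> real"
    using that by simp
  have "iter_pderiv (i # is) (\<lambda>z. \<alpha> * u z + \<beta> * v z) y = pderiv_at i (\<lambda>z. \<alpha> *\<^sub>R ?U z + \<beta> *\<^sub>R ?V z) y"
    unfolding iter_pderiv.simps
    by (rule pderiv_at_cong_open[OF smooth_fun_on_open[OF u] Cons.prems]) (simp add: Cons.IH)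
  also have "\<dots> = \<alpha> * pderiv_at i ?U y + \<beta> * pderiv_at i ?V y"
    using pderiv_at_add[OF s[OF d(1)] s[OF d(2)]] pderiv_at_scaleR[OF d(1)] pderiv_at_scaleR[OF d(2)] by simp
  finally show ?case by simp
qed simp

definition chart_deriv ::
  "('m, 'd) tfield \<Rightarrow> 'm chart \<Rightarrow> 2 list \<Rightarrow> 2 list \<Rightarrow> 'd list \<Rightarrow> 2 list \<Rightarrow> real^2 \<Rightarrow> real" where
  "chart_deriv \<tau> c I J K is = iter_pderiv is (\<lambda>z. \<tau> c (cinv c z) I J K)"

text \<open>The index set over which the squared Sobolev norm is a single sum.\<close>

definition sob_index ::
  "('m chart \<times> (real^2) \<times> (real^2)) set \<Rightarrow> nat \<Rightarrow> nat \<Rightarrow> nat \<Rightarrow> nat \<Rightarrow>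
    (('m chart \<times> (real^2) \<times> (real^2)) \<times> 2 list \<times> 2 list \<times> 'd::finite list \<times> 2 list) set" where
  "sob_index C k p q r = C \<times> {I. length I = p} \<times> {J. length J = q} \<times> {K. length K = r} \<times> {is. length is \<le> k}"

definition sob_term ::
  "('m, 'd) tfield \<Rightarrow> (('m chart \<times> (real^2) \<times> (real^2)) \<times> 2 list \<times> 2 list \<times> 'd list \<times> 2 list) \<Rightarrow> real" where
  "sob_term \<tau> = (\<lambda>((c, a, b), I, J, K, is). l2sq a b (chart_deriv \<tau> c I J K is))"

lemma pre_sob_norm_eq: "pre_sob_norm C k p q r \<tau> = sqrt (\<Sum>z\<in>sob_index C k p q r. sob_term \<tau> z)"
  unfolding pre_sob_norm_def sob_index_def sob_term_def l2sq_def chart_deriv_def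
  by (simp only: sum.cartesian_product' case_prod_unfold fst_conv snd_conv)

lemma sob_term_nonneg: "0 \<le> sob_term \<tau> z"
  by (cases z) (auto simp: sob_term_def)

lemma finite_sob_index: "finite C \<Longrightarrow> finite (sob_index C k p q r)"
  unfolding sob_index_def using finite_lists_length_le[of "UNIV :: 2 set" k]
  by (intro finite_cartesian_product) simp_all

lemma pre_sob_norm_nonneg: "0 \<le> pre_sob_norm C k p q r \<tau>"
  unfolding pre_sob_norm_eq by (intro real_sqrt_ge_zero sum_nonneg sob_term_nonneg)

lemma pre_sob_norm_lincomb_le:
  fixes \<sigma> \<tau> \<rho> :: "('m, 'd::finite) tfield"
  assumes "finite C"
    and c: "\<And>c a b I J K is. (c, a, b) \<in> C \<Longrightarrow> length I = p \<Longrightarrow> length J = q \<Longrightarrow> length K = r \<Longrightarrow> length is \<le> k \<Longrightarrow>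
      continuous_on (cbox a b) (chart_deriv \<sigma> c I J K is)"
      "\<And>c a b I J K is. (c, a, b) \<in> C \<Longrightarrow> length I = p \<Longrightarrow> length J = q \<Longrightarrow> length K = r \<Longrightarrow> length is \<le> k \<Longrightarrow>
      continuous_on (cbox a b) (chart_deriv \<tau> c I J K is)"
    and eq: "\<And>c a b I J K is y. (c, a, b) \<in> C \<Longrightarrow> length I = p \<Longrightarrow> length J = q \<Longrightarrow> length K = r \<Longrightarrow> length is \<le> k \<Longrightarrow>
      y \<in> cbox a b \<Longrightarrow> chart_deriv \<rho> c I J K is y = \<alpha> * chart_deriv \<sigma> c I J K is y + \<beta> * chart_deriv \<tau> c I J K is y"
  shows "pre_sob_norm C k p q r \<rho> \<le> \<bar>\<alpha>\<bar> * pre_sob_norm C k p q r \<sigma> + \<bar>\<beta>\<bar> * pre_sob_norm C k p q r \<tau>"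
proof -
  let ?Z = "sob_index C k p q r :: (('m chart \<times> (real^2) \<times> (real^2)) \<times> 2 list \<times> 2 list \<times> 'd list \<times> 2 list) set"
  let ?S = "\<lambda>\<tau>. \<Sum>z\<in>?Z. sob_term \<tau> z"
  have S0: "0 \<le> ?S \<tau>" for \<tau> by (intro sum_nonneg sob_term_nonneg)
  have "sqrt (?S \<rho>) \<le> \<bar>\<alpha>\<bar> * sqrt (?S \<sigma>) + \<bar>\<beta>\<bar> * sqrt (?S \<tau>)"
  proof (rule sqrt_le_add_of_weighted)
    fix t :: real assume t: "t > 0"
    have "?S \<rho> \<le> (\<Sum>z\<in>?Z. (1 + t) * (\<alpha>\<^sup>2 * sob_term \<sigma> z) + (1 + 1 / t) * (\<beta>\<^sup>2 * sob_term \<tau> z))"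
    proof (rule sum_mono)
      fix z assume z: "z \<in> ?Z"
      obtain c a b I J K "is" where ze: "z = ((c, a, b), I, J, K, is)" by (cases z) auto
      have m: "(c, a, b) \<in> C" "length I = p" "length J = q" "length K = r" "length is \<le> k"
        using z by (simp_all add: ze sob_index_def)
      have "l2sq a b (chart_deriv \<rho> c I J K is) =
          l2sq a b (\<lambda>y. \<alpha> * chart_deriv \<sigma> c I J K is y + \<beta> * chart_deriv \<tau> c I J K is y)"
        using eq[OF m] by (intro l2sq_cong)
      also have "\<dots> \<le> (1 + t) * (\<alpha>\<^sup>2 * l2sq a b (chart_deriv \<sigma> c I J K is)) + (1 + 1 / t) * (\<beta>\<^sup>2 * l2sq a b
          (chart_deriv \<tau> c I J K is))"
        by (rule l2sq_lincomb_le[OF t c(1)[OF m] c(2)[OF m]])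
      finally show "sob_term \<rho> z \<le> (1 + t) * (\<alpha>\<^sup>2 * sob_term \<sigma> z) + (1 + 1 / t) * (\<beta>\<^sup>2 * sob_term \<tau> z)"
        by (simp add: ze sob_term_def)
    qed
    also have "\<dots> = (1 + t) * (\<bar>\<alpha>\<bar> * sqrt (?S \<sigma>))\<^sup>2 + (1 + 1 / t) * (\<bar>\<beta>\<bar> * sqrt (?S \<tau>))\<^sup>2"
      using S0 by (simp add: sum.distrib sum_distrib_left[symmetric] power_mult_distrib)
    finally show "?S \<rho> \<le> (1 + t) * (\<bar>\<alpha>\<bar> * sqrt (?S \<sigma>))\<^sup>2 + (1 + 1 / t) * (\<bar>\<beta>\<bar> * sqrt (?S \<tau>))\<^sup>2" .
  qed (use S0 in auto)
  then show ?thesis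
    by (simp add: pre_sob_norm_eq)
qed

definition tensor_lincomb :: "real \<Rightarrow> ('m, 'd) tfield \<Rightarrow> real \<Rightarrow> ('m, 'd) tfield \<Rightarrow> ('m, 'd) tfield" where
  "tensor_lincomb \<alpha> \<sigma> \<beta> \<tau> = (\<lambda>c x I J K. \<alpha> * \<sigma> c x I J K + \<beta> * \<tau> c x I J K)"

lemma tdiff_eq_tensor_lincomb: "tdiff \<sigma> \<tau> = tensor_lincomb 1 \<sigma> (-1) \<tau>"
  by (simp add: tdiff_def tensor_lincomb_def)

lemma tdiff_tensor_lincomb: "tdiff (tensor_lincomb \<alpha> \<sigma> \<beta> \<tau>) (tensor_lincomb \<alpha> \<sigma>' \<beta> \<tau>') = tensor_lincomb \<alpha> (tdiff
    \<sigma> \<sigma>') \<beta> (tdiff \<tau> \<tau>')"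
  by (simp add: tdiff_def tensor_lincomb_def fun_eq_iff algebra_simps)

lemma tensor_field_tensor_lincomb:
  fixes \<sigma> \<tau> :: "('m, 'd) tfield"
  assumes "tensor_field A p q r \<sigma>" "tensor_field A p q r \<tau>"
  shows "tensor_field A p q r (tensor_lincomb \<alpha> \<sigma> \<beta> \<tau>)"
  unfolding tensor_field_def
proof (intro ballI allI impI)
  fix c c' x and I J :: "2 list" and K :: "'d list"
  assume *: "c \<in> A" "c' \<in> A" "x \<in> cdom c \<inter> cdom c'" "length I = p" "length J = q" "length K = r"
  note e = assms(1)[unfolded tensor_field_def, rule_format, OF *] assms(2)[unfolded tensor_field_def,
      rule_format, OF *]
  show "tensor_lincomb \<alpha> \<sigma> \<beta> \<tau> c' x I J K = (\<Sum>I' | length I' = p. \<Sum>J' | length J' = q.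
             (\<Prod>n<p. transition_jac c c' x $ (I ! n) $ (I' ! n)) *
             (\<Prod>n<q. transition_jac c' c x $ (J' ! n) $ (J ! n)) * tensor_lincomb \<alpha> \<sigma> \<beta> \<tau> c x I' J' K)"
    unfolding tensor_lincomb_def e by (simp add: sum_distrib_left sum.distrib algebra_simps)
qed

lemma smooth_tensor_field_tensor_lincomb:
  assumes "smooth_tensor_field A p q r \<sigma>" "smooth_tensor_field A p q r \<tau>"
  shows "smooth_tensor_field A p q r (tensor_lincomb \<alpha> \<sigma> \<beta> \<tau>)"
  using assms unfolding smooth_tensor_field_def
  by (auto intro!: tensor_field_tensor_lincomb) (auto simp: tensor_lincomb_def intro!: smooth_fun_on_add
      smooth_fun_on_cmult)

lemma continuous_tensor_field_tensor_lincomb: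
  assumes "continuous_tensor_field A p q r \<sigma>" "continuous_tensor_field A p q r \<tau>"
  shows "continuous_tensor_field A p q r (tensor_lincomb \<alpha> \<sigma> \<beta> \<tau>)"
  using assms unfolding continuous_tensor_field_def
  by (auto intro!: tensor_field_tensor_lincomb) (auto simp: tensor_lincomb_def intro!: continuous_on_add
      continuous_on_mult)

context surface
begin

lemma smooth_tensor_field_chart:
  assumes "smooth_tensor_field A p q r \<sigma>" "c \<in> A" "length I = p" "length J = q" "length K = r"
  shows "smooth_fun_on (cimg c) (\<lambda>y. \<sigma> c (cinv c y) I J K)"
  using assms unfolding smooth_tensor_field_def by blast

lemma smooth_chart_deriv_continuous:
  assumes "smooth_tensor_field A p q r \<sigma>" "(c, a, b) \<in> C" "length I = p" "length J = q" "length K = r"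
  shows "continuous_on (cbox a b) (chart_deriv \<sigma> c I J K is)"
  unfolding chart_deriv_def
  using smooth_fun_on_iter_pderiv_continuous[OF smooth_tensor_field_chart[OF assms(1) _ assms(3-5)]] cell[OF assms(2)]
    continuous_on_subset by blast

lemma chart_deriv_tensor_lincomb:
  assumes "smooth_tensor_field A p q r \<sigma>" "smooth_tensor_field A p q r \<tau>" "(c, a, b) \<in> C"
    "length I = p" "length J = q" "length K = r" "y \<in> cbox a b"
  shows "chart_deriv (tensor_lincomb \<alpha> \<sigma> \<beta> \<tau>) c I J K is y = \<alpha> * chart_deriv \<sigma> c I J K is y + \<beta> * chart_deriv \<tau>
      c I J K is y"
  unfolding chart_deriv_def tensor_lincomb_def
  using iter_pderiv_lincomb[OF smooth_tensor_field_chart[OF assms(1) _ assms(4-6)] smooth_tensor_field_chart[OF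
      assms(2) _ assms(4-6)]]
    cell[OF assms(3)] assms(7) by blast

lemma pre_sob_norm_tensor_lincomb_le:
  assumes "smooth_tensor_field A p q r \<sigma>" "smooth_tensor_field A p q r \<tau>"
  shows "pre_sob_norm C k p q r (tensor_lincomb \<alpha> \<sigma> \<beta> \<tau>) \<le> \<bar>\<alpha>\<bar> * pre_sob_norm C k p q r \<sigma> + \<bar>\<beta>\<bar> * pre_sob_norm C
      k p q r \<tau>"
  by (rule pre_sob_norm_lincomb_le[OF finite_C smooth_chart_deriv_continuous[OF assms(1)]
      smooth_chart_deriv_continuous[OF assms(2)] chart_deriv_tensor_lincomb[OF assms]])

lemma continuous_tensor_field_cell:
  assumes "continuous_tensor_field A p q r \<tau>" "(c, a, b) \<in> C" "length I = p" "length J = q" "length K = r"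
  shows "continuous_on (cbox a b) (\<lambda>y. \<tau> c (cinv c y) I J K)"
proof (rule continuous_on_compose2[where g = "\<lambda>x. \<tau> c x I J K"])
  have c: "c \<in> A" "cbox a b \<subseteq> cimg c" using cell[OF assms(2)] by auto
  show "continuous_on (cdom c) (\<lambda>x. \<tau> c x I J K)"
    using assms c unfolding continuous_tensor_field_def by blast
  show "continuous_on (cbox a b) (cinv c)"
    using continuous_on_subset[OF continuous_cinv] c by blast
  show "cinv c ` cbox a b \<subseteq> cdom c"
    using cinv_in c by blast
qed

lemma pre_sob_norm_0_tensor_lincomb_le:
  assumes "continuous_tensor_field A p q r \<sigma>" "continuous_tensor_field A p q r \<tau>"
  shows "pre_sob_norm C 0 p q r (tensor_lincomb \<alpha> \<sigma> \<beta> \<tau>) \<le> \<bar>\<alpha>\<bar> * pre_sob_norm C 0 p q r \<sigma> + \<bar>\<beta>\<bar> * pre_sob_norm C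
      0 p q r \<tau>"
  by (rule pre_sob_norm_lincomb_le[OF finite_C])
     (simp_all add: chart_deriv_def continuous_tensor_field_cell[OF assms(1)] continuous_tensor_field_cell[OF
         assms(2)] tensor_lincomb_def)

lemma smooth_imp_continuous_tensor_field:
  assumes "smooth_tensor_field A p q r \<sigma>"
  shows "continuous_tensor_field A p q r \<sigma>"
proof (rule continuous_tensor_fieldI)
  show "tensor_field A p q r \<sigma>" using assms by (simp add: smooth_tensor_field_def)
  show "continuous_on (box a b) (\<lambda>y. \<sigma> c (cinv c y) I J K)"
    if "(c, a, b) \<in> C" "length I = p" "length J = q" "length K = r" for c a b I J K
    using smooth_chart_deriv_continuous[OF assms that, of "[]"] box_subset_cbox[of a b]
    by (auto simp: chart_deriv_def intro: continuous_on_subset)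
qed

lemma sob_approx_tensor_lincomb:
  assumes \<sigma>: "sob_approx A C k p q r \<sigma> \<tau>" and \<sigma>': "sob_approx A C k p q r \<sigma>' \<tau>'"
    and c: "continuous_tensor_field A p q r \<tau>" "continuous_tensor_field A p q r \<tau>'"
  shows "sob_approx A C k p q r (\<lambda>n. tensor_lincomb \<alpha> (\<sigma> n) \<beta> (\<sigma>' n)) (tensor_lincomb \<alpha> \<tau> \<beta> \<tau>')"
  unfolding sob_approx_def
proof (intro conjI allI impI)
  have s: "smooth_tensor_field A p q r (\<sigma> n)" "smooth_tensor_field A p q r (\<sigma>' n)" for n
    using assms by (auto simp: sob_approx_def)
  then show "smooth_tensor_field A p q r (tensor_lincomb \<alpha> (\<sigma> n) \<beta> (\<sigma>' n))" for n
    by (rule smooth_tensor_field_tensor_lincomb)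
  have sd: "smooth_tensor_field A p q r (tdiff (\<sigma> m) (\<sigma> n))" "smooth_tensor_field A p q r (tdiff (\<sigma>' m) (\<sigma>' n))"
      for m n
    unfolding tdiff_eq_tensor_lincomb by (intro smooth_tensor_field_tensor_lincomb s)+
  have le: "pre_sob_norm C k p q r (tdiff (tensor_lincomb \<alpha> (\<sigma> m) \<beta> (\<sigma>' m)) (tensor_lincomb \<alpha> (\<sigma> n) \<beta> (\<sigma>' n)))
      \<le> \<bar>\<alpha>\<bar> * pre_sob_norm C k p q r (tdiff (\<sigma> m) (\<sigma> n)) + \<bar>\<beta>\<bar> * pre_sob_norm C k p q r (tdiff (\<sigma>' m) (\<sigma>' n))" for m n
    unfolding tdiff_tensor_lincomb by (rule pre_sob_norm_tensor_lincomb_le[OF sd])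
  have v: "vanishes2 (\<lambda>m n. pre_sob_norm C k p q r (tdiff (\<sigma> m) (\<sigma> n)))"
    "vanishes2 (\<lambda>m n. pre_sob_norm C k p q r (tdiff (\<sigma>' m) (\<sigma>' n)))"
    using assms unfolding vanishes2_def sob_approx_def by (simp_all add: pre_sob_norm_nonneg)
  have "vanishes2 (\<lambda>m n. pre_sob_norm C k p q r (tdiff (tensor_lincomb \<alpha> (\<sigma> m) \<beta> (\<sigma>' m)) (tensor_lincomb \<alpha> (\<sigma> n)
      \<beta> (\<sigma>' n))))"
    by (rule vanishes2_le[OF vanishes2_add[OF vanishes2_cmult[OF v(1), of "\<bar>\<alpha>\<bar>"] vanishes2_cmult[OF v(2), of "\<bar>\<beta>\<bar>"]]])
       (use le in \<open>simp add: pre_sob_norm_nonneg\<close>)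
  then show "\<exists>N. \<forall>m\<ge>N. \<forall>n\<ge>N. pre_sob_norm C k p q r (tdiff (tensor_lincomb \<alpha> (\<sigma> m) \<beta> (\<sigma>' m)) (tensor_lincomb \<alpha>
      (\<sigma> n) \<beta> (\<sigma>' n))) < e"
    if "e > 0" for e
    using that unfolding vanishes2_def by (simp add: pre_sob_norm_nonneg)
  have cd: "continuous_tensor_field A p q r (tdiff (\<sigma> n) \<tau>)" "continuous_tensor_field A p q r (tdiff (\<sigma>' n) \<tau>')" for n
    unfolding tdiff_eq_tensor_lincomb by (intro continuous_tensor_field_tensor_lincomb
        smooth_imp_continuous_tensor_field s c)+
  have "(\<lambda>n. \<bar>\<alpha>\<bar> * pre_sob_norm C 0 p q r (tdiff (\<sigma> n) \<tau>) + \<bar>\<beta>\<bar> * pre_sob_norm C 0 p q r (tdiff (\<sigma>' n) \<tau>')) \<longlonglongrightarrow>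
      \<bar>\<alpha>\<bar> * 0 + \<bar>\<beta>\<bar> * 0"
    using assms by (intro tendsto_intros) (simp_all add: sob_approx_def)
  then have "(\<lambda>n. \<bar>\<alpha>\<bar> * pre_sob_norm C 0 p q r (tdiff (\<sigma> n) \<tau>) + \<bar>\<beta>\<bar> * pre_sob_norm C 0 p q r (tdiff (\<sigma>' n) \<tau>')) \<longlonglongrightarrow> 0"
    by simp
  then show "(\<lambda>n. pre_sob_norm C 0 p q r (tdiff (tensor_lincomb \<alpha> (\<sigma> n) \<beta> (\<sigma>' n)) (tensor_lincomb \<alpha> \<tau> \<beta> \<tau>'))) \<longlonglongrightarrow> 0"
    by (rule tendsto_sandwich[OF _ _ tendsto_const, rotated 2])
       (auto simp: tdiff_tensor_lincomb pre_sob_norm_nonneg intro!: pre_sob_norm_0_tensor_lincomb_le[OF cd]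
           always_eventually)
qed

text \<open>A seminorm is Lipschitz continuous for the distance it defines, so the norms of a Cauchy
sequence converge.\<close>

lemma sob_approx_norm_convergent:
  assumes "sob_approx A C k p q r \<sigma> \<tau>"
  obtains L where "(\<lambda>n. pre_sob_norm C k p q r (\<sigma> n)) \<longlonglongrightarrow> L" "0 \<le> L"
proof -
  have s: "smooth_tensor_field A p q r (\<sigma> n)" for n
    using assms by (auto simp: sob_approx_def)
  have le: "pre_sob_norm C k p q r (\<sigma> m) - pre_sob_norm C k p q r (\<sigma> n) \<le> pre_sob_norm C k p q r (tdiff (\<sigma> m) (\<sigma>
      n))" for m n
  proof -
    have "\<sigma> m = tensor_lincomb 1 (tdiff (\<sigma> m) (\<sigma> n)) 1 (\<sigma> n)" by (simp add: tensor_lincomb_def tdiff_def)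
    then show ?thesis
      using pre_sob_norm_tensor_lincomb_le[OF smooth_tensor_field_tensor_lincomb[OF s s, of 1 m "-1" n] s[of n],
          of k 1 1]
      by (simp add: tdiff_eq_tensor_lincomb[symmetric])
  qed
  have sym: "pre_sob_norm C k p q r (tdiff (\<sigma> n) (\<sigma> m)) = pre_sob_norm C k p q r (tdiff (\<sigma> m) (\<sigma> n))" for m n
  proof -
    have "pre_sob_norm C k p q r (tdiff (\<sigma> n) (\<sigma> m)) \<le> pre_sob_norm C k p q r (tdiff (\<sigma> m) (\<sigma> n))" for m n
    proof -
      have "tdiff (\<sigma> n) (\<sigma> m) = tensor_lincomb (-1) (tdiff (\<sigma> m) (\<sigma> n)) 0 (\<sigma> n)" by (simp add:
          tensor_lincomb_def tdiff_def fun_eq_iff)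
      then show ?thesis
        using pre_sob_norm_tensor_lincomb_le[OF smooth_tensor_field_tensor_lincomb[OF s s, of 1 m "-1" n] s[of
            n], of k "-1" 0]
        by (simp add: tdiff_eq_tensor_lincomb[symmetric])
    qed
    from antisym[OF this this] show ?thesis .
  qed
  have "Cauchy (\<lambda>n. pre_sob_norm C k p q r (\<sigma> n))"
  proof (rule CauchyI)
    fix e :: real assume "e > 0"
    then obtain N where N: "\<And>m n. m \<ge> N \<Longrightarrow> n \<ge> N \<Longrightarrow> pre_sob_norm C k p q r (tdiff (\<sigma> m) (\<sigma> n)) < e"
      using assms unfolding sob_approx_def by blast
    have "norm (pre_sob_norm C k p q r (\<sigma> m) - pre_sob_norm C k p q r (\<sigma> n)) < e" if "m \<ge> N" "n \<ge> N" for m n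
      using N[OF that] le[of m n] le[of n m] sym[of m n] by (simp add: abs_less_iff)
    then show "\<exists>M. \<forall>m\<ge>M. \<forall>n\<ge>M. norm (pre_sob_norm C k p q r (\<sigma> m) - pre_sob_norm C k p q r (\<sigma> n)) < e"
      by blast
  qed
  then obtain L where L: "(\<lambda>n. pre_sob_norm C k p q r (\<sigma> n)) \<longlonglongrightarrow> L"
    using Cauchy_convergent convergent_def by blast
  moreover have "0 \<le> L"
    using L by (rule LIMSEQ_le_const) (simp add: pre_sob_norm_nonneg)
  ultimately show thesis by (rule that)
qed

lemma sob_term_le:
  assumes "(c, a, b) \<in> C" "length I = p" "length J = q" "length K = r" "length is \<le> k"
  shows "l2sq a b (chart_deriv \<tau> c I J K is) \<le> (pre_sob_norm C k p q r \<tau>)\<^sup>2"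
proof -
  have "sob_term \<tau> ((c, a, b), I, J, K, is) \<le> (\<Sum>z\<in>sob_index C k p q r. sob_term \<tau> z)"
    by (rule member_le_sum) (use assms finite_sob_index[OF finite_C] sob_term_nonneg in \<open>simp_all add: sob_index_def\<close>)
  then show ?thesis
    unfolding pre_sob_norm_eq by (subst real_sqrt_pow2) (auto simp: sob_term_def intro!: sum_nonneg sob_term_nonneg)
qed

lemma sob_approx_sobolev_Cauchy:
  assumes \<sigma>: "sob_approx A C k p q r \<sigma> \<tau>" and cc: "(c, a, b) \<in> C"
    and l: "length I = p" "length J = q" "length K = r"
  shows "sobolev_Cauchy (cimg c) a b k (\<lambda>n y. \<sigma> n c (cinv c y) I J K)"
  unfolding sobolev_Cauchy_iff_iter_pderiv
proof (intro conjI allI impI)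
  have s: "smooth_tensor_field A p q r (\<sigma> n)" for n
    using \<sigma> by (auto simp: sob_approx_def)
  then show "smooth_fun_on (cimg c) (\<lambda>y. \<sigma> n c (cinv c y) I J K)" for n
    using smooth_tensor_field_chart cell[OF cc] l by blast
  fix "is" :: "2 list" assume ln: "length is \<le> k"
  let ?d = "\<lambda>m n. pre_sob_norm C k p q r (tdiff (\<sigma> m) (\<sigma> n))"
  have "vanishes2 ?d"
    using \<sigma> unfolding vanishes2_def sob_approx_def by (simp add: pre_sob_norm_nonneg)
  then have "vanishes2 (\<lambda>m n. (?d m n)\<^sup>2)"
    unfolding vanishes2_tendsto using tendsto_power[of _ 0 _ 2] by force
  then show "L2_Cauchy a b (\<lambda>n. iter_pderiv is (\<lambda>y. \<sigma> n c (cinv c y) I J K))"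
  proof (rule L2_Cauchy_le[rotated])
    show "continuous_on (cbox a b) (iter_pderiv is (\<lambda>y. \<sigma> n c (cinv c y) I J K))" for n
      using smooth_chart_deriv_continuous[OF s cc l] by (simp add: chart_deriv_def)
    show "l2sq a b (\<lambda>y. iter_pderiv is (\<lambda>y. \<sigma> m c (cinv c y) I J K) y - iter_pderiv is (\<lambda>y. \<sigma> n c (cinv c y) I J K) y)
        \<le> (?d m n)\<^sup>2" for m n
    proof -
      have "l2sq a b (\<lambda>y. iter_pderiv is (\<lambda>y. \<sigma> m c (cinv c y) I J K) y - iter_pderiv is (\<lambda>y. \<sigma> n c (cinv c y) I
          J K) y)
        = l2sq a b (chart_deriv (tdiff (\<sigma> m) (\<sigma> n)) c I J K is)"
        unfolding tdiff_eq_tensor_lincomb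
        by (rule l2sq_cong) (simp add: chart_deriv_tensor_lincomb[OF s s cc l] chart_deriv_def[of "\<sigma> _"])
      then show ?thesis using sob_term_le[OF cc l ln] by simp
    qed
  qed
qed

end

section \<open>Sobolev embedding for limits\<close>

lemma small_quotient:
  fixes K e :: real
  assumes "0 \<le> K" "0 < e"
  shows "0 < e / (K + 1)" "K * (e / (K + 1)) \<le> e"
proof -
  have "0 < K + 1" using assms by linarith
  then show "0 < e / (K + 1)" "K * (e / (K + 1)) \<le> e"
    using assms by (simp_all add: field_simps)
qed

lemma L2_limit_if_uniform_limit:
  assumes cu: "\<And>n. continuous_on (cbox a b) (u n)" and cv: "continuous_on (cbox a b) v"
    and v: "uniform_limit (cbox a b) u v sequentially"
  shows "(\<lambda>n. l2sq a b (\<lambda>y. v y - u n y)) \<longlonglongrightarrow> 0"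
proof (rule LIMSEQ_I)
  fix e :: real assume "e > 0"
  define M where "M = l2sq a b (\<lambda>y. 1)"
  have M0: "0 \<le> M" by (simp add: M_def)
  define d where "d = sqrt (e / (M + 1))"
  have d: "d > 0" "d\<^sup>2 * M < e" using \<open>e > 0\<close> M0 by (auto simp: d_def field_simps)
  from uniform_limitD[OF v d(1)] obtain N
    where N: "\<And>n y. n \<ge> N \<Longrightarrow> y \<in> cbox a b \<Longrightarrow> \<bar>u n y - v y\<bar> < d"
    unfolding eventually_sequentially dist_real_def by blast
  have "l2sq a b (\<lambda>y. v y - u n y) < e" if "n \<ge> N" for n
  proof -
    have "l2sq a b (\<lambda>y. (v y - u n y) * 1) \<le> d\<^sup>2 * l2sq a b (\<lambda>y. 1)"
    proof (rule l2sq_mult_le)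
      show "\<bar>v y - u n y\<bar> \<le> d" if "y \<in> cbox a b" for y
        using N[OF \<open>n \<ge> N\<close> that] by simp
    qed (auto intro!: continuous_on_diff cv cu)
    then show ?thesis using d(2) by (simp add: M_def)
  qed
  then show "\<exists>N. \<forall>n\<ge>N. norm (l2sq a b (\<lambda>y. v y - u n y) - 0) < e"
    by auto
qed

lemma sup_Cauchy_uniform_limit:
  assumes "sup_Cauchy a b u"
  obtains v where "continuous_on (cbox a b) v" "uniform_limit (cbox a b) u v sequentially"
proof -
  have "uniformly_Cauchy_on (cbox a b) u"
    using assms unfolding uniformly_Cauchy_on_def sup_Cauchy_def dist_real_def by blast
  then obtain v where v: "uniform_limit (cbox a b) u v sequentially"
    using Cauchy_uniformly_convergent uniformly_convergent_on_def by blast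
  have "continuous_on (cbox a b) v"
    by (rule uniform_limit_theorem[OF _ v]) (use assms in \<open>simp_all add: sup_Cauchy_def\<close>)
  then show thesis using v by (rule that)
qed

context rectangle_nbhd
begin

text \<open>The uniform limit \<open>v\<close> exists since \<open>H\<^sup>2\<close> convergence implies uniform convergence. It agrees
with \<open>w\<close> because both are continuous and have \<open>L\<^sup>2\<close> distance zero.\<close>

lemma uniform_limit_if_L2_limit:
  assumes k: "2 \<le> k" and u: "sobolev_Cauchy S a b k u" and w: "continuous_on (cbox a b) w"
    and lim: "(\<lambda>n. l2sq a b (\<lambda>y. u n y - w y)) \<longlonglongrightarrow> 0"
  shows "uniform_limit (cbox a b) u w sequentially"
proof -
  have u2: "sobolev_Cauchy S a b (Suc (Suc 0)) u"
    using sobolev_Cauchy_mono[OF _ u, of "Suc (Suc 0)"] k by simp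
  have sup: "sup_Cauchy a b u" by (rule sobolev_Cauchy_sup[OF u2])
  have cu: "continuous_on (cbox a b) (u n)" for n
    using sup by (simp add: sup_Cauchy_def)
  obtain v where cv: "continuous_on (cbox a b) v" and v: "uniform_limit (cbox a b) u v sequentially"
    by (rule sup_Cauchy_uniform_limit[OF sup])
  have uv: "(\<lambda>n. l2sq a b (\<lambda>y. v y - u n y)) \<longlonglongrightarrow> 0"
    by (rule L2_limit_if_uniform_limit[OF cu cv v])
  have "(\<lambda>n. 2 * l2sq a b (\<lambda>y. v y - u n y) + 2 * l2sq a b (\<lambda>y. u n y - w y)) \<longlonglongrightarrow> 2 * 0 + 2 * 0"
    by (intro tendsto_intros uv lim)
  moreover have "l2sq a b (\<lambda>y. v y - w y) \<le> 2 * l2sq a b (\<lambda>y. v y - u n y) + 2 * l2sq a b (\<lambda>y. u n y - w y)" for n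
    using l2sq_add_le[of a b "\<lambda>y. v y - u n y" "\<lambda>y. u n y - w y"] cv cu w by (simp add: continuous_on_diff)
  ultimately have "l2sq a b (\<lambda>y. v y - w y) \<le> 0"
    using LIMSEQ_le_const by fastforce
  then have "l2sq a b (\<lambda>y. v y - w y) = 0"
    using l2sq_nonneg[of a b "\<lambda>y. v y - w y"] by linarith
  moreover have c: "continuous_on (cbox a b) (\<lambda>y. (v y - w y)\<^sup>2)"
    by (intro continuous_intros cv w)
  ultimately have "((\<lambda>y. (v y - w y)\<^sup>2) has_integral 0) (cbox a b)"
    using integrable_integral[OF integrable_continuous[OF c]] by (simp add: l2sq_def)
  from has_integral_0_cbox_imp_0[OF c _ this ne]
  have "v y = w y" if "y \<in> cbox a b" for y
    using that by simp
  then show ?thesis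
    using v uniform_limit_cong'[of "cbox a b" u u v w] by simp
qed

text \<open>For \<open>k \<ge> 2\<close> the first derivatives of an \<open>H\<^sup>k\<^sup>+\<^sup>1\<close> Cauchy sequence converge uniformly, so the
limit is continuously differentiable and its derivatives are the limits of the derivatives.\<close>

lemma limit_C1:
  assumes k: "2 \<le> k" and u: "sobolev_Cauchy S a b (Suc k) u" and w: "uniform_limit (cbox a b) u w sequentially"
  shows "y \<in> box a b \<Longrightarrow> w differentiable (at y)"
    and "uniform_limit (box a b) (\<lambda>n. pderiv_at i (u n)) (pderiv_at i w) sequentially"
    and "continuous_on (box a b) (pderiv_at i w)"
proof -
  have sub: "box a b \<subseteq> cbox a b" "box a b \<subseteq> S" using box_subset_cbox[of a b] S by auto
  have sup: "sup_Cauchy a b (\<lambda>n. pderiv_at i (u n))" for i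
  proof -
    have "sobolev_Cauchy S a b (Suc (Suc 0)) (\<lambda>n. pderiv_at i (u n))"
      using sobolev_Cauchy_mono[OF _ sobolev_Cauchy_pderiv[OF u, of i], of "Suc (Suc 0)"] k by simp
    then show ?thesis by (rule sobolev_Cauchy_sup)
  qed
  have "\<exists>d. continuous_on (cbox a b) d \<and> uniform_limit (cbox a b) (\<lambda>n. pderiv_at i (u n)) d sequentially" for i
    by (rule sup_Cauchy_uniform_limit[OF sup[of i]]) blast
  then have "\<forall>i. \<exists>d. continuous_on (cbox a b) d \<and> uniform_limit (cbox a b) (\<lambda>n. pderiv_at i (u n)) d sequentially"
    by blast
  from choice[OF this] obtain d where cd: "\<And>i. continuous_on (cbox a b) (d i)"
    and d: "\<And>i. uniform_limit (cbox a b) (\<lambda>n. pderiv_at i (u n)) (d i) sequentially"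
    by blast
  have ptw: "(\<lambda>n. u n y) \<longlonglongrightarrow> w y" if "y \<in> box a b" for y
    using tendsto_uniform_limitI[OF w] that sub by blast
  define D' where "D' n x h = (\<Sum>i\<in>UNIV. h $ i * pderiv_at i (u n) x)" for n x and h :: "real^2"
  define G' where "G' x h = (\<Sum>i\<in>UNIV. h $ i * d i x)" for x and h :: "real^2"
  have der: "(u n has_derivative D' n x) (at x within box a b)" if "x \<in> box a b" for n x
  proof -
    have df: "u n differentiable (at x)"
      using smooth_fun_on_differentiable[OF sobolev_Cauchy_smooth[OF u]] that sub by blast
    have "frechet_derivative (u n) (at x) h = D' n x h" for h
      unfolding frechet_derivative_eq_sum_pderiv[OF df] D'_def by simp
    then have "frechet_derivative (u n) (at x) = D' n x" by blast
    then show ?thesis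
      using differentiable_has_derivative[OF df] has_derivative_at_withinI by metis
  qed
  have close: "\<forall>\<^sub>F n in sequentially. \<forall>x\<in>box a b. \<forall>h. norm (D' n x h - G' x h) \<le> e * norm h" if "e > 0" for e
  proof -
    have "\<forall>\<^sub>F n in sequentially. \<forall>i. \<forall>x\<in>cbox a b. dist (pderiv_at i (u n) x) (d i x) < e / 2"
      using uniform_limitD[OF d, of "e / 2"] \<open>e > 0\<close> by (intro eventually_all_finite) simp
    then show ?thesis
    proof (rule eventually_mono, intro ballI allI)
      fix n x h assume *: "\<forall>i. \<forall>x\<in>cbox a b. dist (pderiv_at i (u n) x) (d i x) < e / 2" and x: "x \<in> box a b"
      have "D' n x h - G' x h = (\<Sum>i\<in>UNIV. h $ i * (pderiv_at i (u n) x - d i x))"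
        by (simp add: D'_def G'_def sum_subtractf right_diff_distrib)
      also have "norm \<dots> \<le> (\<Sum>i\<in>(UNIV :: 2 set). norm h * (e / 2))"
      proof (rule order_trans[OF norm_sum sum_mono])
        fix i :: 2
        have "\<bar>pderiv_at i (u n) x - d i x\<bar> \<le> e / 2"
          using * x sub by (auto simp: dist_real_def intro: less_imp_le)
        then show "norm (h $ i * (pderiv_at i (u n) x - d i x)) \<le> norm h * (e / 2)"
          unfolding norm_mult using component_le_norm_cart[of h i] by (intro mult_mono) auto
      qed
      also have "\<dots> = e * norm h" by simp
      finally show "norm (D' n x h - G' x h) \<le> e * norm h" .
    qed
  qed
  obtain y0 where y0: "y0 \<in> box a b" using ne by blast
  have "\<exists>g. \<forall>x\<in>box a b. (\<lambda>n. u n x) \<longlonglongrightarrow> g x \<and> (g has_derivative G' x) (at x within box a b)"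
    by (rule has_derivative_sequence[OF convex_box(2) der close y0 ptw[OF y0]])
  then obtain g where g: "\<And>x. x \<in> box a b \<Longrightarrow> (\<lambda>n. u n x) \<longlonglongrightarrow> g x" "\<And>x. x \<in> box a b \<Longrightarrow> (g has_derivative G' x) (at x
      within box a b)"
    by blast
  have gw: "g x = w x" if "x \<in> box a b" for x
    using LIMSEQ_unique[OF g(1)[OF that] ptw[OF that]] .
  have wd: "(w has_derivative G' x) (at x)" if x: "x \<in> box a b" for x
  proof -
    have "(g has_derivative G' x) (at x)"
      using g(2)[OF x] at_within_open[OF x open_box] by simp
    then show ?thesis
      by (rule has_derivative_transform_within_open[OF _ open_box x]) (rule gw)
  qed
  then show "y \<in> box a b \<Longrightarrow> w differentiable (at y)"
    unfolding differentiable_def by blast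
  have pd: "pderiv_at i w x = d i x" if "x \<in> box a b" for i x
    unfolding pderiv_at_eqI[OF wd[OF that]] G'_def by (simp add: axis_def if_distrib[of "\<lambda>x. x * _"] cong: if_cong)
  show "uniform_limit (box a b) (\<lambda>n. pderiv_at i (u n)) (pderiv_at i w) sequentially"
  proof -
    have "uniform_limit (box a b) (\<lambda>n. pderiv_at i (u n)) (d i) sequentially"
      using d sub(1) by (rule uniform_limit_on_subset)
    then show ?thesis
      using uniform_limit_cong'[of "box a b" "\<lambda>n. pderiv_at i (u n)" "\<lambda>n. pderiv_at i (u n)" "d i" "pderiv_at i
          w"] pd by simp
  qed
  show "continuous_on (box a b) (pderiv_at i w)"
    by (rule continuous_on_eq[OF continuous_on_subset[OF cd[of i] sub(1)]]) (simp add: pd)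
qed

end

section \<open>Sobolev maps on the surface\<close>

context surface
begin

lemma sob_approx_uniform_limit:
  assumes k: "2 \<le> k" and \<sigma>: "sob_approx A C k p q r \<sigma> \<tau>" and \<tau>: "continuous_tensor_field A p q r \<tau>"
    and cc: "(c, a, b) \<in> C" "box a b \<noteq> {}" and l: "length I = p" "length J = q" "length K = r"
  shows "uniform_limit (cbox a b) (\<lambda>n y. \<sigma> n c (cinv c y) I J K) (\<lambda>y. \<tau> c (cinv c y) I J K) sequentially"
proof (rule rectangle_nbhd.uniform_limit_if_L2_limit[OF rectangle_nbhd_cell[OF cc] k
    sob_approx_sobolev_Cauchy[OF \<sigma> cc(1) l]
      continuous_tensor_field_cell[OF \<tau> cc(1) l]])
  have "(\<lambda>n. pre_sob_norm C 0 p q r (tdiff (\<sigma> n) \<tau>)) \<longlonglongrightarrow> 0"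
    using \<sigma> by (simp add: sob_approx_def)
  from tendsto_power[OF this, of 2] have lim: "(\<lambda>n. (pre_sob_norm C 0 p q r (tdiff (\<sigma> n) \<tau>))\<^sup>2) \<longlonglongrightarrow> 0"
    by simp
  have le: "l2sq a b (\<lambda>y. \<sigma> n c (cinv c y) I J K - \<tau> c (cinv c y) I J K) \<le> (pre_sob_norm C 0 p q r (tdiff (\<sigma> n)
      \<tau>))\<^sup>2" for n
    using sob_term_le[OF cc(1) l, of "[]" 0 "tdiff (\<sigma> n) \<tau>"] by (simp add: chart_deriv_def tdiff_def)
  show "(\<lambda>n. l2sq a b (\<lambda>y. \<sigma> n c (cinv c y) I J K - \<tau> c (cinv c y) I J K)) \<longlonglongrightarrow> 0"
    by (rule tendsto_sandwich[OF _ _ tendsto_const lim]) (auto intro!: always_eventually le)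
qed

lemma sobolev_mapD:
  assumes "h \<in> sobolev_maps A C l"
  obtains \<sigma> where "continuous_tensor_field A 0 0 1 (fun_tensor h)" "sob_approx A C l 0 0 1 \<sigma> (fun_tensor h)"
  using assms unfolding sobolev_maps_def sobolev_def by blast

lemma fun_tensor_chart [simp]: "(\<lambda>y. fun_tensor h c (cinv c y) [] [] [k]) = (\<lambda>y. h (cinv c y) $ k)"
  by (simp add: fun_tensor_def)

text \<open>Sobolev embedding: a map of class \<open>H\<^sup>l\<close> is continuously differentiable.\<close>

lemma sobolev_map_cell:
  fixes h :: "'m \<Rightarrow> real^'d::finite"
  assumes l: "3 \<le> l" and h: "h \<in> sobolev_maps A C l" and cc: "(c, a, b) \<in> C"
  shows "y \<in> box a b \<Longrightarrow> (h \<circ> cinv c) differentiable (at y)"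
    and "continuous_on (box a b) (\<lambda>y. pderiv_at i (h \<circ> cinv c) y $ k)"
proof -
  obtain l' where l': "l = Suc l'" "2 \<le> l'" using l by (cases l) auto
  obtain \<sigma> where \<sigma>: "continuous_tensor_field A 0 0 1 (fun_tensor h)" "sob_approx A C l 0 0 1 \<sigma> (fun_tensor h)"
    by (rule sobolev_mapD[OF h])
  have C1: "y \<in> box a b \<Longrightarrow> (\<lambda>y. h (cinv c y) $ k) differentiable (at y)"
    "continuous_on (box a b) (pderiv_at i (\<lambda>y. h (cinv c y) $ k))" for y i k
  proof -
    have *: "y \<in> box a b \<Longrightarrow> (\<lambda>y. h (cinv c y) $ k) differentiable (at y)"
      "continuous_on (box a b) (pderiv_at i (\<lambda>y. h (cinv c y) $ k))" if ne: "box a b \<noteq> {}" for y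
    proof -
      have "uniform_limit (cbox a b) (\<lambda>n y. \<sigma> n c (cinv c y) [] [] [k]) (\<lambda>y. h (cinv c y) $ k) sequentially"
        using sob_approx_uniform_limit[OF _ \<sigma>(2,1) cc ne, of "[]" "[]" "[k]"] l by simp
      note lim = rectangle_nbhd.limit_C1[OF rectangle_nbhd_cell[OF cc ne] l'(2) sob_approx_sobolev_Cauchy[OF
          \<sigma>(2)[unfolded l'(1)] cc] this]
      show "y \<in> box a b \<Longrightarrow> (\<lambda>y. h (cinv c y) $ k) differentiable (at y)"
        by (rule lim(1)) simp_all
      show "continuous_on (box a b) (pderiv_at i (\<lambda>y. h (cinv c y) $ k))"
        by (rule lim(3)) simp_all
    qed
    show "y \<in> box a b \<Longrightarrow> (\<lambda>y. h (cinv c y) $ k) differentiable (at y)" using *(1) by blast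
    show "continuous_on (box a b) (pderiv_at i (\<lambda>y. h (cinv c y) $ k))" using *(2) by (cases "box a b = {}") auto
  qed
  have diff: "(h \<circ> cinv c) differentiable (at y)" if "y \<in> box a b" for y
    unfolding differentiable_componentwise_within[of "h \<circ> cinv c"]
    using C1(1)[OF that] by (auto simp: Basis_vec_def inner_axis)
  then show "y \<in> box a b \<Longrightarrow> (h \<circ> cinv c) differentiable (at y)" .
  show "continuous_on (box a b) (\<lambda>y. pderiv_at i (h \<circ> cinv c) y $ k)"
    by (rule continuous_on_eq[OF C1(2)[of i k]]) (simp add: pderiv_at_nth[OF diff, symmetric])
qed

lemma sobolev_map_differentiable:
  assumes l: "3 \<le> l" and h: "h \<in> sobolev_maps A C l" and c: "c \<in> A" "x \<in> cdom c"
  shows "(h \<circ> cinv c) differentiable (at (cmap c x))"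
proof -
  obtain c' a b y where c': "(c', a, b) \<in> C" "y \<in> box a b" "x = cinv c' y" "c' \<in> A" "x \<in> cdom c'" "cmap c' x = y"
    by (rule ex_cell[of x])
  show ?thesis
    by (rule chart_change(1)[OF c(1) c'(4) c(2) c'(5)]) (use sobolev_map_cell(1)[OF l h c'(1,2)] c'(6) in simp)
qed

lemma tensor_field_nabla:
  fixes h :: "'m \<Rightarrow> real^'d::finite"
  assumes d: "\<And>c x. c \<in> A \<Longrightarrow> x \<in> cdom c \<Longrightarrow> (h \<circ> cinv c) differentiable (at (cmap c x))"
  shows "tensor_field A 0 1 1 (nabla h)"
  unfolding tensor_field_def
proof (intro ballI allI impI)
  fix c c' x and I J :: "2 list" and K :: "'d list"
  assume c: "c \<in> A" "c' \<in> A" "x \<in> cdom c \<inter> cdom c'" and "length I = 0" "length J = 1" "length K = 1"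
  then have x: "x \<in> cdom c'" "x \<in> cdom c" by auto
  show "nabla h c' x I J K = (\<Sum>I' | length I' = 0. \<Sum>J' | length J' = 1.
             (\<Prod>n<0. transition_jac c c' x $ (I ! n) $ (I' ! n)) *
             (\<Prod>n<1. transition_jac c' c x $ (J' ! n) $ (J ! n)) * nabla h c x I' J' K)"
    using chart_change(2)[OF c(2,1) x d[OF c(1) x(2)], of "J ! 0"]
    by (simp add: nabla_def sum_lists_Suc)
qed

lemma continuous_nabla:
  fixes h :: "'m \<Rightarrow> real^'d::finite"
  assumes l: "3 \<le> l" and h: "h \<in> sobolev_maps A C l"
  shows "continuous_tensor_field A 0 1 1 (nabla h)"
proof (rule continuous_tensor_fieldI[OF tensor_field_nabla[OF sobolev_map_differentiable[OF l h]]])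
  fix c a b and I J :: "2 list" and K :: "'d list"
  assume cc: "(c, a, b) \<in> C"
  have c: "c \<in> A" "box a b \<subseteq> cimg c" using cell[OF cc] box_subset_cbox[of a b] by auto
  show "continuous_on (box a b) (\<lambda>y. nabla h c (cinv c y) I J K)"
    by (rule continuous_on_eq[OF sobolev_map_cell(2)[OF l h cc, of "J ! 0" "K ! 0"]])
       (use c(2) in \<open>simp add: nabla_def cmap_cinv[OF c(1)] subset_iff\<close>)
qed

lemma continuous_pderiv_chart:
  assumes l: "3 \<le> l" and h: "h \<in> sobolev_maps A C l" and c: "c \<in> A"
  shows "continuous_on (cdom c) (\<lambda>x. pderiv_at i (h \<circ> cinv c) (cmap c x))"
proof -
  have "continuous_on (cdom c) (\<lambda>x. nabla h c x [] [i] [k])" for k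
    using continuous_nabla[OF l h] c unfolding continuous_tensor_field_def by simp
  then have "continuous_on (cdom c) (\<lambda>x. \<chi> k. pderiv_at i (h \<circ> cinv c) (cmap c x) $ k)"
    by (intro continuous_on_vec_lambda) (simp add: nabla_def)
  then show ?thesis by simp
qed

lemma continuous_pullback_metric:
  assumes "3 \<le> l" "h \<in> sobolev_maps A C l" "c \<in> A"
  shows "continuous_on (cdom c) (\<lambda>x. pullback_metric h c x $ i $ j)"
  unfolding pullback_metric_def using continuous_pderiv_chart[OF assms] by (auto intro!: continuous_on_inner)

lemma metric_law_pullback:
  fixes h :: "'m \<Rightarrow> real^'d::finite"
  assumes d: "\<And>c x. c \<in> A \<Longrightarrow> x \<in> cdom c \<Longrightarrow> (h \<circ> cinv c) differentiable (at (cmap c x))"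
  shows "metric_law (pullback_metric h)"
  unfolding metric_law_def
proof (intro ballI)
  fix c c' x assume c: "c \<in> A" "c' \<in> A" "x \<in> cdom c \<inter> cdom c'"
  then have x: "x \<in> cdom c" "x \<in> cdom c'" by auto
  note ch = chart_change(2)[OF c(1,2) x d[OF c(2) x(2)]]
  show "pullback_metric h c x =
     transpose (transition_jac c c' x) ** pullback_metric h c' x ** transition_jac c c' x"
    unfolding vec_eq_iff congruence_nth
    unfolding pullback_metric_def ch vec_lambda_beta inner_sum_left
    by (simp add: inner_sum_right mult.assoc mult.left_commute)
qed

section \<open>The Sobolev norm of maps\<close>

lemma
  assumes "h \<in> sobolev_maps A C l"
  shows map_norm_nonneg: "0 \<le> map_norm A C l h"
  and map_norm_approx: "e > 0 \<Longrightarrow> \<exists>\<sigma> L. sob_approx A C l 0 0 1 \<sigma> (fun_tensor h) \<and>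
    (\<lambda>n. pre_sob_norm C l 0 0 1 (\<sigma> n)) \<longlonglongrightarrow> L \<and> L < map_norm A C l h + e"
  and map_norm_le: "sob_approx A C l 0 0 1 \<sigma> (fun_tensor h) \<Longrightarrow> (\<lambda>n. pre_sob_norm C l 0 0 1 (\<sigma> n)) \<longlonglongrightarrow> L \<Longrightarrow> map_norm
      A C l h \<le> L"
proof -
  let ?S = "{L. \<exists>\<sigma>. sob_approx A C l 0 0 1 \<sigma> (fun_tensor h) \<and> (\<lambda>n. pre_sob_norm C l 0 0 1 (\<sigma> n)) \<longlonglongrightarrow> L}"
  have N: "map_norm A C l h = Inf ?S" by (simp add: map_norm_def sob_norm_def)
  obtain \<sigma>0 where \<sigma>0: "sob_approx A C l 0 0 1 \<sigma>0 (fun_tensor h)" by (rule sobolev_mapD[OF assms])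
  obtain L0 where "(\<lambda>n. pre_sob_norm C l 0 0 1 (\<sigma>0 n)) \<longlonglongrightarrow> L0" by (rule sob_approx_norm_convergent[OF \<sigma>0])
  then have ne: "?S \<noteq> {}" using \<sigma>0 by blast
  have pos: "0 \<le> L" if "L \<in> ?S" for L
  proof -
    obtain \<sigma> where "sob_approx A C l 0 0 1 \<sigma> (fun_tensor h)" "(\<lambda>n. pre_sob_norm C l 0 0 1 (\<sigma> n)) \<longlonglongrightarrow> L"
      using \<open>L \<in> ?S\<close> by blast
    from LIMSEQ_le_const[OF this(2)] show ?thesis using pre_sob_norm_nonneg by blast
  qed
  then show "0 \<le> map_norm A C l h"
    unfolding N by (intro cInf_greatest[OF ne])
  have bdd: "bdd_below ?S" using pos by (rule bdd_belowI)
  show "sob_approx A C l 0 0 1 \<sigma> (fun_tensor h) \<Longrightarrow> (\<lambda>n. pre_sob_norm C l 0 0 1 (\<sigma> n)) \<longlonglongrightarrow> L \<Longrightarrow> map_norm A C l h \<le> L"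
    unfolding N by (intro cInf_lower bdd) blast
  assume "e > 0"
  then have "Inf ?S < map_norm A C l h + e" unfolding N by simp
  from cInf_lessD[OF ne this] show "\<exists>\<sigma> L. sob_approx A C l 0 0 1 \<sigma> (fun_tensor h) \<and>
    (\<lambda>n. pre_sob_norm C l 0 0 1 (\<sigma> n)) \<longlonglongrightarrow> L \<and> L < map_norm A C l h + e"
    by blast
qed

lemma sobolev_maps_lincomb:
  fixes h k :: "'m \<Rightarrow> real^'d::finite"
  assumes h: "h \<in> sobolev_maps A C l" and k: "k \<in> sobolev_maps A C l"
  shows "(\<lambda>x. \<alpha> *\<^sub>R h x + \<beta> *\<^sub>R k x) \<in> sobolev_maps A C l"
    and "map_norm A C l (\<lambda>x. \<alpha> *\<^sub>R h x + \<beta> *\<^sub>R k x) \<le> \<bar>\<alpha>\<bar> * map_norm A C l h + \<bar>\<beta>\<bar> * map_norm A C l k"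
proof -
  have ft: "fun_tensor (\<lambda>x. \<alpha> *\<^sub>R h x + \<beta> *\<^sub>R k x) = tensor_lincomb \<alpha> (fun_tensor h) \<beta> (fun_tensor k)"
    by (simp add: fun_tensor_def tensor_lincomb_def)
  obtain \<sigma> where \<sigma>: "continuous_tensor_field A 0 0 1 (fun_tensor h)" "sob_approx A C l 0 0 1 \<sigma> (fun_tensor h)"
    by (rule sobolev_mapD[OF h])
  obtain \<sigma>' where \<sigma>': "continuous_tensor_field A 0 0 1 (fun_tensor k)" "sob_approx A C l 0 0 1 \<sigma>' (fun_tensor k)"
    by (rule sobolev_mapD[OF k])
  show mem: "(\<lambda>x. \<alpha> *\<^sub>R h x + \<beta> *\<^sub>R k x) \<in> sobolev_maps A C l"
    unfolding sobolev_maps_def sobolev_def mem_Collect_eq ft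
    using continuous_tensor_field_tensor_lincomb[OF \<sigma>(1) \<sigma>'(1)] sob_approx_tensor_lincomb[OF \<sigma>(2) \<sigma>'(2) \<sigma>(1)
        \<sigma>'(1)] by blast
  show "map_norm A C l (\<lambda>x. \<alpha> *\<^sub>R h x + \<beta> *\<^sub>R k x) \<le> \<bar>\<alpha>\<bar> * map_norm A C l h + \<bar>\<beta>\<bar> * map_norm A C l k"
  proof (rule field_le_epsilon)
    fix e :: real assume "e > 0"
    define d where "d = e / (\<bar>\<alpha>\<bar> + \<bar>\<beta>\<bar> + 1)"
    have d: "d > 0" "(\<bar>\<alpha>\<bar> + \<bar>\<beta>\<bar>) * d \<le> e"
      unfolding d_def by (rule small_quotient[OF _ \<open>e > 0\<close>], simp)+
    obtain \<sigma> L where s: "sob_approx A C l 0 0 1 \<sigma> (fun_tensor h)" "(\<lambda>n. pre_sob_norm C l 0 0 1 (\<sigma> n)) \<longlonglongrightarrow> L" "L <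
        map_norm A C l h + d"
      using map_norm_approx[OF h d(1)] by blast
    obtain \<sigma>2 L2 where s2: "sob_approx A C l 0 0 1 \<sigma>2 (fun_tensor k)" "(\<lambda>n. pre_sob_norm C l 0 0 1 (\<sigma>2 n)) \<longlonglongrightarrow> L2"
        "L2 < map_norm A C l k + d"
      using map_norm_approx[OF k d(1)] by blast
    have ap: "sob_approx A C l 0 0 1 (\<lambda>n. tensor_lincomb \<alpha> (\<sigma> n) \<beta> (\<sigma>2 n)) (fun_tensor (\<lambda>x. \<alpha> *\<^sub>R h x + \<beta> *\<^sub>R k x))"
      unfolding ft by (rule sob_approx_tensor_lincomb[OF s(1) s2(1) \<sigma>(1) \<sigma>'(1)])
    obtain M where M: "(\<lambda>n. pre_sob_norm C l 0 0 1 (tensor_lincomb \<alpha> (\<sigma> n) \<beta> (\<sigma>2 n))) \<longlonglongrightarrow> M"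
      by (rule sob_approx_norm_convergent[OF ap])
    have "map_norm A C l (\<lambda>x. \<alpha> *\<^sub>R h x + \<beta> *\<^sub>R k x) \<le> M"
      by (rule map_norm_le[OF mem ap M])
    also have "M \<le> \<bar>\<alpha>\<bar> * L + \<bar>\<beta>\<bar> * L2"
    proof (rule LIMSEQ_le[OF M tendsto_add[OF tendsto_mult_left[OF s(2)] tendsto_mult_left[OF s2(2)]]])
      have "smooth_tensor_field A 0 0 1 (\<sigma> n)" "smooth_tensor_field A 0 0 1 (\<sigma>2 n)" for n
        using s(1) s2(1) by (auto simp: sob_approx_def)
      from pre_sob_norm_tensor_lincomb_le[OF this]
      show "\<exists>N. \<forall>n\<ge>N. pre_sob_norm C l 0 0 1 (tensor_lincomb \<alpha> (\<sigma> n) \<beta> (\<sigma>2 n))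
          \<le> \<bar>\<alpha>\<bar> * pre_sob_norm C l 0 0 1 (\<sigma> n) + \<bar>\<beta>\<bar> * pre_sob_norm C l 0 0 1 (\<sigma>2 n)" by blast
    qed
    also have "\<dots> \<le> \<bar>\<alpha>\<bar> * (map_norm A C l h + d) + \<bar>\<beta>\<bar> * (map_norm A C l k + d)"
      using s(3) s2(3) by (intro add_mono mult_left_mono) auto
    also have "\<dots> \<le> \<bar>\<alpha>\<bar> * map_norm A C l h + \<bar>\<beta>\<bar> * map_norm A C l k + e"
      using d(2) by (simp add: algebra_simps)
    finally show "map_norm A C l (\<lambda>x. \<alpha> *\<^sub>R h x + \<beta> *\<^sub>R k x) \<le> \<bar>\<alpha>\<bar> * map_norm A C l h + \<bar>\<beta>\<bar> * map_norm A C l k + e" .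
  qed
qed

text \<open>The embedding of \<open>H\<^sup>3\<close> into \<open>C\<^sup>1\<close> with an explicit constant: the squared value is estimated by
the nine \<open>L\<^sup>2\<close> norms that \<open>sq_le_h1sq_h1sq\<close> involves. The bound holds along every approximating
sequence, hence also for the infimum that defines the norm.\<close>

lemma pderiv_le_map_norm:
  fixes h :: "'m \<Rightarrow> real^'d::finite"
  assumes l: "3 \<le> l" and h: "h \<in> sobolev_maps A C l" and cc: "(c, a, b) \<in> C" and y: "y \<in> box a b"
  shows "\<bar>pderiv_at i (h \<circ> cinv c) y $ k\<bar> \<le> sqrt (box_const a b * 9) * map_norm A C l h"
proof -
  have ne: "box a b \<noteq> {}" using y by blast
  have B0: "0 \<le> box_const a b" by (rule box_const_nonneg[OF ne])
  obtain l' where l': "l = Suc l'" "2 \<le> l'" using l by (cases l) auto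
  note R = rectangle_nbhd_cell[OF cc ne]
  let ?w = "\<lambda>y. h (cinv c y) $ k"
  have le: "\<bar>pderiv_at i ?w y\<bar> \<le> sqrt (box_const a b * 9) * L"
    if \<sigma>: "sob_approx A C l 0 0 1 \<sigma> (fun_tensor h)" and L: "(\<lambda>n. pre_sob_norm C l 0 0 1 (\<sigma> n)) \<longlonglongrightarrow> L" for \<sigma> L
  proof -
    let ?u = "\<lambda>n y. \<sigma> n c (cinv c y) [] [] [k]"
    have ct: "continuous_tensor_field A 0 0 1 (fun_tensor h)" by (rule sobolev_mapD[OF h])
    have ul: "uniform_limit (cbox a b) ?u ?w sequentially"
      using sob_approx_uniform_limit[OF _ \<sigma> ct cc ne, of "[]" "[]" "[k]"] l by simp
    have Ca: "sobolev_Cauchy (cimg c) a b (Suc l') ?u"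
      using sob_approx_sobolev_Cauchy[OF \<sigma>[unfolded l'(1)] cc, of "[]" "[]" "[k]"] by simp
    have lim: "(\<lambda>n. pderiv_at i (?u n) y) \<longlonglongrightarrow> pderiv_at i ?w y"
      using tendsto_uniform_limitI[OF rectangle_nbhd.limit_C1(2)[OF R l'(2) Ca ul] y] .
    have bound: "\<bar>pderiv_at i (?u n) y\<bar> \<le> sqrt (box_const a b * 9) * pre_sob_norm C l 0 0 1 (\<sigma> n)" for n
    proof -
      let ?P = "pre_sob_norm C l 0 0 1 (\<sigma> n)"
      have sm: "smooth_fun_on (cimg c) (?u n)" by (rule sobolev_Cauchy_smooth[OF Ca])
      note C1 = smooth_fun_on_C1_on_cbox[OF _ conjunct2[OF cell[OF cc]]]
      have tm: "l2sq a b (iter_pderiv is (?u n)) \<le> ?P\<^sup>2" if "length is \<le> 3" for "is"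
        using sob_term_le[OF cc, of "[]" 0 "[]" 0 "[k]" 1 "is" l "\<sigma> n"] that l by (simp add: chart_deriv_def)
      have t1: "l2sq a b (pderiv_at i (?u n)) \<le> ?P\<^sup>2" for i using tm[of "[i]"] by simp
      have t2: "l2sq a b (pderiv_at j (pderiv_at i (?u n))) \<le> ?P\<^sup>2" for i j using tm[of "[j, i]"] by simp
      have t3: "l2sq a b (pderiv_at m (pderiv_at j (pderiv_at i (?u n)))) \<le> ?P\<^sup>2" for i j m using tm[of "[m, j,
          i]"] by simp
      have "(pderiv_at i (?u n) y)\<^sup>2 \<le> box_const a b * (h1sq a b (pderiv_at i (?u n)) + (\<Sum>j\<in>UNIV. h1sq a b
          (pderiv_at j (pderiv_at i (?u n)))))"
        using y box_subset_cbox[of a b]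
        by (intro sq_le_h1sq_h1sq ne C1 smooth_fun_on_pderiv sm) auto
      also have "\<dots> \<le> box_const a b * (9 * ?P\<^sup>2)"
      proof (rule mult_left_mono[OF _ B0])
        show "h1sq a b (pderiv_at i (?u n)) + (\<Sum>j\<in>UNIV. h1sq a b (pderiv_at j (pderiv_at i (?u n)))) \<le> 9 * ?P\<^sup>2"
          unfolding h1sq_def sum_2
          using t1[of i] t2[of 1 i] t2[of 2 i] t3[of 1 1 i] t3[of 1 2 i] t3[of 2 1 i] t3[of 2 2 i] by linarith
      qed
      finally have "sqrt ((pderiv_at i (?u n) y)\<^sup>2) \<le> sqrt (box_const a b * 9 * ?P\<^sup>2)"
        by (intro real_sqrt_le_mono) simp
      then show ?thesis
        by (simp add: real_sqrt_mult pre_sob_norm_nonneg)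
    qed
    show ?thesis
      by (rule LIMSEQ_le[OF tendsto_rabs[OF lim] tendsto_mult_left[OF L]]) (use bound in blast)
  qed
  have "\<bar>pderiv_at i ?w y\<bar> \<le> sqrt (box_const a b * 9) * map_norm A C l h"
  proof (rule field_le_epsilon)
    fix e :: real assume "e > 0"
    let ?K = "sqrt (box_const a b * 9)"
    have K: "0 \<le> ?K" using B0 by simp
    define d where "d = e / (?K + 1)"
    have d: "d > 0" "?K * d \<le> e" unfolding d_def by (rule small_quotient[OF K \<open>e > 0\<close>])+
    obtain \<sigma> L where s: "sob_approx A C l 0 0 1 \<sigma> (fun_tensor h)" "(\<lambda>n. pre_sob_norm C l 0 0 1 (\<sigma> n)) \<longlonglongrightarrow> L" "L <
        map_norm A C l h + d"
      using map_norm_approx[OF h d(1)] by blast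
    have "\<bar>pderiv_at i ?w y\<bar> \<le> ?K * L" by (rule le[OF s(1,2)])
    also have "\<dots> \<le> ?K * (map_norm A C l h + d)" using s(3) K by (intro mult_left_mono) auto
    finally show "\<bar>pderiv_at i ?w y\<bar> \<le> ?K * map_norm A C l h + e"
      using d(2) by (simp add: algebra_simps)
  qed
  then show ?thesis
    using pderiv_at_nth[OF sobolev_map_cell(1)[OF l h cc y], of i k] by (simp add: o_def)
qed

end

section \<open>Symmetric positive matrices\<close>

definition pos_sym :: "real^2^2 \<Rightarrow> bool" where
  "pos_sym g \<longleftrightarrow> transpose g = g \<and> (\<forall>u. u \<noteq> 0 \<longrightarrow> 0 < u \<bullet> (g *v u))"

lemma pos_sym_swap:
  assumes "pos_sym g"
  shows "w \<bullet> (g *v u) = u \<bullet> (g *v w)"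
  using assms dot_lmul_matrix[of w g u] by (simp add: pos_sym_def inner_commute flip: transpose_matrix_vector)

lemma pos_sym_nonneg: "pos_sym g \<Longrightarrow> 0 \<le> u \<bullet> (g *v u)"
  by (cases "u = 0") (auto simp: pos_sym_def less_imp_le)

lemma pos_sym_invertible:
  assumes "pos_sym g"
  shows "invertible g"
proof -
  have "v = 0" if "g *v v = 0" for v
  proof (rule ccontr)
    assume "v \<noteq> 0"
    then have "0 < v \<bullet> (g *v v)" using assms by (simp add: pos_sym_def)
    then show False by (simp add: that)
  qed
  then show ?thesis
    unfolding invertible_left_inverse matrix_left_invertible_ker by blast
qed

lemma pos_sym_Cauchy_Schwarz:
  assumes g: "pos_sym g"
  shows "(w \<bullet> (g *v u))\<^sup>2 \<le> (w \<bullet> (g *v w)) * (u \<bullet> (g *v u))"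
proof (cases "u = 0")
  case False
  define p where "p = u \<bullet> (g *v u)"
  define r where "r = w \<bullet> (g *v u)"
  have p: "p > 0" using g False by (simp add: p_def pos_sym_def)
  have "0 \<le> (p *\<^sub>R w - r *\<^sub>R u) \<bullet> (g *v (p *\<^sub>R w - r *\<^sub>R u))"
    by (rule pos_sym_nonneg[OF g])
  also have "\<dots> = p * (p * (w \<bullet> (g *v w)) - r\<^sup>2)"
    using pos_sym_swap[OF g, of u w]
    by (simp add: matrix_vector_mult_diff_distrib matrix_vector_mult_scaleR inner_diff_left inner_diff_right
        p_def[symmetric] r_def[symmetric] power2_eq_square algebra_simps)
  finally have "0 \<le> p * (w \<bullet> (g *v w)) - r\<^sup>2"
    using p by (simp add: zero_le_mult_iff)
  then show ?thesis by (simp add: p_def r_def mult.commute)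
qed simp

lemma matrix_inv_apply:
  fixes g :: "real^'n^'n"
  assumes "invertible g"
  shows "g *v (matrix_inv g *v \<xi>) = \<xi>"
  using matrix_inv_inverse(1)[OF assms] by (simp add: matrix_vector_mul_assoc)

lemma pos_sym_matrix_inv:
  assumes g: "pos_sym g"
  shows "pos_sym (matrix_inv g)"
proof -
  note inv = pos_sym_invertible[OF g]
  have "g ** transpose (matrix_inv g) = transpose (matrix_inv g ** g)"
    using g by (simp add: pos_sym_def matrix_transpose_mul)
  also have "\<dots> = mat 1" by (simp add: matrix_inv_inverse(2)[OF inv] transpose_mat)
  finally have "transpose (matrix_inv g) = matrix_inv g"
    using matrix_inv_eqI by metis
  moreover have "0 < \<xi> \<bullet> (matrix_inv g *v \<xi>)" if "\<xi> \<noteq> 0" for \<xi>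
  proof -
    let ?w = "matrix_inv g *v \<xi>"
    have w: "g *v ?w = \<xi>" by (rule matrix_inv_apply[OF inv])
    then have "?w \<noteq> 0" using that by auto
    then have "0 < ?w \<bullet> (g *v ?w)" using g by (simp add: pos_sym_def)
    then show ?thesis by (simp add: w inner_commute)
  qed
  ultimately show ?thesis by (simp add: pos_sym_def)
qed

definition quasi_isometric :: "real \<Rightarrow> real^2^2 \<Rightarrow> real^2^2 \<Rightarrow> bool" where
  "quasi_isometric \<kappa> g h \<longleftrightarrow> (\<forall>u. u \<bullet> (h *v u) \<le> exp \<kappa> * (u \<bullet> (g *v u)) \<and> u \<bullet> (g *v u) \<le> exp \<kappa> * (u \<bullet> (h *v u)))"

text \<open>Inversion reverses the order of positive forms. With \<open>u = h\<^sup>-\<^sup>1 \<xi>\<close> and \<open>w = g\<^sup>-\<^sup>1 \<xi>\<close> the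
number \<open>\<xi> \<bullet> u\<close> equals both \<open>h(u,u)\<close> and \<open>g(u,w)\<close>, and Cauchy-Schwarz for \<open>g\<close> compares the two.\<close>

lemma quasi_isometric_inv_aux:
  assumes g: "pos_sym g" and h: "pos_sym h" and le: "\<And>u. u \<bullet> (g *v u) \<le> exp \<kappa> * (u \<bullet> (h *v u))"
  shows "\<xi> \<bullet> (matrix_inv h *v \<xi>) \<le> exp \<kappa> * (\<xi> \<bullet> (matrix_inv g *v \<xi>))"
proof -
  let ?u = "matrix_inv h *v \<xi>" and ?w = "matrix_inv g *v \<xi>"
  have u: "h *v ?u = \<xi>" and w: "g *v ?w = \<xi>"
    by (rule matrix_inv_apply[OF pos_sym_invertible], fact)+
  define s where "s = \<xi> \<bullet> ?u"
  have s0: "0 \<le> s" unfolding s_def by (rule pos_sym_nonneg[OF pos_sym_matrix_inv[OF h]])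
  have W: "0 \<le> \<xi> \<bullet> ?w" by (rule pos_sym_nonneg[OF pos_sym_matrix_inv[OF g]])
  have "s\<^sup>2 = (?u \<bullet> (g *v ?w))\<^sup>2" by (simp add: w s_def inner_commute)
  also have "\<dots> \<le> (?u \<bullet> (g *v ?u)) * (?w \<bullet> (g *v ?w))" by (rule pos_sym_Cauchy_Schwarz[OF g])
  also have "\<dots> \<le> (exp \<kappa> * (?u \<bullet> (h *v ?u))) * (?w \<bullet> (g *v ?w))"
    using le pos_sym_nonneg[OF g] by (intro mult_right_mono)
  also have "\<dots> = s * (exp \<kappa> * (\<xi> \<bullet> ?w))" by (simp add: u w s_def inner_commute mult_ac)
  finally have "s * s \<le> s * (exp \<kappa> * (\<xi> \<bullet> ?w))" by (simp add: power2_eq_square)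
  then show ?thesis
    using s0 W unfolding s_def[symmetric] by (cases "s = 0") (auto simp: mult_le_cancel_left)
qed

lemma quasi_isometric_matrix_inv:
  assumes "pos_sym g" "pos_sym h" "quasi_isometric \<kappa> g h"
  shows "quasi_isometric \<kappa> (matrix_inv g) (matrix_inv h)"
  using assms quasi_isometric_inv_aux[of g h \<kappa>] quasi_isometric_inv_aux[of h g \<kappa>]
  unfolding quasi_isometric_def by blast

lemma quadratic_form_2:
  "u \<bullet> (g *v w) = g$1$1 * u$1 * w$1 + g$1$2 * u$1 * w$2 + g$2$1 * u$2 * w$1 + g$2$2 * u$2 * w$2" for g :: "real^2^2"
  by (simp add: inner_vec_def matrix_vector_mult_def sum_2 algebra_simps)

lemma quadratic_form_le_entries:
  fixes g :: "real^2^2"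
  assumes "\<And>i j. \<bar>g $ i $ j\<bar> \<le> M"
  shows "u \<bullet> (g *v u) \<le> 2 * M * (u \<bullet> u)"
proof -
  have M: "0 \<le> M" using assms[of 1 1] by linarith
  have t: "g $ i $ j * u $ i * u $ j \<le> M * (((u $ i)\<^sup>2 + (u $ j)\<^sup>2) / 2)" for i j
  proof -
    have "g $ i $ j * u $ i * u $ j \<le> \<bar>g $ i $ j\<bar> * (\<bar>u $ i\<bar> * \<bar>u $ j\<bar>)"
      by (metis abs_ge_self abs_mult mult.assoc)
    also have "\<dots> \<le> M * (((u $ i)\<^sup>2 + (u $ j)\<^sup>2) / 2)"
      using assms M sum_squares_bound[of "\<bar>u $ i\<bar>" "\<bar>u $ j\<bar>"] by (intro mult_mono) auto
    finally show ?thesis .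
  qed
  show ?thesis
    using t[of 1 1] t[of 1 2] t[of 2 1] t[of 2 2] unfolding quadratic_form_2
    by (simp add: inner_vec_def sum_2 power2_eq_square algebra_simps)
qed

lemma entries_le_quadratic_form:
  fixes S :: "real^2^2"
  assumes sym: "S $ 1 $ 2 = S $ 2 $ 1" and le: "\<And>u. \<bar>u \<bullet> (S *v u)\<bar> \<le> m * (u \<bullet> u)"
  shows "\<bar>S $ i $ j\<bar> \<le> 2 * m"
proof -
  have 1: "\<bar>S $ 1 $ 1\<bar> \<le> m" using le[of "vec2 1 0"] unfolding quadratic_form_2 by (simp add: inner_vec_def sum_2)
  have 2: "\<bar>S $ 2 $ 2\<bar> \<le> m" using le[of "vec2 0 1"] unfolding quadratic_form_2 by (simp add: inner_vec_def sum_2)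
  have "\<bar>S $ 1 $ 1 + S $ 1 $ 2 + S $ 2 $ 1 + S $ 2 $ 2\<bar> \<le> m * 2"
    using le[of "vec2 1 1"] unfolding quadratic_form_2 by (simp add: inner_vec_def sum_2)
  then have 3: "\<bar>S $ 1 $ 2\<bar> \<le> 2 * m" "\<bar>S $ 2 $ 1\<bar> \<le> 2 * m" using 1 2 sym by linarith+
  have "i = 1 \<or> i = 2" "j = 1 \<or> j = 2" using exhaust_2 by blast+
  then show ?thesis using 1 2 3 by fastforce
qed

text \<open>The hypothesis controls the quadratic form of \<open>g - h\<close>; polarisation controls its matrix
entries.\<close>

lemma quasi_isometric_entries:
  assumes g: "pos_sym g" and h: "pos_sym h" and q: "quasi_isometric \<kappa> g h" and \<kappa>: "0 \<le> \<kappa>"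
    and M: "\<And>i j. \<bar>g $ i $ j\<bar> \<le> M"
  shows "\<bar>g $ i $ j - h $ i $ j\<bar> \<le> 4 * M * (exp \<kappa> - 1)"
proof -
  have e1: "1 \<le> exp \<kappa>" using \<kappa> by simp
  have sym: "S $ 1 $ 2 = S $ 2 $ 1" if "pos_sym S" for S
  proof -
    have "S $ 1 $ 2 = transpose S $ 1 $ 2" using that by (simp add: pos_sym_def)
    also have "\<dots> = S $ 2 $ 1" unfolding transpose_def by simp
    finally show ?thesis .
  qed
  have "\<bar>u \<bullet> ((g - h) *v u)\<bar> \<le> (2 * M * (exp \<kappa> - 1)) * (u \<bullet> u)" for u
  proof -
    define x where "x = u \<bullet> (g *v u)"
    define y where "y = u \<bullet> (h *v u)"
    have x: "0 \<le> x" "0 \<le> y" "y \<le> exp \<kappa> * x" "x \<le> exp \<kappa> * y"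
      using pos_sym_nonneg[OF g] pos_sym_nonneg[OF h] q by (auto simp: x_def y_def quasi_isometric_def)
    have "x - y \<le> (exp \<kappa> - 1) * x"
    proof (cases "y \<le> x")
      case True
      have "x - y \<le> (exp \<kappa> - 1) * y" using x by (simp add: algebra_simps)
      also have "\<dots> \<le> (exp \<kappa> - 1) * x" using True e1 by (intro mult_left_mono) auto
      finally show ?thesis .
    next
      case False
      moreover have "0 \<le> (exp \<kappa> - 1) * x" using x e1 by (intro mult_nonneg_nonneg) auto
      ultimately show ?thesis by linarith
    qed
    moreover have "y - x \<le> (exp \<kappa> - 1) * x" using x by (simp add: algebra_simps)
    ultimately have "\<bar>x - y\<bar> \<le> (exp \<kappa> - 1) * x" by linarith
    also have "\<dots> \<le> (exp \<kappa> - 1) * (2 * M * (u \<bullet> u))"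
      unfolding x_def using e1 quadratic_form_le_entries[OF M] by (intro mult_left_mono) auto
    finally show ?thesis
      by (simp add: x_def y_def matrix_vector_mult_diff_rdistrib inner_diff_right mult_ac)
  qed
  from entries_le_quadratic_form[OF _ this, of i j] sym[OF g] sym[OF h]
  show ?thesis by simp
qed

section \<open>A Gronwall estimate\<close>

text \<open>Up to a factor \<open>\<phi>\<close>, the expressions \<open>\<phi>' - \<kappa> s \<phi>\<close> and \<open>\<phi>' + \<kappa> s \<phi>\<close> are the derivatives of \<open>\<phi>\<close>
multiplied by the integrating factors \<open>exp (- \<kappa> \<Sigma>)\<close> and \<open>exp (\<kappa> \<Sigma>)\<close>; their signs make these products
monotone.\<close>

lemma log_derivative_bound:
  fixes \<phi> \<phi>' s :: "real \<Rightarrow> real"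
  assumes d: "\<And>t. t \<in> {0..1} \<Longrightarrow> (\<phi> has_real_derivative \<phi>' t) (at t within {0..1})"
    and s: "continuous_on {0..1} s" and le: "\<And>t. t \<in> {0..1} \<Longrightarrow> \<bar>\<phi>' t\<bar> \<le> \<kappa> * s t * \<phi> t"
  shows "\<phi> 1 \<le> exp (\<kappa> * integral {0..1} s) * \<phi> 0" "\<phi> 0 \<le> exp (\<kappa> * integral {0..1} s) * \<phi> 1"
proof -
  define \<Sigma> where "\<Sigma> t = integral {0..t} s" for t
  have \<Sigma>: "(\<Sigma> has_real_derivative s t) (at t within {0..1})" if "t \<in> {0..1}" for t
    unfolding \<Sigma>_def by (rule integral_has_real_derivative[OF s that])
  have mono: "\<exists>t\<in>{0<..<1}. \<phi> 1 * exp (r * \<Sigma> 1) - \<phi> 0 = (\<phi>' t + r * s t * \<phi> t) * exp (r * \<Sigma> t)" for r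
  proof -
    define F where "F t = \<phi> t * exp (r * \<Sigma> t)" for t
    have "(F has_real_derivative (\<phi>' t + r * s t * \<phi> t) * exp (r * \<Sigma> t)) (at t within {0..1})" if "t \<in> {0..1}" for t
      unfolding F_def using d[OF that] \<Sigma>[OF that]
      by (auto intro!: derivative_eq_intros simp: algebra_simps)
    then have "\<exists>t\<in>{0<..<1}. F 1 - F 0 = (\<lambda>h. ((\<phi>' t + r * s t * \<phi> t) * exp (r * \<Sigma> t)) * h) (1 - 0)"
      by (intro mvt_simple) (auto simp: has_field_derivative_def)
    then show ?thesis by (simp add: F_def \<Sigma>_def)
  qed
  obtain t where t: "t \<in> {0<..<1}" "\<phi> 1 * exp (-\<kappa> * \<Sigma> 1) - \<phi> 0 = (\<phi>' t + -\<kappa> * s t * \<phi> t) * exp (-\<kappa> * \<Sigma> t)"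
    using mono[of "-\<kappa>"] by blast
  have "\<phi>' t + -\<kappa> * s t * \<phi> t \<le> 0" using le[of t] t(1) by auto
  then have "\<phi> 1 * exp (-\<kappa> * \<Sigma> 1) \<le> \<phi> 0"
    using t(2) mult_nonpos_nonneg[of "\<phi>' t + -\<kappa> * s t * \<phi> t" "exp (-\<kappa> * \<Sigma> t)", OF _ exp_ge_zero] by linarith
  then have "exp (\<kappa> * \<Sigma> 1) * (\<phi> 1 * exp (-\<kappa> * \<Sigma> 1)) \<le> exp (\<kappa> * \<Sigma> 1) * \<phi> 0" by simp
  then show "\<phi> 1 \<le> exp (\<kappa> * integral {0..1} s) * \<phi> 0"
    by (simp add: \<Sigma>_def exp_minus field_simps)
  obtain t where t: "t \<in> {0<..<1}" "\<phi> 1 * exp (\<kappa> * \<Sigma> 1) - \<phi> 0 = (\<phi>' t + \<kappa> * s t * \<phi> t) * exp (\<kappa> * \<Sigma> t)"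
    using mono[of "\<kappa>"] by blast
  have "0 \<le> \<phi>' t + \<kappa> * s t * \<phi> t" using le[of t] t(1) by auto
  then have "\<phi> 0 \<le> \<phi> 1 * exp (\<kappa> * \<Sigma> 1)"
    using t(2) mult_nonneg_nonneg[of "\<phi>' t + \<kappa> * s t * \<phi> t" "exp (\<kappa> * \<Sigma> t)", OF _ exp_ge_zero] by linarith
  then show "\<phi> 0 \<le> exp (\<kappa> * integral {0..1} s) * \<phi> 1"
    by (simp add: \<Sigma>_def mult.commute)
qed

section \<open>Paths of immersions\<close>

locale metric_on_immersions = surface A C
  for A :: "'m::t2_space chart set" and C :: "('m chart \<times> (real^2) \<times> (real^2)) set" +
  fixes l :: nat and G :: "('m \<Rightarrow> real^'d::finite) \<Rightarrow> ('m \<Rightarrow> real^'d) \<Rightarrow> ('m \<Rightarrow> real^'d) \<Rightarrow> real" and c0 :: real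
  assumes l: "3 \<le> l"
    and G: "smooth_riemannian_metric (sobolev_maps A C l) (map_norm A C l) (Imm A C l) G"
    and c0: "c0 > 0"
    and G_bound: "\<And>f h. f \<in> Imm A C l \<Longrightarrow> h \<in> sobolev_maps A C l \<Longrightarrow>
      ennreal c0 * Linf_norm A (pullback_metric f) 0 1 1 (nabla h) \<le> ennreal (sqrt (G f h h))"
begin

abbreviation H :: "('m \<Rightarrow> real^'d) set" where "H \<equiv> sobolev_maps A C l"
abbreviation U :: "('m \<Rightarrow> real^'d) set" where "U \<equiv> Imm A C l"
abbreviation N :: "('m \<Rightarrow> real^'d) \<Rightarrow> real" where "N \<equiv> map_norm A C l"

lemma U_H: "f \<in> U \<Longrightarrow> f \<in> H"
  by (simp add: Imm_def)

lemma H_diff: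
  assumes "h \<in> H" "k \<in> H"
  shows "(\<lambda>x. h x - k x) \<in> H" "N (\<lambda>x. h x - k x) \<le> N h + N k"
  using sobolev_maps_lincomb[OF assms, of 1 "-1"] by simp_all

lemma H_add:
  assumes "h \<in> H" "k \<in> H"
  shows "(\<lambda>x. h x + k x) \<in> H" "N (\<lambda>x. h x + k x) \<le> N h + N k"
  using sobolev_maps_lincomb[OF assms, of 1 1] by simp_all

lemma H_scale:
  assumes "h \<in> H"
  shows "(\<lambda>x. r *\<^sub>R h x) \<in> H" "N (\<lambda>x. r *\<^sub>R h x) \<le> \<bar>r\<bar> * N h"
  using sobolev_maps_lincomb[OF assms assms, of r 0] by simp_all

text \<open>Consequences of smoothness at \<open>f\<close>: bilinearity, boundedness, and a Lipschitz estimate in the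
footpoint for footpoints near \<open>f\<close>. The last one combines the first order Taylor estimate with the
boundedness of the first derivative.\<close>

lemma G_regularity:
  assumes "f \<in> U"
  obtains B K \<delta> where "0 \<le> B" "0 \<le> K" "0 < \<delta>"
    "\<And>h k. h \<in> H \<Longrightarrow> k \<in> H \<Longrightarrow> \<bar>G f h k\<bar> \<le> B * (N h * N k)"
    "\<And>h k w. h \<in> H \<Longrightarrow> k \<in> H \<Longrightarrow> w \<in> H \<Longrightarrow> G f (\<lambda>x. h x - k x) w = G f h w - G f k w"
    "\<And>h k w. h \<in> H \<Longrightarrow> k \<in> H \<Longrightarrow> w \<in> H \<Longrightarrow> G f w (\<lambda>x. h x - k x) = G f w h - G f w k"
    "\<And>f' h k. f' \<in> U \<Longrightarrow> N (\<lambda>x. f' x - f x) < \<delta> \<Longrightarrow> h \<in> H \<Longrightarrow> k \<in> H \<Longrightarrow>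
       \<bar>G f' h k - G f h k\<bar> \<le> K * N (\<lambda>x. f' x - f x) * (N h * N k)"
proof -
  have "smooth_form_field H N U 2 (\<lambda>f hs. G f (hs ! 0) (hs ! 1))"
    using G unfolding smooth_riemannian_metric_def by blast
  then obtain D where
    D0: "\<forall>f\<in>U. \<forall>hs. set hs \<subseteq> H \<longrightarrow> length hs = 2 \<longrightarrow> D f hs = G f (hs ! 0) (hs ! 1)"
    and Dm: "\<forall>f\<in>U. \<forall>k\<ge>2. bounded_multilinear_form H N k (D f)"
    and Dd: "\<forall>f\<in>U. \<forall>k\<ge>2. \<forall>e>0. \<exists>\<delta>>0. \<forall>f'\<in>U. N (\<lambda>x. f' x - f x) < \<delta> \<longrightarrow>
        (\<forall>hs. set hs \<subseteq> H \<longrightarrow> length hs = k \<longrightarrow>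
           \<bar>D f' hs - D f hs - D f ((\<lambda>x. f' x - f x) # hs)\<bar>
             \<le> e * N (\<lambda>x. f' x - f x) * prod_list (map N hs))"
    unfolding smooth_form_field_def by (elim exE conjE) (rule that)
  have D2: "D f [h, k] = G f h k" if "f \<in> U" "h \<in> H" "k \<in> H" for f h k
    using D0[rule_format, OF that(1), of "[h, k]"] that by simp
  note m2 = Dm[rule_format, OF assms, of 2, unfolded bounded_multilinear_form_def]
  note m3 = Dm[rule_format, OF assms, of 3, unfolded bounded_multilinear_form_def]
  obtain B where B: "\<And>hs. set hs \<subseteq> H \<Longrightarrow> length hs = 2 \<Longrightarrow> \<bar>D f hs\<bar> \<le> B * prod_list (map N hs)"
    using m2 by auto
  obtain B3 where B3: "\<And>hs. set hs \<subseteq> H \<Longrightarrow> length hs = 3 \<Longrightarrow> \<bar>D f hs\<bar> \<le> B3 * prod_list (map N hs)"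
    using m3 by auto
  obtain \<delta> where \<delta>: "\<delta> > 0" "\<And>f' hs. f' \<in> U \<Longrightarrow> N (\<lambda>x. f' x - f x) < \<delta> \<Longrightarrow> set hs \<subseteq> H \<Longrightarrow> length hs = 2 \<Longrightarrow>
      \<bar>D f' hs - D f hs - D f ((\<lambda>x. f' x - f x) # hs)\<bar> \<le> 1 * N (\<lambda>x. f' x - f x) * prod_list (map N hs)"
    using Dd[rule_format, OF assms order_refl zero_less_one] by blast
  have NN: "0 \<le> N h * N k" if "h \<in> H" "k \<in> H" for h k
    using that by (intro mult_nonneg_nonneg map_norm_nonneg)
  show thesis
  proof (rule that[of "\<bar>B\<bar>" "1 + \<bar>B3\<bar>" \<delta>])
    show "\<bar>G f h k\<bar> \<le> \<bar>B\<bar> * (N h * N k)" if "h \<in> H" "k \<in> H" for h k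
    proof -
      have "\<bar>G f h k\<bar> \<le> B * (N h * N k)" using B[of "[h, k]"] D2[OF assms that] that by simp
      also have "\<dots> \<le> \<bar>B\<bar> * (N h * N k)" using NN[OF that] by (intro mult_right_mono) auto
      finally show ?thesis .
    qed
    show "G f (\<lambda>x. h x - k x) w = G f h w - G f k w" if "h \<in> H" "k \<in> H" "w \<in> H" for h k w
    proof -
      have "D f ([] @ (\<lambda>x. 1 *\<^sub>R h x + (-1) *\<^sub>R k x) # [w]) = 1 * D f ([] @ h # [w]) + (-1) * D f ([] @ k # [w])"
        by (rule conjunct1[OF m2, rule_format]) (use that in auto)
      then show ?thesis using that H_diff[OF that(1,2)] by (simp add: D2[OF assms])
    qed
    show "G f w (\<lambda>x. h x - k x) = G f w h - G f w k" if "h \<in> H" "k \<in> H" "w \<in> H" for h k w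
    proof -
      have "D f ([w] @ (\<lambda>x. 1 *\<^sub>R h x + (-1) *\<^sub>R k x) # []) = 1 * D f ([w] @ h # []) + (-1) * D f ([w] @ k # [])"
        by (rule conjunct1[OF m2, rule_format]) (use that in auto)
      then show ?thesis using that H_diff[OF that(1,2)] by (simp add: D2[OF assms])
    qed
    show "\<bar>G f' h k - G f h k\<bar> \<le> (1 + \<bar>B3\<bar>) * N (\<lambda>x. f' x - f x) * (N h * N k)"
      if f': "f' \<in> U" "N (\<lambda>x. f' x - f x) < \<delta>" and hk: "h \<in> H" "k \<in> H" for f' h k
    proof -
      let ?d = "\<lambda>x. f' x - f x"
      have d: "?d \<in> H" using H_diff[OF U_H[OF f'(1)] U_H[OF assms]] by simp
      have P: "0 \<le> N ?d * (N h * N k)" using NN[OF hk] map_norm_nonneg[OF d] by simp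
      have 1: "\<bar>G f' h k - G f h k - D f [?d, h, k]\<bar> \<le> N ?d * (N h * N k)"
        using \<delta>(2)[OF f', of "[h, k]"] hk by (simp add: D2[OF assms] D2[OF f'(1)])
      have "\<bar>D f [?d, h, k]\<bar> \<le> B3 * (N ?d * (N h * N k))"
        using B3[of "[?d, h, k]"] hk d by simp
      also have "\<dots> \<le> \<bar>B3\<bar> * (N ?d * (N h * N k))" using P by (intro mult_right_mono) auto
      finally show ?thesis using 1 by (simp add: algebra_simps)
    qed
  qed (use \<delta>(1) in auto)
qed

lemma C1_pathD:
  assumes "C1_path H N U \<gamma> v" "t \<in> {0..1}"
  shows "\<gamma> t \<in> U" "v t \<in> H"
  using assms unfolding C1_path_def by blast+

lemma C1_path_close:
  assumes "C1_path H N U \<gamma> v" "t \<in> {0..1}" "e > 0"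
  obtains \<delta> where "\<delta> > 0"
    "\<And>s. s \<in> {0..1} \<Longrightarrow> \<bar>s - t\<bar> < \<delta> \<Longrightarrow> N (\<lambda>x. \<gamma> s x - \<gamma> t x - (s - t) *\<^sub>R v t x) \<le> e * \<bar>s - t\<bar>"
    "\<And>s. s \<in> {0..1} \<Longrightarrow> \<bar>s - t\<bar> < \<delta> \<Longrightarrow> N (\<lambda>x. v s x - v t x) \<le> e"
  using assms unfolding C1_path_def by blast

lemma C1_path_tendsto:
  assumes p: "C1_path H N U \<gamma> v" and t: "t \<in> {0..1}"
  shows "((\<lambda>s. N (\<lambda>x. v s x - v t x)) \<longlongrightarrow> 0) (at t within {0..1})"
    and "((\<lambda>s. N (\<lambda>x. \<gamma> s x - \<gamma> t x)) \<longlongrightarrow> 0) (at t within {0..1})"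
proof -
  note H = C1_pathD[OF p]
  show "((\<lambda>s. N (\<lambda>x. v s x - v t x)) \<longlongrightarrow> 0) (at t within {0..1})"
  proof (rule tendstoI)
    fix e :: real assume "e > 0"
    then have e2: "e / 2 > 0" by simp
    obtain \<delta> where \<delta>: "\<delta> > 0" "\<And>s. s \<in> {0..1} \<Longrightarrow> \<bar>s - t\<bar> < \<delta> \<Longrightarrow> N (\<lambda>x. v s x - v t x) \<le> e / 2"
      by (rule C1_path_close[OF p t e2]) blast
    have "dist (N (\<lambda>x. v s x - v t x)) 0 < e" if "s \<in> {0..1}" "dist s t < \<delta>" for s
    proof -
      have "N (\<lambda>x. v s x - v t x) \<le> e / 2" using \<delta>(2)[OF that(1)] that(2) by (simp add: dist_real_def)
      moreover have "0 \<le> N (\<lambda>x. v s x - v t x)"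
        by (rule map_norm_nonneg[OF H_diff(1)[OF H(2)[OF that(1)] H(2)[OF t]]])
      ultimately show ?thesis using \<open>e > 0\<close> by simp
    qed
    then show "\<forall>\<^sub>F s in at t within {0..1}. dist (N (\<lambda>x. v s x - v t x)) 0 < e"
      using \<delta>(1) unfolding eventually_at by blast
  qed
  show "((\<lambda>s. N (\<lambda>x. \<gamma> s x - \<gamma> t x)) \<longlongrightarrow> 0) (at t within {0..1})"
  proof (rule tendsto_sandwich[of "\<lambda>_. 0" _ _ "\<lambda>s. (1 + N (v t)) * \<bar>s - t\<bar>"])
    obtain \<delta> where \<delta>: "\<delta> > 0"
      "\<And>s. s \<in> {0..1} \<Longrightarrow> \<bar>s - t\<bar> < \<delta> \<Longrightarrow> N (\<lambda>x. \<gamma> s x - \<gamma> t x - (s - t) *\<^sub>R v t x) \<le> 1 * \<bar>s - t\<bar>"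
      by (rule C1_path_close[OF p t zero_less_one]) blast
    have "N (\<lambda>x. \<gamma> s x - \<gamma> t x) \<le> (1 + N (v t)) * \<bar>s - t\<bar>" if "s \<in> {0..1}" "dist s t < \<delta>" for s
    proof -
      let ?a = "\<lambda>x. \<gamma> s x - \<gamma> t x" and ?b = "\<lambda>x. (s - t) *\<^sub>R v t x"
      have a: "?a \<in> H" by (rule H_diff(1)[OF U_H[OF H(1)[OF that(1)]] U_H[OF H(1)[OF t]]])
      have b: "?b \<in> H" "N ?b \<le> \<bar>s - t\<bar> * N (v t)" by (rule H_scale[OF H(2)[OF t]])+
      have "N (\<lambda>x. (?a x - ?b x) + ?b x) \<le> N (\<lambda>x. ?a x - ?b x) + N ?b"
        by (rule H_add(2)[OF H_diff(1)[OF a b(1)] b(1)])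
      moreover have "N (\<lambda>x. ?a x - ?b x) \<le> 1 * \<bar>s - t\<bar>"
        using \<delta>(2)[OF that(1)] that(2) by (simp add: dist_real_def)
      ultimately show ?thesis using b(2) by (simp add: algebra_simps)
    qed
    then show "\<forall>\<^sub>F s in at t within {0..1}. N (\<lambda>x. \<gamma> s x - \<gamma> t x) \<le> (1 + N (v t)) * \<bar>s - t\<bar>"
      using \<delta>(1) unfolding eventually_at by blast
    have "0 \<le> N (\<lambda>x. \<gamma> s x - \<gamma> t x)" if "s \<in> {0..1}" for s
      by (rule map_norm_nonneg[OF H_diff(1)[OF U_H[OF H(1)[OF that]] U_H[OF H(1)[OF t]]]])
    then show "\<forall>\<^sub>F s in at t within {0..1}. 0 \<le> N (\<lambda>x. \<gamma> s x - \<gamma> t x)"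
      unfolding eventually_at using zero_less_one by blast
    have "((\<lambda>s. (1 + N (v t)) * \<bar>s - t\<bar>) \<longlongrightarrow> (1 + N (v t)) * \<bar>t - t\<bar>) (at t within {0..1})"
      by (intro tendsto_intros)
    then show "((\<lambda>s. (1 + N (v t)) * \<bar>s - t\<bar>) \<longlongrightarrow> 0) (at t within {0..1})" by simp
  qed simp
qed

text \<open>The integral of a function that is not integrable is zero by convention, so the length of a
path controls the path only because the speed is continuous.\<close>

lemma speed_continuous:
  assumes p: "C1_path H N U \<gamma> v"
  shows "continuous_on {0..1} (\<lambda>t. sqrt (G (\<gamma> t) (v t) (v t)))"
proof (intro continuous_on_real_sqrt)
  note H = C1_pathD[OF p]
  show "continuous_on {0..1} (\<lambda>t. G (\<gamma> t) (v t) (v t))"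
    unfolding continuous_on_def
  proof
    fix t :: real assume t: "t \<in> {0..1}"
    obtain B K \<delta> where K: "0 \<le> B" "0 \<le> K" "0 < \<delta>"
      and GB: "\<And>h k. h \<in> H \<Longrightarrow> k \<in> H \<Longrightarrow> \<bar>G (\<gamma> t) h k\<bar> \<le> B * (N h * N k)"
      and G1: "\<And>h k w. h \<in> H \<Longrightarrow> k \<in> H \<Longrightarrow> w \<in> H \<Longrightarrow> G (\<gamma> t) (\<lambda>x. h x - k x) w = G (\<gamma> t) h w - G (\<gamma> t) k w"
      and G2: "\<And>h k w. h \<in> H \<Longrightarrow> k \<in> H \<Longrightarrow> w \<in> H \<Longrightarrow> G (\<gamma> t) w (\<lambda>x. h x - k x) = G (\<gamma> t) w h - G (\<gamma> t) w k"
      and GK: "\<And>f' h k. f' \<in> U \<Longrightarrow> N (\<lambda>x. f' x - \<gamma> t x) < \<delta> \<Longrightarrow> h \<in> H \<Longrightarrow> k \<in> H \<Longrightarrow>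
       \<bar>G f' h k - G (\<gamma> t) h k\<bar> \<le> K * N (\<lambda>x. f' x - \<gamma> t x) * (N h * N k)"
      by (rule G_regularity[OF H(1)[OF t]]) blast
    define a where "a s = N (\<lambda>x. v s x - v t x)" for s
    define b where "b s = N (\<lambda>x. \<gamma> s x - \<gamma> t x)" for s
    define V where "V = N (v t)"
    have lim: "(a \<longlongrightarrow> 0) (at t within {0..1})" "(b \<longlongrightarrow> 0) (at t within {0..1})"
      using C1_path_tendsto[OF p t] by (simp_all add: a_def[abs_def] b_def[abs_def])
    have bound: "\<bar>G (\<gamma> s) (v s) (v s) - G (\<gamma> t) (v t) (v t)\<bar>
        \<le> K * b s * ((V + a s) * (V + a s)) + (B * (a s * (V + a s)) + B * (V * a s))"
      if s: "s \<in> {0..1}" and bs: "b s < \<delta>" for s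
    proof -
      have v: "v s \<in> H" "v t \<in> H" using H(2) s t by auto
      note w = H_diff(1)[OF v]
      have a0: "0 \<le> a s" "0 \<le> b s" "0 \<le> V" "0 \<le> N (v s)"
        using map_norm_nonneg[OF w] map_norm_nonneg[OF v(1)] map_norm_nonneg[OF v(2)]
          map_norm_nonneg[OF H_diff(1)[OF U_H[OF H(1)[OF s]] U_H[OF H(1)[OF t]]]]
        by (simp_all add: a_def b_def V_def)
      have Nvs: "N (v s) \<le> V + a s"
        using H_add(2)[OF w v(2)] by (simp add: a_def V_def)
      \<comment> \<open>the footpoint and the two arguments are moved from \<open>s\<close> to \<open>t\<close> one at a time\<close>
      have "\<bar>G (\<gamma> s) (v s) (v s) - G (\<gamma> t) (v s) (v s)\<bar> \<le> K * b s * (N (v s) * N (v s))"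
        using GK[OF H(1)[OF s] _ v(1) v(1)] bs by (simp add: b_def)
      also have "\<dots> \<le> K * b s * ((V + a s) * (V + a s))"
        using Nvs a0 K by (intro mult_left_mono mult_mono) auto
      finally have 1: "\<bar>G (\<gamma> s) (v s) (v s) - G (\<gamma> t) (v s) (v s)\<bar> \<le> K * b s * ((V + a s) * (V + a s))" .
      have "\<bar>G (\<gamma> t) (v s) (v s) - G (\<gamma> t) (v t) (v s)\<bar> \<le> B * (a s * N (v s))"
        using G1[OF v v(1)] GB[OF w v(1)] by (simp add: a_def)
      also have "\<dots> \<le> B * (a s * (V + a s))"
        using Nvs a0 K by (intro mult_left_mono) auto
      finally have 2: "\<bar>G (\<gamma> t) (v s) (v s) - G (\<gamma> t) (v t) (v s)\<bar> \<le> B * (a s * (V + a s))" .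
      have 3: "\<bar>G (\<gamma> t) (v t) (v s) - G (\<gamma> t) (v t) (v t)\<bar> \<le> B * (V * a s)"
        using G2[OF v v(2)] GB[OF v(2) w] by (simp add: a_def V_def)
      show ?thesis using 1 2 3 by linarith
    qed
    have "((\<lambda>s. K * b s * ((V + a s) * (V + a s)) + (B * (a s * (V + a s)) + B * (V * a s)))
        \<longlongrightarrow> K * 0 * ((V + 0) * (V + 0)) + (B * (0 * (V + 0)) + B * (V * 0))) (at t within {0..1})"
      by (intro tendsto_intros lim)
    then have r: "((\<lambda>s. K * b s * ((V + a s) * (V + a s)) + (B * (a s * (V + a s)) + B * (V * a s))) \<longlongrightarrow> 0) (at t
        within {0..1})"
      by simp
    have evb: "\<forall>\<^sub>F s in at t within {0..1}. b s < \<delta>"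
      using order_tendstoD(2)[OF lim(2) K(3)] .
    have evs: "\<forall>\<^sub>F s in at t within {0..1}. s \<in> {0..1::real}"
      unfolding eventually_at using zero_less_one by blast
    have "\<forall>\<^sub>F s in at t within {0..1}. norm (G (\<gamma> s) (v s) (v s) - G (\<gamma> t) (v t) (v t)) \<le>
        K * b s * ((V + a s) * (V + a s)) + (B * (a s * (V + a s)) + B * (V * a s))"
      using eventually_conj[OF evb evs] by (rule eventually_mono) (use bound in simp)
    from Lim_null_comparison[OF this r]
    show "((\<lambda>t. G (\<gamma> t) (v t) (v t)) \<longlongrightarrow> G (\<gamma> t) (v t) (v t)) (at t within {0..1})"
      by (rule LIM_zero_cancel)
  qed
qed

lemma pderiv_norm_le:
  assumes cc: "(c, a, b) \<in> C" and y: "y \<in> box a b"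
  obtains K where "0 \<le> K" "\<And>h i. h \<in> H \<Longrightarrow> norm (pderiv_at i (h \<circ> cinv c) y) \<le> K * N h"
proof -
  let ?K = "sqrt (box_const a b * 9)"
  have ne: "box a b \<noteq> {}" using y by blast
  have le: "norm (pderiv_at i (h \<circ> cinv c) y) \<le> (real CARD('d) * ?K) * N h" if "h \<in> H" for h i
  proof -
    have "norm (pderiv_at i (h \<circ> cinv c) y) \<le> (\<Sum>k\<in>UNIV. \<bar>pderiv_at i (h \<circ> cinv c) y $ k\<bar>)"
      by (rule norm_le_l1_cart)
    also have "\<dots> \<le> (\<Sum>k\<in>(UNIV :: 'd set). ?K * N h)"
      by (intro sum_mono pderiv_le_map_norm[OF l that cc y])
    finally show ?thesis by simp
  qed
  have "0 \<le> real CARD('d) * ?K"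
    by (intro mult_nonneg_nonneg real_sqrt_ge_zero box_const_nonneg[OF ne]) simp_all
  then show thesis
    using le by (rule that)
qed

text \<open>Taking first derivatives at a point is a bounded linear functional on \<open>H\<^sup>l\<close>, so it commutes
with differentiation in time.\<close>

lemma path_pderiv_derivative:
  assumes p: "C1_path H N U \<gamma> v" and cc: "(c, a, b) \<in> C" and y: "y \<in> box a b" and t: "t \<in> {0..1}"
  shows "((\<lambda>t. pderiv_at i (\<gamma> t \<circ> cinv c) y) has_vector_derivative pderiv_at i (v t \<circ> cinv c) y) (at t within {0..1})"
  unfolding has_vector_derivative_def has_derivative_within_alt
proof (intro conjI allI impI)
  note H = C1_pathD[OF p]
  show "bounded_linear (\<lambda>x. x *\<^sub>R pderiv_at i (v t \<circ> cinv c) y)"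
    by (rule bounded_linear_scaleR_left)
  fix e :: real assume "e > 0"
  obtain K where K: "0 \<le> K" "\<And>h i. h \<in> H \<Longrightarrow> norm (pderiv_at i (h \<circ> cinv c) y) \<le> K * N h"
    by (rule pderiv_norm_le[OF cc y]) blast
  define e' where "e' = e / (K + 1)"
  have e': "e' > 0" "K * e' \<le> e" unfolding e'_def by (rule small_quotient[OF K(1) \<open>e > 0\<close>])+
  obtain \<delta> where \<delta>: "\<delta> > 0"
    "\<And>s. s \<in> {0..1} \<Longrightarrow> \<bar>s - t\<bar> < \<delta> \<Longrightarrow> N (\<lambda>x. \<gamma> s x - \<gamma> t x - (s - t) *\<^sub>R v t x) \<le> e' * \<bar>s - t\<bar>"
    by (rule C1_path_close[OF p t e'(1)]) blast
  have "norm (pderiv_at i (\<gamma> s \<circ> cinv c) y - pderiv_at i (\<gamma> t \<circ> cinv c) y - (s - t) *\<^sub>R pderiv_at i (v t \<circ> cinv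
      c) y) \<le> e * norm (s - t)"
    if s: "s \<in> {0..1}" and st: "norm (s - t) < \<delta>" for s
  proof -
    have df: "(h \<circ> cinv c) differentiable (at y)" if "h \<in> H" for h
      by (rule sobolev_map_cell(1)[OF l that cc y])
    let ?b = "\<lambda>x. (s - t) *\<^sub>R v t x" and ?a = "\<lambda>x. \<gamma> s x - \<gamma> t x"
    note gH = U_H[OF H(1)[OF s]] U_H[OF H(1)[OF t]]
    have a: "?a \<in> H" by (rule H_diff(1)[OF gH])
    have b: "?b \<in> H" by (rule H_scale(1)[OF H(2)[OF t]])
    have "pderiv_at i ((\<lambda>x. ?a x - ?b x) \<circ> cinv c) y = pderiv_at i (?a \<circ> cinv c) y - pderiv_at i (?b \<circ> cinv c) y"
      using pderiv_at_diff[OF df[OF a] df[OF b], of i] by (simp add: o_def)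
    also have "pderiv_at i (?a \<circ> cinv c) y = pderiv_at i (\<gamma> s \<circ> cinv c) y - pderiv_at i (\<gamma> t \<circ> cinv c) y"
      using pderiv_at_diff[OF df[OF gH(1)] df[OF gH(2)], of i] by (simp add: o_def)
    also have "pderiv_at i (?b \<circ> cinv c) y = (s - t) *\<^sub>R pderiv_at i (v t \<circ> cinv c) y"
      using pderiv_at_scaleR[OF df[OF H(2)[OF t]], of i "s - t"] by (simp add: o_def)
    finally have eq: "pderiv_at i (\<gamma> s \<circ> cinv c) y - pderiv_at i (\<gamma> t \<circ> cinv c) y - (s - t) *\<^sub>R pderiv_at i (v t
        \<circ> cinv c) y
      = pderiv_at i ((\<lambda>x. ?a x - ?b x) \<circ> cinv c) y" by (rule sym)
    have "norm (pderiv_at i ((\<lambda>x. ?a x - ?b x) \<circ> cinv c) y) \<le> K * N (\<lambda>x. ?a x - ?b x)"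
      by (rule K(2)[OF H_diff(1)[OF a b]])
    also have "\<dots> \<le> K * (e' * \<bar>s - t\<bar>)"
      using \<delta>(2)[OF s] st K(1) by (intro mult_left_mono) auto
    also have "\<dots> \<le> e * \<bar>s - t\<bar>"
      using mult_right_mono[OF e'(2), of "\<bar>s - t\<bar>"] by (simp add: mult.assoc)
    finally show ?thesis unfolding eq by simp
  qed
  then show "\<exists>d>0. \<forall>s\<in>{0..1}. norm (s - t) < d \<longrightarrow>
      norm (pderiv_at i (\<gamma> s \<circ> cinv c) y - pderiv_at i (\<gamma> t \<circ> cinv c) y - (s - t) *\<^sub>R pderiv_at i (v t \<circ> cinv c)
          y) \<le> e * norm (s - t)"
    using \<delta>(1) by blast
qed

end

section \<open>Positivity of the pullback metric\<close>

lemma pullback_quadratic_form: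
  "u \<bullet> (pullback_metric f c x *v u) = (norm (\<Sum>i\<in>UNIV. u $ i *\<^sub>R pderiv_at i (f \<circ> cinv c) (cmap c x)))\<^sup>2"
  unfolding quadratic_form_2 power2_norm_eq_inner pullback_metric_def
  by (simp add: sum_2 inner_add_left inner_add_right inner_commute algebra_simps)

lemma transpose_pullback_metric: "transpose (pullback_metric f c x) = pullback_metric f c x"
  by (simp add: transpose_def pullback_metric_def vec_eq_iff inner_commute)

lemma ImmD:
  assumes "f \<in> Imm A C l"
  shows "f \<in> sobolev_maps A C l"
    and "c \<in> A \<Longrightarrow> x \<in> cdom c \<Longrightarrow> (f \<circ> cinv c) differentiable (at (cmap c x))"
    and "c \<in> A \<Longrightarrow> x \<in> cdom c \<Longrightarrow> inj (frechet_derivative (f \<circ> cinv c) (at (cmap c x)))"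
  using assms unfolding Imm_def by blast+

lemma pos_sym_pullback_metric:
  assumes f: "f \<in> Imm A C l" and c: "c \<in> A" "x \<in> cdom c"
  shows "pos_sym (pullback_metric f c x)"
proof -
  have "0 < u \<bullet> (pullback_metric f c x *v u)" if "u \<noteq> 0" for u
  proof -
    have lin: "linear (frechet_derivative (f \<circ> cinv c) (at (cmap c x)))"
      using ImmD(2)[OF f c] by (rule linear_frechet_derivative)
    have "frechet_derivative (f \<circ> cinv c) (at (cmap c x)) u \<noteq> 0"
      using that linear_injective_0[OF lin] ImmD(3)[OF f c] by blast
    then show ?thesis
      unfolding pullback_quadratic_form frechet_derivative_eq_sum_pderiv[OF ImmD(2)[OF f c]] by simp
  qed
  then show ?thesis
    by (simp add: pos_sym_def transpose_pullback_metric)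
qed

lemma fiber_inner_nabla:
  fixes h :: "'m \<Rightarrow> real^'d::finite"
  shows "fiber_inner g 0 1 1 (nabla h c x) (nabla h c x) =
    (\<Sum>k\<in>UNIV. (\<chi> i. pderiv_at i (h \<circ> cinv c) (cmap c x) $ k) \<bullet>
        (matrix_inv g *v (\<chi> i. pderiv_at i (h \<circ> cinv c) (cmap c x) $ k)))"
proof -
  let ?p = "\<lambda>i k. pderiv_at i (h \<circ> cinv c) (cmap c x) $ k"
  have "fiber_inner g 0 1 1 (nabla h c x) (nabla h c x) =
      (\<Sum>i\<in>UNIV. \<Sum>k\<in>UNIV. \<Sum>j\<in>UNIV. matrix_inv g $ i $ j * ?p i k * ?p j k)"
    unfolding fiber_inner_def fiber_gram_def nabla_def
    by (simp add: sum_lists_Suc if_distrib[of "\<lambda>z. _ * z"] if_distrib[of "\<lambda>z. z * _"] sum.delta cong: if_cong)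
  also have "\<dots> = (\<Sum>k\<in>UNIV. \<Sum>i\<in>UNIV. \<Sum>j\<in>UNIV. matrix_inv g $ i $ j * ?p i k * ?p j k)"
    by (rule sum.swap)
  also have "\<dots> = (\<Sum>k\<in>UNIV. (\<chi> i. ?p i k) \<bullet> (matrix_inv g *v (\<chi> i. ?p i k)))"
    by (simp add: inner_vec_def matrix_vector_mult_def sum_distrib_left mult_ac)
  finally show ?thesis .
qed

text \<open>The directional derivative along \<open>u\<close> is bounded by the norm of the full derivative times the
length of \<open>u\<close>. For each component the linear form \<open>a\<close> is written as \<open>g(w, _)\<close> with \<open>w = g\<^sup>-\<^sup>1 a\<close>,
and Cauchy-Schwarz for \<open>g\<close> applies.\<close>

lemma norm_sum_pderiv_le:
  fixes p :: "2 \<Rightarrow> real^'d::finite"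
  assumes g: "pos_sym g"
  shows "(norm (\<Sum>i\<in>UNIV. u $ i *\<^sub>R p i))\<^sup>2 \<le>
    (\<Sum>k\<in>UNIV. (\<chi> i. p i $ k) \<bullet> (matrix_inv g *v (\<chi> i. p i $ k))) * (u \<bullet> (g *v u))"
proof -
  have "(norm (\<Sum>i\<in>UNIV. u $ i *\<^sub>R p i))\<^sup>2 = (\<Sum>k\<in>UNIV. (u \<bullet> (\<chi> i. p i $ k))\<^sup>2)"
    unfolding power2_norm_eq_inner by (simp add: inner_vec_def power2_eq_square)
  also have "\<dots> \<le> (\<Sum>k\<in>UNIV. ((\<chi> i. p i $ k) \<bullet> (matrix_inv g *v (\<chi> i. p i $ k))) * (u \<bullet> (g *v u)))"
  proof (rule sum_mono)
    fix k
    let ?a = "\<chi> i. p i $ k"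
    let ?w = "matrix_inv g *v ?a"
    have w: "g *v ?w = ?a" by (rule matrix_inv_apply[OF pos_sym_invertible[OF g]])
    have "(u \<bullet> ?a)\<^sup>2 = (u \<bullet> (g *v ?w))\<^sup>2" by (simp only: w)
    also have "\<dots> \<le> (u \<bullet> (g *v u)) * (?w \<bullet> (g *v ?w))" by (rule pos_sym_Cauchy_Schwarz[OF g])
    also have "\<dots> = (?a \<bullet> ?w) * (u \<bullet> (g *v u))" unfolding w by (simp add: inner_commute mult.commute)
    finally show "(u \<bullet> ?a)\<^sup>2 \<le> (?a \<bullet> ?w) * (u \<bullet> (g *v u))" .
  qed
  finally show ?thesis by (simp add: sum_distrib_right)
qed

context metric_on_immersions
begin

lemma G_nonneg:
  assumes f: "f \<in> U" and h: "h \<in> H"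
  shows "0 \<le> G f h h"
proof (cases "h = (\<lambda>x. 0)")
  case True
  obtain B K \<delta> where G1: "\<And>h k w. h \<in> H \<Longrightarrow> k \<in> H \<Longrightarrow> w \<in> H \<Longrightarrow> G f (\<lambda>x. h x - k x) w = G f h w - G f k w"
    by (rule G_regularity[OF f]) blast
  show ?thesis using G1[OF h h h] True by simp
next
  case False
  have "\<forall>f\<in>U. \<forall>h\<in>H. h \<noteq> (\<lambda>x. 0) \<longrightarrow> G f h h > 0"
    using G unfolding smooth_riemannian_metric_def by blast
  then have "G f h h > 0" using f h False by blast
  then show ?thesis by simp
qed

lemma continuous_fiber_inner_nabla:
  assumes f: "f \<in> U" and h: "h \<in> H" and c: "c \<in> A"
  shows "continuous_on (cdom c) (\<lambda>x. fiber_inner (pullback_metric f c x) 0 1 1 (nabla h c x) (nabla h c x))"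
proof -
  have nz: "det (pullback_metric f c x) \<noteq> 0" if "x \<in> cdom c" for x
    using pos_sym_invertible[OF pos_sym_pullback_metric[OF f c that]] by (simp add: invertible_det_nz)
  have "continuous_on (cdom c) (\<lambda>x. nabla h c x I J K)" for I J K
    unfolding nabla_def using continuous_pderiv_chart[OF l h c] by (intro continuous_intros)
  moreover have "continuous_on (cdom c) (\<lambda>x. fiber_gram (pullback_metric f c x) 0 1 1 I J K I' J' K')"
    for I J I' J' :: "2 list" and K K' :: "'d list"
    by (rule continuous_on_fiber_gram[OF continuous_pullback_metric[OF l U_H[OF f] c] nz])
  ultimately show ?thesis
    unfolding fiber_inner_def by (intro continuous_on_sum continuous_on_mult)
qed

lemma open_cmap_image:
  assumes c: "c \<in> A" and W: "open W" "W \<subseteq> cdom c"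
  shows "open (cmap c ` W)"
proof -
  have "cmap c ` W = cimg c \<inter> cinv c -` W"
  proof (intro equalityI subsetI)
    fix y assume "y \<in> cmap c ` W"
    then show "y \<in> cimg c \<inter> cinv c -` W" using W(2) cmap_in[OF c] cinv_cmap[OF c] by auto
  next
    fix y assume "y \<in> cimg c \<inter> cinv c -` W"
    then show "y \<in> cmap c ` W" using cmap_cinv[OF c, of y] by (intro image_eqI[of _ _ "cinv c y"]) auto
  qed
  then show ?thesis
    using continuous_open_preimage[OF continuous_cinv[OF c] open_cimg[OF c] W(1)] by simp
qed

text \<open>The hypothesis bounds only the essential supremum. Since the pointwise norm is continuous, a
bound that fails somewhere would fail on a nonempty open set, which is not negligible.\<close>

lemma nabla_pointwise:
  assumes f: "f \<in> U" and h: "h \<in> H" and c: "c \<in> A" "x \<in> cdom c"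
  shows "sqrt (fiber_inner (pullback_metric f c x) 0 1 1 (nabla h c x) (nabla h c x)) \<le> sqrt (G f h h) / c0"
proof (rule dense_ge)
  fix r assume r: "sqrt (G f h h) / c0 < r"
  define \<phi> where "\<phi> c x = sqrt (fiber_inner (pullback_metric f c x) 0 1 1 (nabla h c x) (nabla h c x))" for c x
  let ?S = "{s. \<forall>c\<in>A. negligible (cmap c ` {x \<in> cdom c. s < ennreal (\<phi> c x)})}"
  have L: "Linf_norm A (pullback_metric f) 0 1 1 (nabla h) = Inf ?S"
    unfolding Linf_norm_def \<phi>_def ..
  have q0: "0 \<le> sqrt (G f h h)" using G_nonneg[OF f h] by simp
  have r0: "0 < r" using r divide_nonneg_pos[OF q0 c0] by linarith
  have lt: "sqrt (G f h h) < c0 * r" using r c0 by (simp add: field_simps)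
  have "Inf ?S < ennreal r"
  proof (rule ccontr)
    assume "\<not> Inf ?S < ennreal r"
    then have "ennreal c0 * ennreal r \<le> ennreal c0 * Inf ?S" by (intro mult_left_mono) auto
    also have "\<dots> \<le> ennreal (sqrt (G f h h))" using G_bound[OF f h] unfolding L .
    finally have "ennreal (c0 * r) \<le> ennreal (sqrt (G f h h))" using c0 r0 by (simp add: ennreal_mult)
    then show False using lt q0 by (simp add: ennreal_le_iff)
  qed
  then obtain s where s: "s \<in> ?S" "s < ennreal r"
    unfolding Inf_less_iff by blast
  define W where "W = {x \<in> cdom c. r < \<phi> c x}"
  have cont: "continuous_on (cdom c) (\<phi> c)"
    unfolding \<phi>_def by (intro continuous_on_real_sqrt continuous_fiber_inner_nabla[OF f h c(1)])
  have "W = cdom c \<inter> \<phi> c -` {r<..}" by (auto simp: W_def)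
  then have W: "open W" using continuous_open_preimage[OF cont open_cdom[OF c(1)] open_greaterThan] by simp
  then have o: "open (cmap c ` W)" by (rule open_cmap_image[OF c(1)]) (auto simp: W_def)
  have "negligible (cmap c ` {x \<in> cdom c. s < ennreal (\<phi> c x)})"
    using s(1) c(1) by blast
  moreover have "W \<subseteq> {x \<in> cdom c. s < ennreal (\<phi> c x)}"
  proof
    fix z assume "z \<in> W"
    then have z: "z \<in> cdom c" "r < \<phi> c z" by (simp_all add: W_def)
    have "s < ennreal (\<phi> c z)"
      by (rule less_le_trans[OF s(2) ennreal_leI]) (use z(2) in simp)
    then show "z \<in> {x \<in> cdom c. s < ennreal (\<phi> c x)}" using z(1) by simp
  qed
  ultimately have "negligible (cmap c ` W)"
    by (meson negligible_subset image_mono)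
  then have "W = {}" using open_not_negligible[OF o] by blast
  then have "\<not> r < \<phi> c x" using c(2) by (auto simp: W_def)
  then show "sqrt (fiber_inner (pullback_metric f c x) 0 1 1 (nabla h c x) (nabla h c x)) \<le> r"
    by (simp add: \<phi>_def)
qed

text \<open>For fixed \<open>u\<close> the function \<open>\<phi> = g(u,u) = |X|\<^sup>2\<close> has derivative \<open>2 X \<bullet> X'\<close>, where \<open>X\<close> and \<open>X'\<close>
are the derivatives of the map and of the velocity along \<open>u\<close>. The norm of \<open>X'\<close> is at most the speed
divided by \<open>c0\<close>, times the norm of \<open>X\<close>.\<close>

lemma quasi_isometric_path:
  assumes p: "C1_path H N U \<gamma> v" and cc: "(c, a, b) \<in> C" and y: "y \<in> box a b"
  shows "quasi_isometric (2 / c0 * integral {0..1} (\<lambda>t. sqrt (G (\<gamma> t) (v t) (v t))))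
    (pullback_metric (\<gamma> 0) c (cinv c y)) (pullback_metric (\<gamma> 1) c (cinv c y))"
  unfolding quasi_isometric_def
proof (rule allI)
  fix u :: "real^2"
  note H = C1_pathD[OF p]
  have c: "c \<in> A" "y \<in> cimg c" using cell[OF cc] y box_subset_cbox[of a b] by auto
  have x: "cinv c y \<in> cdom c" "cmap c (cinv c y) = y" using cinv_in[OF c] cmap_cinv[OF c] by auto
  define s where "s t = sqrt (G (\<gamma> t) (v t) (v t))" for t
  define X where "X t = (\<Sum>i\<in>UNIV. u $ i *\<^sub>R pderiv_at i (\<gamma> t \<circ> cinv c) y)" for t
  define X' where "X' t = (\<Sum>i\<in>UNIV. u $ i *\<^sub>R pderiv_at i (v t \<circ> cinv c) y)" for t
  define \<phi> where "\<phi> t = X t \<bullet> X t" for t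
  have quad: "u \<bullet> (pullback_metric (\<gamma> t) c (cinv c y) *v u) = \<phi> t" for t
    unfolding pullback_quadratic_form x(2) \<phi>_def X_def power2_norm_eq_inner ..
  have sc: "continuous_on {0..1} s" unfolding s_def by (rule speed_continuous[OF p])
  have X: "(X has_vector_derivative X' t) (at t within {0..1})" if "t \<in> {0..1}" for t
    unfolding X_def X'_def using path_pderiv_derivative[OF p cc y that]
    by (intro has_vector_derivative_sum) (auto intro: bounded_linear.has_vector_derivative[OF
        bounded_linear_scaleR_right])
  have der: "(\<phi> has_real_derivative 2 * (X t \<bullet> X' t)) (at t within {0..1})" if "t \<in> {0..1}" for t
  proof -
    have "((\<lambda>t. X t \<bullet> X t) has_derivative (\<lambda>h. X t \<bullet> (h *\<^sub>R X' t) + (h *\<^sub>R X' t) \<bullet> X t)) (at t within {0..1})"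
      using X[OF that] unfolding has_vector_derivative_def by (intro has_derivative_inner)
    moreover have "(\<lambda>h. X t \<bullet> (h *\<^sub>R X' t) + (h *\<^sub>R X' t) \<bullet> X t) = (*) (2 * (X t \<bullet> X' t))"
      by (simp add: fun_eq_iff inner_commute)
    ultimately show ?thesis
      unfolding \<phi>_def[abs_def] has_field_derivative_def by simp
  qed
  have le: "\<bar>2 * (X t \<bullet> X' t)\<bar> \<le> 2 / c0 * s t * \<phi> t" if t: "t \<in> {0..1}" for t
  proof -
    let ?g = "pullback_metric (\<gamma> t) c (cinv c y)"
    let ?F = "fiber_inner ?g 0 1 1 (nabla (v t) c (cinv c y)) (nabla (v t) c (cinv c y))"
    note g = pos_sym_pullback_metric[OF H(1)[OF t] c(1) x(1)]
    have F: "sqrt ?F \<le> s t / c0"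
      unfolding s_def by (rule nabla_pointwise[OF H(1,2)[OF t] c(1) x(1)])
    have "(norm (X' t))\<^sup>2 \<le> ?F * \<phi> t"
      using norm_sum_pderiv_le[OF g, of u "\<lambda>i. pderiv_at i (v t \<circ> cinv c) y"]
      unfolding fiber_inner_nabla x(2) quad X'_def .
    then have "sqrt ((norm (X' t))\<^sup>2) \<le> sqrt (?F * \<phi> t)" by (rule real_sqrt_le_mono)
    also have "\<dots> = sqrt ?F * norm (X t)" by (simp add: real_sqrt_mult \<phi>_def norm_eq_sqrt_inner)
    also have "\<dots> \<le> s t / c0 * norm (X t)" using F by (rule mult_right_mono) simp
    finally have n: "norm (X' t) \<le> s t / c0 * norm (X t)" by simp
    have "\<bar>X t \<bullet> X' t\<bar> \<le> norm (X t) * norm (X' t)" by (rule Cauchy_Schwarz_ineq2)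
    also have "\<dots> \<le> norm (X t) * (s t / c0 * norm (X t))" using n by (rule mult_left_mono) simp
    also have "\<dots> = s t / c0 * \<phi> t" by (simp add: \<phi>_def dot_square_norm power2_eq_square)
    finally have "2 * \<bar>X t \<bullet> X' t\<bar> \<le> 2 * (s t / c0 * \<phi> t)" by simp
    then show ?thesis by (simp add: abs_mult)
  qed
  show "u \<bullet> (pullback_metric (\<gamma> 1) c (cinv c y) *v u) \<le> exp (2 / c0 * integral {0..1} (\<lambda>t. sqrt (G (\<gamma> t) (v t)
      (v t)))) * (u \<bullet> (pullback_metric (\<gamma> 0) c (cinv c y) *v u)) \<and>
     u \<bullet> (pullback_metric (\<gamma> 0) c (cinv c y) *v u) \<le> exp (2 / c0 * integral {0..1} (\<lambda>t. sqrt (G (\<gamma> t) (v t) (v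
         t)))) * (u \<bullet> (pullback_metric (\<gamma> 1) c (cinv c y) *v u))"
    using log_derivative_bound[OF der sc le] unfolding quad s_def[abs_def] by blast
qed

lemma path_length_nonneg:
  assumes p: "C1_path H N U \<gamma> v"
  shows "0 \<le> integral {0..1} (\<lambda>t. sqrt (G (\<gamma> t) (v t) (v t)))"
  using G_nonneg C1_pathD[OF p]
  by (intro integral_nonneg integrable_continuous_real speed_continuous[OF p]) simp

end

section \<open>Lipschitz dependence of the fiber metric on the metric\<close>

lemma prod_diff_le:
  fixes a b :: "nat \<Rightarrow> real"
  assumes "1 \<le> B" "0 \<le> \<delta>"
    and "\<And>n. n < p \<Longrightarrow> \<bar>a n\<bar> \<le> B" "\<And>n. n < p \<Longrightarrow> \<bar>b n\<bar> \<le> B" "\<And>n. n < p \<Longrightarrow> \<bar>a n - b n\<bar> \<le> \<delta>"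
  shows "\<bar>(\<Prod>n<p. a n) - (\<Prod>n<p. b n)\<bar> \<le> real p * B ^ p * \<delta>"
  using assms(3-5)
proof (induction p)
  case (Suc p)
  let ?a = "\<Prod>n<p. a n" and ?b = "\<Prod>n<p. b n"
  have IH: "\<bar>?a - ?b\<bar> \<le> real p * B ^ p * \<delta>" using Suc by simp
  have b: "\<bar>?b\<bar> \<le> B ^ p"
    unfolding abs_prod using prod_mono[of "{..<p}" "\<lambda>n. \<bar>b n\<bar>" "\<lambda>n. B"] Suc.prems by simp
  have "?a * a p - ?b * b p = (?a - ?b) * a p + ?b * (a p - b p)" by (simp add: algebra_simps)
  also have "\<bar>\<dots>\<bar> \<le> \<bar>?a - ?b\<bar> * \<bar>a p\<bar> + \<bar>?b\<bar> * \<bar>a p - b p\<bar>"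
    by (metis abs_mult abs_triangle_ineq)
  also have "\<dots> \<le> (real p * B ^ p * \<delta>) * B + B ^ p * \<delta>"
    using IH b Suc.prems assms(1,2) by (intro add_mono mult_mono) auto
  also have "\<dots> \<le> (real p * B ^ p * \<delta>) * B + (B ^ p * \<delta>) * B"
    using assms(1,2) mult_left_mono[of 1 B "B ^ p * \<delta>"] by simp
  also have "\<dots> = real (Suc p) * B ^ Suc p * \<delta>" by (simp add: algebra_simps)
  finally show ?case by simp
qed simp

lemma fiber_gram_diff_le:
  assumes B: "1 \<le> B" and \<delta>: "0 \<le> \<delta>"
    and g: "\<And>i j. \<bar>g $ i $ j\<bar> \<le> B" "\<And>i j. \<bar>matrix_inv g $ i $ j\<bar> \<le> B"
    and h: "\<And>i j. \<bar>h $ i $ j\<bar> \<le> B" "\<And>i j. \<bar>matrix_inv h $ i $ j\<bar> \<le> B"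
    and d: "\<And>i j. \<bar>g $ i $ j - h $ i $ j\<bar> \<le> \<delta>" "\<And>i j. \<bar>matrix_inv g $ i $ j - matrix_inv h $ i $ j\<bar> \<le> \<delta>"
  shows "\<bar>fiber_gram g p q r I J K I' J' K' - fiber_gram h p q r I J K I' J' K'\<bar> \<le> real (p + q) * (B ^ p * B ^ q) * \<delta>"
proof -
  let ?a = "\<lambda>g. \<Prod>n<p. g $ (I ! n) $ (I' ! n) :: real" and ?b = "\<lambda>g. \<Prod>n<q. matrix_inv g $ (J ! n) $ (J' ! n) :: real"
  let ?z = "\<Prod>n<r. if K ! n = K' ! n then 1 else 0 :: real"
  have z: "\<bar>?z\<bar> \<le> 1"
    unfolding abs_prod using prod_mono[of "{..<r}" "\<lambda>n. \<bar>if K ! n = K' ! n then 1 else 0 :: real\<bar>" "\<lambda>n. 1"] by simp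
  have a: "\<bar>?a g - ?a h\<bar> \<le> real p * B ^ p * \<delta>" by (intro prod_diff_le B \<delta> g h d)
  have b: "\<bar>?b g - ?b h\<bar> \<le> real q * B ^ q * \<delta>" by (intro prod_diff_le B \<delta> g h d)
  have ah: "\<bar>?a h\<bar> \<le> B ^ p" unfolding abs_prod using prod_mono[of "{..<p}" "\<lambda>n. \<bar>h $ (I ! n) $ (I' ! n)\<bar>" "\<lambda>n.
      B"] h by simp
  have bg: "\<bar>?b g\<bar> \<le> B ^ q" unfolding abs_prod using prod_mono[of "{..<q}" "\<lambda>n. \<bar>matrix_inv g $ (J ! n) $ (J' !
      n)\<bar>" "\<lambda>n. B"] g by simp
  have t1: "\<bar>?a g - ?a h\<bar> * \<bar>?b g\<bar> \<le> (real p * B ^ p * \<delta>) * B ^ q"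
    by (rule mult_mono[OF a bg]) (use B \<delta> in simp_all)
  have t2: "\<bar>?a h\<bar> * \<bar>?b g - ?b h\<bar> \<le> B ^ p * (real q * B ^ q * \<delta>)"
    by (rule mult_mono[OF ah b]) (use B \<delta> in simp_all)
  have eq: "fiber_gram g p q r I J K I' J' K' - fiber_gram h p q r I J K I' J' K' = ((?a g - ?a h) * ?b g + ?a h
      * (?b g - ?b h)) * ?z"
    unfolding fiber_gram_def by (simp add: algebra_simps)
  have "\<bar>fiber_gram g p q r I J K I' J' K' - fiber_gram h p q r I J K I' J' K'\<bar> \<le> (\<bar>?a g - ?a h\<bar> * \<bar>?b g\<bar> + \<bar>?a
      h\<bar> * \<bar>?b g - ?b h\<bar>) * 1"
    unfolding eq abs_mult by (intro mult_mono z order_trans[OF abs_triangle_ineq]) (simp_all add: abs_mult)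
  also have "\<dots> \<le> (real p * B ^ p * \<delta> * B ^ q + B ^ p * (real q * B ^ q * \<delta>)) * 1"
    unfolding mult_1_right by (rule add_mono[OF t1 t2])
  also have "\<dots> = real (p + q) * (B ^ p * B ^ q) * \<delta>" by (simp add: algebra_simps)
  finally show ?thesis .
qed

text \<open>For \<open>L \<le> 1\<close> the first bound is used, with \<open>exp \<kappa> - 1 \<le> \<kappa> exp \<kappa>\<close>; for \<open>L > 1\<close> the second bound
is already a multiple of \<open>L\<close>. The result is linear in \<open>L\<close> for paths of any length.\<close>

lemma exp_bound_Lipschitz:
  fixes M L c0 x :: real
  assumes M: "0 \<le> M" and L: "0 \<le> L" and c0: "0 < c0"
    and x: "x \<le> 4 * M * (exp (2 / c0 * L) - 1)" "x \<le> 2 * M"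
  shows "x \<le> (4 * M * (2 / c0 * exp (2 / c0)) + 2 * M) * L"
proof (cases "L \<le> 1")
  case True
  define \<kappa> where "\<kappa> = 2 / c0 * L"
  have \<kappa>: "0 \<le> \<kappa>" "\<kappa> \<le> 2 / c0" using L c0 True by (simp_all add: \<kappa>_def mult_left_le field_simps)
  have "(1 - \<kappa>) * exp \<kappa> \<le> exp (-\<kappa>) * exp \<kappa>"
    using exp_ge_add_one_self[of "-\<kappa>"] by (intro mult_right_mono) auto
  then have "exp \<kappa> - 1 \<le> \<kappa> * exp \<kappa>" by (simp add: exp_minus algebra_simps)
  also have "\<dots> \<le> \<kappa> * exp (2 / c0)" using \<kappa> by (intro mult_left_mono) auto
  finally have "4 * M * (exp \<kappa> - 1) \<le> 4 * M * (\<kappa> * exp (2 / c0))" using M by (intro mult_left_mono) auto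
  then have "x \<le> 4 * M * (2 / c0 * exp (2 / c0)) * L" using x(1) by (simp add: \<kappa>_def mult_ac)
  moreover have "0 \<le> 2 * M * L" using M L by simp
  ultimately show ?thesis by (simp only: distrib_right)
next
  case False
  have "x \<le> 2 * M" by (rule x(2))
  also have "\<dots> \<le> 2 * M * L" using False M by (simp add: mult_le_cancel_left1)
  finally have "x \<le> 2 * M * L" .
  moreover have "0 \<le> 4 * M * (2 / c0 * exp (2 / c0)) * L" using M L c0 by simp
  ultimately show ?thesis by (simp only: distrib_right)
qed

context metric_on_immersions
begin

abbreviation len :: "(real \<Rightarrow> 'm \<Rightarrow> real^'d) \<Rightarrow> (real \<Rightarrow> 'm \<Rightarrow> real^'d) \<Rightarrow> real" where
  "len \<gamma> v \<equiv> integral {0..1} (\<lambda>t. sqrt (G (\<gamma> t) (v t) (v t)))"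

abbreviation path_between where
  "path_between f1 f2 \<gamma> v \<equiv> C1_path H N U \<gamma> v \<and> \<gamma> 0 = f1 \<and> \<gamma> 1 = f2"

lemma metric_bounds_along_path:
  assumes p: "C1_path H N U \<gamma> v" and cc: "(c, a, b) \<in> C" and y: "y \<in> box a b"
    and M: "\<And>i j. \<bar>pullback_metric (\<gamma> 0) c (cinv c y) $ i $ j\<bar> \<le> M" "\<And>i j. \<bar>matrix_inv (pullback_metric (\<gamma> 0) c
        (cinv c y)) $ i $ j\<bar> \<le> M"
  shows "\<bar>pullback_metric (\<gamma> 0) c (cinv c y) $ i $ j - pullback_metric (\<gamma> 1) c (cinv c y) $ i $ j\<bar> \<le> 4 * M *
      (exp (2 / c0 * len \<gamma> v) - 1)"
    and "\<bar>matrix_inv (pullback_metric (\<gamma> 0) c (cinv c y)) $ i $ j - matrix_inv (pullback_metric (\<gamma> 1) c (cinv c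
        y)) $ i $ j\<bar> \<le> 4 * M * (exp (2 / c0 * len \<gamma> v) - 1)"
proof -
  have c: "c \<in> A" "y \<in> cimg c" using cell[OF cc] y box_subset_cbox[of a b] by auto
  have x: "cinv c y \<in> cdom c" using cinv_in[OF c] .
  have ps: "pos_sym (pullback_metric (\<gamma> t) c (cinv c y))" if "t \<in> {0..1}" for t
    by (rule pos_sym_pullback_metric[OF C1_pathD(1)[OF p that] c(1) x])
  note p0 = ps[of 0, simplified] and p1 = ps[of 1, simplified]
  note q = quasi_isometric_path[OF p cc y]
  have \<kappa>: "0 \<le> 2 / c0 * len \<gamma> v" using path_length_nonneg[OF p] c0 by simp
  show "\<bar>pullback_metric (\<gamma> 0) c (cinv c y) $ i $ j - pullback_metric (\<gamma> 1) c (cinv c y) $ i $ j\<bar> \<le> 4 * M * (exp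
      (2 / c0 * len \<gamma> v) - 1)"
    by (rule quasi_isometric_entries[OF p0 p1 q \<kappa> M(1)])
  show "\<bar>matrix_inv (pullback_metric (\<gamma> 0) c (cinv c y)) $ i $ j - matrix_inv (pullback_metric (\<gamma> 1) c (cinv c
      y)) $ i $ j\<bar> \<le> 4 * M * (exp (2 / c0 * len \<gamma> v) - 1)"
    by (rule quasi_isometric_entries[OF pos_sym_matrix_inv[OF p0] pos_sym_matrix_inv[OF p1]
        quasi_isometric_matrix_inv[OF p0 p1 q] \<kappa> M(2)])
qed

definition bounded_metric :: "real \<Rightarrow> ('m \<Rightarrow> real^'d) \<Rightarrow> bool" where
  "bounded_metric M f \<longleftrightarrow> (\<forall>c a b y i j. (c, a, b) \<in> C \<longrightarrow> y \<in> box a b \<longrightarrow>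
     \<bar>pullback_metric f c (cinv c y) $ i $ j\<bar> \<le> M \<and> \<bar>matrix_inv (pullback_metric f c (cinv c y)) $ i $ j\<bar> \<le> M)"

lemma bounded_metricD:
  assumes "bounded_metric M f" "(c, a, b) \<in> C" "y \<in> box a b"
  shows "\<bar>pullback_metric f c (cinv c y) $ i $ j\<bar> \<le> M" "\<bar>matrix_inv (pullback_metric f c (cinv c y)) $ i $ j\<bar> \<le> M"
  using assms unfolding bounded_metric_def by blast+

lemma bounded_metric_ex:
  assumes f: "f \<in> U"
  shows "\<exists>M\<ge>1. bounded_metric M f"
proof -
  obtain M where "M \<ge> 1" and M: "\<forall>c a b y. (c, a, b) \<in> C \<longrightarrow> y \<in> cbox a b \<longrightarrow>
      (\<forall>i j. \<bar>pullback_metric f c (cinv c y) $ i $ j\<bar> \<le> M \<and> \<bar>matrix_inv (pullback_metric f c (cinv c y)) $ i $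
          j\<bar> \<le> M)"
    using metric_bounded_on_cells[of "pullback_metric f", OF continuous_pullback_metric[OF l U_H[OF f]]
        pos_sym_invertible[OF pos_sym_pullback_metric[OF f]]]
    by blast
  have "bounded_metric M f"
    unfolding bounded_metric_def
  proof (intro allI impI)
    fix c a b y i j assume "(c, a, b) \<in> C" "y \<in> box a b"
    then show "\<bar>pullback_metric f c (cinv c y) $ i $ j\<bar> \<le> M \<and> \<bar>matrix_inv (pullback_metric f c (cinv c y)) $ i $
        j\<bar> \<le> M"
      using M[rule_format, of c a b y i j] box_subset_cbox[of a b] by blast
  qed
  then show ?thesis using \<open>M \<ge> 1\<close> by blast
qed

lemma geodesic_dist_lessD:
  assumes "geodesic_dist H N U G f1 f2 < ennreal R"
  shows "\<exists>\<gamma> v. path_between f1 f2 \<gamma> v \<and> len \<gamma> v < R"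
proof -
  obtain \<gamma> v where p: "path_between f1 f2 \<gamma> v" "ennreal (len \<gamma> v) < ennreal R"
    using assms unfolding geodesic_dist_def Inf_less_iff by blast
  then have "len \<gamma> v < R"
    using path_length_nonneg[of \<gamma> v] by (simp add: ennreal_less_iff)
  then show ?thesis using p by blast
qed

lemma bounded_metric_on_ball:
  assumes f0: "f0 \<in> U"
  shows "\<exists>M\<ge>1. \<forall>f. geodesic_dist H N U G f0 f < ennreal R \<longrightarrow> bounded_metric M f"
proof -
  obtain M where M: "M \<ge> 1" "bounded_metric M f0" using bounded_metric_ex[OF f0] by blast
  \<comment> \<open>the maximum with 1 covers the case of a radius \<open>R \<le> 0\<close>, in which the ball is empty\<close>
  define E where "E = max 1 (exp (2 / c0 * R))"
  define M' where "M' = M + 4 * M * (E - 1)"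
  have E1: "1 \<le> E" by (simp add: E_def)
  then have "0 \<le> 4 * M * (E - 1)" using M(1) by (intro mult_nonneg_nonneg) auto
  then have M1: "1 \<le> M'" using M(1) unfolding M'_def by linarith
  have "bounded_metric M' f" if dist: "geodesic_dist H N U G f0 f < ennreal R" for f
  proof -
    obtain \<gamma> v where p: "C1_path H N U \<gamma> v" "\<gamma> 0 = f0" "\<gamma> 1 = f" and len: "len \<gamma> v < R"
      using geodesic_dist_lessD[OF dist] by blast
    have "2 / c0 * len \<gamma> v \<le> 2 / c0 * R" using len c0 by (intro mult_left_mono) auto
    then have "exp (2 / c0 * len \<gamma> v) \<le> E" by (simp add: E_def le_max_iff_disj)
    then have e: "4 * M * (exp (2 / c0 * len \<gamma> v) - 1) \<le> 4 * M * (E - 1)"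
      using M(1) by (intro mult_left_mono) auto
    show ?thesis
      unfolding bounded_metric_def
    proof (intro allI impI)
      fix c a b y i j assume cc: "(c, a, b) \<in> C" and y: "y \<in> box a b"
      note m = bounded_metricD[OF M(2) cc y]
      note d = metric_bounds_along_path[OF p(1) cc y, unfolded p(2,3), OF m, of i j]
      show "\<bar>pullback_metric f c (cinv c y) $ i $ j\<bar> \<le> M' \<and> \<bar>matrix_inv (pullback_metric f c (cinv c y)) $ i $
          j\<bar> \<le> M'"
        using d e m(1)[of i j] m(2)[of i j] unfolding M'_def by linarith
    qed
  qed
  then show ?thesis using M1 by blast
qed

lemma invertible_pullback: "f \<in> U \<Longrightarrow> c \<in> A \<Longrightarrow> x \<in> cdom c \<Longrightarrow> invertible (pullback_metric f c x)"
  by (rule pos_sym_invertible[OF pos_sym_pullback_metric])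

lemma tensor_field_fiber_pullback:
  fixes f :: "'m \<Rightarrow> real^'d"
  assumes f: "f \<in> U"
  shows "tensor_field A (2 * j) (2 * i) (2 * m) (fiber_metric_tensor (pullback_metric f) i j m :: ('m, 'd) tfield)"
  by (rule tensor_field_fiber_metric[OF metric_law_pullback[OF ImmD(2)[OF f]] invertible_pullback[OF f]])

text \<open>Every path between two points of the ball gives an estimate by its length, with a constant
that depends only on the ball. Taking the infimum over all paths yields the distance, also when
there are no paths.\<close>

lemma fiber_metric_Lipschitz:
  assumes gbar: "riemannian_metric A gbar"
  shows "lipschitz_bounded_on_balls U (geodesic_dist H N U G) (Linf_norm A gbar (2 * j) (2 * i) (2 * m))
    (\<lambda>f. fiber_metric_tensor (pullback_metric f) i j m :: ('m, 'd) tfield)"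
  unfolding lipschitz_bounded_on_balls_def Let_def
proof (intro ballI allI)
  fix f0 :: "'m \<Rightarrow> real^'d" and R :: real
  assume f0: "f0 \<in> U"
  let ?F = "\<lambda>f. fiber_metric_tensor (pullback_metric f) i j m :: ('m, 'd) tfield"
  let ?dist = "geodesic_dist H N U G"
  let ?norm = "Linf_norm A gbar (2 * j) (2 * i) (2 * m) :: ('m, 'd) tfield \<Rightarrow> ennreal"
  obtain M where M: "M \<ge> 1" "\<And>f. ?dist f0 f < ennreal R \<Longrightarrow> bounded_metric M f"
    using bounded_metric_on_ball[OF f0, of R] by blast
  obtain K where K: "K \<ge> 0" and norm_le: "\<forall>\<tau> :: ('m, 'd) tfield. \<forall>s\<ge>0. tensor_field A (2 * j) (2 * i) (2 * m) \<tau> \<longrightarrow>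
    (\<forall>c a b y I J K. (c, a, b) \<in> C \<longrightarrow> y \<in> box a b \<longrightarrow> length I = 2 * j \<longrightarrow> length J = 2 * i \<longrightarrow> length K = 2 * m \<longrightarrow> \<bar>\<tau> c
        (cinv c y) I J K\<bar> \<le> s)
    \<longrightarrow> ?norm \<tau> \<le> ennreal (K * s)"
    using Linf_norm_le_cells[OF gbar, of "2 * j" "2 * i" "2 * m", where 'd = 'd] by blast
  define K1 where "K1 = 4 * M * (2 / c0 * exp (2 / c0)) + 2 * M"
  have K1: "0 \<le> K1" using M(1) c0 by (simp add: K1_def)
  \<comment> \<open>the summand 1 makes \<open>K2\<close> positive, so that \<open>K2\<close> times an infinite distance is infinite\<close>
  define K2 where "K2 = K * (real (i + j) * (M ^ i * M ^ j) * K1) + 1"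
  have K2: "K2 > 0" using K K1 M(1) by (simp add: K2_def add_nonneg_pos)
  have path_le: "?norm (tdiff (?F f1) (?F f2)) \<le> ennreal K2 * ennreal (len \<gamma> v)"
    if f: "f1 \<in> U" "?dist f0 f1 < ennreal R" "f2 \<in> U" "?dist f0 f2 < ennreal R" and p: "path_between f1 f2 \<gamma> v"
        for f1 f2 \<gamma> v
  proof -
    have p': "C1_path H N U \<gamma> v" "\<gamma> 0 = f1" "\<gamma> 1 = f2" using p by auto
    define L where "L = len \<gamma> v"
    have L: "0 \<le> L" unfolding L_def by (rule path_length_nonneg[OF p'(1)])
    have tf: "tensor_field A (2 * j) (2 * i) (2 * m) (tdiff (?F f1) (?F f2))"
      unfolding tdiff_eq_tensor_lincomb by (intro tensor_field_tensor_lincomb tensor_field_fiber_pullback f)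
    have "?norm (tdiff (?F f1) (?F f2)) \<le> ennreal (K * (real (i + j) * (M ^ i * M ^ j) * (K1 * L)))"
    proof (rule norm_le[rule_format, OF _ tf])
      show "0 \<le> real (i + j) * (M ^ i * M ^ j) * (K1 * L)" using M(1) K1 L by simp
      fix c a b y and I J :: "2 list" and Ka :: "'d list"
      assume cc: "(c, a, b) \<in> C" and y: "y \<in> box a b"
      note m1 = bounded_metricD[OF M(2)[OF f(2)] cc y] and m2 = bounded_metricD[OF M(2)[OF f(4)] cc y]
      note d = metric_bounds_along_path[OF p'(1) cc y, unfolded p'(2,3), OF m1]
      have e1: "\<bar>pullback_metric f1 c (cinv c y) $ k $ n - pullback_metric f2 c (cinv c y) $ k $ n\<bar> \<le> K1 * L" for k n
        unfolding K1_def using M(1) m1(1)[of k n] m2(1)[of k n] d(1)[of k n]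
        by (intro exp_bound_Lipschitz L c0) (auto simp: L_def)
      have e2: "\<bar>matrix_inv (pullback_metric f1 c (cinv c y)) $ k $ n - matrix_inv (pullback_metric f2 c (cinv c
          y)) $ k $ n\<bar> \<le> K1 * L" for k n
        unfolding K1_def using M(1) m1(2)[of k n] m2(2)[of k n] d(2)[of k n]
        by (intro exp_bound_Lipschitz L c0) (auto simp: L_def)
      show "\<bar>tdiff (?F f1) (?F f2) c (cinv c y) I J Ka\<bar> \<le> real (i + j) * (M ^ i * M ^ j) * (K1 * L)"
        unfolding tdiff_def fiber_metric_tensor_def
        using K1 L by (intro fiber_gram_diff_le M(1) m1 m2 e1 e2) simp
    qed
    also have "\<dots> \<le> ennreal (K2 * L)"
      using L by (intro ennreal_leI) (simp add: K2_def algebra_simps)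
    also have "\<dots> = ennreal K2 * ennreal (len \<gamma> v)"
      using K2 L by (simp add: ennreal_mult L_def)
    finally show ?thesis .
  qed
  have lip: "?norm (tdiff (?F f1) (?F f2)) \<le> ennreal K2 * ?dist f1 f2"
    if f: "f1 \<in> U" "?dist f0 f1 < ennreal R" "f2 \<in> U" "?dist f0 f2 < ennreal R" for f1 f2
  proof -
    have K2': "ennreal K2 \<noteq> 0" "ennreal K2 \<noteq> top" "0 < ennreal K2" "ennreal K2 < top" using K2 by (auto simp:
        ennreal_eq_0_iff)
    have "?norm (tdiff (?F f1) (?F f2)) / ennreal K2 \<le> ?dist f1 f2"
      unfolding geodesic_dist_def
    proof (rule Inf_greatest)
      fix z assume "z \<in> {ennreal (len \<gamma> v) |\<gamma> v. path_between f1 f2 \<gamma> v}"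
      then obtain \<gamma> v where z: "z = ennreal (len \<gamma> v)" "path_between f1 f2 \<gamma> v" by blast
      show "?norm (tdiff (?F f1) (?F f2)) / ennreal K2 \<le> z"
        unfolding z(1) using path_le[OF f z(2)] K2' by (intro divide_le_posI_ennreal) (auto simp: mult.commute)
    qed
    then have "ennreal K2 * (?norm (tdiff (?F f1) (?F f2)) / ennreal K2) \<le> ennreal K2 * ?dist f1 f2"
      by (rule mult_left_mono) simp
    moreover have "ennreal K2 * (?norm (tdiff (?F f1) (?F f2)) / ennreal K2) = ?norm (tdiff (?F f1) (?F f2))"
      unfolding ennreal_times_divide
      by (subst mult.commute) (rule mult_divide_eq_ennreal[OF K2'(1,2)])
    ultimately show ?thesis by simp
  qed
  have bdd: "?norm (?F f) \<le> ennreal (K * (M ^ i * M ^ j))" if f: "f \<in> U" "?dist f0 f < ennreal R" for f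
  proof (rule norm_le[rule_format, OF _ tensor_field_fiber_pullback[OF f(1)]])
    show "0 \<le> M ^ i * M ^ j" using M(1) by simp
    fix c a b y and I J :: "2 list" and Ka :: "'d list"
    assume cc: "(c, a, b) \<in> C" and y: "y \<in> box a b"
    show "\<bar>?F f c (cinv c y) I J Ka\<bar> \<le> M ^ i * M ^ j"
      unfolding fiber_metric_tensor_def
      by (intro abs_fiber_gram_le M(1) bounded_metricD[OF M(2)[OF f(2)] cc y])
  qed
  show "(\<exists>K\<ge>0. \<forall>f1\<in>{f \<in> U. ?dist f0 f < ennreal R}. \<forall>f2\<in>{f \<in> U. ?dist f0 f < ennreal R}.
           ?norm (tdiff (?F f1) (?F f2)) \<le> ennreal K * ?dist f1 f2) \<and>
        (\<exists>K. \<forall>f\<in>{f \<in> U. ?dist f0 f < ennreal R}. ?norm (?F f) \<le> ennreal K)"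
  proof (intro conjI)
    show "\<exists>K\<ge>0. \<forall>f1\<in>{f \<in> U. ?dist f0 f < ennreal R}. \<forall>f2\<in>{f \<in> U. ?dist f0 f < ennreal R}.
           ?norm (tdiff (?F f1) (?F f2)) \<le> ennreal K * ?dist f1 f2"
      using K2 by (intro exI[of _ K2] conjI ballI lip) auto
    show "\<exists>K. \<forall>f\<in>{f \<in> U. ?dist f0 f < ennreal R}. ?norm (?F f) \<le> ennreal K"
      by (intro exI[of _ "K * (M ^ i * M ^ j)"] ballI bdd) auto
  qed
qed

end

section \<open>Membership in Sobolev spaces of tensor fields\<close>

lemma l2sq_degenerate: "box a b = {} \<Longrightarrow> l2sq a b u = 0"
  unfolding l2sq_def by (rule integral_null) (simp add: content_eq_0_interior)

lemma sobolev_Cauchy_shift: "sobolev_Cauchy S a b k u \<Longrightarrow> sobolev_Cauchy S a b k (\<lambda>n. u (n + N))"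
proof (induction k arbitrary: u)
  have L: "L2_Cauchy a b (\<lambda>n. u (n + N))" if "L2_Cauchy a b u" for u
  proof -
    have v: "vanishes2 (\<lambda>m n. l2sq a b (\<lambda>y. u m y - u n y))" using that by (simp add: L2_Cauchy_def)
    have "vanishes2 (\<lambda>m n. l2sq a b (\<lambda>y. u (m + N) y - u (n + N) y))"
      unfolding vanishes2_def
    proof (intro allI impI)
      fix e :: real assume "e > 0"
      obtain M where M: "\<And>m n. m \<ge> M \<Longrightarrow> n \<ge> M \<Longrightarrow> \<bar>l2sq a b (\<lambda>y. u m y - u n y)\<bar> < e"
        by (rule vanishes2D[OF v \<open>e > 0\<close>]) blast
      then show "\<exists>M. \<forall>m\<ge>M. \<forall>n\<ge>M. \<bar>l2sq a b (\<lambda>y. u (m + N) y - u (n + N) y)\<bar> < e"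
        by (intro exI[of _ M] allI impI M) auto
    qed
    then show ?thesis using that by (simp add: L2_Cauchy_def)
  qed
  { case 0
    then show ?case using L by simp
  next
    case (Suc k)
    have "sobolev_Cauchy S a b k (\<lambda>n. pderiv_at i (u (n + N)))" for i
      by (rule Suc.IH[OF sobolev_Cauchy_pderiv[OF Suc.prems]])
    then show ?case using Suc.prems L[of u] by simp
  }
qed

lemma tendsto_fiber_gram:
  fixes h :: "nat \<Rightarrow> real^2^2"
  assumes h: "\<And>i j. (\<lambda>n. h n $ i $ j) \<longlonglongrightarrow> g $ i $ j" and nz: "\<And>n. det (h n) \<noteq> 0" "det g \<noteq> 0"
  shows "(\<lambda>n. fiber_gram (h n) p q r I J K I' J' K') \<longlonglongrightarrow> fiber_gram g p q r I J K I' J' K'"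
proof -
  have adj: "(\<lambda>n. adjugate (h n) i j) \<longlonglongrightarrow> adjugate g i j" for i j
    unfolding adjugate_def using h tendsto_minus[OF h, of i j] by (cases "i = j"; cases "i = 1") simp_all
  have det: "(\<lambda>n. det (h n)) \<longlonglongrightarrow> det g"
    unfolding det_2 by (intro tendsto_intros h)
  have "(\<lambda>n. matrix_inv (h n) $ i $ j) \<longlonglongrightarrow> matrix_inv g $ i $ j" for i j
    unfolding matrix_inv_2[OF nz(1)] matrix_inv_2[OF nz(2)]
    by (intro tendsto_mult adj tendsto_inverse det nz)
  then show ?thesis
    unfolding fiber_gram_def by (intro tendsto_mult tendsto_prod h tendsto_const)
qed

context surface
begin

text \<open>A criterion for membership: the components of the approximating fields are Cauchy in the
nondegenerate coordinate rectangles and converge pointwise in their interior. Rectangles with empty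
interior contribute nothing to the norms.\<close>

lemma sobolevI:
  fixes \<tau> :: "('m, 'd::finite) tfield"
  assumes k: "2 \<le> k" and \<sigma>: "\<And>n. smooth_tensor_field A p q r (\<sigma> n)" and \<tau>: "tensor_field A p q r \<tau>"
    and ca: "\<And>c a b I J K. (c, a, b) \<in> C \<Longrightarrow> box a b \<noteq> {} \<Longrightarrow> length I = p \<Longrightarrow> length J = q \<Longrightarrow> length K = r \<Longrightarrow>
      sobolev_Cauchy (cimg c) a b k (\<lambda>n y. \<sigma> n c (cinv c y) I J K)"
    and lim: "\<And>c a b I J K y. (c, a, b) \<in> C \<Longrightarrow> y \<in> box a b \<Longrightarrow> length I = p \<Longrightarrow> length J = q \<Longrightarrow> length K = r \<Longrightarrow>
      (\<lambda>n. \<sigma> n c (cinv c y) I J K) \<longlonglongrightarrow> \<tau> c (cinv c y) I J K"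
  shows "\<tau> \<in> sobolev A C k p q r"
proof -
  have v: "\<exists>v. continuous_on (cbox a b) v \<and> uniform_limit (cbox a b) (\<lambda>n y. \<sigma> n c (cinv c y) I J K) v sequentially \<and>
      (\<forall>y\<in>box a b. v y = \<tau> c (cinv c y) I J K)"
    if cc: "(c, a, b) \<in> C" and ne: "box a b \<noteq> {}" and len: "length I = p" "length J = q" "length K = r" for c a
        b I J K
  proof -
    let ?u = "\<lambda>n y. \<sigma> n c (cinv c y) I J K"
    have "sobolev_Cauchy (cimg c) a b (Suc (Suc 0)) ?u"
      using sobolev_Cauchy_mono[OF _ ca[OF cc ne len], of "Suc (Suc 0)"] k by simp
    then have sup: "sup_Cauchy a b ?u"
      by (rule rectangle_nbhd.sobolev_Cauchy_sup[OF rectangle_nbhd_cell[OF cc ne]])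
    obtain v where cv: "continuous_on (cbox a b) v" and v: "uniform_limit (cbox a b) ?u v sequentially"
      by (rule sup_Cauchy_uniform_limit[OF sup])
    have "v y = \<tau> c (cinv c y) I J K" if "y \<in> box a b" for y
    proof -
      have "(\<lambda>n. ?u n y) \<longlonglongrightarrow> v y"
        using tendsto_uniform_limitI[OF v] that box_subset_cbox[of a b] by blast
      then show ?thesis using lim[OF cc that len] LIMSEQ_unique by blast
    qed
    then show ?thesis using v cv by blast
  qed
  have cont: "continuous_tensor_field A p q r \<tau>"
  proof (rule continuous_tensor_fieldI[OF \<tau>])
    fix c a b and I J :: "2 list" and K :: "'d list"
    assume cc: "(c, a, b) \<in> C" and len: "length I = p" "length J = q" "length K = r"
    show "continuous_on (box a b) (\<lambda>y. \<tau> c (cinv c y) I J K)"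
    proof (cases "box a b = {}")
      case False
      obtain v where v: "continuous_on (cbox a b) v" "\<forall>y\<in>box a b. v y = \<tau> c (cinv c y) I J K"
        using v[OF cc False len] by blast
      show ?thesis
        by (rule continuous_on_eq[OF continuous_on_subset[OF v(1) box_subset_cbox]]) (use v(2) in blast)
    qed simp
  qed
  have L2: "(\<lambda>n. l2sq a b (\<lambda>y. \<sigma> n c (cinv c y) I J K - \<tau> c (cinv c y) I J K)) \<longlonglongrightarrow> 0"
    if cc: "(c, a, b) \<in> C" and len: "length I = p" "length J = q" "length K = r" for c a b I J K
  proof (cases "box a b = {}")
    case False
    obtain v where v: "continuous_on (cbox a b) v" "uniform_limit (cbox a b) (\<lambda>n y. \<sigma> n c (cinv c y) I J K) v
        sequentially"
      "\<forall>y\<in>box a b. v y = \<tau> c (cinv c y) I J K"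
      using v[OF cc False len] by blast
    have ct: "continuous_on (cbox a b) (\<lambda>y. \<tau> c (cinv c y) I J K)"
      by (rule continuous_tensor_field_cell[OF cont cc len])
    have vt: "v y = \<tau> c (cinv c y) I J K" if "y \<in> cbox a b" for y
      using continuous_constant_on_closure[of "box a b" "\<lambda>y. v y - \<tau> c (cinv c y) I J K" 0 y]
        continuous_on_diff[OF v(1) ct] v(3) that closure_box[OF False] by simp
    have "(\<lambda>n. l2sq a b (\<lambda>y. v y - \<sigma> n c (cinv c y) I J K)) \<longlonglongrightarrow> 0"
      by (rule L2_limit_if_uniform_limit[OF continuous_tensor_field_cell[OF
          smooth_imp_continuous_tensor_field[OF \<sigma>] cc len] v(1,2)])
    moreover have "l2sq a b (\<lambda>y. v y - \<sigma> n c (cinv c y) I J K) = l2sq a b (\<lambda>y. \<sigma> n c (cinv c y) I J K - \<tau> c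
        (cinv c y) I J K)" for n
    proof -
      have "l2sq a b (\<lambda>y. v y - \<sigma> n c (cinv c y) I J K) = l2sq a b (\<lambda>y. (-1) * (\<sigma> n c (cinv c y) I J K - \<tau> c
          (cinv c y) I J K))"
        by (rule l2sq_cong) (simp add: vt)
      then show ?thesis by (simp only: l2sq_cmult) simp
    qed
    ultimately show ?thesis by simp
  qed (simp add: l2sq_degenerate)
  have "sob_approx A C k p q r \<sigma> \<tau>"
    unfolding sob_approx_def
  proof (intro conjI allI impI \<sigma>)
    have "vanishes2 (\<lambda>m n. \<Sum>z\<in>sob_index C k p q r. sob_term (tdiff (\<sigma> m) (\<sigma> n)) z)"
    proof (rule vanishes2_sum[OF finite_sob_index[OF finite_C]])
      fix z assume z: "z \<in> (sob_index C k p q r :: (('m chart \<times> (real^2) \<times> (real^2)) \<times> 2 list \<times> 2 list \<times> 'd list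
          \<times> 2 list) set)"
      obtain c a b I J K "is" where ze: "z = ((c, a, b), I, J, K, is)" by (cases z) auto
      have m: "(c, a, b) \<in> C" "length I = p" "length J = q" "length K = r" "length is \<le> k"
        using z by (simp_all add: ze sob_index_def)
      have "vanishes2 (\<lambda>m n. l2sq a b (chart_deriv (tdiff (\<sigma> m) (\<sigma> n)) c I J K is))"
      proof (cases "box a b = {}")
        case True
        then show ?thesis by (simp add: l2sq_degenerate vanishes2_def)
      next
        case False
        have "L2_Cauchy a b (\<lambda>n. chart_deriv (\<sigma> n) c I J K is)"
          using ca[OF m(1) False m(2-4)] m(5) unfolding sobolev_Cauchy_iff_iter_pderiv chart_deriv_def by blast
        then have "vanishes2 (\<lambda>m n. l2sq a b (\<lambda>y. chart_deriv (\<sigma> m) c I J K is y - chart_deriv (\<sigma> n) c I J K is y))"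
          by (simp add: L2_Cauchy_def)
        moreover have "l2sq a b (\<lambda>y. chart_deriv (\<sigma> i) c I J K is y - chart_deriv (\<sigma> j) c I J K is y) = l2sq a b
            (chart_deriv (tdiff (\<sigma> i) (\<sigma> j)) c I J K is)" for i j
          unfolding tdiff_eq_tensor_lincomb by (rule l2sq_cong) (simp add: chart_deriv_tensor_lincomb[OF \<sigma> \<sigma> m(1-4)])
        ultimately show ?thesis by simp
      qed
      then show "vanishes2 (\<lambda>m n. sob_term (tdiff (\<sigma> m) (\<sigma> n)) z)"
        by (simp add: ze sob_term_def)
    qed
    note van = this
    show "\<exists>N. \<forall>m\<ge>N. \<forall>n\<ge>N. pre_sob_norm C k p q r (tdiff (\<sigma> m) (\<sigma> n)) < e" if "e > 0" for e
    proof -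
      have "e\<^sup>2 > 0" using that by simp
      from vanishes2D[OF van this] obtain N where N: "\<And>m n. m \<ge> N \<Longrightarrow> n \<ge> N \<Longrightarrow>
          \<bar>\<Sum>z\<in>sob_index C k p q r. sob_term (tdiff (\<sigma> m) (\<sigma> n)) z\<bar> < e\<^sup>2" by blast
      have "pre_sob_norm C k p q r (tdiff (\<sigma> m) (\<sigma> n)) < e" if "m \<ge> N" "n \<ge> N" for m n
      proof -
        have "sqrt (\<Sum>z\<in>sob_index C k p q r. sob_term (tdiff (\<sigma> m) (\<sigma> n)) z) < sqrt (e\<^sup>2)"
          using N[OF that] by (intro real_sqrt_less_mono) simp
        then show ?thesis using \<open>e > 0\<close> by (simp add: pre_sob_norm_eq)
      qed
      then show ?thesis by blast
    qed
    have "(\<lambda>n. \<Sum>z\<in>sob_index C 0 p q r. sob_term (tdiff (\<sigma> n) \<tau>) z) \<longlonglongrightarrow> (\<Sum>z\<in>(sob_index C 0 p q r :: (('m chart \<times>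
        (real^2) \<times> (real^2)) \<times> 2 list \<times> 2 list \<times> 'd list \<times> 2 list) set). 0)"
    proof (rule tendsto_sum)
      fix z assume z: "z \<in> (sob_index C 0 p q r :: (('m chart \<times> (real^2) \<times> (real^2)) \<times> 2 list \<times> 2 list \<times> 'd list
          \<times> 2 list) set)"
      obtain c a b I J K "is" where ze: "z = ((c, a, b), I, J, K, is)" by (cases z) auto
      have m: "(c, a, b) \<in> C" "length I = p" "length J = q" "length K = r" "is = []"
        using z by (simp_all add: ze sob_index_def)
      show "(\<lambda>n. sob_term (tdiff (\<sigma> n) \<tau>) z) \<longlonglongrightarrow> 0"
        using L2[OF m(1-4)] by (simp add: ze sob_term_def m(5) chart_deriv_def tdiff_def)
    qed
    from tendsto_real_sqrt[OF this] show "(\<lambda>n. pre_sob_norm C 0 p q r (tdiff (\<sigma> n) \<tau>)) \<longlonglongrightarrow> 0"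
      by (simp add: pre_sob_norm_eq)
  qed
  then show ?thesis
    unfolding sobolev_def using cont by blast
qed

text \<open>The approximating sequence of tensor fields for a map comes from maps: with no contravariant
or covariant indices the transformation law says that the components do not depend on the chart.\<close>

lemma sobolev_map_approximants:
  fixes h :: "'m \<Rightarrow> real^'d::finite"
  assumes l: "3 \<le> l" and h: "h \<in> sobolev_maps A C l"
  obtains F :: "nat \<Rightarrow> 'm \<Rightarrow> real^'d" where
    "\<And>n c k. c \<in> A \<Longrightarrow> smooth_fun_on (cimg c) (\<lambda>y. F n (cinv c y) $ k)"
    "\<And>c a b k. (c, a, b) \<in> C \<Longrightarrow> box a b \<noteq> {} \<Longrightarrow> sobolev_Cauchy (cimg c) a b l (\<lambda>n y. F n (cinv c y) $ k)"
    "\<And>c a b y i k. (c, a, b) \<in> C \<Longrightarrow> y \<in> box a b \<Longrightarrow>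
      (\<lambda>n. pderiv_at i (\<lambda>z. F n (cinv c z) $ k) y) \<longlonglongrightarrow> pderiv_at i (\<lambda>z. h (cinv c z) $ k) y"
proof -
  obtain l' where l': "l = Suc l'" "2 \<le> l'" using l by (cases l) auto
  obtain \<sigma> where ct: "continuous_tensor_field A 0 0 1 (fun_tensor h)" and \<sigma>: "sob_approx A C l 0 0 1 \<sigma> (fun_tensor h)"
    by (rule sobolev_mapD[OF h])
  have sm: "smooth_tensor_field A 0 0 1 (\<sigma> n)" for n using \<sigma> by (simp add: sob_approx_def)
  define ch where "ch x = (SOME c. c \<in> A \<and> x \<in> cdom c)" for x
  have ch: "ch x \<in> A" "x \<in> cdom (ch x)" for x
  proof -
    have "\<exists>c. c \<in> A \<and> x \<in> cdom c" by (rule ex_cell[of x]) blast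
    from someI_ex[OF this] show "ch x \<in> A" "x \<in> cdom (ch x)" by (simp_all add: ch_def)
  qed
  define F where "F n x = (\<chi> k. \<sigma> n (ch x) x [] [] [k])" for n x
  have Feq: "F n x $ k = \<sigma> n c x [] [] [k]" if c: "c \<in> A" "x \<in> cdom c" for n x k c
  proof -
    have "tensor_field A 0 0 1 (\<sigma> n)" using sm by (simp add: smooth_tensor_field_def)
    from this[unfolded tensor_field_def, rule_format, OF c(1) ch(1)[of x], of x "[]" "[]" "[k]"]
    show ?thesis using c ch(2) by (simp add: F_def)
  qed
  have Fc: "\<sigma> n c (cinv c y) [] [] [k] = F n (cinv c y) $ k" if "c \<in> A" "y \<in> cimg c" for n c y k
    using Feq[OF that(1) cinv_in[OF that]] by simp
  show thesis
  proof (rule that)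
    show "smooth_fun_on (cimg c) (\<lambda>y. F n (cinv c y) $ k)" if c: "c \<in> A" for n c k
      by (rule smooth_fun_on_cong[OF smooth_tensor_field_chart[OF sm[of n] c, of "[]" "[]" "[k]"]]) (simp_all
          add: Fc[OF c])
    show "sobolev_Cauchy (cimg c) a b l (\<lambda>n y. F n (cinv c y) $ k)" if cc: "(c, a, b) \<in> C" and ne: "box a b \<noteq>
        {}" for c a b k
      by (rule rectangle_nbhd.sobolev_Cauchy_cong[OF rectangle_nbhd_cell[OF cc ne] sob_approx_sobolev_Cauchy[OF
          \<sigma> cc, of "[]" "[]" "[k]"]])
        (use cell[OF cc] in \<open>simp_all add: Fc\<close>)
    show "(\<lambda>n. pderiv_at i (\<lambda>z. F n (cinv c z) $ k) y) \<longlonglongrightarrow> pderiv_at i (\<lambda>z. h (cinv c z) $ k) y"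
      if cc: "(c, a, b) \<in> C" and y: "y \<in> box a b" for c a b y i k
    proof -
      have ne: "box a b \<noteq> {}" using y by blast
      have c: "c \<in> A" "y \<in> cimg c" using cell[OF cc] y box_subset_cbox[of a b] by auto
      have ul: "uniform_limit (cbox a b) (\<lambda>n y. \<sigma> n c (cinv c y) [] [] [k]) (\<lambda>y. h (cinv c y) $ k) sequentially"
        using sob_approx_uniform_limit[OF _ \<sigma> ct cc ne, of "[]" "[]" "[k]"] l by simp
      have "(\<lambda>n. pderiv_at i (\<lambda>y. \<sigma> n c (cinv c y) [] [] [k]) y) \<longlonglongrightarrow> pderiv_at i (\<lambda>y. h (cinv c y) $ k) y"
        by (rule tendsto_uniform_limitI[OF rectangle_nbhd.limit_C1(2)[OF rectangle_nbhd_cell[OF cc ne] l'(2)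
            sob_approx_sobolev_Cauchy[OF \<sigma>[unfolded l'(1)] cc] ul] y]) simp_all
      moreover have "pderiv_at i (\<lambda>y. \<sigma> n c (cinv c y) [] [] [k]) y = pderiv_at i (\<lambda>z. F n (cinv c z) $ k) y" for n
        by (rule pderiv_at_cong_open[OF open_cimg[OF c(1)] c(2) Fc[OF c(1)]])
      ultimately show ?thesis by simp
    qed
  qed
qed

lemma pullback_metric_components:
  fixes F :: "'m \<Rightarrow> real^'d::finite"
  assumes c: "c \<in> A" "y \<in> cimg c" and F: "(F \<circ> cinv c) differentiable (at y)"
  shows "pullback_metric F c (cinv c y) $ i $ j =
    (\<Sum>k\<in>UNIV. pderiv_at i (\<lambda>z. F (cinv c z) $ k) y * pderiv_at j (\<lambda>z. F (cinv c z) $ k) y)"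
  using pderiv_at_nth[OF F] by (simp add: pullback_metric_def inner_vec_def cmap_cinv[OF c] o_def)

lemma invertible_all_charts:
  assumes law: "metric_law g" and c: "c \<in> A" "c' \<in> A" "x \<in> cdom c" "x \<in> cdom c'" and inv: "invertible (g c' x)"
  shows "invertible (g c x)"
proof -
  let ?P = "transition_jac c c' x"
  have P: "invertible ?P"
    using transition_jac_inverse[OF c] unfolding invertible_left_inverse by blast
  have "g c x = transpose ?P ** g c' x ** ?P"
    using law c unfolding metric_law_def by blast
  then show ?thesis
    using invertible_mult[OF invertible_mult[OF transpose_invertible[OF P] inv] P] by simp
qed

text \<open>The fiber metrics of smooth maps approximating \<open>f\<close> are the approximating fields. Their
components are polynomials in the first derivatives and in the reciprocal of \<open>det g\<close>. By compactness
\<open>|det g|\<close> is bounded below by some \<open>2 d\<close> for the immersion \<open>f\<close>, and by uniform convergence it is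
bounded below by \<open>d\<close> from some index \<open>N\<close> on; the sequence is shifted by \<open>N\<close>, because earlier maps
need not be immersions.\<close>

lemma fiber_metric_sobolev:
  fixes f :: "'m \<Rightarrow> real^'d::finite"
  assumes l: "3 \<le> l" and f: "f \<in> Imm A C l"
  shows "(fiber_metric_tensor (pullback_metric f) i j m :: ('m, 'd) tfield) \<in> sobolev A C (l - 1) (2 * j) (2 *
      i) (2 * m)"
proof -
  obtain l' where l': "l = Suc l'" "2 \<le> l'" "l - 1 = l'" using l by (cases l) auto
  note fH = ImmD(1)[OF f]
  obtain F :: "nat \<Rightarrow> 'm \<Rightarrow> real^'d" where
    sm: "\<And>n c k. c \<in> A \<Longrightarrow> smooth_fun_on (cimg c) (\<lambda>y. F n (cinv c y) $ k)" and
    ca: "\<And>c a b k. (c, a, b) \<in> C \<Longrightarrow> box a b \<noteq> {} \<Longrightarrow> sobolev_Cauchy (cimg c) a b l (\<lambda>n y. F n (cinv c y) $ k)" and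
    lim: "\<And>c a b y i k. (c, a, b) \<in> C \<Longrightarrow> y \<in> box a b \<Longrightarrow>
      (\<lambda>n. pderiv_at i (\<lambda>z. F n (cinv c z) $ k) y) \<longlonglongrightarrow> pderiv_at i (\<lambda>z. f (cinv c z) $ k) y"
    by (rule sobolev_map_approximants[OF l fH]) blast
  define g where "g n = pullback_metric (F n)" for n
  have dF: "(F n \<circ> cinv c) differentiable (at y)" if "c \<in> A" "y \<in> cimg c" for n c y
    unfolding differentiable_componentwise_within[of "F n \<circ> cinv c"]
    using smooth_fun_on_differentiable[OF sm[OF that(1)] that(2)] by (auto simp: Basis_vec_def inner_axis)
  have law: "metric_law (g n)" for n
    unfolding g_def by (rule metric_law_pullback) (simp add: dF cmap_in)
  have comp: "g n c (cinv c y) $ i $ j = (\<Sum>k\<in>UNIV. pderiv_at i (\<lambda>z. F n (cinv c z) $ k) y * pderiv_at j (\<lambda>z. F n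
      (cinv c z) $ k) y)"
    if "c \<in> A" "y \<in> cimg c" for n c y i j
    unfolding g_def by (rule pullback_metric_components[OF that dF[OF that]])
  have gsm: "smooth_fun_on (cimg c) (\<lambda>y. g n c (cinv c y) $ i $ j)" if c: "c \<in> A" for n c i j
    by (rule smooth_fun_on_cong[OF smooth_fun_on_sum[OF open_cimg[OF c] smooth_fun_on_mult[OF
          smooth_fun_on_pderiv[OF sm[OF c]] smooth_fun_on_pderiv[OF sm[OF c]]]]]) (simp add: comp[OF c])
  have gca: "sobolev_Cauchy (cimg c) a b l' (\<lambda>n y. g n c (cinv c y) $ i $ j)"
    if cc: "(c, a, b) \<in> C" and ne: "box a b \<noteq> {}" for c a b i j
  proof -
    interpret R: rectangle_nbhd "cimg c" a b by (rule rectangle_nbhd_cell[OF cc ne])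
    note c = conjunct1[OF cell[OF cc]]
    note d = sobolev_Cauchy_pderiv[OF ca[OF cc ne, unfolded l'(1)]]
    show ?thesis
      by (rule R.sobolev_Cauchy_cong[OF R.sobolev_Cauchy_sum[OF R.sobolev_Cauchy_mult[OF l'(2) d d]]]) (simp
          add: comp[OF c])
  qed
  have glim: "(\<lambda>n. g n c (cinv c y) $ i $ j) \<longlonglongrightarrow> pullback_metric f c (cinv c y) $ i $ j"
    if cc: "(c, a, b) \<in> C" and y: "y \<in> box a b" for c a b y i j
  proof -
    have c: "c \<in> A" "y \<in> cimg c" using cell[OF cc] y box_subset_cbox[of a b] by auto
    show ?thesis
      unfolding comp[OF c] pullback_metric_components[OF c sobolev_map_cell(1)[OF l fH cc y]]
      by (intro tendsto_sum tendsto_mult lim[OF cc y])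
  qed
  have detf: "det (pullback_metric f c x) \<noteq> 0" if "c \<in> A" "x \<in> cdom c" for c x
    using pos_sym_invertible[OF pos_sym_pullback_metric[OF f that]] by (simp add: invertible_det_nz)
  have "continuous_on (cdom c) (\<lambda>x. inverse (det (pullback_metric f c x)))" if c: "c \<in> A" for c
    unfolding det_2
    by (intro continuous_intros continuous_pullback_metric[OF l fH c] ballI) (use detf[OF c] in \<open>simp add: det_2\<close>)
  from bounded_on_cells[OF this] obtain B where B1: "B \<ge> 1" and
    B: "\<forall>c a b y. (c, a, b) \<in> C \<longrightarrow> y \<in> cbox a b \<longrightarrow> \<bar>inverse (det (pullback_metric f c (cinv c y)))\<bar> \<le> B"
    by blast
  define d where "d = 1 / (2 * B)"
  have d: "d > 0" using B1 by (simp add: d_def)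
  have low: "\<exists>N. \<forall>n\<ge>N. \<forall>y\<in>cbox a b. d \<le> \<bar>det (g n c (cinv c y))\<bar>"
    if cc: "(c, a, b) \<in> C" and ne: "box a b \<noteq> {}" for c a b
  proof -
    interpret R: rectangle_nbhd "cimg c" a b by (rule rectangle_nbhd_cell[OF cc ne])
    let ?D = "\<lambda>n y. det (g n c (cinv c y))"
    have "sobolev_Cauchy (cimg c) a b l' (\<lambda>n y. g n c (cinv c y) $ 1 $ 1 * g n c (cinv c y) $ 2 $ 2 +
        (-1) * (g n c (cinv c y) $ 1 $ 2 * g n c (cinv c y) $ 2 $ 1))"
      by (intro R.sobolev_Cauchy_add R.sobolev_Cauchy_mult[OF l'(2)] R.sobolev_Cauchy_const gca[OF cc ne])
    then have "sobolev_Cauchy (cimg c) a b l' ?D"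
      unfolding det_2 by simp
    then have "sobolev_Cauchy (cimg c) a b (Suc (Suc 0)) ?D"
      by (rule sobolev_Cauchy_mono[rotated]) (use l'(2) in simp)
    then have sup: "sup_Cauchy a b ?D" by (rule R.sobolev_Cauchy_sup)
    obtain N where N: "\<And>m n y. m \<ge> N \<Longrightarrow> n \<ge> N \<Longrightarrow> y \<in> cbox a b \<Longrightarrow> \<bar>?D m y - ?D n y\<bar> < d"
      by (rule sup_CauchyD[OF sup d]) blast
    have box: "d \<le> \<bar>?D n y\<bar>" if n: "n \<ge> N" and y: "y \<in> box a b" for n y
    proof -
      have yc: "y \<in> cbox a b" using y box_subset_cbox[of a b] by blast
      let ?d = "det (pullback_metric f c (cinv c y))"
      have cy: "c \<in> A" "y \<in> cimg c" using cell[OF cc] yc by auto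
      have c: "c \<in> A" "cinv c y \<in> cdom c" using cy(1) cinv_in[OF cy] .
      have "(\<lambda>m. \<bar>?D m y - ?D n y\<bar>) \<longlonglongrightarrow> \<bar>?d - ?D n y\<bar>"
        unfolding det_2 by (intro tendsto_intros glim[OF cc y])
      then have "\<bar>?d - ?D n y\<bar> \<le> d"
        by (rule LIMSEQ_le_const2) (use N[OF _ n yc] in \<open>auto intro!: exI[of _ N] less_imp_le\<close>)
      moreover have "2 * d \<le> \<bar>?d\<bar>"
      proof -
        have "\<bar>inverse ?d\<bar> \<le> B" using B cc yc by blast
        then have "1 \<le> B * \<bar>?d\<bar>" using detf[OF c] by (simp add: abs_inverse field_simps)
        then show ?thesis using B1 by (simp add: d_def field_simps)
      qed
      ultimately show ?thesis by linarith
    qed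
    have "d \<le> \<bar>?D n y\<bar>" if n: "n \<ge> N" and y: "y \<in> cbox a b" for n y
    proof (rule continuous_ge_on_closure[of "box a b"])
      show "continuous_on (closure (box a b)) (\<lambda>y. \<bar>?D n y\<bar>)"
        unfolding closure_box[OF ne] using sup by (auto simp: sup_Cauchy_def intro!: continuous_intros)
      show "y \<in> closure (box a b)" using y by (simp add: closure_box[OF ne])
    qed (rule box[OF n])
    then show ?thesis by blast
  qed
  have "\<forall>z\<in>C. \<exists>N. box (fst (snd z)) (snd (snd z)) \<noteq> {} \<longrightarrow>
      (\<forall>n\<ge>N. \<forall>y\<in>cbox (fst (snd z)) (snd (snd z)). d \<le> \<bar>det (g n (fst z) (cinv (fst z) y))\<bar>)"
  proof
    fix z assume z: "z \<in> C"
    obtain c a b where ze: "z = (c, a, b)" by (cases z)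
    show "\<exists>N. box (fst (snd z)) (snd (snd z)) \<noteq> {} \<longrightarrow>
      (\<forall>n\<ge>N. \<forall>y\<in>cbox (fst (snd z)) (snd (snd z)). d \<le> \<bar>det (g n (fst z) (cinv (fst z) y))\<bar>)"
      using low[of c a b] z unfolding ze fst_conv snd_conv by blast
  qed
  from bchoice[OF this] obtain NN where NN: "\<And>z. z \<in> C \<Longrightarrow> box (fst (snd z)) (snd (snd z)) \<noteq> {} \<longrightarrow>
      (\<forall>n\<ge>NN z. \<forall>y\<in>cbox (fst (snd z)) (snd (snd z)). d \<le> \<bar>det (g n (fst z) (cinv (fst z) y))\<bar>)"
    by blast
  \<comment> \<open>a common bound for the finitely many indices \<open>NN z\<close>\<close>
  define N where "N = (\<Sum>z\<in>C. NN z)"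
  have NN_le: "NN z \<le> N" if "z \<in> C" for z
    unfolding N_def by (rule member_le_sum[OF that _ finite_C]) simp
  have lowN: "d \<le> \<bar>det (g (n + N) c (cinv c y))\<bar>" if cc: "(c, a, b) \<in> C" and ne: "box a b \<noteq> {}" and y: "y \<in> cbox
      a b" for c a b y n
    using NN[OF cc] NN_le[OF cc] ne y by (simp add: trans_le_add2)
  have inv: "invertible (g (n + N) c x)" if c: "c \<in> A" "x \<in> cdom c" for n c x
  proof -
    obtain c' a b y where c': "(c', a, b) \<in> C" "y \<in> box a b" "x = cinv c' y" "c' \<in> A" "x \<in> cdom c'"
      by (rule ex_cell[of x])
    have "d \<le> \<bar>det (g (n + N) c' x)\<bar>"
      unfolding c'(3) using c'(2) box_subset_cbox[of a b] by (intro lowN[OF c'(1)]) auto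
    then have "invertible (g (n + N) c' x)" using d by (auto simp: invertible_det_nz)
    then show ?thesis by (rule invertible_all_charts[OF law c(1) c'(4) c(2) c'(5)])
  qed
  have nz: "det (g (n + N) c (cinv c y)) \<noteq> 0" if "c \<in> A" "y \<in> cimg c" for n c y
    using inv[OF that(1) cinv_in[OF that]] by (simp add: invertible_det_nz)
  show ?thesis
    unfolding l'(3)
  proof (rule sobolevI[OF l'(2), where \<sigma> = "\<lambda>n. fiber_metric_tensor (g (n + N)) i j m"])
    show "smooth_tensor_field A (2 * j) (2 * i) (2 * m) (fiber_metric_tensor (g (n + N)) i j m)" for n
      unfolding smooth_tensor_field_def
    proof (intro conjI ballI allI impI tensor_field_fiber_metric[OF law inv])
      fix c I J K assume c: "c \<in> A"
      show "smooth_fun_on (cimg c) (\<lambda>y. fiber_metric_tensor (g (n + N)) i j m c (cinv c y) I J K)"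
        unfolding fiber_metric_tensor_def by (rule smooth_fun_on_fiber_gram[OF open_cimg[OF c] gsm[OF c] nz[OF c]])
    qed
    show "tensor_field A (2 * j) (2 * i) (2 * m) (fiber_metric_tensor (pullback_metric f) i j m)"
      by (rule tensor_field_fiber_metric[OF metric_law_pullback[OF ImmD(2)[OF f]] pos_sym_invertible[OF
          pos_sym_pullback_metric[OF f]]])
    show "sobolev_Cauchy (cimg c) a b l' (\<lambda>n y. fiber_metric_tensor (g (n + N)) i j m c (cinv c y) I J K)"
      if cc: "(c, a, b) \<in> C" and ne: "box a b \<noteq> {}" for c a b I J K
      unfolding fiber_metric_tensor_def
      by (rule rectangle_nbhd.sobolev_Cauchy_fiber_gram[OF rectangle_nbhd_cell[OF cc ne] l'(2)
            sobolev_Cauchy_shift[OF gca[OF cc ne]] nz[OF conjunct1[OF cell[OF cc]]] d lowN[OF cc ne]])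
    show "(\<lambda>n. fiber_metric_tensor (g (n + N)) i j m c (cinv c y) I J K) \<longlonglongrightarrow> fiber_metric_tensor (pullback_metric
        f) i j m c (cinv c y) I J K"
      if cc: "(c, a, b) \<in> C" and y: "y \<in> box a b" for c a b I J K y
    proof -
      have c: "c \<in> A" "y \<in> cimg c" using cell[OF cc] y box_subset_cbox[of a b] by auto
      show ?thesis
        unfolding fiber_metric_tensor_def
        by (rule tendsto_fiber_gram[OF LIMSEQ_ignore_initial_segment[OF glim[OF cc y]] nz[OF c] detf[OF c(1)
            cinv_in[OF c]]])
    qed
  qed
qed

end

section \<open>Tensor fields that agree on admissible indices\<close>

text \<open>Tensor fields are compared only on index lists of the right lengths, the only ones that carry
meaning.\<close>

definition same_components :: "nat \<Rightarrow> nat \<Rightarrow> nat \<Rightarrow> ('m, 'd) tfield \<Rightarrow> ('m, 'd) tfield \<Rightarrow> bool" where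
  "same_components p q r \<sigma> \<tau> \<longleftrightarrow>
    (\<forall>c x I J K. length I = p \<longrightarrow> length J = q \<longrightarrow> length K = r \<longrightarrow> \<sigma> c x I J K = \<tau> c x I J K)"

lemma same_componentsD:
  assumes "same_components p q r \<sigma> \<tau>" "length I = p" "length J = q" "length K = r"
  shows "\<sigma> c x I J K = \<tau> c x I J K"
  using assms unfolding same_components_def by blast

lemma Linf_norm_same_components:
  assumes "same_components p q r \<sigma> \<tau>"
  shows "Linf_norm A g p q r \<sigma> = Linf_norm A g p q r \<tau>"
proof -
  have "fiber_inner (g c x) p q r (\<sigma> c x) (\<sigma> c x) = fiber_inner (g c x) p q r (\<tau> c x) (\<tau> c x)" for c x
    unfolding fiber_inner_def by (intro sum.cong refl) (simp add: same_componentsD[OF assms])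
  then show ?thesis
    unfolding Linf_norm_def by simp
qed

lemma same_components_tdiff:
  "same_components p q r \<sigma> \<tau> \<Longrightarrow> same_components p q r \<sigma>' \<tau>' \<Longrightarrow> same_components p q r (tdiff \<sigma> \<sigma>') (tdiff \<tau> \<tau>')"
  by (simp add: same_components_def tdiff_def)

lemma lipschitz_same_components:
  assumes "lipschitz_bounded_on_balls U dst (Linf_norm A g p q r) F" "\<And>f. same_components p q r (F f) (F' f)"
  shows "lipschitz_bounded_on_balls U dst (Linf_norm A g p q r) F'"
  using assms(1)
  unfolding lipschitz_bounded_on_balls_def Linf_norm_same_components[OF assms(2)]
    Linf_norm_same_components[OF same_components_tdiff[OF assms(2) assms(2)]] .

lemma tensor_field_same_components:
  fixes \<sigma> \<tau> :: "('m, 'd) tfield"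
  assumes "tensor_field A p q r \<sigma>" "same_components p q r \<sigma> \<tau>"
  shows "tensor_field A p q r \<tau>"
  unfolding tensor_field_def
proof (intro ballI allI impI)
  fix c c' x and I J :: "2 list" and K :: "'d list"
  assume *: "c \<in> A" "c' \<in> A" "x \<in> cdom c \<inter> cdom c'" "length I = p" "length J = q" "length K = r"
  have eq: "\<tau> c x I J K = \<sigma> c x I J K" if "length I = p" "length J = q" "length K = r" for c x I J K
    using same_componentsD[OF assms(2) that] by simp
  show "\<tau> c' x I J K = (\<Sum>I' | length I' = p. \<Sum>J' | length J' = q.
             (\<Prod>n<p. transition_jac c c' x $ (I ! n) $ (I' ! n)) *
             (\<Prod>n<q. transition_jac c' c x $ (J' ! n) $ (J ! n)) * \<tau> c x I' J' K)"
    unfolding eq[OF *(4-6)] assms(1)[unfolded tensor_field_def, rule_format, OF *]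
    by (intro sum.cong refl) (simp add: eq *)
qed

lemma sobolev_same_components:
  fixes \<sigma> \<tau> :: "('m::topological_space, 'd::finite) tfield"
  assumes \<sigma>: "\<sigma> \<in> sobolev A C k p q r" and same: "same_components p q r \<sigma> \<tau>"
  shows "\<tau> \<in> sobolev A C k p q r"
proof -
  have eq: "\<tau> c x I J K = \<sigma> c x I J K" if "length I = p" "length J = q" "length K = r" for c x I J K
    using same_componentsD[OF same that] by simp
  have ct: "continuous_tensor_field A p q r \<sigma>" using \<sigma> by (simp add: sobolev_def)
  have "continuous_tensor_field A p q r \<tau>"
    unfolding continuous_tensor_field_def
  proof (intro conjI ballI allI impI)
    show "tensor_field A p q r \<tau>"
      using tensor_field_same_components[OF _ same] ct by (simp add: continuous_tensor_field_def)
    fix c and I J :: "2 list" and K :: "'d list" assume *: "c \<in> A" "length I = p" "length J = q" "length K = r"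
    show "continuous_on (cdom c) (\<lambda>x. \<tau> c x I J K)"
      unfolding eq[OF *(2-4)] using ct * unfolding continuous_tensor_field_def by blast
  qed
  moreover have "pre_sob_norm C 0 p q r (tdiff \<rho> \<tau>) = pre_sob_norm C 0 p q r (tdiff \<rho> \<sigma>)" for \<rho>
    unfolding pre_sob_norm_def tdiff_def by (intro arg_cong[where f = sqrt] sum.cong refl) (auto simp: eq
        intro!: sum.cong)
  ultimately show ?thesis
    using \<sigma> by (simp add: sobolev_def sob_approx_def)
qed

lemma metric_tensor_eq_fiber: "same_components 0 2 0 (fiber_metric_tensor g 1 0 0) (metric_tensor g)"
  by (auto simp: same_components_def fiber_metric_tensor_def fiber_gram_def metric_tensor_def)

lemma inv_metric_tensor_eq_fiber: "same_components 2 0 0 (fiber_metric_tensor g 0 1 0) (inv_metric_tensor g)"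
  by (auto simp: same_components_def fiber_metric_tensor_def fiber_gram_def inv_metric_tensor_def)

section \<open>Lipschitz continuity of the pullback metric on balls\<close>

theorem lemma5p3:
  fixes A :: "'m::t2_space chart set"
    and C :: "('m chart \<times> (real^2) \<times> (real^2)) set"
    and gbar :: "'m metric_field"
    and G :: "('m \<Rightarrow> real^'d) \<Rightarrow> ('m \<Rightarrow> real^'d) \<Rightarrow> ('m \<Rightarrow> real^'d) \<Rightarrow> real"
    and l :: nat
  defines "H \<equiv> (sobolev_maps A C l :: ('m \<Rightarrow> real^'d) set)"
    and "\<I> \<equiv> (Imm A C l :: ('m \<Rightarrow> real^'d) set)"
    and "dist\<^sub>G \<equiv> geodesic_dist (sobolev_maps A C l) (map_norm A C l) (Imm A C l) G"
  assumes "closed_oriented_surface A"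
    and "coord_cover A C"
    and "riemannian_metric A gbar"
    and "CARD('d) \<ge> 3"
    and "l \<ge> 3"
    and "smooth_riemannian_metric H (map_norm A C l) \<I> G"
    and "\<exists>c>0. \<forall>f\<in>\<I>. \<forall>h\<in>H.
           ennreal (sqrt (G f h h)) \<ge> ennreal c * Linf_norm A (pullback_metric f) 0 1 1 (nabla h)"
  shows
    "(\<forall>f\<in>\<I>. (metric_tensor (pullback_metric f) :: ('m, 'd) tfield) \<in> sobolev A C (l - 1) 0 2 0) \<and>
     lipschitz_bounded_on_balls \<I> dist\<^sub>G (Linf_norm A gbar 0 2 0)
       (\<lambda>f. metric_tensor (pullback_metric f) :: ('m, 'd) tfield) \<and>
     (\<forall>f\<in>\<I>. (inv_metric_tensor (pullback_metric f) :: ('m, 'd) tfield) \<in> sobolev A C (l - 1) 2 0 0) \<and>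
     lipschitz_bounded_on_balls \<I> dist\<^sub>G (Linf_norm A gbar 2 0 0)
       (\<lambda>f. inv_metric_tensor (pullback_metric f) :: ('m, 'd) tfield) \<and>
     (\<forall>i j m.
       (\<forall>f\<in>\<I>. (fiber_metric_tensor (pullback_metric f) i j m :: ('m, 'd) tfield)
                 \<in> sobolev A C (l - 1) (2 * j) (2 * i) (2 * m)) \<and>
       lipschitz_bounded_on_balls \<I> dist\<^sub>G (Linf_norm A gbar (2 * j) (2 * i) (2 * m))
         (\<lambda>f. fiber_metric_tensor (pullback_metric f) i j m :: ('m, 'd) tfield))"
proof -
  obtain c0 where c0: "c0 > 0" "\<forall>f\<in>\<I>. \<forall>h\<in>H.
      ennreal c0 * Linf_norm A (pullback_metric f) 0 1 1 (nabla h) \<le> ennreal (sqrt (G f h h))"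
    using assms(10) by blast
  interpret metric_on_immersions A C l G c0
    by unfold_locales (use assms c0 in \<open>simp_all add: H_def \<I>_def\<close>)
  have mem: "(fiber_metric_tensor (pullback_metric f) i j m :: ('m, 'd) tfield) \<in> sobolev A C (l - 1) (2 * j) (2 * i) (2 * m)"
    if "f \<in> \<I>" for f i j m
    using fiber_metric_sobolev[OF \<open>l \<ge> 3\<close>] that by (simp add: \<I>_def)
  have lip: "lipschitz_bounded_on_balls \<I> dist\<^sub>G (Linf_norm A gbar (2 * j) (2 * i) (2 * m))
         (\<lambda>f. fiber_metric_tensor (pullback_metric f) i j m :: ('m, 'd) tfield)" for i j m
    unfolding \<I>_def dist\<^sub>G_def by (rule fiber_metric_Lipschitz[OF \<open>riemannian_metric A gbar\<close>])
  have "(metric_tensor (pullback_metric f) :: ('m, 'd) tfield) \<in> sobolev A C (l - 1) 0 2 0" if "f \<in> \<I>" for f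
    by (rule sobolev_same_components[OF _ metric_tensor_eq_fiber]) (use mem[OF that, of 1 0 0] in simp)
  moreover have "lipschitz_bounded_on_balls \<I> dist\<^sub>G (Linf_norm A gbar 0 2 0)
       (\<lambda>f. metric_tensor (pullback_metric f) :: ('m, 'd) tfield)"
    by (rule lipschitz_same_components[OF _ metric_tensor_eq_fiber]) (use lip[of 0 1 0] in simp)
  moreover have "(inv_metric_tensor (pullback_metric f) :: ('m, 'd) tfield) \<in> sobolev A C (l - 1) 2 0 0" if "f \<in> \<I>" for f
    by (rule sobolev_same_components[OF _ inv_metric_tensor_eq_fiber]) (use mem[OF that, of 0 1 0] in simp)
  moreover have "lipschitz_bounded_on_balls \<I> dist\<^sub>G (Linf_norm A gbar 2 0 0)
       (\<lambda>f. inv_metric_tensor (pullback_metric f) :: ('m, 'd) tfield)"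
    by (rule lipschitz_same_components[OF _ inv_metric_tensor_eq_fiber]) (use lip[of 1 0 0] in simp)
  ultimately show ?thesis
    using mem lip by blast
qed

end
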